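(* Let $d\ge 2$ and $p_1,\dots,p_d\in(2,\infty)$. Then there is a constant $N=N(d,p_1,\dots,p_d)$ such that for any $u\in W^2_{2,\mathrm{loc}}(\mathbb{R}^d)$ we have $$\|D^2u\|_{L_{p_1,\dots,p_d}}\le N\,\|\Delta u\|_{L_{p_1,\dots,p_d}},$$ provided that $\|D^2u\|_{L_{p_1,\dots,p_d}}+\|Du\|_{L_{p_1,\dots,p_d}}+\|u\|_{L_{p_1,\dots,p_d}}$ is finite.
   Context: $Du$ and $D^2u$ denote the collections of all first-order, respectively second-order, (generalized) partial derivatives of $u$, and $|Du|$, $|D^2u|$ their Euclidean norms; norms of $Du$, $D^2u$ are norms of $|Du|$, $|D^2u|$. For $p_i\in(1,\infty)$ the mixed norm on functions on $\mathbb{R}^d$ is defined by $$\|f\|_{L_{p_1,\dots,p_d}}^{p_d}:=\int_{\mathbb{R}}\Big(\cdots\Big(\int_{\mathbb{R}}\Big(\int_{\mathbb{R}}|f|^{p_1}\,dx_1\Big)^{p_2/p_1}dx_2\Big)^{p_3/p_2}\cdots\Big)^{p_d/p_{d-1}}dx_d .$$ *)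

theory Defs
  imports "HOL-Analysis.Analysis"
begin

text \<open>Points of Euclidean \<open>d\<close>-space have type \<open>real ^ 'n\<close> with \<open>d = CARD('n)\<close>. The mixed norms depend on
  the order of the coordinates, so where they occur the index type is also linearly ordered; its
  elements, listed in increasing order, play the role of \<open>1, ..., d\<close>.\<close>

section \<open>Test functions\<close>

definition partial_deriv :: "'n::finite \<Rightarrow> (real ^ 'n \<Rightarrow> real) \<Rightarrow> real ^ 'n \<Rightarrow> real" where
  "partial_deriv i f x = frechet_derivative f (at x) (axis i 1)"

primrec partial_derivs :: "'n::finite list \<Rightarrow> (real ^ 'n \<Rightarrow> real) \<Rightarrow> real ^ 'n \<Rightarrow> real" where
  "partial_derivs [] f = f"
| "partial_derivs (i # is) f = partial_deriv i (partial_derivs is f)"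

text \<open>If all iterated partial derivatives are differentiable, they are all continuous; hence this is
  the usual infinite differentiability.\<close>

definition smooth :: "(real ^ 'n::finite \<Rightarrow> real) \<Rightarrow> bool" where
  "smooth f \<longleftrightarrow> (\<forall>is x. partial_derivs is f differentiable (at x))"

definition test_function :: "(real ^ 'n::finite \<Rightarrow> real) \<Rightarrow> bool" where
  "test_function \<phi> \<longleftrightarrow> smooth \<phi> \<and> compact (closure {x. \<phi> x \<noteq> 0})"

section \<open>Generalized derivatives and local Sobolev spaces\<close>

definition locally_integrable :: "(real ^ 'n::finite \<Rightarrow> real) \<Rightarrow> bool" where
  "locally_integrable f \<longleftrightarrow> (\<forall>K. compact K \<longrightarrow> f absolutely_integrable_on K)"

definition Lp_loc :: "real \<Rightarrow> (real ^ 'n::finite \<Rightarrow> real) \<Rightarrow> bool" where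
  "Lp_loc p f \<longleftrightarrow> f \<in> borel_measurable lebesgue \<and>
     (\<forall>K. compact K \<longrightarrow> (\<lambda>x. \<bar>f x\<bar> powr p) absolutely_integrable_on K)"

text \<open>A multi-index is given by the list of the directions of differentiation.\<close>

definition has_weak_deriv ::
  "'n::finite list \<Rightarrow> (real ^ 'n \<Rightarrow> real) \<Rightarrow> (real ^ 'n \<Rightarrow> real) \<Rightarrow> bool" where
  "has_weak_deriv is u v \<longleftrightarrow> locally_integrable u \<and> locally_integrable v \<and>
     (\<forall>\<phi>. test_function \<phi> \<longrightarrow>
        (LINT x|lebesgue. u x * partial_derivs is \<phi> x) =
        (- 1) ^ length is * (LINT x|lebesgue. v x * \<phi> x))"

definition sobolev_loc :: "nat \<Rightarrow> real \<Rightarrow> (real ^ 'n::finite \<Rightarrow> real) \<Rightarrow> bool" where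
  "sobolev_loc k p u \<longleftrightarrow> Lp_loc p u \<and>
     (\<forall>is. length is \<le> k \<longrightarrow> (\<exists>v. has_weak_deriv is u v \<and> Lp_loc p v))"

text \<open>Generalized derivatives are determined up to null sets; a representative is chosen. The integrals
  below do not depend on this choice.\<close>

definition weak_deriv :: "'n::finite list \<Rightarrow> (real ^ 'n \<Rightarrow> real) \<Rightarrow> real ^ 'n \<Rightarrow> real" where
  "weak_deriv is u = (SOME v. has_weak_deriv is u v)"

definition weak_grad :: "(real ^ 'n::finite \<Rightarrow> real) \<Rightarrow> real ^ 'n \<Rightarrow> real ^ 'n" where
  "weak_grad u x = (\<chi> i. weak_deriv [i] u x)"

definition weak_hessian :: "(real ^ 'n::finite \<Rightarrow> real) \<Rightarrow> real ^ 'n \<Rightarrow> real ^ 'n ^ 'n" where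
  "weak_hessian u x = (\<chi> i j. weak_deriv [i, j] u x)"

definition weak_laplacian :: "(real ^ 'n::finite \<Rightarrow> real) \<Rightarrow> real ^ 'n \<Rightarrow> real" where
  "weak_laplacian u x = (\<Sum>i\<in>UNIV. weak_deriv [i, i] u x)"

section \<open>Mixed norms\<close>

text \<open>Only used for positive exponents.\<close>

definition ennreal_powr :: "ennreal \<Rightarrow> real \<Rightarrow> ennreal" where
  "ennreal_powr a r = (if a = top then top else ennreal (enn2real a powr r))"

definition update_coord :: "real ^ 'n::finite \<Rightarrow> 'n \<Rightarrow> real \<Rightarrow> real ^ 'n" where
  "update_coord x i t = (\<chi> j. if j = i then t else x $ j)"

text \<open>\<open>mixed_int p q is g\<close> integrates successively over the coordinates in \<open>is\<close>, where \<open>q\<close> is the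
  exponent belonging to the coordinate treated before; at the end it takes the root of the order of
  the last exponent.\<close>

primrec mixed_int ::
  "('n::finite \<Rightarrow> real) \<Rightarrow> real \<Rightarrow> 'n list \<Rightarrow> (real ^ 'n \<Rightarrow> ennreal) \<Rightarrow> real ^ 'n \<Rightarrow> ennreal" where
  "mixed_int p q [] g = (\<lambda>x. ennreal_powr (g x) (1 / q))"
| "mixed_int p q (i # is) g =
     mixed_int p (p i) is
       (\<lambda>x. \<integral>\<^sup>+ t. ennreal_powr (g (update_coord x i t)) (p i / q) \<partial>lebesgue)"

lemma mixed_int_cong_point:
  assumes "\<And>x y. (\<And>j. j \<in> A \<Longrightarrow> x $ j = y $ j) \<Longrightarrow> g x = g y"
    and "\<And>j. j \<in> A - set is \<Longrightarrow> x $ j = y $ j"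
  shows "mixed_int p q is g x = mixed_int p q is g y"
  using assms
proof (induction "is" arbitrary: A q g)
  case Nil
  have "g x = g y"
    by (rule Nil.prems(1)) (use Nil.prems(2) in simp)
  then show ?case by simp
next
  case (Cons i "is")
  let ?h = "\<lambda>x. \<integral>\<^sup>+ t. ennreal_powr (g (update_coord x i t)) (p i / q) \<partial>lebesgue"
  have "?h z = ?h w" if "\<And>j. j \<in> A - {i} \<Longrightarrow> z $ j = w $ j" for z w
  proof -
    have "g (update_coord z i t) = g (update_coord w i t)" for t
      by (rule Cons.prems(1)) (use that in \<open>auto simp: update_coord_def\<close>)
    then show ?thesis by simp
  qed
  then have "mixed_int p (p i) is ?h x = mixed_int p (p i) is ?h y"
    by (rule Cons.IH[of "A - {i}"]) (use Cons.prems(2) in auto)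
  then show ?case by simp
qed

text \<open>After all the coordinates have been integrated out the result is constant, so it may be evaluated
  at the origin.\<close>

lemma mixed_int_const:
  "mixed_int p q (sorted_list_of_set (UNIV :: 'n::{finite,linorder} set)) g x =
   mixed_int p q (sorted_list_of_set UNIV) g y"
proof (rule mixed_int_cong_point[of UNIV])
  show "g x = g y" if "\<And>j. j \<in> UNIV \<Longrightarrow> x $ j = y $ j" for x y
  proof -
    have "x = y" using that by (simp add: vec_eq_iff)
    then show ?thesis by simp
  qed
qed simp

definition mixed_norm ::
  "('n::{finite,linorder} \<Rightarrow> real) \<Rightarrow>
   (real ^ 'n::{finite,linorder} \<Rightarrow> 'b::real_normed_vector) \<Rightarrow> ennreal" where
  "mixed_norm p f = mixed_int p 1 (sorted_list_of_set UNIV) (\<lambda>x. ennreal (norm (f x))) 0"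

end

theory Submission
  imports Defs
begin

text \<open>Let \<open>M\<close> be the strong maximal function. It is bounded in all mixed norms with exponents
  greater than one: for dyadic averages in one variable this is Doob's inequality with values in the
  mixed norm of the remaining variables, extrapolated from the exponent of the innermost variable by a
  good-\<open>\<lambda>\<close> argument on binary trees.

  For smooth \<open>w\<close> put \<open>H = D\<^sub>i\<^sub>j w\<close> and \<open>f = \<Delta> w\<close>. On every cube the mean oscillation of \<open>H\<close> is bounded
  by a multiple of \<open>(M f\<^sup>2)\<^bsup>1/2\<^esup>\<close> at any point of the cube: near the cube by the energy identity for
  second derivatives, and far from it because the derivative in \<open>t\<close> of the averages of \<open>H\<close> against
  the dilations of a bump by \<open>t\<close> is an average of \<open>f\<close>. A stopping-time decomposition of a test function
  \<open>g\<close> then gives \<open>\<integral> H g \<le> C \<integral> (M f\<^sup>2)\<^bsup>1/2\<^esup> M g\<close>, and Hoelder's inequality together with the bounds for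
  \<open>M\<close> with the exponents \<open>p/2 > 1\<close> and \<open>p/(p-1)\<close> yields the estimate for smooth functions. The general
  case follows by mollification, Minkowski's inequality and Fatou's lemma.\<close>

section \<open>Powers of extended nonnegative reals\<close>

text \<open>A mixed norm is not determined by the measures of the level sets of a function, so
  distributional inequalities between \<open>H\<close> and its mean oscillation are of no direct
  use. Pairing with a test function confines the stopping arguments to integrals over the whole
  space; what reaches the mixed norm are pointwise maximal functions, which split into operators in
  one variable. For such an operator the variables integrated earlier form a norm on a lattice, in
  which the norm of a supremum is not the supremum of the norms; hence Doob's inequality alone does
  not suffice and an extrapolation is needed. The variables integrated later only require
  monotonicity.

  The square comes from the energy identity, the bound on second derivatives that integration by
  parts provides: it sees \<open>f\<close> in quadratic mean, so \<open>M\<close> acts on the square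
  of \<open>f\<close> and needs \<open>p/2 > 1\<close>. As the identity requires compact support, it
  is applied to a localized parametrix instead of \<open>w\<close>. Finiteness of the norm of
  \<open>H\<close> makes its means over large cubes vanish and so excludes harmonic quadratic
  polynomials.\<close>

lemma ennreal_powr_0 [simp]: "0 < r \<Longrightarrow> ennreal_powr 0 r = 0"
  by (simp add: ennreal_powr_def)

lemma ennreal_powr_top [simp]: "ennreal_powr top r = top"
  by (simp add: ennreal_powr_def)

lemma ennreal_powr_ennreal: "0 \<le> a \<Longrightarrow> ennreal_powr (ennreal a) r = ennreal (a powr r)"
  by (simp add: ennreal_powr_def)

lemma ennreal_powr_1 [simp]: "ennreal_powr a 1 = a"
  by (cases a) (auto simp: ennreal_powr_def top_unique)

lemma ennreal_powr_one [simp]: "ennreal_powr 1 r = 1"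
  by (simp add: ennreal_powr_def)

lemma ennreal_powr_eq_top [simp]: "ennreal_powr a r = top \<longleftrightarrow> a = top"
  by (simp add: ennreal_powr_def)

lemma ennreal_powr_eq_0: "0 < r \<Longrightarrow> ennreal_powr a r = 0 \<longleftrightarrow> a = 0"
  by (cases a) (auto simp: ennreal_powr_ennreal)

lemma ennreal_powr_mono: "a \<le> b \<Longrightarrow> 0 < r \<Longrightarrow> ennreal_powr a r \<le> ennreal_powr b r"
  by (cases a; cases b) (auto simp: ennreal_powr_ennreal powr_mono2 top_unique)

lemma ennreal_powr_powr: "ennreal_powr (ennreal_powr a r) s = ennreal_powr a (r * s)"
  by (cases a) (auto simp: ennreal_powr_ennreal powr_powr)

lemma ennreal_powr_mult: "0 < r \<Longrightarrow> ennreal_powr (a * b) r = ennreal_powr a r * ennreal_powr b r"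
  by (cases a; cases b)
     (auto simp: ennreal_powr_ennreal powr_mult ennreal_mult_top ennreal_top_mult ennreal_powr_eq_0
        simp flip: ennreal_mult)

lemma ennreal_powr_add: "0 < r \<Longrightarrow> 0 < s \<Longrightarrow> ennreal_powr a (r + s) = ennreal_powr a r * ennreal_powr a s"
  by (cases a) (auto simp: ennreal_powr_ennreal powr_add simp flip: ennreal_mult)

text \<open>The power \<open>1/r\<close> inverts the power \<open>r\<close> on all of
  [0, \<infinity>], so the latter is an order isomorphism and preserves arbitrary suprema.\<close>

lemma ennreal_powr_SUP:
  assumes "0 < r" shows "ennreal_powr (SUP n\<in>A. f n) r = (SUP n\<in>A. ennreal_powr (f n) r)"
proof (rule antisym)
  let ?s = "SUP n\<in>A. ennreal_powr (f n) r"
  have "f n \<le> ennreal_powr ?s (1/r)" if "n \<in> A" for n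
  proof -
    have "ennreal_powr (ennreal_powr (f n) r) (1/r) \<le> ennreal_powr ?s (1/r)"
      by (rule ennreal_powr_mono) (use assms that in \<open>auto intro: SUP_upper\<close>)
    then show ?thesis using assms by (simp add: ennreal_powr_powr)
  qed
  then have "(SUP n\<in>A. f n) \<le> ennreal_powr ?s (1/r)" by (rule SUP_least)
  from ennreal_powr_mono[OF this assms] show "ennreal_powr (SUP n\<in>A. f n) r \<le> ?s"
    using assms by (simp add: ennreal_powr_powr)
qed (auto intro!: SUP_least ennreal_powr_mono SUP_upper assms)

lemma ennreal_powr_measurable [measurable]:
  assumes [measurable]: "f \<in> borel_measurable M"
  shows "(\<lambda>x. ennreal_powr (f x) r) \<in> borel_measurable M"
  unfolding ennreal_powr_def by measurable

section \<open>The inequalities of Young, Hoelder and Minkowski\<close>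

lemma ennreal_Youngs_inequality:
  fixes a b :: ennreal
  assumes p: "1 < p" and q: "q = p / (p - 1)"
  shows "a * b \<le> ennreal (1/p) * ennreal_powr a p + ennreal (1/q) * ennreal_powr b q"
proof -
  have q1: "1 < q" using p by (simp add: q)
  have pq: "1/p + 1/q = 1" using p by (simp add: q field_simps)
  show ?thesis
  proof (cases a; cases b)
    fix x y assume *: "0 \<le> x" "a = ennreal x" "0 \<le> y" "b = ennreal y"
    from Youngs_inequality[OF p q1 pq this(1,3)]
    show ?thesis using * p q1
      by (simp add: ennreal_powr_ennreal ennreal_mult[symmetric] ennreal_plus[symmetric] ennreal_le_iff
          del: ennreal_plus)
  qed (use p q1 in \<open>auto simp: ennreal_mult_top\<close>)
qed

text \<open>Both factors are scaled so that their power integrals become one; then Young's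
  inequality is integrated. An infinite integral on the right does not settle the claim by itself,
  since \<open>0 * top = 0\<close>; the vanishing of either integral is therefore treated first,
  through almost everywhere vanishing of the product.\<close>

lemma nn_integral_Hoelder:
  fixes f g :: "'a \<Rightarrow> ennreal"
  assumes p: "1 < p" and q: "q = p / (p - 1)"
    and [measurable]: "f \<in> borel_measurable M" "g \<in> borel_measurable M"
  shows "(\<integral>\<^sup>+x. f x * g x \<partial>M) \<le>
    ennreal_powr (\<integral>\<^sup>+x. ennreal_powr (f x) p \<partial>M) (1/p) * ennreal_powr (\<integral>\<^sup>+x. ennreal_powr (g x) q \<partial>M) (1/q)"
proof -
  have q1: "1 < q" using p by (simp add: q)
  have pq: "1/p + 1/q = 1" using p by (simp add: q field_simps)
  let ?F = "\<integral>\<^sup>+x. ennreal_powr (f x) p \<partial>M" and ?G = "\<integral>\<^sup>+x. ennreal_powr (g x) q \<partial>M"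
  have zero: "(\<integral>\<^sup>+x. f x * g x \<partial>M) = 0" if "?F = 0 \<or> ?G = 0"
  proof -
    have "AE x in M. f x = 0 \<or> g x = 0"
      using that
    proof
      assume "?F = 0"
      then have "AE x in M. ennreal_powr (f x) p = 0" by (subst (asm) nn_integral_0_iff_AE) auto
      then show ?thesis using p by (auto simp: ennreal_powr_eq_0)
    next
      assume "?G = 0"
      then have "AE x in M. ennreal_powr (g x) q = 0" by (subst (asm) nn_integral_0_iff_AE) auto
      then show ?thesis using q1 by (auto simp: ennreal_powr_eq_0)
    qed
    then show ?thesis by (subst nn_integral_0_iff_AE) auto
  qed
  show ?thesis
  proof (cases "?F = 0 \<or> ?G = 0 \<or> ?F = top \<or> ?G = top")
    case True
    then show ?thesis using zero p q1
      by (auto simp: ennreal_mult_top ennreal_top_mult ennreal_powr_eq_0)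
  next
    case False
    then obtain F where F: "?F = ennreal F" "0 < F" by (cases ?F) auto
    from False obtain G where G: "?G = ennreal G" "0 < G" by (cases ?G) auto
    define a b where "a = F powr (-1/p)" and "b = G powr (-1/q)"
    have ab: "0 < a" "0 < b" using F G by (auto simp: a_def b_def)
    have apF: "a powr p * F = 1" "b powr q * G = 1"
      using F G p q1 by (simp_all add: a_def b_def powr_powr powr_neg_one)
    have "ennreal (a * b) * (\<integral>\<^sup>+x. f x * g x \<partial>M) = (\<integral>\<^sup>+x. (ennreal a * f x) * (ennreal b * g x) \<partial>M)"
      using ab by (subst nn_integral_cmult[symmetric]) (auto simp: ennreal_mult ac_simps)
    also have "\<dots> \<le> (\<integral>\<^sup>+x. ennreal (1/p) * ennreal_powr (ennreal a * f x) p + ennreal (1/q) * ennreal_powr (ennreal b * g x) q \<partial>M)"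
      by (rule nn_integral_mono) (rule ennreal_Youngs_inequality[OF p q])
    also have "\<dots> = ennreal (1/p) * (ennreal (a powr p) * ?F) + ennreal (1/q) * (ennreal (b powr q) * ?G)"
      using ab p q1 by (simp add: nn_integral_add nn_integral_cmult ennreal_powr_mult ennreal_powr_ennreal)
    also have "\<dots> = ennreal (1/p) + ennreal (1/q)"
      using F G p q1 apF by (simp add: ennreal_mult[symmetric])
    also have "\<dots> = 1" using p q1 pq by (simp flip: ennreal_plus)
    finally have 1: "ennreal (a * b) * (\<integral>\<^sup>+x. f x * g x \<partial>M) \<le> 1" .
    have inv: "ennreal (1/(a*b)) * ennreal (a * b) = 1" using ab by (simp flip: ennreal_mult)
    have "(\<integral>\<^sup>+x. f x * g x \<partial>M) = ennreal (1/(a*b)) * (ennreal (a * b) * (\<integral>\<^sup>+x. f x * g x \<partial>M))"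
      unfolding mult.assoc[symmetric] inv by simp
    also have "\<dots> \<le> ennreal (1/(a*b))" using mult_left_mono[OF 1, of "ennreal (1/(a*b))"] by simp
    also have "1/(a*b) = F powr (1/p) * G powr (1/q)"
      using F G by (simp add: a_def b_def powr_minus_divide field_simps)
    also have "ennreal \<dots> = ennreal_powr ?F (1/p) * ennreal_powr ?G (1/q)"
      using F G by (simp add: ennreal_powr_ennreal ennreal_mult)
    finally show ?thesis .
  qed
qed

text \<open>The classical proof (\<open>G^p = G * G^(p-1)\<close>, Fubini, Hoelder) ends with a
  division by a power of the norm of \<open>G\<close>, which must be finite for that. So it is run
  for truncations, and monotone convergence removes them.\<close>

lemma nn_integral_Minkowski:
  fixes f :: "real \<Rightarrow> 'b \<Rightarrow> ennreal"
  assumes p: "1 < p" and "sigma_finite_measure M"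
    and f[measurable]: "(\<lambda>(x, b). f x b) \<in> borel_measurable (lborel \<Otimes>\<^sub>M M)"
  shows "ennreal_powr (\<integral>\<^sup>+x. ennreal_powr (\<integral>\<^sup>+b. f x b \<partial>M) p \<partial>lborel) (1/p) \<le>
    (\<integral>\<^sup>+b. ennreal_powr (\<integral>\<^sup>+x. ennreal_powr (f x b) p \<partial>lborel) (1/p) \<partial>M)"
proof -
  interpret M: sigma_finite_measure M by fact
  interpret P: pair_sigma_finite lborel M ..
  define G where "G x = (\<integral>\<^sup>+b. f x b \<partial>M)" for x
  have [measurable]: "G \<in> borel_measurable lborel" unfolding G_def
    by (rule M.borel_measurable_nn_integral) (use f in \<open>simp add: split_def\<close>)
  define q where "q = p / (p - 1)"
  have q1: "1 < q" using p by (simp add: q_def)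
  have q': "1/q = 1 - 1/p" "(p - 1) * q = p" using p by (auto simp: q_def field_simps)
  let ?R = "\<integral>\<^sup>+b. ennreal_powr (\<integral>\<^sup>+x. ennreal_powr (f x b) p \<partial>lborel) (1/p) \<partial>M"
  \<comment> \<open>Bounded by \<open>n\<close> and supported in [-n, n], hence with finite power
    integral; increasing in \<open>n\<close> with supremum \<open>G\<close>.\<close>
  define Gn where "Gn n x = min (G x) (of_nat n) * indicator {- real n..real n} x" for n x
  have [measurable]: "Gn n \<in> borel_measurable lborel" for n unfolding Gn_def by measurable
  have bound: "ennreal_powr (\<integral>\<^sup>+x. ennreal_powr (Gn n x) p \<partial>lborel) (1/p) \<le> ?R" for n
  proof -
    let ?I = "\<integral>\<^sup>+x. ennreal_powr (Gn n x) p \<partial>lborel"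
    have "?I \<le> (\<integral>\<^sup>+x. ennreal (real n powr p) * indicator {- real n..real n} x \<partial>lborel)"
    proof (rule nn_integral_mono)
      fix x
      have "min (G x) (of_nat n) \<le> ennreal (real n)" by (simp add: ennreal_of_nat_eq_real_of_nat)
      then have "ennreal_powr (min (G x) (of_nat n)) p \<le> ennreal_powr (ennreal (real n)) p"
        using p by (intro ennreal_powr_mono) auto
      then show "ennreal_powr (Gn n x) p \<le> ennreal (real n powr p) * indicator {- real n..real n} x"
        using p by (auto simp: Gn_def ennreal_powr_ennreal indicator_def)
    qed
    also have "\<dots> < top" by (subst nn_integral_cmult_indicator) (auto simp: ennreal_mult_less_top)
    finally have fin: "?I < top" .
    \<comment> \<open>Only the first factor is enlarged from \<open>Gn\<close> to \<open>G\<close>;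
      the other one stays truncated, so that Hoelder's inequality reproduces the finite integral
      \<open>?I\<close> on the right.\<close>
    have "?I \<le> (\<integral>\<^sup>+x. G x * ennreal_powr (Gn n x) (p - 1) \<partial>lborel)"
    proof (rule nn_integral_mono)
      fix x
      have "ennreal_powr (Gn n x) p = Gn n x * ennreal_powr (Gn n x) (p - 1)"
        using ennreal_powr_add[of 1 "p - 1" "Gn n x"] p by simp
      also have "\<dots> \<le> G x * ennreal_powr (Gn n x) (p - 1)"
        by (intro mult_right_mono) (auto simp: Gn_def indicator_def)
      finally show "ennreal_powr (Gn n x) p \<le> G x * ennreal_powr (Gn n x) (p - 1)" .
    qed
    also have "\<dots> = (\<integral>\<^sup>+x. (\<integral>\<^sup>+b. f x b * ennreal_powr (Gn n x) (p - 1) \<partial>M) \<partial>lborel)"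
      unfolding G_def by (subst nn_integral_multc) auto
    also have "\<dots> = (\<integral>\<^sup>+b. (\<integral>\<^sup>+x. f x b * ennreal_powr (Gn n x) (p - 1) \<partial>lborel) \<partial>M)"
      by (rule P.Fubini'[symmetric]) measurable
    also have "\<dots> \<le> (\<integral>\<^sup>+b. ennreal_powr (\<integral>\<^sup>+x. ennreal_powr (f x b) p \<partial>lborel) (1/p) * ennreal_powr ?I (1/q) \<partial>M)"
    proof (rule nn_integral_mono)
      fix b assume [measurable]: "b \<in> space M"
      have [measurable]: "(\<lambda>x. f x b) \<in> borel_measurable lborel"
        using measurable_compose[OF measurable_Pair2'[of b M lborel] f] by simp
      from nn_integral_Hoelder[OF p q_def this, of "\<lambda>x. ennreal_powr (Gn n x) (p - 1)"]
      show "(\<integral>\<^sup>+x. f x b * ennreal_powr (Gn n x) (p - 1) \<partial>lborel) \<le>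
        ennreal_powr (\<integral>\<^sup>+x. ennreal_powr (f x b) p \<partial>lborel) (1/p) * ennreal_powr ?I (1/q)"
        using q' by (simp add: ennreal_powr_powr)
    qed
    also have "\<dots> = ?R * ennreal_powr ?I (1/q)"
    proof (rule nn_integral_multc)
      have [measurable]: "(\<lambda>(b, x). f x b) \<in> borel_measurable (M \<Otimes>\<^sub>M lborel)"
        using measurable_compose[OF measurable_pair_swap' f] by (simp add: split_def)
      have "(\<lambda>b. \<integral>\<^sup>+x. ennreal_powr (f x b) p \<partial>lborel) \<in> borel_measurable M"
        by (rule sigma_finite_measure.borel_measurable_nn_integral[OF sigma_finite_lborel]) measurable
      then show "(\<lambda>b. ennreal_powr (\<integral>\<^sup>+x. ennreal_powr (f x b) p \<partial>lborel) (1/p)) \<in> borel_measurable M"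
        by measurable
    qed
    finally have le: "?I \<le> ?R * ennreal_powr ?I (1/q)" .
    show ?thesis
    proof (cases "?I = 0")
      case True then show ?thesis using p by simp
    next
      case False
      then obtain I where I: "?I = ennreal I" "0 < I" using fin by (cases ?I) auto
      have "ennreal_powr ?I (1/p) * ennreal_powr ?I (1/q) = ?I"
        using ennreal_powr_add[of "1/p" "1/q" ?I] q' p q1 by simp
      then have le': "ennreal_powr ?I (1/p) * ennreal (I powr (1/q)) \<le> ?R * ennreal (I powr (1/q))"
        using le I by (simp add: ennreal_powr_ennreal)
      have inv: "ennreal (I powr (1/q)) * ennreal (1 / I powr (1/q)) = 1"
        using I by (simp flip: ennreal_mult)
      from mult_right_mono[OF le', of "ennreal (1 / I powr (1/q))"]
      show ?thesis unfolding mult.assoc inv by simp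
    qed
  qed
  have "(SUP n. Gn n x) = G x" for x
  proof -
    obtain N where N: "\<bar>x\<bar> \<le> real N" using real_arch_simple by blast
    have "(SUP n. Gn n x) = (SUP n. min (G x) (of_nat n))"
    proof (rule antisym)
      show "(SUP n. Gn n x) \<le> (SUP n. min (G x) (of_nat n))"
        by (rule SUP_subset_mono) (auto simp: Gn_def indicator_def)
      show "(SUP n. min (G x) (of_nat n)) \<le> (SUP n. Gn n x)"
      proof (rule SUP_mono)
        fix n
        have "min (G x) (of_nat n) \<le> min (G x) (of_nat (max n N))"
          by (intro min.mono of_nat_mono) auto
        also have "\<dots> = Gn (max n N) x"
          using N by (auto simp: Gn_def indicator_def)
        finally have "min (G x) (of_nat n) \<le> Gn (max n N) x" .
        then show "\<exists>m\<in>UNIV. min (G x) (of_nat n) \<le> Gn m x" by blast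
      qed
    qed
    also have "\<dots> = inf (G x) (SUP n. of_nat n)"
      by (simp add: inf_SUP flip: inf_min)
    also have "\<dots> = G x" by (simp add: ennreal_SUP_of_nat_eq_top)
    finally show ?thesis .
  qed
  note SUPG = this
  have "incseq (\<lambda>n x. ennreal_powr (Gn n x) p)"
    unfolding incseq_def le_fun_def
    by (intro allI impI ennreal_powr_mono)
       (use p in \<open>auto simp: Gn_def indicator_def min_le_iff_disj min.coboundedI2\<close>)
  then have "(\<integral>\<^sup>+x. ennreal_powr (G x) p \<partial>lborel) = (SUP n. \<integral>\<^sup>+x. ennreal_powr (Gn n x) p \<partial>lborel)"
    using p by (subst nn_integral_monotone_convergence_SUP[symmetric])
       (auto simp: ennreal_powr_SUP[symmetric] SUPG)
  then have "ennreal_powr (\<integral>\<^sup>+x. ennreal_powr (G x) p \<partial>lborel) (1/p) =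
    (SUP n. ennreal_powr (\<integral>\<^sup>+x. ennreal_powr (Gn n x) p \<partial>lborel) (1/p))"
    using p by (simp add: ennreal_powr_SUP)
  also have "\<dots> \<le> ?R" by (rule SUP_least) (rule bound)
  finally show ?thesis by (simp add: G_def)
qed

section \<open>Iterated integrals and mixed norms\<close>

lemma update_coord_eq: "update_coord x i t = x + (t - x $ i) *\<^sub>R axis i 1"
  by (simp add: update_coord_def vec_eq_iff axis_def)

lemma update_coord_nth: "update_coord x i t $ j = (if j = i then t else x $ j)"
  by (simp add: update_coord_def)

lemma update_coord_same [simp]: "update_coord (update_coord x i s) i t = update_coord x i t"
  by (simp add: vec_eq_iff update_coord_nth)

lemma update_coord_commute:
  "i \<noteq> j \<Longrightarrow> update_coord (update_coord x i s) j t = update_coord (update_coord x j t) i s"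
  by (simp add: vec_eq_iff update_coord_nth)

lemma coord_measurable [measurable]: "(\<lambda>x::real ^ 'n::finite. x $ i) \<in> borel_measurable borel"
  by (rule borel_measurable_continuous_onI) (auto intro!: continuous_intros)

lemma update_coord_measurable [measurable]:
  fixes f :: "'a \<Rightarrow> real ^ 'n"
  assumes [measurable]: "f \<in> borel_measurable M" "g \<in> borel_measurable M"
  shows "(\<lambda>x. update_coord (f x) i (g x)) \<in> borel_measurable M"
proof -
  have [measurable]: "(\<lambda>x. f x $ i) \<in> borel_measurable M"
    by (rule borel_measurable_continuous_on[where f="\<lambda>v. v $ i"]) (auto intro!: continuous_intros)
  show ?thesis unfolding update_coord_eq by measurable
qed

text \<open>The head of the list is the variable integrated last, so that an induction peels off the
  outermost integral; this reverses the order of \<open>mixed_int\<close>. With the root taken at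
  every stage each tail yields a norm of its own, depending on the remaining coordinates as
  parameters.\<close>

primrec mnorm :: "('n::finite \<Rightarrow> real) \<Rightarrow> 'n list \<Rightarrow> (real ^ 'n \<Rightarrow> ennreal) \<Rightarrow> real ^ 'n \<Rightarrow> ennreal" where
  "mnorm p [] g = g"
| "mnorm p (i # is) g = (\<lambda>x. ennreal_powr
     (\<integral>\<^sup>+t. ennreal_powr (mnorm p is g (update_coord x i t)) (p i) \<partial>lborel) (1 / p i))"

primrec iter_int :: "'n::finite list \<Rightarrow> (real ^ 'n \<Rightarrow> ennreal) \<Rightarrow> real ^ 'n \<Rightarrow> ennreal" where
  "iter_int [] g = g"
| "iter_int (i # is) g = (\<lambda>x. \<integral>\<^sup>+t. iter_int is g (update_coord x i t) \<partial>lborel)"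

lemma mnorm_append: "mnorm p (as @ bs) g = mnorm p as (mnorm p bs g)"
  by (induction as) auto

text \<open>\<open>mixed_int\<close> postpones the root of each stage to the next power,
  \<open>q\<close> being the exponent still pending; the induction therefore needs an argument that
  is itself a \<open>q\<close>-th power.\<close>

lemma mixed_int_eq_mnorm:
  assumes "0 < q" "\<And>i. 0 < p i"
  shows "mixed_int p q is (\<lambda>x. ennreal_powr (G x) q) = mnorm p (rev is) G"
  using assms(1)
proof (induction "is" arbitrary: q G)
  case Nil
  then show ?case by (simp add: ennreal_powr_powr)
next
  case (Cons i "is")
  have eq: "(\<lambda>x. \<integral>\<^sup>+ t. ennreal_powr (ennreal_powr (G (update_coord x i t)) q) (p i / q) \<partial>lebesgue) =
    (\<lambda>x. ennreal_powr (mnorm p [i] G x) (p i))"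
    using Cons.prems assms(2)[of i]
    by (auto simp: ennreal_powr_powr nn_integral_completion)
  show ?case
    by (simp only: mixed_int.simps eq Cons.IH[OF assms(2)] rev.simps mnorm_append)
qed

lemma mnorm_measurable_param [measurable (raw)]:
  fixes f :: "'b \<Rightarrow> real ^ 'n::finite \<Rightarrow> ennreal"
  assumes "(\<lambda>(b, x). f b x) \<in> borel_measurable (M \<Otimes>\<^sub>M borel)"
  shows "(\<lambda>(b, x). mnorm p is (f b) x) \<in> borel_measurable (M \<Otimes>\<^sub>M borel)"
proof (induction "is")
  case Nil then show ?case using assms by simp
next
  case (Cons i "is")
  have "(\<lambda>z. (fst (fst z), update_coord (snd (fst z)) i (snd z))) \<in> (M \<Otimes>\<^sub>M borel) \<Otimes>\<^sub>M lborel \<rightarrow>\<^sub>M M \<Otimes>\<^sub>M borel"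
    by measurable
  from ennreal_powr_measurable[OF measurable_compose[OF this Cons.IH]]
  have "(\<lambda>(z, t). ennreal_powr (mnorm p is (f (fst z)) (update_coord (snd z) i t)) (p i))
      \<in> borel_measurable ((M \<Otimes>\<^sub>M borel) \<Otimes>\<^sub>M lborel)"
    by (simp add: split_def)
  from sigma_finite_measure.borel_measurable_nn_integral[OF sigma_finite_lborel this]
  have [measurable]: "(\<lambda>z. \<integral>\<^sup>+t. ennreal_powr (mnorm p is (f (fst z)) (update_coord (snd z) i t)) (p i) \<partial>lborel)
     \<in> borel_measurable (M \<Otimes>\<^sub>M borel)" .
  have "(\<lambda>z. ennreal_powr (\<integral>\<^sup>+t. ennreal_powr (mnorm p is (f (fst z)) (update_coord (snd z) i t)) (p i) \<partial>lborel) (1 / p i))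
     \<in> borel_measurable (M \<Otimes>\<^sub>M borel)" by measurable
  then show ?case by (simp add: split_def)
qed

lemma mnorm_measurable [measurable]:
  assumes [measurable]: "f \<in> borel_measurable borel"
  shows "mnorm p is f \<in> borel_measurable borel"
proof -
  have "(\<lambda>(b::real, x). mnorm p is f x) \<in> borel_measurable (borel \<Otimes>\<^sub>M borel)"
    by (rule mnorm_measurable_param) (simp add: split_def)
  from measurable_compose[OF _ this, of "\<lambda>x. (0, x)" borel] show ?thesis by simp
qed

lemma iter_int_measurable [measurable]:
  assumes [measurable]: "f \<in> borel_measurable borel"
  shows "iter_int is f \<in> borel_measurable borel"
proof (induction "is")
  case (Cons i "is")
  note [measurable] = this
  show ?case unfolding iter_int.simps
    by (rule sigma_finite_measure.borel_measurable_nn_integral[OF sigma_finite_lborel]) measurable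
qed simp

section \<open>Norm properties of \<open>mnorm\<close>\<close>

lemma mnorm_mono:
  assumes "\<And>x. f x \<le> g x" "\<And>i. 0 < p i"
  shows "mnorm p is f x \<le> mnorm p is g x"
  by (induction "is" arbitrary: x)
     (auto intro!: assms ennreal_powr_mono nn_integral_mono simp: assms)

lemma mnorm_cong: "(\<And>x. f x = g x) \<Longrightarrow> mnorm p is f x = mnorm p is g x"
  by (rule arg_cong[where f="\<lambda>f. mnorm p is f x"]) (rule ext)

lemma mnorm_update:
  "i \<notin> set is \<Longrightarrow> mnorm p is g (update_coord x i t) = mnorm p is (\<lambda>y. g (update_coord y i t)) x"
  by (induction "is" arbitrary: x) (auto simp: update_coord_commute)

lemma mnorm_update_mem:
  "i \<in> set is \<Longrightarrow> mnorm p is g (update_coord x i t) = mnorm p is g x"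
proof (induction "is" arbitrary: x)
  case (Cons j "is")
  show ?case
  proof (cases "i = j")
    case False
    with Cons have *: "mnorm p is g (update_coord x i t) = mnorm p is g x" for x by auto
    from False show ?thesis by (simp add: update_coord_commute[of i j] *)
  qed simp
qed simp

text \<open>A factor that is constant in the integrated variables passes through every stage; the
  dual function in \<open>mnorm_dual\<close> is built from such factors.\<close>

lemma mnorm_cmult_indep:
  assumes [measurable]: "f \<in> borel_measurable borel" "k \<in> borel_measurable borel"
    and "\<And>x i t. i \<in> set is \<Longrightarrow> k (update_coord x i t) = k x" "\<And>i. 0 < p i"
  shows "mnorm p is (\<lambda>y. k y * f y) x = k x * mnorm p is f x"
  using assms(3)
proof (induction "is" arbitrary: x)
  case (Cons i "is")
  then have IH: "mnorm p is (\<lambda>y. k y * f y) x = k x * mnorm p is f x" for x by simp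
  show ?case using assms(4)[of i]
    by (simp add: IH Cons.prems ennreal_powr_mult nn_integral_cmult ennreal_powr_powr)
qed simp

lemma iter_int_cmult_indep:
  assumes [measurable]: "f \<in> borel_measurable borel" "k \<in> borel_measurable borel"
    and "\<And>x i t. i \<in> set is \<Longrightarrow> k (update_coord x i t) = k x"
  shows "iter_int is (\<lambda>y. k y * f y) x = k x * iter_int is f x"
  using assms(3)
proof (induction "is" arbitrary: x)
  case (Cons i "is")
  then have IH: "iter_int is (\<lambda>y. k y * f y) x = k x * iter_int is f x" for x by simp
  show ?case by (simp add: IH Cons.prems nn_integral_cmult)
qed simp

lemma mnorm_cmult:
  assumes [measurable]: "f \<in> borel_measurable borel" and "\<And>i. 0 < p i"
  shows "mnorm p is (\<lambda>y. c * f y) x = c * mnorm p is f x"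
  by (rule mnorm_cmult_indep[where k="\<lambda>_. c"]) (use assms in auto)

lemma mnorm_SUP:
  fixes f :: "nat \<Rightarrow> real ^ 'n::finite \<Rightarrow> ennreal"
  assumes [measurable]: "\<And>n. f n \<in> borel_measurable borel" and f: "incseq f" and p: "\<And>i. 0 < p i"
  shows "mnorm p is (\<lambda>y. SUP n. f n y) x = (SUP n. mnorm p is (f n) x)"
proof (induction "is" arbitrary: x)
  case (Cons i "is")
  have mono: "incseq (\<lambda>n t. ennreal_powr (mnorm p is (f n) (update_coord x i t)) (p i))"
    using f p by (auto simp: incseq_def le_fun_def intro!: ennreal_powr_mono mnorm_mono)
  show ?case using p[of i]
    by (simp add: Cons.IH ennreal_powr_SUP nn_integral_monotone_convergence_SUP[OF mono])
qed simp

lemma mnorm_powr: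
  assumes "0 < s" "\<And>i. 0 < p i"
  shows "mnorm p is (\<lambda>y. ennreal_powr (g y) s) x = ennreal_powr (mnorm (\<lambda>i. s * p i) is g x) s"
proof (induction "is" arbitrary: x)
  case (Cons i "is")
  show ?case using assms(1) assms(2)[of i]
    by (simp add: Cons.IH ennreal_powr_powr)
qed simp

lemma mnorm_Minkowski:
  fixes f :: "'b \<Rightarrow> real ^ 'n::finite \<Rightarrow> ennreal"
  assumes p: "\<And>i. 1 < p i" and M: "sigma_finite_measure M"
    and f: "(\<lambda>(b, x). f b x) \<in> borel_measurable (M \<Otimes>\<^sub>M borel)"
  shows "mnorm p is (\<lambda>y. \<integral>\<^sup>+b. f b y \<partial>M) x \<le> (\<integral>\<^sup>+b. mnorm p is (f b) x \<partial>M)"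
proof (induction "is" arbitrary: x)
  case (Cons i "is")
  have p': "0 < p i" using p[of i] by simp
  have "mnorm p (i # is) (\<lambda>y. \<integral>\<^sup>+b. f b y \<partial>M) x \<le> ennreal_powr
     (\<integral>\<^sup>+t. ennreal_powr (\<integral>\<^sup>+b. mnorm p is (f b) (update_coord x i t) \<partial>M) (p i) \<partial>lborel) (1 / p i)"
    using p' by (auto intro!: ennreal_powr_mono nn_integral_mono Cons.IH)
  also have "\<dots> \<le> (\<integral>\<^sup>+b. ennreal_powr (\<integral>\<^sup>+t. ennreal_powr (mnorm p is (f b) (update_coord x i t)) (p i) \<partial>lborel) (1 / p i) \<partial>M)"
  proof (rule nn_integral_Minkowski[OF p M])
    note mnorm_measurable_param[OF f, of p "is"]
    from measurable_compose[OF _ this, of "\<lambda>(t, b). (b, update_coord x i t)" "lborel \<Otimes>\<^sub>M M"]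
    show "(\<lambda>(t, b). mnorm p is (f b) (update_coord x i t)) \<in> borel_measurable (lborel \<Otimes>\<^sub>M M)"
      by (simp add: split_def)
  qed
  finally show ?case by simp
qed simp

text \<open>A sum of two functions is an integral over a two-point counting space, for which this is
  Minkowski's integral inequality.\<close>

lemma mnorm_add_le:
  assumes p: "\<And>i. 1 < p i" and [measurable]: "f \<in> borel_measurable borel" "g \<in> borel_measurable borel"
  shows "mnorm p is (\<lambda>y. f y + g y) x \<le> mnorm p is f x + mnorm p is g x"
proof -
  have sf: "sigma_finite_measure (count_space (UNIV :: bool set))"
    by (rule sigma_finite_measure_count_space_finite) simp
  have "mnorm p is (\<lambda>y. \<integral>\<^sup>+b. (if b then f y else g y) \<partial>count_space (UNIV :: bool set)) x \<le>
    (\<integral>\<^sup>+b. mnorm p is (\<lambda>y. if b then f y else g y) x \<partial>count_space (UNIV :: bool set))"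
    by (rule mnorm_Minkowski[OF p sf]) (auto intro!: measurable_pair_measure_countable1 simp: split_def)
  then show ?thesis
    by (simp add: nn_integral_count_space_finite UNIV_bool add.commute)
qed

lemma mnorm_sum_le:
  assumes p: "\<And>i. 1 < p i" and "finite A" "A \<noteq> {}" and [measurable]: "\<And>a. a \<in> A \<Longrightarrow> f a \<in> borel_measurable borel"
  shows "mnorm p is (\<lambda>y. \<Sum>a\<in>A. f a y) x \<le> (\<Sum>a\<in>A. mnorm p is (f a) x)"
  using assms(2-4)
proof (induction A rule: finite_ne_induct)
  case (insert a A)
  then have "mnorm p is (\<lambda>y. f a y + (\<Sum>a\<in>A. f a y)) x \<le> mnorm p is (f a) x + mnorm p is (\<lambda>y. \<Sum>a\<in>A. f a y) x"
    by (intro mnorm_add_le p) auto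
  also have "\<dots> \<le> mnorm p is (f a) x + (\<Sum>a\<in>A. mnorm p is (f a) x)"
    using insert by (intro add_left_mono) auto
  finally show ?case using insert by simp
qed auto

text \<open>Vanishing of the iterated integral of \<open>indicator Z\<close> is the form of nullity
  that almost every section inherits, and so it carries the induction through the variables. After
  the last one it says that the point itself lies outside \<open>Z\<close>.\<close>

lemma mnorm_cong_iter_int_0:
  assumes [measurable]: "Z \<in> sets borel" and "iter_int is (indicator Z) x = 0"
    and "\<And>y. y \<notin> Z \<Longrightarrow> f y = g y"
  shows "mnorm p is f x = mnorm p is g x"
  using assms(2)
proof (induction "is" arbitrary: x)
  case Nil
  then show ?case using assms(3) by (auto simp: indicator_def split: if_splits)
next
  case (Cons i "is")
  then have "AE t in lborel. iter_int is (indicator Z) (update_coord x i t) = 0"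
    by (subst (asm) iter_int.simps, subst (asm) nn_integral_0_iff_AE) auto
  then have "AE t in lborel. mnorm p is f (update_coord x i t) = mnorm p is g (update_coord x i t)"
    using Cons.IH by auto
  then have "(\<integral>\<^sup>+t. ennreal_powr (mnorm p is f (update_coord x i t)) (p i) \<partial>lborel) =
     (\<integral>\<^sup>+t. ennreal_powr (mnorm p is g (update_coord x i t)) (p i) \<partial>lborel)"
    by (intro nn_integral_cong_AE) auto
  then show ?case by simp
qed

section \<open>Lebesgue measure as an iterated integral\<close>

lemma lborel_eq_distr_PiM:
  "(lborel :: (real ^ 'n::finite) measure) = distr (PiM UNIV (\<lambda>_. lborel)) borel (\<lambda>f. \<chi> i. f i)"
proof (rule lborel_eqI)
  interpret product_sigma_finite "\<lambda>_::'n. lborel :: real measure" ..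
  have meas: "(\<lambda>f. \<chi> i::'n. (f i :: real)) \<in> measurable (PiM UNIV (\<lambda>_. lborel)) borel"
    by (subst borel_measurable_euclidean_space)
       (auto simp: Basis_vec_def inner_axis intro!: measurable_component_singleton)
  fix l u :: "real ^ 'n" assume le: "\<And>b. b \<in> Basis \<Longrightarrow> l \<bullet> b \<le> u \<bullet> b"
  have le': "l $ i \<le> u $ i" for i using le[of "axis i 1"] by (simp add: inner_axis)
  have "(\<lambda>f. \<chi> i. f i) -` box l u \<inter> space (PiM UNIV (\<lambda>_. lborel)) = Pi\<^sub>E UNIV (\<lambda>i. {l $ i<..<u $ i})"
    by (auto simp: mem_box Basis_vec_def inner_axis space_PiM PiE_def extensional_def Pi_iff)
  then have "emeasure (distr (PiM UNIV (\<lambda>_. lborel)) borel (\<lambda>f. \<chi> i. f i)) (box l u) = (\<Prod>i\<in>UNIV. ennreal (u $ i - l $ i))"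
    using le' by (subst emeasure_distr[OF meas]) (auto simp: emeasure_PiM)
  also have "\<dots> = ennreal (\<Prod>i\<in>UNIV. u $ i - l $ i)"
    using le' by (intro prod_ennreal) auto
  also have "(\<Prod>i\<in>UNIV. u $ i - l $ i) = (\<Prod>b\<in>range (\<lambda>i. axis i 1). (u - l) \<bullet> b)"
    by (subst prod.reindex) (auto simp: inj_on_def axis_eq_axis inner_axis)
  also have "range (\<lambda>i. axis i 1) = (Basis :: (real ^ 'n) set)"
    by (auto simp: Basis_vec_def)
  finally show "emeasure (distr (PiM UNIV (\<lambda>_. lborel)) borel (\<lambda>f. \<chi> i::'n. f i)) (box l u) = (\<Prod>b\<in>Basis. (u - l) \<bullet> b)" .
qed simp

lemma iter_int_eq_PiM:
  fixes g :: "real ^ 'n::finite \<Rightarrow> ennreal"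
  assumes [measurable]: "g \<in> borel_measurable borel" and "distinct is"
  shows "iter_int is g x = (\<integral>\<^sup>+f. g (\<chi> i. if i \<in> set is then f i else x $ i) \<partial>PiM (set is) (\<lambda>_. lborel))"
  using assms(2)
proof (induction "is" arbitrary: x)
  case Nil
  interpret product_sigma_finite "\<lambda>_::'n. lborel :: real measure" ..
  show ?case by (simp add: nn_integral_empty space_PiM)
next
  case (Cons i "is")
  interpret product_sigma_finite "\<lambda>_::'n. lborel :: real measure" ..
  have meas: "(\<lambda>f. \<chi> j. if j = i \<or> j \<in> set is then f j else x $ j) \<in> borel_measurable (PiM (insert i (set is)) (\<lambda>_. lborel))"
  proof (subst borel_measurable_euclidean_space, clarsimp simp: Basis_vec_def inner_axis)
    fix j
    show "(\<lambda>f. if j = i \<or> j \<in> set is then f j else x $ j) \<in> borel_measurable (PiM (insert i (set is)) (\<lambda>_. lborel))"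
      by (cases "j = i \<or> j \<in> set is") (auto intro!: measurable_component_singleton)
  qed
  have "iter_int (i # is) g x = (\<integral>\<^sup>+t. (\<integral>\<^sup>+f. g (\<chi> j. if j \<in> set is then f j else update_coord x i t $ j) \<partial>PiM (set is) (\<lambda>_. lborel)) \<partial>lborel)"
    using Cons by simp
  also have "\<dots> = (\<integral>\<^sup>+t. (\<integral>\<^sup>+f. g (\<chi> j. if j = i \<or> j \<in> set is then (f(i:=t)) j else x $ j) \<partial>PiM (set is) (\<lambda>_. lborel)) \<partial>lborel)"
    using Cons.prems by (intro nn_integral_cong arg_cong[where f=g]) (auto simp: vec_eq_iff update_coord_nth)
  also have "\<dots> = (\<integral>\<^sup>+f. g (\<chi> j. if j \<in> set (i # is) then f j else x $ j) \<partial>PiM (set (i # is)) (\<lambda>_. lborel))"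
    using Cons.prems meas by (simp, subst product_nn_integral_insert_rev) auto
  finally show ?case .
qed

lemma iter_int_eq_nn_integral:
  fixes g :: "real ^ 'n::finite \<Rightarrow> ennreal"
  assumes [measurable]: "g \<in> borel_measurable borel" and "distinct is" "set is = UNIV"
  shows "iter_int is g x = (\<integral>\<^sup>+y. g y \<partial>lborel)"
proof -
  have meas: "(\<lambda>f. \<chi> i::'n. (f i :: real)) \<in> measurable (PiM UNIV (\<lambda>_. lborel)) borel"
    by (subst borel_measurable_euclidean_space)
       (auto simp: Basis_vec_def inner_axis intro!: measurable_component_singleton)
  show ?thesis
    by (subst iter_int_eq_PiM[OF assms(1,2)], subst lborel_eq_distr_PiM)
       (use meas in \<open>simp add: assms(3) nn_integral_distr\<close>)
qed

section \<open>Hoelder's inequality and duality for mixed norms\<close>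

lemma iter_int_Hoelder:
  assumes p: "\<And>i. 1 < p i" and [measurable]: "f \<in> borel_measurable borel" "g \<in> borel_measurable borel"
  shows "iter_int is (\<lambda>y. f y * g y) x \<le> mnorm p is f x * mnorm (\<lambda>i. p i / (p i - 1)) is g x"
proof (induction "is" arbitrary: x)
  case (Cons i "is")
  have "iter_int (i # is) (\<lambda>y. f y * g y) x \<le>
    (\<integral>\<^sup>+t. mnorm p is f (update_coord x i t) * mnorm (\<lambda>i. p i / (p i - 1)) is g (update_coord x i t) \<partial>lborel)"
    by (auto intro!: nn_integral_mono Cons.IH)
  also have "\<dots> \<le> mnorm p (i # is) f x * mnorm (\<lambda>i. p i / (p i - 1)) (i # is) g x"
    using nn_integral_Hoelder[OF p refl, of "\<lambda>t. mnorm p is f (update_coord x i t)" lborel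
        "\<lambda>t. mnorm (\<lambda>i. p i / (p i - 1)) is g (update_coord x i t)" i] by simp
  finally show ?case .
qed simp

text \<open>The extremal function is a product with one factor per variable. The variable
  \<open>i\<close> contributes the extremal function of Hoelder's inequality on the line for
  \<open>F = mnorm p is h\<close>; this factor does not depend on the variables in
  \<open>is\<close>, so it merely multiplies the inner norm and the inner pairing. The bound on
  \<open>g\<close> holds at every point, the equality where the norm is finite.\<close>

lemma mnorm_dual:
  fixes h :: "real ^ 'n::finite \<Rightarrow> ennreal"
  assumes p: "\<And>i. 1 < p i" and [measurable]: "h \<in> borel_measurable borel" and "distinct is"
  shows "\<exists>g \<in> borel_measurable borel. (\<forall>x. mnorm (\<lambda>i. p i / (p i - 1)) is g x \<le> 1) \<and>
    (\<forall>x. mnorm p is h x < top \<longrightarrow> iter_int is (\<lambda>y. h y * g y) x = mnorm p is h x)"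
  using assms(3)
proof (induction "is")
  case Nil
  show ?case by (rule bexI[of _ "\<lambda>_. 1"]) auto
next
  case (Cons i "is")
  let ?p' = "\<lambda>i. p i / (p i - 1)"
  have p': "0 < p i / (p i - 1)" for i using p[of i] by simp
  from Cons obtain g where [measurable]: "g \<in> borel_measurable borel"
    and g: "\<And>x. mnorm ?p' is g x \<le> 1"
      "\<And>x. mnorm p is h x < top \<Longrightarrow> iter_int is (\<lambda>y. h y * g y) x = mnorm p is h x" by auto
  define F where "F = mnorm p is h"
  define N where "N = mnorm p (i # is) h"
  have [measurable]: "F \<in> borel_measurable borel" "N \<in> borel_measurable borel"
    unfolding F_def N_def by measurable
  have pi: "1 < p i" using p .
  \<comment> \<open>Division by \<open>N\<close> makes the conjugate power of \<open>k\<close>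
    integrate to at most one over the \<open>i\<close>-th line. The value is zero where the quotient
    has no meaning.\<close>
  define k where "k x = (if F x < top \<and> 0 < N x \<and> N x < top then ennreal ((enn2real (F x) / enn2real (N x)) powr (p i - 1)) else 0)" for x
  have [measurable]: "k \<in> borel_measurable borel" unfolding k_def by measurable
  have Nind: "N (update_coord x i t) = N x" for x t unfolding N_def by (rule mnorm_update_mem) simp
  have kind: "k (update_coord x j t) = k x" if "j \<in> set is" for x j t
    using that by (simp add: k_def F_def N_def mnorm_update_mem del: mnorm.simps)
  have Nint: "(\<integral>\<^sup>+t. ennreal_powr (F (update_coord x i t)) (p i) \<partial>lborel) = ennreal_powr (N x) (p i)" for x
    using pi by (simp add: N_def F_def ennreal_powr_powr)
  have kp: "ennreal_powr (k y) (?p' i) \<le> ennreal ((1 / n) powr p i) * ennreal_powr (F y) (p i)"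
    if "N y = ennreal n" "0 < n" for y n
    using that pi by (cases "F y")
      (auto simp: k_def ennreal_powr_ennreal powr_powr powr_divide powr_mult ennreal_mult[symmetric])
  have eF: "k y * F y = ennreal ((1 / n) powr (p i - 1)) * ennreal_powr (F y) (p i)"
    if n: "N y = ennreal n" "0 < n" and Fy: "F y < top" for y n
  proof -
    obtain z where z: "F y = ennreal z" "0 \<le> z" using Fy by (cases "F y") auto
    have "(z / n) powr (p i - 1) * z = (1 / n) powr (p i - 1) * (z powr p i)"
      using n z pi powr_add[of z "p i - 1" 1] by (simp add: powr_divide)
    then show ?thesis using n z
      by (simp add: k_def ennreal_powr_ennreal ennreal_mult[symmetric])
  qed
  show ?case
  proof (intro bexI[of _ "\<lambda>y. k y * g y"] conjI allI impI)
    fix x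
    have le: "mnorm ?p' is (\<lambda>y. k y * g y) y \<le> k y" for y
      using mult_left_mono[OF g(1), of "k y" y] by (subst mnorm_cmult_indep) (use p' kind in auto)
    have "(\<integral>\<^sup>+t. ennreal_powr (mnorm ?p' is (\<lambda>y. k y * g y) (update_coord x i t)) (?p' i) \<partial>lborel)
      \<le> (\<integral>\<^sup>+t. ennreal_powr (k (update_coord x i t)) (?p' i) \<partial>lborel)"
      by (intro nn_integral_mono ennreal_powr_mono le p')
    also have "\<dots> \<le> 1"
    proof (cases "0 < N x \<and> N x < top")
      case True
      then obtain n where n: "N x = ennreal n" "0 < n" by (cases "N x") auto
      have "(\<integral>\<^sup>+t. ennreal_powr (k (update_coord x i t)) (?p' i) \<partial>lborel) \<le>
         (\<integral>\<^sup>+t. ennreal ((1 / n) powr p i) * ennreal_powr (F (update_coord x i t)) (p i) \<partial>lborel)"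
        using n by (intro nn_integral_mono kp) (auto simp: Nind)
      also have "\<dots> = 1"
        using n by (simp add: nn_integral_cmult Nint ennreal_powr_ennreal ennreal_mult[symmetric] powr_mult[symmetric])
      finally show ?thesis .
    next
      case False
      then have "k (update_coord x i t) = 0" for t by (auto simp: k_def Nind)
      then show ?thesis using p' by simp
    qed
    finally show "mnorm ?p' (i # is) (\<lambda>y. k y * g y) x \<le> 1"
      using ennreal_powr_mono[of _ 1 "1 / ?p' i"] pi by simp
  next
    fix x assume "mnorm p (i # is) h x < top"
    then have Nx: "N x < top" by (simp add: N_def)
    have *: "iter_int is (\<lambda>y. h y * (k y * g y)) y = k y * F y" for y
    proof -
      have "iter_int is (\<lambda>y. h y * (k y * g y)) y = iter_int is (\<lambda>y. k y * (h y * g y)) y"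
        by (simp add: ac_simps)
      also have "\<dots> = k y * iter_int is (\<lambda>y. h y * g y) y"
        by (rule iter_int_cmult_indep) (use kind in auto)
      also have "\<dots> = k y * F y"
        using g(2)[of y] by (cases "F y < top") (auto simp: F_def[symmetric] k_def)
      finally show ?thesis .
    qed
    have "iter_int (i # is) (\<lambda>y. h y * (k y * g y)) x = (\<integral>\<^sup>+t. k (update_coord x i t) * F (update_coord x i t) \<partial>lborel)"
      by (simp add: *)
    also have "\<dots> = N x"
    proof (cases "N x = 0")
      case True
      then show ?thesis by (simp add: k_def Nind)
    next
      case False
      then obtain n where n: "N x = ennreal n" "0 < n" using Nx by (cases "N x") auto
      \<comment> \<open>A finite \<open>N\<close> makes \<open>F\<close> finite almost everywhere on
        the line, and there the formula \<open>eF\<close> applies.\<close>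
      have "AE t in lborel. ennreal_powr (F (update_coord x i t)) (p i) \<noteq> \<infinity>"
        by (rule nn_integral_PInf_AE) (use Nx in \<open>auto simp: Nint top.not_eq_extremum\<close>)
      then have "(\<integral>\<^sup>+t. k (update_coord x i t) * F (update_coord x i t) \<partial>lborel) =
        (\<integral>\<^sup>+t. ennreal ((1 / n) powr (p i - 1)) * ennreal_powr (F (update_coord x i t)) (p i) \<partial>lborel)"
        by (intro nn_integral_cong_AE) (auto simp: Nind n eF less_top)
      also have "\<dots> = N x"
        using n powr_add[of n "p i - 1" 1]
        by (simp add: nn_integral_cmult Nint ennreal_powr_ennreal ennreal_mult[symmetric] powr_divide)
      finally show ?thesis .
    qed
    finally show "iter_int (i # is) (\<lambda>y. h y * (k y * g y)) x = mnorm p (i # is) h x" by (simp add: N_def)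
  qed measurable
qed

section \<open>Maximal functions on binary trees\<close>

text \<open>A finite dyadic martingale: a subtree is a dyadic interval, and a leaf at depth
  \<open>k\<close> carries the weight \<open>2^(-k)\<close>. Depths may vary from branch to branch,
  so that stopping a martingale means pruning a tree, and every average is a finite sum.\<close>

datatype 'x btree = Leaf 'x | Node "'x btree" "'x btree"

primrec avg :: "('x \<Rightarrow> real) \<Rightarrow> 'x btree \<Rightarrow> real" where
  "avg \<phi> (Leaf a) = \<phi> a"
| "avg \<phi> (Node l r) = (avg \<phi> l + avg \<phi> r) / 2"

primrec mean :: "('a \<Rightarrow> ennreal) btree \<Rightarrow> 'a \<Rightarrow> ennreal" where
  "mean (Leaf a) = a"
| "mean (Node l r) = (\<lambda>w. (mean l w + mean r w) / 2)"

definition fmax :: "('a \<Rightarrow> ennreal) \<Rightarrow> ('a \<Rightarrow> ennreal) \<Rightarrow> 'a \<Rightarrow> ennreal" where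
  "fmax x y = (\<lambda>w. max (x w) (y w))"

lemma fmax_assoc: "fmax (fmax x y) z = fmax x (fmax y z)"
  by (simp add: fmax_def max.assoc)

lemma fmax_zero [simp]: "fmax (\<lambda>_. 0) x = x"
  by (simp add: fmax_def)

lemma avg_mono: "(\<And>z. z \<in> set_btree t \<Longrightarrow> \<phi> z \<le> \<psi> z) \<Longrightarrow> avg \<phi> t \<le> avg \<psi> t"
  by (induction t) (auto intro!: add_mono divide_right_mono)

lemma avg_const: "avg (\<lambda>_. c) t = c"
  by (induction t) auto

lemma avg_add: "avg (\<lambda>z. \<phi> z + \<psi> z) t = avg \<phi> t + avg \<psi> t"
  by (induction t) (auto simp: add_divide_distrib)

lemma avg_cmult: "avg (\<lambda>z. c * \<phi> z) t = c * avg \<phi> t"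
  by (induction t) (auto simp: algebra_simps)

lemma avg_le: "(\<And>z. z \<in> set_btree t \<Longrightarrow> \<phi> z \<le> c) \<Longrightarrow> avg \<phi> t \<le> c"
  using avg_mono[of t \<phi> "\<lambda>_. c"] by (simp add: avg_const)

lemma avg_ge: "(\<And>z. z \<in> set_btree t \<Longrightarrow> c \<le> \<phi> z) \<Longrightarrow> c \<le> avg \<phi> t"
  using avg_mono[of t "\<lambda>_. c" \<phi>] by (simp add: avg_const)

lemma avg_eq: "(\<And>z. z \<in> set_btree t \<Longrightarrow> \<phi> z = c) \<Longrightarrow> avg \<phi> t = c"
  by (rule antisym) (auto intro!: avg_le avg_ge)

text \<open>What the martingale argument needs of a lattice norm \<open>R\<close> that is finite on
  \<open>S\<close>: convexity, and monotonicity and subadditivity under pointwise maxima. The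
  instance is \<open>mnorm p is\<close> at a fixed point.\<close>

locale tree_norm =
  fixes S :: "('a \<Rightarrow> ennreal) set" and R :: "('a \<Rightarrow> ennreal) \<Rightarrow> real"
  assumes avg_S: "x \<in> S \<Longrightarrow> y \<in> S \<Longrightarrow> (\<lambda>w. (x w + y w) / 2) \<in> S"
    and max_S: "x \<in> S \<Longrightarrow> y \<in> S \<Longrightarrow> fmax x y \<in> S"
    and zero_S: "(\<lambda>_. 0) \<in> S"
    and R_nonneg: "0 \<le> R x"
    and R_avg: "x \<in> S \<Longrightarrow> y \<in> S \<Longrightarrow> R (\<lambda>w. (x w + y w) / 2) \<le> (R x + R y) / 2"
    and R_max: "x \<in> S \<Longrightarrow> y \<in> S \<Longrightarrow> R (fmax x y) \<le> R x + R y"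
    and R_le_max: "x \<in> S \<Longrightarrow> y \<in> S \<Longrightarrow> R x \<le> R (fmax x y)"
    and R_zero: "R (\<lambda>_. 0) = 0"
begin

text \<open>Every leaf is replaced by the norm of the running maximum of the means along its branch
  (started at \<open>m\<close>), the running maximum of the averages of the norm (started at \<open>n\<close>), and the norm
  of the leaf.\<close>

primrec trace :: "('a \<Rightarrow> ennreal) btree \<Rightarrow> ('a \<Rightarrow> ennreal) \<Rightarrow> real \<Rightarrow> (real \<times> real \<times> real) btree" where
  "trace (Leaf a) m n = Leaf (R (fmax m a), max n (R a), R a)"
| "trace (Node l r) m n =
     Node (trace l (fmax m (mean (Node l r))) (max n (avg R (Node l r))))
       (trace r (fmax m (mean (Node l r))) (max n (avg R (Node l r))))"

lemma mean_S: "set_btree t \<subseteq> S \<Longrightarrow> mean t \<in> S"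
  by (induction t) (auto intro: avg_S)

lemma R_mean: "set_btree t \<subseteq> S \<Longrightarrow> R (mean t) \<le> avg R t"
proof (induction t)
  case (Node l r)
  then have "R (mean (Node l r)) \<le> (R (mean l) + R (mean r)) / 2"
    using R_avg[of "mean l" "mean r"] mean_S[of l] mean_S[of r] by auto
  also have "\<dots> \<le> (avg R l + avg R r) / 2" using Node by auto
  finally show ?case by simp
qed simp

lemma trace_fst_ge:
  "set_btree t \<subseteq> S \<Longrightarrow> m \<in> S \<Longrightarrow> z \<in> set_btree (trace t m n) \<Longrightarrow> R (fmax m (mean t)) \<le> fst z"
proof (induction t arbitrary: m n)
  case (Node l r)
  let ?m = "fmax m (mean (Node l r))"
  have mS: "?m \<in> S" using Node.prems mean_S[of "Node l r"] by (intro max_S) auto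
  have "R ?m \<le> R (fmax ?m (mean l))" "R ?m \<le> R (fmax ?m (mean r))"
    using Node.prems mS by (auto intro!: R_le_max mean_S)
  moreover have "R (fmax ?m (mean l)) \<le> fst z \<or> R (fmax ?m (mean r)) \<le> fst z"
    using Node.prems Node.IH[OF _ mS] by auto
  ultimately show ?case by linarith
qed auto

lemma trace_snd_ge:
  "z \<in> set_btree (trace t m n) \<Longrightarrow> max n (avg R t) \<le> fst (snd z)"
  by (induction t arbitrary: m n) fastforce+

lemma trace_nonneg:
  "z \<in> set_btree (trace t m n) \<Longrightarrow> 0 \<le> n \<Longrightarrow> 0 \<le> fst z \<and> 0 \<le> fst (snd z) \<and> 0 \<le> snd (snd z)"
proof (induction t arbitrary: m n)
  case (Node l r)
  have "0 \<le> max n (avg R (Node l r))" using Node.prems(2) by (simp add: le_max_iff_disj)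
  then show ?case using Node by auto
qed (auto simp: R_nonneg)

lemma avg_trace_thd: "avg (\<lambda>z. \<phi> (snd (snd z))) (trace t m n) = avg (\<lambda>a. \<phi> (R a)) t"
  by (induction t arbitrary: m n) auto

text \<open>By \<open>R_max\<close> the past maximum \<open>m\<close> can be taken out of the
  running maximum at the price of adding the number \<open>R m\<close>; what remains is the same
  tree started afresh. \<open>n\<close> and \<open>k\<close> are unrelated because
  \<open>\<phi>\<close> sees the first component only.\<close>

lemma avg_trace_shift:
  assumes "mono \<phi>"
  shows "set_btree t \<subseteq> S \<Longrightarrow> m \<in> S \<Longrightarrow> b \<in> S \<Longrightarrow>
    avg (\<lambda>z. \<phi> (fst z)) (trace t (fmax m b) n) \<le> avg (\<lambda>z. \<phi> (R m + fst z)) (trace t b k)"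
proof (induction t arbitrary: b n k)
  case (Leaf a)
  then show ?case using R_max[of m "fmax b a"] assms
    by (auto simp: fmax_assoc max_S dest: monoD)
next
  case (Node l r)
  have "fmax b (mean (Node l r)) \<in> S" using Node.prems mean_S[of "Node l r"] by (intro max_S) auto
  note IH = Node.IH[OF _ Node.prems(2) this]
  show ?case using Node.prems
    by (auto simp: fmax_assoc simp del: mean.simps intro!: divide_right_mono add_mono IH)
qed

section \<open>Stopping on trees, weak type and good lambda\<close>

primrec stop :: "real \<Rightarrow> ('a \<Rightarrow> ennreal) btree \<Rightarrow> ('a \<Rightarrow> ennreal) btree" where
  "stop c (Leaf a) = Leaf a"
| "stop c (Node l r) = (if avg R (Node l r) > c then Leaf (mean (Node l r)) else Node (stop c l) (stop c r))"

text \<open>The total weight of the nodes at which \<open>stop c\<close> cuts. A leaf that is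
  reached without a cut counts zero, whatever its norm.\<close>

primrec stopped :: "real \<Rightarrow> ('a \<Rightarrow> ennreal) btree \<Rightarrow> real" where
  "stopped c (Leaf a) = 0"
| "stopped c (Node l r) = (if avg R (Node l r) > c then 1 else (stopped c l + stopped c r) / 2)"

lemma avg_R_nonneg: "0 \<le> avg R t"
  by (rule avg_ge) (rule R_nonneg)

lemma stopped_le: "0 < c \<Longrightarrow> c * stopped c t \<le> avg R t"
  by (induction t) (auto simp: R_nonneg algebra_simps add_divide_distrib)

lemma mean_stop: "mean (stop c t) = mean t"
  by (induction t) auto

lemma stop_S: "set_btree t \<subseteq> S \<Longrightarrow> set_btree (stop c t) \<subseteq> S"
  using mean_S by (induction t) (auto simp: avg_S)

lemma avg_stop: "set_btree t \<subseteq> S \<Longrightarrow> avg R (stop c t) \<le> avg R t"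
proof (induction t)
  case (Node l r)
  then show ?case using R_mean[of "Node l r"] by auto
qed simp

text \<open>A parent that is not cut has average at most \<open>c\<close>, and averages are
  nonnegative, so each child has average at most \<open>2 * c\<close>; for the root this is the
  hypothesis.\<close>

lemma stop_le:
  "set_btree t \<subseteq> S \<Longrightarrow> avg R t \<le> 2 * c \<Longrightarrow> a \<in> set_btree (stop c t) \<Longrightarrow> R a \<le> 2 * c"
proof (induction t)
  case (Node l r)
  show ?case
  proof (cases "avg R (Node l r) > c")
    case True
    then show ?thesis using Node.prems R_mean[of "Node l r"] by auto
  next
    case False
    then have "avg R l \<le> 2 * c" "avg R r \<le> 2 * c"
      using avg_R_nonneg[of l] avg_R_nonneg[of r] by auto
    then show ?thesis using Node False by auto
  qed
qed auto

text \<open>Pruning changes no mean at a surviving node (\<open>mean_stop\<close>), so the running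
  maxima differ only below the cuts, where \<open>\<phi> \<le> 1\<close> limits the loss to the
  weight of the cuts.\<close>

lemma avg_trace_stop:
  assumes \<phi>: "\<And>x. \<phi> x \<le> 1" "\<And>x. 0 \<le> \<phi> x"
  shows "avg (\<lambda>z. \<phi> (fst z)) (trace t m n) \<le> stopped c t + avg (\<lambda>z. \<phi> (fst z)) (trace (stop c t) m k)"
proof (induction t arbitrary: m n k)
  case (Node l r)
  show ?case
  proof (cases "avg R (Node l r) > c")
    case True
    have "avg (\<lambda>z. \<phi> (fst z)) (trace (Node l r) m n) \<le> 1" by (rule avg_le) (auto intro: \<phi>)
    moreover have "0 \<le> avg (\<lambda>z. \<phi> (fst z)) (trace (stop c (Node l r)) m k)"
      by (rule avg_ge) (auto intro: \<phi>)
    moreover have "stopped c (Node l r) = 1" using True by simp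
    ultimately show ?thesis by linarith
  next
    case False
    let ?m = "fmax m (mean (Node l r))"
    let ?n = "max n (avg R (Node l r))" and ?k = "max k (avg R (Node (stop c l) (stop c r)))"
    have "avg (\<lambda>z. \<phi> (fst z)) (trace l ?m ?n) \<le> stopped c l + avg (\<lambda>z. \<phi> (fst z)) (trace (stop c l) ?m ?k)"
      "avg (\<lambda>z. \<phi> (fst z)) (trace r ?m ?n) \<le> stopped c r + avg (\<lambda>z. \<phi> (fst z)) (trace (stop c r) ?m ?k)"
      using Node.IH by blast+
    then show ?thesis using False by (simp add: mean_stop add_divide_distrib[symmetric])
  qed
qed auto

text \<open>If the root average exceeds \<open>c\<close>, the claim follows from the left side being
  at most one. Otherwise the leaves of the pruned tree have norm at most \<open>2 * c\<close>, so
  its \<open>r\<close>-th moment is at most \<open>(2 * c) powr (r - 1)\<close> times its average,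
  and Chebyshev's inequality applies to the assumed bound at \<open>r\<close>; this accounts for
  \<open>C * 2 powr (r - 1)\<close>. The summand 1 comes from the weight of the cuts.\<close>

lemma weak_type:
  assumes r: "1 < r" and C: "0 \<le> C"
    and rb: "\<And>t. set_btree t \<subseteq> S \<Longrightarrow>
      avg (\<lambda>z. fst z powr r) (trace t (\<lambda>_. 0) 0) \<le> C * avg (\<lambda>a. R a powr r) t"
    and c: "0 < c" and t: "set_btree t \<subseteq> S"
  shows "avg (\<lambda>z. if fst z > c then 1 else 0) (trace t (\<lambda>_. 0) 0) \<le> (1 + C * 2 powr (r - 1)) / c * avg R t"
proof (cases "avg R t > c")
  case True
  have "avg (\<lambda>z. if fst z > c then 1 else 0) (trace t (\<lambda>_. 0) 0) \<le> 1" by (rule avg_le) auto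
  also have "1 \<le> 1 / c * avg R t" using True c by simp
  also have "\<dots> \<le> (1 + C * 2 powr (r - 1)) / c * avg R t"
    using c C avg_R_nonneg[of t] by (intro mult_right_mono divide_right_mono) auto
  finally show ?thesis .
next
  case False
  let ?s = "stop c t"
  have "avg (\<lambda>z. if fst z > c then 1 else 0) (trace ?s (\<lambda>_. 0) 0) \<le>
    avg (\<lambda>z. (1 / c powr r) * (fst z powr r)) (trace ?s (\<lambda>_. 0) 0)"
  proof (rule avg_mono)
    fix z assume "z \<in> set_btree (trace ?s (\<lambda>_. 0) 0)"
    then have "0 \<le> fst z" using trace_nonneg by fastforce
    then show "(if fst z > c then 1 else 0) \<le> 1 / c powr r * (fst z powr r)"
      using c r by (auto intro!: powr_mono2)
  qed
  also have "\<dots> \<le> (1 / c powr r) * (C * avg (\<lambda>a. R a powr r) ?s)"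
    unfolding avg_cmult by (intro mult_left_mono rb stop_S t) simp
  also have "\<dots> \<le> (1 / c powr r) * (C * avg (\<lambda>a. (2 * c) powr (r - 1) * R a) ?s)"
  proof (intro mult_left_mono avg_mono)
    fix a assume a: "a \<in> set_btree ?s"
    have "R a powr r = R a powr (r - 1) * R a"
      using powr_add[of "R a" "r - 1" 1] R_nonneg[of a] by simp
    also have "\<dots> \<le> (2 * c) powr (r - 1) * R a"
      using stop_le[OF t _ a] False c r R_nonneg[of a] by (intro mult_right_mono powr_mono2) auto
    finally show "R a powr r \<le> (2 * c) powr (r - 1) * R a" .
  qed (use C in auto)
  also have "\<dots> = (C * 2 powr (r - 1) / c) * avg R ?s"
    unfolding avg_cmult using c powr_add[of c "r - 1" 1] by (simp add: powr_mult field_simps)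
  also have "\<dots> \<le> (C * 2 powr (r - 1) / c) * avg R t"
    using C c by (intro mult_left_mono avg_stop t) auto
  finally have 1: "avg (\<lambda>z. if fst z > c then 1 else 0) (trace ?s (\<lambda>_. 0) 0) \<le> (C * 2 powr (r - 1) / c) * avg R t" .
  have "avg (\<lambda>z. if fst z > c then 1 else 0) (trace t (\<lambda>_. 0) 0) \<le> stopped c t +
     avg (\<lambda>z. if fst z > c then 1 else 0) (trace ?s (\<lambda>_. 0) 0)"
    using avg_trace_stop[of "\<lambda>F. if F > c then 1 else 0"] by simp
  moreover have "stopped c t \<le> avg R t / c"
    using stopped_le[OF c, of t] c by (simp add: field_simps)
  ultimately show ?thesis using 1 by (simp add: add_divide_distrib distrib_right)
qed

text \<open>Each branch is followed down to the first node where the norm of the running maximum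
  exceeds \<open>c\<close>. Since it was at most \<open>c\<close> before, reaching
  \<open>2 * c\<close> forces the maximum of the restarted subtree above \<open>c\<close>. By
  \<open>weak\<close> this has weight at most \<open>K / c\<close> times the average at the node,
  and the condition on the second component makes that average at most \<open>g * c\<close>.\<close>

lemma good_lambda:
  assumes weak: "\<And>c t. 0 < c \<Longrightarrow> set_btree t \<subseteq> S \<Longrightarrow>
      avg (\<lambda>z. if fst z > c then 1 else 0) (trace t (\<lambda>_. 0) 0) \<le> K / c * avg R t"
    and c: "0 < c" and K: "0 \<le> K" and g: "0 < g"
    and t: "set_btree t \<subseteq> S"
  shows "m \<in> S \<Longrightarrow> R m \<le> c \<Longrightarrow>
    avg (\<lambda>z. if fst z > 2 * c \<and> fst (snd z) \<le> g * c then 1 else 0) (trace t m n) \<le>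
    K * g * avg (\<lambda>z. if fst z > c then 1 else 0) (trace t m n)"
  using t
proof (induction t arbitrary: m n)
  \<comment> \<open>The first such node, leaf or not. All leaves below it satisfy
    \<open>fst z > c\<close>, so the average on the right is one; and if the average at the node
    exceeds \<open>g * c\<close>, the event on the left is empty.\<close>
  have first_exceed: "avg (\<lambda>z. if fst z > 2 * c \<and> fst (snd z) \<le> g * c then 1 else 0) (trace t m n) \<le>
    K * g * avg (\<lambda>z. if fst z > c then 1 else 0) (trace t m n)"
    if m: "m \<in> S" "R m \<le> c" and t: "set_btree t \<subseteq> S" and gt: "R (fmax m (mean t)) > c" for m n t
  proof -
    have one: "avg (\<lambda>z. if fst z > c then 1 else 0) (trace t m n) = 1"
      using trace_fst_ge[OF t m(1)] gt by (intro avg_eq) fastforce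
    show ?thesis
    proof (cases "avg R t \<le> g * c")
      case True
      have "avg (\<lambda>z. if fst z > 2 * c \<and> fst (snd z) \<le> g * c then 1 else 0) (trace t m n) \<le>
         avg (\<lambda>z. if fst z > 2 * c then 1 else 0) (trace t (fmax m (\<lambda>_. 0)) n)"
        by (simp add: fmax_def) (rule avg_mono, auto)
      also have "\<dots> \<le> avg (\<lambda>z. if R m + fst z > 2 * c then 1 else 0) (trace t (\<lambda>_. 0) 0)"
        using avg_trace_shift[of "\<lambda>F. if F > 2 * c then 1 else 0" t m "\<lambda>_. 0" n 0] t m zero_S
        by (auto simp: mono_def)
      also have "\<dots> \<le> avg (\<lambda>z. if fst z > c then 1 else 0) (trace t (\<lambda>_. 0) 0)"
        by (rule avg_mono) (use m in auto)
      also have "\<dots> \<le> K / c * avg R t" by (rule weak[OF c t])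
      also have "\<dots> \<le> K / c * (g * c)" using True K c by (intro mult_left_mono) auto
      finally show ?thesis using one c by simp
    next
      case False
      have "avg (\<lambda>z. if fst z > 2 * c \<and> fst (snd z) \<le> g * c then 1 else 0) (trace t m n) = 0"
        by (rule avg_eq) (use trace_snd_ge[of _ t m n] False in fastforce)
      then show ?thesis using one K g by simp
    qed
  qed
  {
    case (Leaf a)
    show ?case
    proof (cases "R (fmax m a) > c")
      case True
      then show ?thesis using first_exceed[of m "Leaf a" n] Leaf by simp
    qed (use c in auto)
  next
    case (Node l r)
    let ?m = "fmax m (mean (Node l r))"
    show ?case
    proof (cases "R ?m > c")
      case True
      show ?thesis by (rule first_exceed) (use True Node in auto)
    next
      case False
      have "?m \<in> S" using Node.prems mean_S[of "Node l r"] by (intro max_S) auto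
      then have "avg (\<lambda>z. if fst z > 2 * c \<and> fst (snd z) \<le> g * c then 1 else 0) (trace l ?m k) \<le>
          K * g * avg (\<lambda>z. if fst z > c then 1 else 0) (trace l ?m k)"
        "avg (\<lambda>z. if fst z > 2 * c \<and> fst (snd z) \<le> g * c then 1 else 0) (trace r ?m k) \<le>
          K * g * avg (\<lambda>z. if fst z > c then 1 else 0) (trace r ?m k)" for k
        using False Node by auto
      from add_mono[OF this] show ?thesis
        by (simp only: trace.simps avg.simps distrib_left[symmetric] times_divide_eq_right divide_right_mono zero_le_numeral)
    qed
  }
qed

text \<open>The last bracket is a potential of the average \<open>a\<close> and the running maximum
  \<open>k\<close> at a node, \<open>k powr q - Q * a * k powr (q - 1)\<close> with
  \<open>Q = q / (q - 1)\<close>. It is affine in \<open>a\<close>, so it averages correctly over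
  the two children while \<open>k\<close> is kept, and raising \<open>k\<close> to the average of a
  child does not increase it.\<close>

lemma pathwise_Doob:
  assumes q: "1 < q" and n: "0 \<le> n"
  shows "avg (\<lambda>z. fst (snd z) powr q) (trace t m n) \<le>
     q / (q - 1) * avg (\<lambda>z. snd (snd z) * fst (snd z) powr (q - 1)) (trace t m n) +
     (max n (avg R t) powr q - q / (q - 1) * avg R t * max n (avg R t) powr (q - 1))"
  using n
proof (induction t arbitrary: m n)
  case (Node l r)
  let ?Q = "q / (q - 1)"
  define a where "a = avg R (Node l r)"
  define k where "k = max n a"
  have k: "0 \<le> k" using Node.prems by (simp add: k_def le_max_iff_disj)
  \<comment> \<open>For \<open>k < b\<close> this is Young's inequality for the product
    \<open>b * k powr (q - 1)\<close>, with the exponents \<open>q\<close> and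
    \<open>?Q\<close>.\<close>
  have drop: "max k b powr q - ?Q * b * max k b powr (q - 1) \<le> k powr q - ?Q * b * k powr (q - 1)" if "0 \<le> b" for b
  proof (cases "b \<le> k")
    case False
    then have b: "0 < b" "k < b" using k by auto
    have "b * k powr (q - 1) \<le> b powr q / q + (k powr (q - 1)) powr ?Q / ?Q"
      using q b k by (intro Youngs_inequality) (auto simp: field_simps)
    also have "(k powr (q - 1)) powr ?Q = k powr q" using q by (simp add: powr_powr)
    finally have "?Q * (b * k powr (q - 1)) \<le> ?Q * (b powr q / q + k powr q / ?Q)"
      using q by (intro mult_left_mono) auto
    also have "\<dots> = b powr q / (q - 1) + k powr q" using q by (simp add: field_simps)
    also have "b powr q / (q - 1) = ?Q * (b powr q) - b powr q" using q by (simp add: field_simps)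
    finally have "?Q * b * k powr (q - 1) \<le> ?Q * b powr q - b powr q + k powr q" by simp
    moreover have "b * b powr (q - 1) = b powr q" using b powr_add[of b 1 "q - 1"] by simp
    then have "?Q * b * b powr (q - 1) = ?Q * b powr q" by (simp only: mult.assoc)
    ultimately have "b powr q - ?Q * b * b powr (q - 1) \<le> k powr q - ?Q * b * k powr (q - 1)" by linarith
    then show ?thesis using b by (simp add: max_def)
  qed (simp add: max_def)
  let ?m = "fmax m (mean (Node l r))"
  note IHl = Node.IH(1)[OF k, of ?m] and IHr = Node.IH(2)[OF k, of ?m]
  have "avg (\<lambda>z. fst (snd z) powr q) (trace (Node l r) m n) =
    (avg (\<lambda>z. fst (snd z) powr q) (trace l ?m k) + avg (\<lambda>z. fst (snd z) powr q) (trace r ?m k)) / 2"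
    by (simp add: k_def a_def)
  also have "\<dots> \<le> (?Q * avg (\<lambda>z. snd (snd z) * fst (snd z) powr (q - 1)) (trace l ?m k) + (k powr q - ?Q * avg R l * k powr (q - 1)) +
     (?Q * avg (\<lambda>z. snd (snd z) * fst (snd z) powr (q - 1)) (trace r ?m k) + (k powr q - ?Q * avg R r * k powr (q - 1)))) / 2"
    using IHl IHr drop[OF avg_R_nonneg, of l] drop[OF avg_R_nonneg, of r] by (intro divide_right_mono) linarith+
  also have "\<dots> = ?Q * avg (\<lambda>z. snd (snd z) * fst (snd z) powr (q - 1)) (trace (Node l r) m n) + (k powr q - ?Q * a * k powr (q - 1))"
  proof -
    have "avg (\<lambda>z. snd (snd z) * fst (snd z) powr (q - 1)) (trace (Node l r) m n) =
      (avg (\<lambda>z. snd (snd z) * fst (snd z) powr (q - 1)) (trace l ?m k) + avg (\<lambda>z. snd (snd z) * fst (snd z) powr (q - 1)) (trace r ?m k)) / 2"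
      "a = (avg R l + avg R r) / 2"
      by (simp_all add: k_def a_def)
    moreover have "(Q * X + (K - Q * L * P) + (Q * Y + (K - Q * M * P))) / 2 = Q * ((X + Y) / 2) + (K - Q * ((L + M) / 2) * P)"
      for Q X Y K L M P :: real by (simp add: field_simps)
    ultimately show ?thesis by (simp only:)
  qed
  finally show ?case by (simp add: k_def a_def)
qed simp

text \<open>At the root the running maximum equals the average \<open>a\<close>, and the potential
  is \<open>(1 - Q) * a powr q\<close>, which is not positive. The mixed term is then split so that
  half of the left side is absorbed, which is legitimate because averages over a finite tree are
  finite.\<close>

lemma Doob:
  assumes q: "1 < q"
  shows "avg (\<lambda>z. fst (snd z) powr q) (trace t (\<lambda>_. 0) 0) \<le>
    2 * (q / (q - 1) * (2 * (q / (q - 1))) powr (q - 1)) * avg (\<lambda>a. R a powr q) t"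
proof -
  let ?Q = "q / (q - 1)" and ?T = "trace t (\<lambda>_. 0) 0"
  define D where "D = ?Q * (2 * ?Q) powr (q - 1)"
  have Q: "1 < ?Q" using q by simp
  have D: "0 \<le> D" unfolding D_def using Q by (intro mult_nonneg_nonneg) (linarith, simp)
  have a: "max 0 (avg R t) = avg R t" using avg_R_nonneg[of t] by simp
  have "avg R t powr q = avg R t * avg R t powr (q - 1)"
    using powr_add[of "avg R t" 1 "q - 1"] avg_R_nonneg[of t] by simp
  then have "avg R t powr q - ?Q * avg R t * avg R t powr (q - 1) = (1 - ?Q) * avg R t powr q"
    by (simp add: algebra_simps)
  also have "\<dots> \<le> 0" using Q by (intro mult_nonpos_nonneg) auto
  finally have "avg (\<lambda>z. fst (snd z) powr q) ?T \<le> ?Q * avg (\<lambda>z. snd (snd z) * fst (snd z) powr (q - 1)) ?T"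
    using pathwise_Doob[OF q, of 0 t "\<lambda>_. 0"] by (simp add: a)
  also have "\<dots> = avg (\<lambda>z. ?Q * (snd (snd z) * fst (snd z) powr (q - 1))) ?T"
    by (rule avg_cmult[symmetric])
  also have "\<dots> \<le> avg (\<lambda>z. (1/2) * (fst (snd z) powr q) + D * (snd (snd z) powr q)) ?T"
  proof (rule avg_mono)
    fix z assume "z \<in> set_btree ?T"
    moreover obtain F N A where z: "z = (F, N, A)" by (cases z)
    ultimately have NA: "0 \<le> N" "0 \<le> A" using trace_nonneg[of z] by auto
    have "?Q * (A * N powr (q - 1)) \<le> 1 / 2 * N powr q + D * A powr q"
    \<comment> \<open>Either \<open>N\<close> dominates and the term is absorbed, or
      \<open>N \<le> 2 * ?Q * A\<close> turns it into a power of \<open>A\<close>; the second case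
      determines \<open>D\<close>.\<close>
    proof (cases "?Q * A \<le> N / 2")
      case True
      then have "?Q * A * N powr (q - 1) \<le> N / 2 * N powr (q - 1)" by (intro mult_right_mono) auto
      also have "\<dots> = 1/2 * N powr q" using NA powr_add[of N 1 "q - 1"] by simp
      finally show ?thesis using D by (simp add: add_increasing2 mult.assoc)
    next
      case False
      then have "N \<le> 2 * ?Q * A" by linarith
      then have "N powr (q - 1) \<le> (2 * ?Q * A) powr (q - 1)" using NA q by (intro powr_mono2) auto
      then have "?Q * (A * N powr (q - 1)) \<le> ?Q * (A * (2 * ?Q * A) powr (q - 1))"
        using Q NA by (intro mult_left_mono) auto
      also have "\<dots> = ?Q * (A * ((2 * ?Q) powr (q - 1) * A powr (q - 1)))"
        using Q NA by (subst powr_mult) auto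
      also have "\<dots> = D * (A * A powr (q - 1))" by (simp add: D_def)
      also have "A * A powr (q - 1) = A powr q" using NA powr_add[of A 1 "q - 1"] by simp
      finally show ?thesis by (simp add: add_increasing)
    qed
    then show "?Q * (snd (snd z) * fst (snd z) powr (q - 1)) \<le> 1 / 2 * (fst (snd z) powr q) + D * (snd (snd z) powr q)"
      by (simp add: z)
  qed
  also have "\<dots> = 1/2 * avg (\<lambda>z. fst (snd z) powr q) ?T + D * avg (\<lambda>a. R a powr q) t"
    by (simp only: avg_add avg_cmult avg_trace_thd[of "\<lambda>x. x powr q"])
  finally show ?thesis by (simp add: D_def)
qed

end

section \<open>Layer-cake integration and extrapolation of the exponent\<close>

lemma has_integral_layer_cake:
  assumes q: "1 < (q::real)" and F: "0 \<le> F" "F \<le> B"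
  shows "((\<lambda>l. q * l powr (q - 1) * (if F > l then 1 else 0)) has_integral F powr q) {0..B}"
proof -
  have "((\<lambda>l. q * l powr (q - 1)) has_integral (F powr q - 0 powr q)) {0..F}"
    using F q by (intro fundamental_theorem_of_calculus_interior continuous_on_powr')
      (auto intro!: continuous_intros derivative_eq_intros
        simp flip: has_real_derivative_iff_has_vector_derivative)
  then have "((\<lambda>l. if l \<in> {0..F} then q * l powr (q - 1) else 0) has_integral F powr q) {0..B}"
    using F by (subst has_integral_restrict) auto
  then show ?thesis
    by (rule has_integral_spike_finite[of "{F}", rotated 2]) (use F in auto)
qed

lemma has_integral_layer_cake_avg:
  assumes q: "1 < (q::real)" and "\<And>z. z \<in> set_btree t \<Longrightarrow> 0 \<le> \<phi> z \<and> \<phi> z \<le> B"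
  shows "((\<lambda>l. q * l powr (q - 1) * avg (\<lambda>z. if \<phi> z > l then 1 else 0) t) has_integral avg (\<lambda>z. \<phi> z powr q) t) {0..B}"
  using assms(2)
proof (induction t)
  case (Leaf a)
  then show ?case using has_integral_layer_cake[OF q, of "\<phi> a" B] by simp
next
  case (Node l r)
  then have "((\<lambda>x. (q * x powr (q - 1) * avg (\<lambda>z. if \<phi> z > x then 1 else 0) l +
     q * x powr (q - 1) * avg (\<lambda>z. if \<phi> z > x then 1 else 0) r) / 2) has_integral
    (avg (\<lambda>z. \<phi> z powr q) l + avg (\<lambda>z. \<phi> z powr q) r) / 2) {0..B}"
    by (intro has_integral_divide has_integral_add) auto
  then show ?case by (simp add: algebra_simps)
qed

context tree_norm begin

lemma set_btree_finite: "finite (set_btree t)"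
  by (induction t) auto

text \<open>The good-lambda inequality is integrated against \<open>q * l powr (q - 1)\<close>. Its
  left side becomes \<open>1 / 2 powr q\<close> times the \<open>q\<close>-th moment of the running
  maximum, and \<open>g\<close> is chosen so that \<open>K * g\<close> is half of this factor: the
  first term on the right is absorbed. The second one involves scalar averages only, to which
  \<open>Doob\<close> applies at the exponent \<open>q\<close>.\<close>

proposition extrapolation:
  assumes r: "1 < r" and C: "0 \<le> C"
    and rb: "\<And>t. set_btree t \<subseteq> S \<Longrightarrow>
      avg (\<lambda>z. fst z powr r) (trace t (\<lambda>_. 0) 0) \<le> C * avg (\<lambda>a. R a powr r) t"
    and q: "1 < q"
    and t: "set_btree t \<subseteq> S"
  defines "K \<equiv> 1 + C * 2 powr (r - 1)"
  defines "D \<equiv> 2 * (q / (q - 1) * (2 * (q / (q - 1))) powr (q - 1))"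
  defines "g \<equiv> 1 / (2 * (2 powr q * K))"
  shows "avg (\<lambda>z. fst z powr q) (trace t (\<lambda>_. 0) 0) \<le>
    2 * 2 powr q * (1 / g) powr q * D * avg (\<lambda>a. R a powr q) t"
proof -
  let ?T = "trace t (\<lambda>_. 0) 0"
  have K: "1 \<le> K" using C by (simp add: K_def)
  have g: "0 < g" using K by (simp add: g_def)
  obtain B where B: "\<And>F N A. (F, N, A) \<in> set_btree ?T \<Longrightarrow> F / 2 \<le> B \<and> F \<le> B \<and> N / g \<le> B"
  proof
    let ?f = "\<lambda>z. max (fst z) (fst (snd z) / g)"
    fix F N A assume z: "(F, N, A) \<in> set_btree ?T"
    have "?f (F, N, A) \<le> Max (?f ` set_btree ?T)"
      using z set_btree_finite by (intro Max_ge finite_imageI imageI)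
    moreover have "0 \<le> F" using trace_nonneg[OF z] by simp
    ultimately show "F / 2 \<le> Max (?f ` set_btree ?T) \<and> F \<le> Max (?f ` set_btree ?T) \<and> N / g \<le> Max (?f ` set_btree ?T)"
      by simp
  qed
  have nn: "0 \<le> F \<and> 0 \<le> N" if "(F, N, A) \<in> set_btree ?T" for F N A
    using trace_nonneg[OF that] by simp
  have i1: "((\<lambda>l. q * l powr (q - 1) * avg (\<lambda>z. if fst z / 2 > l then 1 else 0) ?T) has_integral
     avg (\<lambda>z. (fst z / 2) powr q) ?T) {0..B}"
    by (rule has_integral_layer_cake_avg[OF q]) (use nn B in auto)
  have i2: "((\<lambda>l. q * l powr (q - 1) * avg (\<lambda>z. if fst z > l then 1 else 0) ?T) has_integral
     avg (\<lambda>z. fst z powr q) ?T) {0..B}"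
    by (rule has_integral_layer_cake_avg[OF q]) (use nn B in auto)
  have i3: "((\<lambda>l. q * l powr (q - 1) * avg (\<lambda>z. if fst (snd z) / g > l then 1 else 0) ?T) has_integral
     avg (\<lambda>z. (fst (snd z) / g) powr q) ?T) {0..B}"
    by (rule has_integral_layer_cake_avg[OF q]) (use nn B g in auto)
  have "avg (\<lambda>z. (fst z / 2) powr q) ?T \<le> K * g * avg (\<lambda>z. fst z powr q) ?T + avg (\<lambda>z. (fst (snd z) / g) powr q) ?T"
  proof (rule has_integral_le[OF i1 has_integral_add[OF has_integral_mult_right[OF i2, of "K * g"] i3]])
    fix l assume l: "l \<in> {0..B}"
    show "q * l powr (q - 1) * avg (\<lambda>z. if fst z / 2 > l then 1 else 0) ?T \<le>
       K * g * (q * l powr (q - 1) * avg (\<lambda>z. if fst z > l then 1 else 0) ?T) +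
       q * l powr (q - 1) * avg (\<lambda>z. if fst (snd z) / g > l then 1 else 0) ?T"
    proof (cases "l = 0")
      case False
      then have l: "0 < l" using l by simp
      \<comment> \<open>Where \<open>fst z > 2 * l\<close>, either the second component is at most
        \<open>g * l\<close>, or its quotient by \<open>g\<close> exceeds \<open>l\<close>.\<close>
      have "avg (\<lambda>z. if fst z / 2 > l then 1 else 0) ?T \<le>
        avg (\<lambda>z. (if fst z > 2 * l \<and> fst (snd z) \<le> g * l then 1 else 0) + (if fst (snd z) / g > l then 1 else 0)) ?T"
        by (rule avg_mono) (use g in \<open>auto simp: field_simps\<close>)
      also have "\<dots> \<le> K * g * avg (\<lambda>z. if fst z > l then 1 else 0) ?T + avg (\<lambda>z. if fst (snd z) / g > l then 1 else 0) ?T"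
        unfolding avg_add
        using good_lambda[where K=K, OF weak_type[OF r C rb, folded K_def] l _ g t zero_S, of 0] K l R_zero
        by (simp add: split_def)
      finally have "q * l powr (q - 1) * avg (\<lambda>z. if fst z / 2 > l then 1 else 0) ?T \<le> q * l powr (q - 1) * (K * g * avg (\<lambda>z. if fst z > l then 1 else 0) ?T + avg (\<lambda>z. if fst (snd z) / g > l then 1 else 0) ?T)"
        using q by (intro mult_left_mono) auto
      then show ?thesis by (simp add: algebra_simps)
    qed (use q in auto)
  qed
  moreover have "avg (\<lambda>z. (fst z / 2) powr q) ?T = avg (\<lambda>z. (1 / 2 powr q) * fst z powr q) ?T"
    using nn by (intro antisym avg_mono) (auto simp: powr_divide)
  then have "avg (\<lambda>z. (fst z / 2) powr q) ?T = 1 / 2 powr q * avg (\<lambda>z. fst z powr q) ?T" by (simp only: avg_cmult)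
  moreover have "avg (\<lambda>z. (fst (snd z) / g) powr q) ?T = avg (\<lambda>z. ((1 / g) powr q) * fst (snd z) powr q) ?T"
    using nn g by (intro antisym avg_mono) (auto simp: powr_divide)
  then have "avg (\<lambda>z. (fst (snd z) / g) powr q) ?T = (1 / g) powr q * avg (\<lambda>z. fst (snd z) powr q) ?T" by (simp only: avg_cmult)
  moreover have "K * g = 1 / 2 powr q / 2" using K by (simp add: g_def)
  ultimately have "1 / 2 powr q / 2 * avg (\<lambda>z. fst z powr q) ?T \<le> (1 / g) powr q * avg (\<lambda>z. fst (snd z) powr q) ?T"
    by simp
  then have "avg (\<lambda>z. fst z powr q) ?T \<le> 2 * 2 powr q * ((1 / g) powr q * avg (\<lambda>z. fst (snd z) powr q) ?T)"
    by (simp add: field_simps)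
  also have "avg (\<lambda>z. fst (snd z) powr q) ?T \<le> D * avg (\<lambda>a. R a powr q) t"
    using Doob[OF q, of t] by (simp add: split_def D_def)
  finally show ?thesis by (simp add: split_def mult.assoc mult_left_mono)
qed

end

section \<open>Moments with infinite values, and induction over the variables\<close>

lemma ennreal_half: "0 \<le> x \<Longrightarrow> 0 \<le> y \<Longrightarrow> (ennreal x + ennreal y) / 2 = ennreal ((x + y) / 2)"
  by (simp flip: ennreal_plus ennreal_numeral add: divide_ennreal)

text \<open>The counterpart of an average over \<open>trace\<close> without assuming finite norms.
  It is needed because the inner norm will be integrated along a line, on part of which it may be
  infinite.\<close>

primrec max_moment :: "(('a \<Rightarrow> ennreal) \<Rightarrow> ennreal) \<Rightarrow> real \<Rightarrow> ('a \<Rightarrow> ennreal) \<Rightarrow> ('a \<Rightarrow> ennreal) btree \<Rightarrow> ennreal" where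
  "max_moment \<rho> q m (Leaf a) = ennreal_powr (\<rho> (fmax m a)) q"
| "max_moment \<rho> q m (Node l r) =
    (max_moment \<rho> q (fmax m (mean (Node l r))) l + max_moment \<rho> q (fmax m (mean (Node l r))) r) / 2"

primrec moment :: "(('a \<Rightarrow> ennreal) \<Rightarrow> ennreal) \<Rightarrow> real \<Rightarrow> ('a \<Rightarrow> ennreal) btree \<Rightarrow> ennreal" where
  "moment \<rho> q (Leaf a) = ennreal_powr (\<rho> a) q"
| "moment \<rho> q (Node l r) = (moment \<rho> q l + moment \<rho> q r) / 2"

lemma moment_top:
  "a \<in> set_btree t \<Longrightarrow> \<rho> a = top \<Longrightarrow> moment \<rho> q t = top"
  by (induction t) (auto simp: ennreal_top_divide)

lemma mean_measurable:
  "set_btree t \<subseteq> borel_measurable M \<Longrightarrow> mean t \<in> borel_measurable M"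
  by (induction t) auto

lemma fmax_measurable:
  "x \<in> borel_measurable M \<Longrightarrow> y \<in> borel_measurable M \<Longrightarrow> fmax x y \<in> borel_measurable M"
  unfolding fmax_def by measurable

lemma mnorm_zero: "(\<And>i. 0 < p i) \<Longrightarrow> mnorm p is (\<lambda>_. 0) x = 0"
  by (induction "is" arbitrary: x) simp_all

lemma tree_norm_mnorm:
  fixes x :: "real ^ 'n::finite"
  assumes p: "\<And>i. 1 < p i"
  shows "tree_norm {h \<in> borel_measurable borel. mnorm p is h x < top} (\<lambda>h. enn2real (mnorm p is h x))"
proof -
  have p0: "0 < p i" for i using p[of i] by simp
  have half: "mnorm p is (\<lambda>w. (f w + g w) / 2) x \<le> (mnorm p is f x + mnorm p is g x) / 2"
    if "f \<in> borel_measurable borel" "g \<in> borel_measurable borel" for f g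
  proof -
    have "mnorm p is (\<lambda>w. (f w + g w) / 2) x = mnorm p is (\<lambda>w. inverse 2 * (f w + g w)) x"
      by (rule mnorm_cong) (simp add: divide_ennreal_def mult.commute)
    also have "\<dots> = inverse 2 * mnorm p is (\<lambda>w. f w + g w) x"
      by (rule mnorm_cmult) (use that p0 in auto)
    also have "\<dots> \<le> inverse 2 * (mnorm p is f x + mnorm p is g x)"
      by (intro mult_left_mono mnorm_add_le p that) auto
    finally show ?thesis by (simp add: divide_ennreal_def mult.commute)
  qed
  have mx: "mnorm p is (fmax f g) x \<le> mnorm p is f x + mnorm p is g x"
    if "f \<in> borel_measurable borel" "g \<in> borel_measurable borel" for f g
  proof -
    have "mnorm p is (fmax f g) x \<le> mnorm p is (\<lambda>w. f w + g w) x"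
      by (rule mnorm_mono) (auto simp: fmax_def p0)
    also have "\<dots> \<le> mnorm p is f x + mnorm p is g x" by (intro mnorm_add_le p that)
    finally show ?thesis .
  qed
  have mxl: "mnorm p is f x \<le> mnorm p is (fmax f g) x" for f g
    by (rule mnorm_mono) (auto simp: fmax_def p0)
  show ?thesis
  proof
    fix f g assume f: "f \<in> {h \<in> borel_measurable borel. mnorm p is h x < top}"
      and g: "g \<in> {h \<in> borel_measurable borel. mnorm p is h x < top}"
    then have fg: "f \<in> borel_measurable borel" "g \<in> borel_measurable borel" by auto
    from f g obtain a b where ab: "mnorm p is f x = ennreal a" "mnorm p is g x = ennreal b" "0 \<le> a" "0 \<le> b"
      by (metis (no_types, lifting) ennreal_cases less_top mem_Collect_eq)
    have h: "mnorm p is (\<lambda>w. (f w + g w) / 2) x \<le> ennreal ((a + b) / 2)"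
      using half[OF fg] ab by (simp only: ennreal_half)
    have m: "mnorm p is (fmax f g) x \<le> ennreal (a + b)"
      using mx[OF fg] ab by (simp only: ennreal_plus)
    show "(\<lambda>w. (f w + g w) / 2) \<in> {h \<in> borel_measurable borel. mnorm p is h x < top}"
      using fg le_less_trans[OF h] by auto
    show "fmax f g \<in> {h \<in> borel_measurable borel. mnorm p is h x < top}"
      using fg le_less_trans[OF m] by (auto intro: fmax_measurable)
    show "enn2real (mnorm p is (\<lambda>w. (f w + g w) / 2) x) \<le> (enn2real (mnorm p is f x) + enn2real (mnorm p is g x)) / 2"
      using enn2real_mono[OF h] ab by simp
    show "enn2real (mnorm p is (fmax f g) x) \<le> enn2real (mnorm p is f x) + enn2real (mnorm p is g x)"
      using enn2real_mono[OF m] ab by (simp del: ennreal_plus)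
    show "enn2real (mnorm p is f x) \<le> enn2real (mnorm p is (fmax f g) x)"
      by (intro enn2real_mono mxl) (use le_less_trans[OF m] in auto)
  qed (auto simp: mnorm_zero p0)
qed

context tree_norm begin

lemma moment_eq_avg:
  assumes \<rho>: "\<And>h. h \<in> S \<Longrightarrow> \<rho> h = ennreal (R h)"
  shows "set_btree t \<subseteq> S \<Longrightarrow> moment \<rho> q t = ennreal (avg (\<lambda>a. R a powr q) t)"
  by (induction t) (auto simp: \<rho> ennreal_powr_ennreal R_nonneg ennreal_half avg_ge)

lemma max_moment_eq_avg:
  assumes \<rho>: "\<And>h. h \<in> S \<Longrightarrow> \<rho> h = ennreal (R h)"
  shows "set_btree t \<subseteq> S \<Longrightarrow> m \<in> S \<Longrightarrow> max_moment \<rho> q m t = ennreal (avg (\<lambda>z. fst z powr q) (trace t m n))"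
proof (induction t arbitrary: m n)
  case (Leaf a)
  then show ?case by (simp add: \<rho> max_S ennreal_powr_ennreal R_nonneg)
next
  case (Node l r)
  have "fmax m (mean (Node l r)) \<in> S" using Node.prems mean_S[of "Node l r"] by (intro max_S) auto
  note IH = Node.IH(1)[OF _ this] Node.IH(2)[OF _ this]
  show ?case
    using Node.prems
    by (simp add: IH[of "max n ((avg R l + avg R r) / 2)", simplified] ennreal_half avg_ge)
qed

end

definition tree_bound :: "('n::finite \<Rightarrow> real) \<Rightarrow> 'n list \<Rightarrow> real \<Rightarrow> real \<Rightarrow> bool" where
  "tree_bound p is q C \<longleftrightarrow> (\<forall>x t. set_btree t \<subseteq> borel_measurable borel \<longrightarrow>
     max_moment (\<lambda>h. mnorm p is h x) q (\<lambda>_. 0) t \<le> ennreal C * moment (\<lambda>h. mnorm p is h x) q t)"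

text \<open>A leaf of infinite norm makes the right side infinite as soon as the constant is
  positive; since \<open>0 * top = 0\<close>, the constant is raised to
  \<open>C + 1\<close>.\<close>

lemma tree_boundI:
  fixes p :: "'n::finite \<Rightarrow> real"
  assumes p: "\<And>i. 1 < p i" and C: "0 \<le> C"
    and bd: "\<And>x t. tree_norm {h \<in> borel_measurable borel. mnorm p is h x < top} (\<lambda>h. enn2real (mnorm p is h x)) \<Longrightarrow>
      set_btree t \<subseteq> {h \<in> borel_measurable borel. mnorm p is h x < top} \<Longrightarrow>
      avg (\<lambda>z. fst z powr q) (tree_norm.trace (\<lambda>h. enn2real (mnorm p is h x)) t (\<lambda>_. 0) 0) \<le>
        C * avg (\<lambda>a. enn2real (mnorm p is a x) powr q) t"
  shows "tree_bound p is q (C + 1)"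
  unfolding tree_bound_def
proof (intro allI impI)
  fix x and t :: "(real ^ 'n \<Rightarrow> ennreal) btree"
  assume t: "set_btree t \<subseteq> borel_measurable borel"
  interpret tree_norm "{h \<in> borel_measurable borel. mnorm p is h x < top}" "\<lambda>h. enn2real (mnorm p is h x)"
    by (rule tree_norm_mnorm) (rule p)
  show "max_moment (\<lambda>h. mnorm p is h x) q (\<lambda>_. 0) t \<le> ennreal (C + 1) * moment (\<lambda>h. mnorm p is h x) q t"
  proof (cases "\<exists>a\<in>set_btree t. mnorm p is a x = top")
    case True
    then have "moment (\<lambda>h. mnorm p is h x) q t = top" by (auto intro: moment_top)
    then show ?thesis using C by (simp add: ennreal_mult_top)
  next
    case False
    then have tS: "set_btree t \<subseteq> {h \<in> borel_measurable borel. mnorm p is h x < top}"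
      using t by (auto simp: less_top)
    let ?A = "avg (\<lambda>a. enn2real (mnorm p is a x) powr q) t"
    have "avg (\<lambda>z. fst z powr q) (trace t (\<lambda>_. 0) 0) \<le> C * ?A"
      by (rule bd[OF _ tS]) (rule tree_norm_axioms)
    also have "\<dots> \<le> (C + 1) * ?A" by (intro mult_right_mono avg_ge) auto
    finally have "ennreal (avg (\<lambda>z. fst z powr q) (trace t (\<lambda>_. 0) 0)) \<le> ennreal (C + 1) * ennreal ?A"
      using C by (subst ennreal_mult[symmetric]) (auto intro!: avg_ge ennreal_leI)
    then show ?thesis
      by (subst max_moment_eq_avg[OF _ tS zero_S], simp, subst moment_eq_avg[OF _ tS], simp)
  qed
qed

lemma max_moment_measurable:
  fixes t :: "(real ^ 'n::finite \<Rightarrow> ennreal) btree"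
  assumes "set_btree t \<subseteq> borel_measurable borel" "m \<in> borel_measurable borel"
  shows "(\<lambda>x. max_moment (\<lambda>h. mnorm p is h x) q m t) \<in> borel_measurable borel"
  using assms
proof (induction t arbitrary: m)
  case (Leaf a)
  then have [measurable]: "fmax m a \<in> borel_measurable borel" by (intro fmax_measurable) auto
  show ?case by simp
next
  case (Node l r)
  then have "fmax m (mean (Node l r)) \<in> borel_measurable borel"
    using mean_measurable[of "Node l r"] by (intro fmax_measurable) auto
  note [measurable] = Node.IH(1)[OF _ this] Node.IH(2)[OF _ this]
  show ?case using Node.prems by (simp del: mean.simps)
qed

lemma moment_measurable:
  fixes t :: "(real ^ 'n::finite \<Rightarrow> ennreal) btree"
  assumes "set_btree t \<subseteq> borel_measurable borel"
  shows "(\<lambda>x. moment (\<lambda>h. mnorm p is h x) q t) \<in> borel_measurable borel"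
  using assms by (induction t) auto

text \<open>With the exponent equal to \<open>p j\<close> the outer root cancels, and the moment is
  an integral over the \<open>j\<close>-th line of moments for the shorter list, with the same tree
  and the same running maxima. This is the exponent at which a bound passes to one more variable by
  integration.\<close>

lemma max_moment_Cons:
  fixes t :: "(real ^ 'n::finite \<Rightarrow> ennreal) btree"
  assumes "set_btree t \<subseteq> borel_measurable borel" "m \<in> borel_measurable borel" "0 < p j"
  shows "max_moment (\<lambda>h. mnorm p (j # is) h x) (p j) m t =
    (\<integral>\<^sup>+s. max_moment (\<lambda>h. mnorm p is h (update_coord x j s)) (p j) m t \<partial>lborel)"
  using assms(1,2)
proof (induction t arbitrary: m)
  case (Leaf a)
  then show ?case using assms(3) by (simp add: ennreal_powr_powr)
next
  case (Node l r)
  let ?m = "fmax m (mean (Node l r))"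
  have m: "?m \<in> borel_measurable borel"
    using Node.prems mean_measurable[of "Node l r"] by (intro fmax_measurable) auto
  have [measurable]: "(\<lambda>x. max_moment (\<lambda>h. mnorm p is h x) (p j) ?m l) \<in> borel_measurable borel"
     "(\<lambda>x. max_moment (\<lambda>h. mnorm p is h x) (p j) ?m r) \<in> borel_measurable borel"
    using Node.prems m by (auto intro!: max_moment_measurable)
  show ?case using Node m
    by (simp del: mnorm.simps mean.simps add: nn_integral_divide nn_integral_add)
qed

lemma moment_Cons:
  fixes t :: "(real ^ 'n::finite \<Rightarrow> ennreal) btree"
  assumes "set_btree t \<subseteq> borel_measurable borel" "0 < p j"
  shows "moment (\<lambda>h. mnorm p (j # is) h x) (p j) t =
    (\<integral>\<^sup>+s. moment (\<lambda>h. mnorm p is h (update_coord x j s)) (p j) t \<partial>lborel)"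
  using assms(1)
proof (induction t)
  case (Leaf a)
  then show ?case using assms(2) by (simp add: ennreal_powr_powr)
next
  case (Node l r)
  have [measurable]: "(\<lambda>x. moment (\<lambda>h. mnorm p is h x) (p j) l) \<in> borel_measurable borel"
     "(\<lambda>x. moment (\<lambda>h. mnorm p is h x) (p j) r) \<in> borel_measurable borel"
    using Node.prems by (auto intro!: moment_measurable)
  show ?case using Node
    by (simp del: mnorm.simps add: nn_integral_divide nn_integral_add)
qed

text \<open>All exponents \<open>q\<close> are treated at each stage of the induction. For the empty
  list the norm is evaluation at a point, which commutes with maxima, so the norm of the running
  maximum lies below the running maximum of the averages and \<open>Doob\<close> suffices. For
  \<open>j # is\<close> the induction hypothesis is integrated at the exponent \<open>p j\<close>,
  and \<open>extrapolation\<close> leads from there to \<open>q\<close>.\<close>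

proposition tree_bound_ex:
  fixes p :: "'n::finite \<Rightarrow> real"
  assumes p: "\<And>i. 1 < p i" and q: "1 < q"
  shows "\<exists>C\<ge>0. tree_bound p is q C"
  using q
proof (induction "is" arbitrary: q)
  case Nil
  let ?D = "2 * (q / (q - 1) * (2 * (q / (q - 1))) powr (q - 1))"
  have D: "0 \<le> ?D" using Nil by simp
  have "tree_bound p [] q (?D + 1)"
  proof (rule tree_boundI[OF p D])
    fix x and t :: "(real ^ 'n \<Rightarrow> ennreal) btree"
    assume "tree_norm {h \<in> borel_measurable borel. mnorm p [] h x < top} (\<lambda>h. enn2real (mnorm p [] h x))"
    then interpret tree_norm "{h \<in> borel_measurable borel. mnorm p [] h x < top}" "\<lambda>h. enn2real (mnorm p [] h x)" .
    let ?S = "{h \<in> borel_measurable borel. mnorm p [] h x < top}"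
    let ?R = "\<lambda>h. enn2real (mnorm p [] h x)"
    assume t: "set_btree t \<subseteq> ?S"
    have R_fmax: "?R (fmax f g) = max (?R f) (?R g)" if "f \<in> ?S" "g \<in> ?S" for f g
      using that by (cases "f x"; cases "g x") (auto simp: fmax_def max_def)
    have le: "fst z \<le> fst (snd z)" if "z \<in> set_btree (trace t m n)" "?R m \<le> n" "m \<in> ?S" "set_btree t \<subseteq> ?S" for z t m n
      using that
    proof (induction t arbitrary: m n)
      case (Leaf a)
      then show ?case using R_fmax[of m a] by (auto simp del: mnorm.simps)
    next
      case (Node l r)
      let ?m = "fmax m (mean (Node l r))"
      have S1: "mean (Node l r) \<in> ?S" using mean_S[OF Node.prems(4)] .
      note S = S1 max_S[OF Node.prems(3) S1]
      have "?R ?m = max (?R m) (?R (mean (Node l r)))"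
        using R_fmax[of m "mean (Node l r)"] S Node.prems by blast
      also have "\<dots> \<le> max n (avg ?R (Node l r))"
        using R_mean[of "Node l r"] Node.prems by (intro max.mono) auto
      finally have le: "?R ?m \<le> max n (avg ?R (Node l r))" .
      from Node.prems(1) have "z \<in> set_btree (trace l ?m (max n (avg ?R (Node l r)))) \<or>
          z \<in> set_btree (trace r ?m (max n (avg ?R (Node l r))))"
        by (simp del: mnorm.simps)
      then show ?case using Node.IH(1)[OF _ le S(2)] Node.IH(2)[OF _ le S(2)] Node.prems(4)
        by (auto simp del: mnorm.simps mean.simps avg.simps)
    qed
    have "avg (\<lambda>z. fst z powr q) (trace t (\<lambda>_. 0) 0) \<le> avg (\<lambda>z. fst (snd z) powr q) (trace t (\<lambda>_. 0) 0)"
    proof (rule avg_mono)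
      fix z assume z: "z \<in> set_btree (trace t (\<lambda>_. 0) 0)"
      have "fst z \<le> fst (snd z)" by (rule le[OF z _ zero_S t]) simp
      then show "fst z powr q \<le> fst (snd z) powr q"
        using trace_nonneg[OF z] Nil by (intro powr_mono2) auto
    qed
    also have "\<dots> \<le> ?D * avg (\<lambda>a. ?R a powr q) t" by (rule Doob[OF Nil])
    finally show "avg (\<lambda>z. fst z powr q) (trace t (\<lambda>_. 0) 0) \<le> ?D * avg (\<lambda>a. ?R a powr q) t" .
  qed
  then show ?case using D by (intro exI[of _ "?D + 1"]) auto
next
  case (Cons j "is")
  have pj: "1 < p j" by (rule p)
  from Cons.IH[OF pj] obtain C where C: "0 \<le> C" "tree_bound p is (p j) C" by auto
  let ?K = "1 + C * 2 powr (p j - 1)"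
  let ?E = "2 * 2 powr q * (1 / (1 / (2 * (2 powr q * ?K)))) powr q * (2 * (q / (q - 1) * (2 * (q / (q - 1))) powr (q - 1)))"
  have E: "0 \<le> ?E" using Cons.prems by simp
  have "tree_bound p (j # is) q (?E + 1)"
  proof (rule tree_boundI[OF p E])
    fix x and t :: "(real ^ 'n \<Rightarrow> ennreal) btree"
    assume "tree_norm {h \<in> borel_measurable borel. mnorm p (j # is) h x < top} (\<lambda>h. enn2real (mnorm p (j # is) h x))"
    then interpret tree_norm "{h \<in> borel_measurable borel. mnorm p (j # is) h x < top}" "\<lambda>h. enn2real (mnorm p (j # is) h x)" .
    let ?S = "{h \<in> borel_measurable borel. mnorm p (j # is) h x < top}"
    let ?R = "\<lambda>h. enn2real (mnorm p (j # is) h x)"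
    assume t: "set_btree t \<subseteq> ?S"
    have "avg (\<lambda>z. fst z powr p j) (trace t (\<lambda>_. 0) 0) \<le> C * avg (\<lambda>a. ?R a powr p j) t"
      if t: "set_btree t \<subseteq> ?S" for t
    proof -
      have tb: "set_btree t \<subseteq> borel_measurable borel" using t by auto
      have [measurable]: "(\<lambda>x. moment (\<lambda>h. mnorm p is h x) (p j) t) \<in> borel_measurable borel"
        by (rule moment_measurable[OF tb])
      have "ennreal (avg (\<lambda>z. fst z powr p j) (trace t (\<lambda>_. 0) 0)) =
          max_moment (\<lambda>h. mnorm p (j # is) h x) (p j) (\<lambda>_. 0) t"
        by (rule max_moment_eq_avg[symmetric, OF _ t zero_S]) (simp del: mnorm.simps)
      also have "\<dots> = (\<integral>\<^sup>+s. max_moment (\<lambda>h. mnorm p is h (update_coord x j s)) (p j) (\<lambda>_. 0) t \<partial>lborel)"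
        by (rule max_moment_Cons[OF tb]) (use pj in auto)
      also have "\<dots> \<le> (\<integral>\<^sup>+s. ennreal C * moment (\<lambda>h. mnorm p is h (update_coord x j s)) (p j) t \<partial>lborel)"
        using C(2) tb by (intro nn_integral_mono) (auto simp: tree_bound_def)
      also have "\<dots> = ennreal C * (\<integral>\<^sup>+s. moment (\<lambda>h. mnorm p is h (update_coord x j s)) (p j) t \<partial>lborel)"
        by (rule nn_integral_cmult) measurable
      also have "\<dots> = ennreal C * moment (\<lambda>h. mnorm p (j # is) h x) (p j) t"
        using moment_Cons[OF tb, of p j "is" x] pj by simp
      also have "\<dots> = ennreal C * ennreal (avg (\<lambda>a. ?R a powr p j) t)"
        by (subst moment_eq_avg[OF _ t]) (simp_all del: mnorm.simps)
      also have "\<dots> = ennreal (C * avg (\<lambda>a. ?R a powr p j) t)"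
        using C by (subst ennreal_mult) (auto intro: avg_ge)
      finally show ?thesis
        using C by (subst (asm) ennreal_le_iff) (auto intro!: mult_nonneg_nonneg avg_ge)
    qed
    from extrapolation[OF pj C(1) this Cons.prems t]
    show "avg (\<lambda>z. fst z powr q) (trace t (\<lambda>_. 0) 0) \<le> ?E * avg (\<lambda>a. ?R a powr q) t" .
  qed
  then show ?case using E by (intro exI[of _ "?E + 1"]) auto
qed

section \<open>The strong maximal function\<close>

definition interval_avg :: "'n::finite \<Rightarrow> real \<Rightarrow> real \<Rightarrow> (real ^ 'n \<Rightarrow> ennreal) \<Rightarrow> real ^ 'n \<Rightarrow> ennreal" where
  "interval_avg i a b F x = (\<integral>\<^sup>+s. F (update_coord x i s) * indicator {a..<b} s \<partial>lborel) / ennreal (b - a)"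

primrec dyadic_tree :: "'n::finite \<Rightarrow> nat \<Rightarrow> real \<Rightarrow> real \<Rightarrow> (real ^ 'n \<Rightarrow> ennreal) \<Rightarrow> (real ^ 'n \<Rightarrow> ennreal) btree" where
  "dyadic_tree i 0 a b F = Leaf (interval_avg i a b F)"
| "dyadic_tree i (Suc m) a b F = Node (dyadic_tree i m a ((a + b) / 2) F) (dyadic_tree i m ((a + b) / 2) b F)"

text \<open>The branch is selected by the separate parameter \<open>y\<close>, while the
  \<open>i\<close>-th coordinate of the argument is overwritten in every average. For fixed
  \<open>y\<close> this is thus a function of the other variables, to which the norm in the inner
  variables applies.\<close>

primrec dyadic_max :: "'n::finite \<Rightarrow> nat \<Rightarrow> real \<Rightarrow> real \<Rightarrow> (real ^ 'n \<Rightarrow> ennreal) \<Rightarrow> real \<Rightarrow> real ^ 'n \<Rightarrow> ennreal" where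
  "dyadic_max i 0 a b F y = interval_avg i a b F"
| "dyadic_max i (Suc m) a b F y = fmax (interval_avg i a b F)
     (if y < (a + b) / 2 then dyadic_max i m a ((a + b) / 2) F y else dyadic_max i m ((a + b) / 2) b F y)"

lemma interval_avg_measurable [measurable]:
  assumes [measurable]: "F \<in> borel_measurable borel" "f \<in> borel_measurable M" "a \<in> borel_measurable M" "b \<in> borel_measurable M"
  shows "(\<lambda>x. interval_avg i (a x) (b x) F (f x)) \<in> borel_measurable M"
proof -
  have "(\<lambda>(x, s). F (update_coord (f x) i s) * (if a x \<le> s \<and> s < b x then 1 else 0)) \<in> borel_measurable (M \<Otimes>\<^sub>M lborel)"
    by measurable
  from sigma_finite_measure.borel_measurable_nn_integral[OF sigma_finite_lborel this]
  have [measurable]: "(\<lambda>x. \<integral>\<^sup>+s. F (update_coord (f x) i s) * (if a x \<le> s \<and> s < b x then 1 else 0) \<partial>lborel) \<in> borel_measurable M" .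
  have "interval_avg i (a x) (b x) F (f x) =
    (\<integral>\<^sup>+s. F (update_coord (f x) i s) * (if a x \<le> s \<and> s < b x then 1 else 0) \<partial>lborel) / ennreal (b x - a x)" for x
    unfolding interval_avg_def by (intro arg_cong2[where f="(/)"] nn_integral_cong) (auto simp: indicator_def)
  then show ?thesis by simp
qed

lemma interval_avg_update [simp]: "interval_avg i a b F (update_coord x i t) = interval_avg i a b F x"
  by (simp add: interval_avg_def)

lemma dyadic_tree_measurable:
  "F \<in> borel_measurable borel \<Longrightarrow> set_btree (dyadic_tree i m a b F) \<subseteq> borel_measurable borel"
  by (induction m arbitrary: a b) auto

lemma dyadic_max_measurable:
  "F \<in> borel_measurable borel \<Longrightarrow> dyadic_max i m a b F y \<in> borel_measurable borel"
  by (induction m arbitrary: a b) (auto intro: fmax_measurable)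

lemma dyadic_max_update: "dyadic_max i m a b F y (update_coord x i t) = dyadic_max i m a b F y x"
  by (induction m arbitrary: a b) (auto simp: fmax_def)

lemma nn_integral_split_interval:
  assumes [measurable]: "f \<in> borel_measurable borel" and "a \<le> c" "c \<le> (b::real)"
  shows "(\<integral>\<^sup>+s. f s * indicator {a..<b} s \<partial>lborel) =
     (\<integral>\<^sup>+s. f s * indicator {a..<c} s \<partial>lborel) + (\<integral>\<^sup>+s. f s * indicator {c..<b} s \<partial>lborel)"
  using assms(2,3)
  by (subst nn_integral_add[symmetric]) (auto intro!: nn_integral_cong simp: indicator_def)

lemma mean_dyadic_tree:
  assumes [measurable]: "F \<in> borel_measurable borel" and "a < b"
  shows "mean (dyadic_tree i m a b F) = interval_avg i a b F"
  using assms(2)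
proof (induction m arbitrary: a b)
  case (Suc m)
  define c where "c = (a + b) / 2"
  have c: "a < c" "c < b" "c - a = (b - a) / 2" "b - c = (b - a) / 2"
    using Suc.prems by (auto simp: c_def field_simps)
  have half: "(X / ennreal ((b - a) / 2) + Y / ennreal ((b - a) / 2)) / 2 = (X + Y) / ennreal (b - a)" for X Y
  proof -
    have "ennreal ((b - a) / 2) * 2 = ennreal ((b - a) / 2 * 2)"
      using Suc.prems by (subst ennreal_mult) auto
    also have "(b - a) / 2 * 2 = b - a" by (simp add: field_simps)
    finally have "ennreal ((b - a) / 2) * 2 = ennreal (b - a)" .
    then show ?thesis using Suc.prems
      by (simp add: add_divide_distrib_ennreal[symmetric] ennreal_divide_times divide_ennreal_def distrib_right mult.assoc ennreal_inverse_mult[symmetric])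
  qed
  show ?case
  proof
    fix x
    have "interval_avg i a b F x = ((\<integral>\<^sup>+s. F (update_coord x i s) * indicator {a..<c} s \<partial>lborel) +
        (\<integral>\<^sup>+s. F (update_coord x i s) * indicator {c..<b} s \<partial>lborel)) / ennreal (b - a)"
      unfolding interval_avg_def using c by (subst nn_integral_split_interval[of _ a c b]) auto
    also have "\<dots> = (interval_avg i a c F x + interval_avg i c b F x) / 2"
      by (simp add: half[symmetric] interval_avg_def c)
    finally show "mean (dyadic_tree i (Suc m) a b F) x = interval_avg i a b F x"
      using Suc.IH[of a c] Suc.IH[of c b] c by (simp add: c_def[symmetric])
  qed
qed simp

text \<open>Piecewise constant in \<open>y\<close>, on the cells of the finest grid.\<close>

lemma dyadic_max_measurable_arg [measurable]:
  "(\<lambda>y. mnorm p is (fmax h (dyadic_max i n a b F y)) x) \<in> borel_measurable borel"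
proof (induction n arbitrary: a b h)
  case (Suc n)
  have eq: "(\<lambda>y. mnorm p is (fmax h (dyadic_max i (Suc n) a b F y)) x) =
    (\<lambda>y. if y < (a + b) / 2 then mnorm p is (fmax (fmax h (interval_avg i a b F)) (dyadic_max i n a ((a + b) / 2) F y)) x
      else mnorm p is (fmax (fmax h (interval_avg i a b F)) (dyadic_max i n ((a + b) / 2) b F y)) x)"
    by (auto simp: fmax_assoc)
  show ?case unfolding eq by (rule measurable_If) (use Suc.IH in simp_all)
qed simp

text \<open>The points \<open>y\<close> that select a given leaf form an interval of length
  \<open>(b - a) / 2 ^ m\<close>, so the integral in \<open>y\<close> is a tree average. This is the
  dictionary between trees and maximal functions on the line.\<close>

lemma dyadic_max_moment:
  assumes [measurable]: "F \<in> borel_measurable borel" and "a < b"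
  shows "(\<integral>\<^sup>+y. ennreal_powr (mnorm p is (fmax g (dyadic_max i m a b F y)) x) q * indicator {a..<b} y \<partial>lborel) =
    ennreal (b - a) * max_moment (\<lambda>h. mnorm p is h x) q g (dyadic_tree i m a b F)"
  using assms(2)
proof (induction m arbitrary: a b g)
  case 0
  then show ?case by (simp add: nn_integral_cmult_indicator) (simp add: mult.commute)
next
  case (Suc m)
  define c where "c = (a + b) / 2"
  have c: "a < c" "c < b" "c - a = (b - a) / 2" "b - c = (b - a) / 2"
    using Suc.prems by (auto simp: c_def field_simps)
  let ?g = "fmax g (interval_avg i a b F)"
  have m: "mean (dyadic_tree i (Suc m) a b F) = interval_avg i a b F"
    by (rule mean_dyadic_tree) (use Suc.prems in auto)
  let ?f = "\<lambda>y. ennreal_powr (mnorm p is (fmax g (dyadic_max i (Suc m) a b F y)) x) q"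
  have eq: "?f y * indicator {a..<b} y =
    ennreal_powr (mnorm p is (fmax ?g (dyadic_max i m a c F y)) x) q * indicator {a..<c} y +
    ennreal_powr (mnorm p is (fmax ?g (dyadic_max i m c b F y)) x) q * indicator {c..<b} y" for y
    using c by (auto simp: indicator_def fmax_assoc c_def[symmetric])
  have h: "ennreal ((b - a) / 2) * X + ennreal ((b - a) / 2) * Y = ennreal (b - a) * ((X + Y) / 2)" for X Y
  proof -
    have "ennreal ((b - a) / 2) = ennreal (b - a) / 2"
      using Suc.prems by (subst divide_ennreal[symmetric]) auto
    then show ?thesis by (simp add: divide_ennreal_def algebra_simps)
  qed
  have "(\<integral>\<^sup>+y. ?f y * indicator {a..<b} y \<partial>lborel) =
     ennreal (c - a) * max_moment (\<lambda>h. mnorm p is h x) q ?g (dyadic_tree i m a c F) +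
     ennreal (b - c) * max_moment (\<lambda>h. mnorm p is h x) q ?g (dyadic_tree i m c b F)"
    unfolding eq by (subst nn_integral_add) (use Suc.IH c in auto)
  also have "\<dots> = ennreal (b - a) * max_moment (\<lambda>h. mnorm p is h x) q g (dyadic_tree i (Suc m) a b F)"
    using m by (simp only: c(3,4) dyadic_tree.simps max_moment.simps c_def[symmetric] h)
  finally show ?case .
qed

text \<open>Jensen's inequality for a norm: Minkowski's inequality moves the average outside of
  \<open>mnorm p is\<close>, and Hoelder's inequality on the interval supplies the power
  \<open>q\<close>.\<close>

lemma mnorm_interval_avg_le:
  assumes p: "\<And>i. 1 < p i" and q: "1 < q" and [measurable]: "F \<in> borel_measurable borel" and "a < b" "i \<notin> set is"
  shows "ennreal (b - a) * ennreal_powr (mnorm p is (interval_avg i a b F) x) q \<le>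
    (\<integral>\<^sup>+y. ennreal_powr (mnorm p is F (update_coord x i y)) q * indicator {a..<b} y \<partial>lborel)"
proof -
  have p0: "0 < p i" for i using p[of i] by simp
  let ?G = "\<lambda>s. mnorm p is F (update_coord x i s)"
  let ?I = "\<integral>\<^sup>+y. ennreal_powr (?G y) q * indicator {a..<b} y \<partial>lborel"
  define L where "L = b - a"
  have L: "0 < L" using assms by (simp add: L_def)
  have eq: "interval_avg i a b F y = inverse (ennreal L) * (\<integral>\<^sup>+s. F (update_coord y i s) * indicator {a..<b} s \<partial>lborel)" for y
    by (simp add: interval_avg_def divide_ennreal_def mult.commute L_def)
  have "mnorm p is (interval_avg i a b F) x =
    mnorm p is (\<lambda>y. inverse (ennreal L) * (\<integral>\<^sup>+s. F (update_coord y i s) * indicator {a..<b} s \<partial>lborel)) x"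
    by (rule mnorm_cong) (rule eq)
  also have "\<dots> = inverse (ennreal L) * mnorm p is (\<lambda>y. \<integral>\<^sup>+s. F (update_coord y i s) * indicator {a..<b} s \<partial>lborel) x"
  proof (rule mnorm_cmult[OF _ p0])
    have "(\<lambda>(y, s). F (update_coord y i s) * indicator {a..<b} s) \<in> borel_measurable (borel \<Otimes>\<^sub>M lborel)"
      by measurable
    from sigma_finite_measure.borel_measurable_nn_integral[OF sigma_finite_lborel this]
    show "(\<lambda>y. \<integral>\<^sup>+s. F (update_coord y i s) * indicator {a..<b} s \<partial>lborel) \<in> borel_measurable borel" .
  qed
  also have "\<dots> \<le> inverse (ennreal L) * (\<integral>\<^sup>+s. mnorm p is (\<lambda>y. F (update_coord y i s) * indicator {a..<b} s) x \<partial>lborel)"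
    by (intro mult_left_mono mnorm_Minkowski[OF p sigma_finite_lborel]) measurable
  also have "(\<lambda>s. mnorm p is (\<lambda>y. F (update_coord y i s) * indicator {a..<b} s) x) = (\<lambda>s. ?G s * indicator {a..<b} s)"
  proof
    fix s
    have "mnorm p is (\<lambda>y. F (update_coord y i s) * indicator {a..<b} s) x = mnorm p is (\<lambda>y. indicator {a..<b} s * F (update_coord y i s)) x"
      by (simp add: mult.commute)
    also have "\<dots> = indicator {a..<b} s * mnorm p is (\<lambda>y. F (update_coord y i s)) x"
      by (rule mnorm_cmult) (use p0 in auto)
    finally show "mnorm p is (\<lambda>y. F (update_coord y i s) * indicator {a..<b} s) x = ?G s * indicator {a..<b} s"
      using assms(5) by (simp add: mnorm_update mult.commute)
  qed
  \<comment> \<open>The indicator is doubled so that the second factor in Hoelder's inequality is a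
    power of the length of the interval.\<close>
  also have "(\<integral>\<^sup>+s. ?G s * indicator {a..<b} s \<partial>lborel) = (\<integral>\<^sup>+s. (?G s * indicator {a..<b} s) * indicator {a..<b} s \<partial>lborel)"
    by (intro nn_integral_cong) (auto simp: indicator_def)
  also have "\<dots> \<le> ennreal_powr (\<integral>\<^sup>+s. ennreal_powr (?G s * indicator {a..<b} s) q \<partial>lborel) (1/q) *
     ennreal_powr (\<integral>\<^sup>+s. ennreal_powr (indicator {a..<b} s) (q / (q - 1)) \<partial>lborel) (1 / (q / (q - 1)))"
    by (rule nn_integral_Hoelder[OF q refl]) measurable
  also have "(\<lambda>s. ennreal_powr (?G s * indicator {a..<b} s) q) = (\<lambda>s. ennreal_powr (?G s) q * indicator {a..<b} s)"
    using q by (auto simp: indicator_def)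
  also have "(\<lambda>s. ennreal_powr (indicator {a..<b} s) (q / (q - 1))) = indicator {a..<b}"
    using q by (auto simp: indicator_def)
  also have "(\<integral>\<^sup>+s. indicator {a..<b} s \<partial>lborel) = ennreal L"
    using assms by (simp add: L_def)
  finally have le: "mnorm p is (interval_avg i a b F) x \<le>
      inverse (ennreal L) * (ennreal_powr ?I (1/q) * ennreal_powr (ennreal L) (1 / (q / (q - 1))))"
    by (simp add: mult_left_mono)
  have "ennreal L * ennreal_powr (mnorm p is (interval_avg i a b F) x) q \<le>
     ennreal L * ennreal_powr (inverse (ennreal L) * (ennreal_powr ?I (1/q) * ennreal_powr (ennreal L) (1 / (q / (q - 1))))) q"
    using q le by (intro mult_left_mono ennreal_powr_mono) auto
  also have "\<dots> = ennreal L * (ennreal (inverse L powr q) * (?I * ennreal (L powr ((q - 1) / q * q))))"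
    using q L by (simp add: ennreal_powr_mult ennreal_powr_powr inverse_ennreal ennreal_powr_ennreal powr_powr)
  also have "\<dots> = ennreal (L * inverse L powr q * L powr (q - 1)) * ?I"
    using q L by (simp add: ennreal_mult ac_simps)
  also have "L * inverse L powr q * L powr (q - 1) = 1"
    using L powr_add[of L 1 "q - 1"] by (simp add: inverse_powr) (simp add: field_simps)
  finally show ?thesis by (simp add: L_def)
qed

lemma dyadic_tree_moment_le:
  assumes p: "\<And>i. 1 < p i" and q: "1 < q" and [measurable]: "F \<in> borel_measurable borel" and "a < b" "i \<notin> set is"
  shows "ennreal (b - a) * moment (\<lambda>h. mnorm p is h x) q (dyadic_tree i m a b F) \<le>
    (\<integral>\<^sup>+y. ennreal_powr (mnorm p is F (update_coord x i y)) q * indicator {a..<b} y \<partial>lborel)"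
  using assms(4)
proof (induction m arbitrary: a b)
  case 0
  then show ?case using mnorm_interval_avg_le[OF p q assms(3) 0 assms(5)] by simp
next
  case (Suc m)
  define c where "c = (a + b) / 2"
  have c: "a < c" "c < b" "c - a = (b - a) / 2" "b - c = (b - a) / 2"
    using Suc.prems by (auto simp: c_def field_simps)
  have h: "ennreal (b - a) * ((X + Y) / 2) = ennreal ((b - a) / 2) * X + ennreal ((b - a) / 2) * Y" for X Y
  proof -
    have "ennreal ((b - a) / 2) = ennreal (b - a) / 2"
      using Suc.prems by (subst divide_ennreal[symmetric]) auto
    then show ?thesis by (simp add: divide_ennreal_def algebra_simps)
  qed
  have "ennreal (b - a) * moment (\<lambda>h. mnorm p is h x) q (dyadic_tree i (Suc m) a b F) =
    ennreal (c - a) * moment (\<lambda>h. mnorm p is h x) q (dyadic_tree i m a c F) +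
    ennreal (b - c) * moment (\<lambda>h. mnorm p is h x) q (dyadic_tree i m c b F)"
    by (simp only: c(3,4) dyadic_tree.simps moment.simps c_def[symmetric] h)
  also have "\<dots> \<le> (\<integral>\<^sup>+y. ennreal_powr (mnorm p is F (update_coord x i y)) q * indicator {a..<c} y \<partial>lborel) +
    (\<integral>\<^sup>+y. ennreal_powr (mnorm p is F (update_coord x i y)) q * indicator {c..<b} y \<partial>lborel)"
    by (intro add_mono Suc.IH c)
  also have "\<dots> = (\<integral>\<^sup>+y. ennreal_powr (mnorm p is F (update_coord x i y)) q * indicator {a..<b} y \<partial>lborel)"
    using c by (intro nn_integral_split_interval[symmetric]) auto
  finally show ?case .
qed

lemma dyadic_max_bound:
  assumes p: "\<And>i. 1 < p i" and q: "1 < q" and F[measurable]: "F \<in> borel_measurable borel" and ab: "a < b" and i: "i \<notin> set is"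
    and C: "tree_bound p is q C"
  shows "(\<integral>\<^sup>+y. ennreal_powr (mnorm p is (dyadic_max i m a b F y) x) q * indicator {a..<b} y \<partial>lborel) \<le>
    ennreal C * (\<integral>\<^sup>+y. ennreal_powr (mnorm p is F (update_coord x i y)) q \<partial>lborel)"
proof -
  have "(\<integral>\<^sup>+y. ennreal_powr (mnorm p is (dyadic_max i m a b F y) x) q * indicator {a..<b} y \<partial>lborel) =
    ennreal (b - a) * max_moment (\<lambda>h. mnorm p is h x) q (\<lambda>_. 0) (dyadic_tree i m a b F)"
    using dyadic_max_moment[OF F ab, of p "is" "\<lambda>_. 0"] by simp
  also have "\<dots> \<le> ennreal (b - a) * (ennreal C * moment (\<lambda>h. mnorm p is h x) q (dyadic_tree i m a b F))"
    using C dyadic_tree_measurable[OF F] unfolding tree_bound_def by (intro mult_left_mono) auto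
  also have "\<dots> = ennreal C * (ennreal (b - a) * moment (\<lambda>h. mnorm p is h x) q (dyadic_tree i m a b F))"
    by (simp add: ac_simps)
  also have "\<dots> \<le> ennreal C * (\<integral>\<^sup>+y. ennreal_powr (mnorm p is F (update_coord x i y)) q * indicator {a..<b} y \<partial>lborel)"
    by (intro mult_left_mono dyadic_tree_moment_le p q F ab i) simp
  also have "\<dots> \<le> ennreal C * (\<integral>\<^sup>+y. ennreal_powr (mnorm p is F (update_coord x i y)) q \<partial>lborel)"
    by (intro mult_left_mono nn_integral_mono) (auto simp: indicator_def)
  finally show ?thesis .
qed

lemma dyadic_max_ge:
  assumes "d \<le> m" "j < 2 ^ d" "a < b"
    "a + real j * ((b - a) / 2 ^ d) \<le> y" "y < a + (real j + 1) * ((b - a) / 2 ^ d)"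
  shows "interval_avg i (a + real j * ((b - a) / 2 ^ d)) (a + (real j + 1) * ((b - a) / 2 ^ d)) F x \<le> dyadic_max i m a b F y x"
  using assms
proof (induction d arbitrary: m a b j)
  case 0
  then show ?case by (cases m) (auto simp: fmax_def)
next
  case (Suc d)
  then obtain n where m: "m = Suc n" "d \<le> n" by (cases m) auto
  define c where "c = (a + b) / 2"
  have c: "a < c" "c < b" "c - a = (b - a) / 2" "b - c = (b - a) / 2" "c = a + (b - a) / 2"
    using Suc.prems by (auto simp: c_def field_simps)
  define L where "L = (b - a) / 2 ^ Suc d"
  have L: "0 < L" using Suc.prems by (simp add: L_def)
  have half: "2 ^ d * L = (b - a) / 2" by (simp add: L_def)
  have y: "a + real j * L \<le> y" "y < a + (real j + 1) * L"
    using Suc.prems(4,5) by (simp_all only: L_def)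
  show ?case
  proof (cases "y < c")
    case True
    have "real j * L < 2 ^ d * L" using y True c half by linarith
    then have "real j < 2 ^ d" using L by simp
    then have j: "j < 2 ^ d" by (metis of_nat_less_iff of_nat_numeral of_nat_power)
    have "interval_avg i (a + real j * L) (a + (real j + 1) * L) F x \<le> dyadic_max i n a c F y x"
      using Suc.IH[of n j a c] m j c Suc.prems by (simp add: L_def)
    then have "interval_avg i (a + real j * L) (a + (real j + 1) * L) F x \<le> dyadic_max i m a b F y x"
      using True m by (simp add: fmax_def c_def[symmetric] le_max_iff_disj)
    then show ?thesis by (simp only: L_def)
  next
    case False
    have "2 ^ d * L < (real j + 1) * L" using y False c half by linarith
    then have "2 ^ d < real j + 1" using L by simp
    then have "real (2 ^ d) < real (Suc j)" by simp
    then have j: "2 ^ d \<le> j" by (simp only: of_nat_less_iff)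
    then obtain k where k: "j = 2 ^ d + k" using le_Suc_ex by blast
    have shift: "a + (real j + u) * L = c + (real k + u) * L" for u
      using c(5) half by (simp add: k algebra_simps)
    have k2: "k < 2 ^ d" using Suc.prems k by simp
    have Lc: "(b - c) / 2 ^ d = L" by (simp only: L_def c(4)) simp
    have "interval_avg i (c + real k * L) (c + (real k + 1) * L) F x \<le> dyadic_max i n c b F y x"
      by (rule Suc.IH[of n k c b, unfolded Lc]) (use m k2 c y shift[of 0] shift[of 1] in auto)
    then have "interval_avg i (a + real j * L) (a + (real j + 1) * L) F x \<le> dyadic_max i m a b F y x"
      using False m shift[of 0] shift[of 1] by (simp add: fmax_def c_def[symmetric] le_max_iff_disj)
    then show ?thesis by (simp only: L_def)
  qed
qed

section \<open>Centred averages under two shifted dyadic grids\<close>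

definition centered_avg :: "'n::finite \<Rightarrow> real \<Rightarrow> (real ^ 'n \<Rightarrow> ennreal) \<Rightarrow> real ^ 'n \<Rightarrow> ennreal" where
  "centered_avg i r F x = interval_avg i (x $ i - r) (x $ i + r) F x"

lemma interval_avg_mono_set:
  assumes "a \<le> a'" "b' \<le> b" "a' < b'" "b - a \<le> K * (b' - a')"
  shows "interval_avg i a' b' F x \<le> ennreal K * interval_avg i a b F x"
proof -
  have K: "0 \<le> K" using assms by (smt (verit) mult_nonneg_nonneg mult_neg_pos)
  let ?J = "\<integral>\<^sup>+s. F (update_coord x i s) * indicator {a..<b} s \<partial>lborel"
  have "interval_avg i a' b' F x \<le> ?J / ennreal (b' - a')"
    unfolding interval_avg_def using assms
    by (intro divide_right_mono_ennreal nn_integral_mono) (auto simp: indicator_def)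
  also have "\<dots> = ?J * ennreal (1 / (b' - a'))"
    using assms by (simp add: divide_ennreal_def inverse_ennreal inverse_eq_divide)
  also have "\<dots> \<le> ?J * ennreal (K * (1 / (b - a)))"
    using assms by (intro mult_left_mono ennreal_leI) (auto simp: field_simps)
  also have "\<dots> = ennreal K * (?J * ennreal (1 / (b - a)))"
    using K assms by (subst ennreal_mult) (auto simp: ac_simps)
  also have "?J * ennreal (1 / (b - a)) = interval_avg i a b F x"
    unfolding interval_avg_def using assms by (simp add: divide_ennreal_def inverse_ennreal inverse_eq_divide)
  finally show ?thesis .
qed

text \<open>Two grids of the same mesh \<open>c\<close>, shifted against each other by \<open>2L/3\<close> where \<open>2L\<close> is a multiple of
  \<open>c\<close> by a power of two, are at distance at least \<open>c/3\<close> since three does not divide a power of two.\<close>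

lemma grid_gap:
  fixes j k :: int and c :: real
  assumes "0 < c"
  shows "c / 3 \<le> \<bar>(c * j) - (c * k + 2 ^ d * c / 3)\<bar>"
proof -
  have "(2::int) ^ d mod 3 = 1 \<or> (2::int) ^ d mod 3 = 2"
  proof (induction d)
    case (Suc d)
    then show ?case by (simp only: power_Suc) presburger
  qed simp
  then have "3 * (j - k) - 2 ^ d \<noteq> 0" by presburger
  then have "1 \<le> \<bar>3 * (j - k) - 2 ^ d\<bar>" by linarith
  then have "1 \<le> real_of_int \<bar>3 * (j - k) - 2 ^ d\<bar>" by linarith
  then have "c / 3 * 1 \<le> c / 3 * real_of_int \<bar>3 * (j - k) - 2 ^ d\<bar>"
    using assms by (intro mult_left_mono) auto
  also have "\<dots> = \<bar>c / 3 * (3 * (real_of_int j - real_of_int k) - 2 ^ d)\<bar>"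
    using assms by (simp add: abs_mult)
  also have "c / 3 * (3 * (real_of_int j - real_of_int k) - 2 ^ d) = c * j - (c * k + 2 ^ d * c / 3)"
    by (simp add: algebra_simps)
  finally show ?thesis by simp
qed

lemma in_grid_cell:
  fixes a c y r :: real
  assumes c: "0 < c" and y: "a \<le> y" "y < a + 2 ^ d * c" and r: "0 < r"
    and far: "\<And>j::int. r \<le> \<bar>y - (a + c * j)\<bar>"
  shows "\<exists>j::nat. j < 2 ^ d \<and> a + real j * c \<le> y - r \<and> y + r \<le> a + (real j + 1) * c \<and>
    a + real j * c \<le> y \<and> y < a + (real j + 1) * c"
proof -
  define j where "j = nat \<lfloor>(y - a) / c\<rfloor>"
  have nn: "0 \<le> (y - a) / c" using c y by simp
  have j: "real j \<le> (y - a) / c" "(y - a) / c < real j + 1"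
    using nn by (auto simp: j_def)
  then have j1: "a + real j * c \<le> y" "y < a + (real j + 1) * c"
    using c by (auto simp: field_simps)
  have "r \<le> \<bar>y - (a + c * real j)\<bar>" "r \<le> \<bar>y - (a + c * (real j + 1))\<bar>"
    using far[of "int j"] far[of "int j + 1"] by auto
  then have j2: "a + real j * c \<le> y - r" "y + r \<le> a + (real j + 1) * c"
    using j1 by (auto simp: algebra_simps abs_if split: if_splits)
  have "real j * c < 2 ^ d * c" using j1 y by linarith
  then have "real j < 2 ^ d" using c by simp
  then have "j < 2 ^ d" by (metis of_nat_less_iff of_nat_numeral of_nat_power)
  with j1 j2 show ?thesis by blast
qed

text \<open>One of the two grids has no point within \<open>r\<close> of \<open>y\<close>: a point
  of each grid that close would make them less than \<open>2 * r\<close> apart, against the gap from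
  \<open>grid_gap\<close>. In that grid the interval of radius \<open>r\<close> about
  \<open>y\<close> lies in a single cell.\<close>

lemma centered_avg_le_dyadic_max:
  fixes k :: int and N P :: nat and B :: real
  assumes k: "- int N \<le> k" "k \<le> int N" and P: "N + 2 \<le> P"
    and y: "- (2 ^ P / 3) \<le> y" "y < 2 ^ P" and xi: "x $ i = y"
  shows "centered_avg i (2 powi k) F x \<le>
    ennreal 4 * (dyadic_max i (P + N) (- (2 ^ P)) (2 ^ P) F y x + dyadic_max i (P + N) (- (2 ^ P / 3)) (5 * 2 ^ P / 3) F y x)"
proof -
  \<comment> \<open>Both root intervals have length \<open>2 * 2 ^ P\<close>, so \<open>d\<close>
    halvings lead to cells of length \<open>8 * 2 powi k\<close>. The depth \<open>P + N\<close>
    leaves room for every \<open>k \<ge> - N\<close>.\<close>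
  define d where "d = nat (int P - 2 - k)"
  have d: "int d = int P - 2 - k" "d \<le> P + N" using k P by (auto simp: d_def)
  define r where "r = (2::real) powi k"
  \<comment> \<open>The factor 8 makes the gap \<open>c / 3\<close> larger than
    \<open>2 * r\<close>. A cell is then 4 times as long as the centred interval, whence the 4 in
    the claim.\<close>
  define c where "c = 8 * r"
  have r: "0 < r" by (simp add: r_def)
  have "(2::real) ^ d * c = 2 powi (int d) * (2 powi 3 * 2 powi k)"
    by (simp add: c_def r_def power_int_def)
  also have "\<dots> = 2 powi (int d + 3 + k)"
    by (simp only: power_int_add[symmetric] power_int_add_1 add.assoc) (simp add: power_int_add)
  also have "int d + 3 + k = int P + 1" using d by simp
  also have "(2::real) powi (int P + 1) = 2 * 2 ^ P" by (simp add: power_int_add)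
  finally have len: "2 ^ d * c = 2 * 2 ^ P" .
  have c: "0 < c" using r by (simp add: c_def)
  define a1 a2 :: real where "a1 = - (2 ^ P)" and "a2 = - (2 ^ P / 3)"
  have a: "a2 = a1 + 2 ^ d * c / 3" "a1 + 2 ^ d * c = 2 ^ P" "a2 + 2 ^ d * c = 5 * 2 ^ P / 3"
    by (simp_all add: a1_def a2_def len)
  have key: "centered_avg i r F x \<le> ennreal 4 * dyadic_max i (P + N) a (a + 2 ^ d * c) F y x"
    if far: "\<And>j::int. r \<le> \<bar>y - (a + c * j)\<bar>" and ya: "a \<le> y" "y < a + 2 ^ d * c" for a
  proof -
    from in_grid_cell[OF c ya r far] obtain j :: nat where j: "j < 2 ^ d" "a + real j * c \<le> y - r" "y + r \<le> a + (real j + 1) * c"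
      "a + real j * c \<le> y" "y < a + (real j + 1) * c" by blast
    have "centered_avg i r F x \<le> ennreal 4 * interval_avg i (a + real j * c) (a + (real j + 1) * c) F x"
      unfolding centered_avg_def xi using j r
      by (intro interval_avg_mono_set) (auto simp: algebra_simps c_def)
    also have "interval_avg i (a + real j * c) (a + (real j + 1) * c) F x \<le> dyadic_max i (P + N) a (a + 2 ^ d * c) F y x"
      using dyadic_max_ge[of d "P + N" j a "a + 2 ^ d * c" y i F x] d j c by simp
    finally show ?thesis by (simp add: mult_left_mono)
  qed
  have pos: "0 < (2::real) ^ P" by simp
  have "a1 \<le> y" "a2 \<le> y" unfolding a1_def a2_def using y pos by linarith+
  moreover have "y < a1 + 2 ^ d * c" "y < a2 + 2 ^ d * c" unfolding a(2,3) using y pos by linarith+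
  ultimately have y1: "a1 \<le> y" "y < a1 + 2 ^ d * c" and y2: "a2 \<le> y" "y < a2 + 2 ^ d * c"
    by auto
  consider "\<And>j::int. r \<le> \<bar>y - (a1 + c * j)\<bar>" | "\<And>j::int. r \<le> \<bar>y - (a2 + c * j)\<bar>"
  proof -
    have False if "\<bar>y - (a1 + c * j)\<bar> < r" "\<bar>y - (a2 + c * k)\<bar> < r" for j k :: int
    proof -
      have "\<bar>(a1 + c * j) - (a2 + c * k)\<bar> < 2 * r" using that by linarith
      moreover have "(a1 + c * j) - (a2 + c * k) = c * j - (c * k + 2 ^ d * c / 3)" using a by simp
      ultimately have "c / 3 < 2 * r" using grid_gap[OF c, of j k d] by linarith
      then show False using r by (simp add: c_def)
    qed
    then show ?thesis using that by (meson not_le)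
  qed
  then show ?thesis
  proof cases
    case 1
    have "centered_avg i r F x \<le> ennreal 4 * dyadic_max i (P + N) a1 (2 ^ P) F y x"
      using key[OF 1 y1] unfolding a(2) .
    also have "\<dots> \<le> ennreal 4 * (dyadic_max i (P + N) a1 (2 ^ P) F y x + dyadic_max i (P + N) a2 (5 * 2 ^ P / 3) F y x)"
      by (intro mult_left_mono) auto
    finally show ?thesis by (simp add: a1_def a2_def r_def)
  next
    case 2
    have "centered_avg i r F x \<le> ennreal 4 * dyadic_max i (P + N) a2 (5 * 2 ^ P / 3) F y x"
      using key[OF 2 y2] unfolding a(3) .
    also have "\<dots> \<le> ennreal 4 * (dyadic_max i (P + N) a1 (2 ^ P) F y x + dyadic_max i (P + N) a2 (5 * 2 ^ P / 3) F y x)"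
      by (intro mult_left_mono) auto
    finally show ?thesis by (simp add: a1_def a2_def r_def)
  qed
qed

section \<open>Maximal operators in one variable and their composites\<close>

definition coord_max :: "'n::finite \<Rightarrow> (real ^ 'n \<Rightarrow> ennreal) \<Rightarrow> real ^ 'n \<Rightarrow> ennreal" where
  "coord_max i F x = (SUP k::int. centered_avg i (2 powi k) F x)"

text \<open>Finitely many scales, for which trees of finite depth suffice; \<open>coord_max\<close>
  follows by monotone convergence in \<open>N\<close>.\<close>

definition coord_max_upto :: "nat \<Rightarrow> 'n::finite \<Rightarrow> (real ^ 'n \<Rightarrow> ennreal) \<Rightarrow> real ^ 'n \<Rightarrow> ennreal" where
  "coord_max_upto N i F x = (SUP k\<in>{- int N..int N}. centered_avg i (2 powi k) F x)"

lemma coord_max_eq_SUP: "coord_max i F x = (SUP N. coord_max_upto N i F x)"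
proof (rule antisym)
  show "coord_max i F x \<le> (SUP N. coord_max_upto N i F x)"
    unfolding coord_max_def
  proof (rule SUP_least)
    fix k :: int
    have "centered_avg i (2 powi k) F x \<le> coord_max_upto (nat \<bar>k\<bar>) i F x"
      unfolding coord_max_upto_def by (rule SUP_upper) auto
    also have "\<dots> \<le> (SUP N. coord_max_upto N i F x)" by (rule SUP_upper) simp
    finally show "centered_avg i (2 powi k) F x \<le> (SUP N. coord_max_upto N i F x)" .
  qed
qed (auto simp: coord_max_def coord_max_upto_def intro!: SUP_least SUP_upper)

lemma centered_avg_measurable [measurable]:
  assumes [measurable]: "F \<in> borel_measurable borel"
  shows "centered_avg i r F \<in> borel_measurable borel"
proof -
  show ?thesis unfolding centered_avg_def by measurable
qed

lemma coord_max_measurable [measurable]: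
  assumes [measurable]: "F \<in> borel_measurable borel"
  shows "coord_max i F \<in> borel_measurable borel" "coord_max_upto N i F \<in> borel_measurable borel"
proof -
  show "coord_max i F \<in> borel_measurable borel"
    unfolding coord_max_def[abs_def] by measurable
  have "(\<lambda>x. SUP k\<in>{- int N..int N}. centered_avg i (2 powi k) F x) \<in> borel_measurable borel"
    by (rule borel_measurable_SUP) auto
  then show "coord_max_upto N i F \<in> borel_measurable borel"
    unfolding coord_max_upto_def[abs_def] .
qed

lemma ennreal_powr_add_le:
  assumes "0 < q"
  shows "ennreal_powr (a + b) q \<le> ennreal (2 powr q) * (ennreal_powr a q + ennreal_powr b q)"
proof -
  have "a + b \<le> ennreal 2 * max a b"
    by (simp add: mult_2 add_mono)
  then have "ennreal_powr (a + b) q \<le> ennreal_powr (ennreal 2 * max a b) q"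
    using assms by (intro ennreal_powr_mono)
  also have "\<dots> = ennreal (2 powr q) * ennreal_powr (max a b) q"
    using assms by (simp only: ennreal_powr_mult) (subst ennreal_powr_ennreal, auto)
  also have "ennreal_powr (max a b) q \<le> ennreal_powr a q + ennreal_powr b q"
    by (auto simp: max_def)
  finally show ?thesis by (simp add: mult_left_mono)
qed

lemma nn_integral_le_exhaustion:
  fixes A :: "nat \<Rightarrow> 'a set" and f :: "'a \<Rightarrow> ennreal"
  assumes bd: "\<And>n. (\<integral>\<^sup>+x. f x * indicator (A n) x \<partial>M) \<le> K"
    and inc: "incseq A" and U: "(\<Union>n. A n) = UNIV"
    and [measurable]: "f \<in> borel_measurable M" "\<And>n. A n \<in> sets M"
  shows "(\<integral>\<^sup>+x. f x \<partial>M) \<le> K"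
proof -
  have inc': "incseq (\<lambda>n x. f x * indicator (A n) x)"
    using inc by (auto simp: incseq_def le_fun_def indicator_def)
  have "f x = (SUP n. f x * indicator (A n) x)" for x
  proof (rule antisym)
    obtain n where "x \<in> A n" using U by auto
    then show "f x \<le> (SUP n. f x * indicator (A n) x)"
      by (intro SUP_upper2[of n]) auto
  qed (auto intro!: SUP_least simp: indicator_def)
  then have "(\<integral>\<^sup>+x. f x \<partial>M) = (\<integral>\<^sup>+x. (SUP n. f x * indicator (A n) x) \<partial>M)" by simp
  also have "\<dots> = (SUP n. \<integral>\<^sup>+x. f x * indicator (A n) x \<partial>M)"
    by (rule nn_integral_monotone_convergence_SUP[OF inc']) measurable
  also have "\<dots> \<le> K" by (rule SUP_least) (rule bd)
  finally show ?thesis .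
qed

text \<open>The coordinate \<open>x $ i\<close> becomes the parameter \<open>y\<close>, for which
  two dyadic maximal functions dominate all scales up to \<open>N\<close>. Their bounds depend
  neither on the size \<open>2 ^ P\<close> of the root intervals nor on \<open>N\<close>, so both
  can be sent to infinity. The 8 is the 4 of \<open>centered_avg_le_dyadic_max\<close> times the 2
  of \<open>ennreal_powr_add_le\<close>, and \<open>2 * C\<close> counts the grids.\<close>

proposition coord_max_bound_inner:
  fixes p :: "'n::finite \<Rightarrow> real"
  assumes p: "\<And>i. 1 < p i" and F[measurable]: "F \<in> borel_measurable borel" and i: "i \<notin> set is"
    and C: "tree_bound p is (p i) C" "0 \<le> C"
  shows "mnorm p (i # is) (coord_max i F) x \<le> ennreal ((8 powr p i * (2 * C)) powr (1 / p i)) * mnorm p (i # is) F x"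
proof -
  have p0: "0 < p i" for i using p[of i] by simp
  let ?J = "\<integral>\<^sup>+y. ennreal_powr (mnorm p is F (update_coord x i y)) (p i) \<partial>lborel"
  have up: "mnorm p is (coord_max_upto N i F) (update_coord x i y) \<le>
      ennreal 4 * (mnorm p is (dyadic_max i (P + N) (- (2 ^ P)) (2 ^ P) F y) x + mnorm p is (dyadic_max i (P + N) (- (2 ^ P / 3)) (5 * 2 ^ P / 3) F y) x)"
    if P: "N + 2 \<le> P" and y: "- (2 ^ P / 3) \<le> y" "y < 2 ^ P" for N P y
  proof -
    have "mnorm p is (coord_max_upto N i F) (update_coord x i y) = mnorm p is (\<lambda>z. coord_max_upto N i F (update_coord z i y)) x"
      by (rule mnorm_update[OF i])
    also have "\<dots> \<le> mnorm p is (\<lambda>z. ennreal 4 * (dyadic_max i (P + N) (- (2 ^ P)) (2 ^ P) F y z + dyadic_max i (P + N) (- (2 ^ P / 3)) (5 * 2 ^ P / 3) F y z)) x"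
    proof (rule mnorm_mono[OF _ p0])
      fix z
      show "coord_max_upto N i F (update_coord z i y) \<le>
         ennreal 4 * (dyadic_max i (P + N) (- (2 ^ P)) (2 ^ P) F y z + dyadic_max i (P + N) (- (2 ^ P / 3)) (5 * 2 ^ P / 3) F y z)"
        unfolding coord_max_upto_def
      proof (rule SUP_least)
        fix k assume "k \<in> {- int N..int N}"
        then have "centered_avg i (2 powi k) F (update_coord z i y) \<le>
          ennreal 4 * (dyadic_max i (P + N) (- (2 ^ P)) (2 ^ P) F y (update_coord z i y) + dyadic_max i (P + N) (- (2 ^ P / 3)) (5 * 2 ^ P / 3) F y (update_coord z i y))"
          by (intro centered_avg_le_dyadic_max P y) (auto simp: update_coord_nth)
        then show "centered_avg i (2 powi k) F (update_coord z i y) \<le>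
          ennreal 4 * (dyadic_max i (P + N) (- (2 ^ P)) (2 ^ P) F y z + dyadic_max i (P + N) (- (2 ^ P / 3)) (5 * 2 ^ P / 3) F y z)"
          by (simp only: dyadic_max_update)
      qed
    qed
    also have "\<dots> = ennreal 4 * mnorm p is (\<lambda>z. dyadic_max i (P + N) (- (2 ^ P)) (2 ^ P) F y z + dyadic_max i (P + N) (- (2 ^ P / 3)) (5 * 2 ^ P / 3) F y z) x"
      by (rule mnorm_cmult[OF _ p0]) (use dyadic_max_measurable[OF F] in auto)
    also have "\<dots> \<le> ennreal 4 * (mnorm p is (dyadic_max i (P + N) (- (2 ^ P)) (2 ^ P) F y) x + mnorm p is (dyadic_max i (P + N) (- (2 ^ P / 3)) (5 * 2 ^ P / 3) F y) x)"
      by (intro mult_left_mono mnorm_add_le p dyadic_max_measurable F) simp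
    finally show ?thesis .
  qed
  have meas[measurable]: "(\<lambda>y. mnorm p is (dyadic_max i n a b F y) x) \<in> borel_measurable borel" for n a b
    using dyadic_max_measurable_arg[of p "is" "\<lambda>_. 0"] by simp
  have bd: "(\<integral>\<^sup>+y. ennreal_powr (mnorm p is (coord_max_upto N i F) (update_coord x i y)) (p i) * indicator {- (2 ^ P / 3)..<2 ^ P} y \<partial>lborel) \<le>
    ennreal (8 powr p i * (2 * C)) * ?J" if P: "N + 2 \<le> P" for N P
  proof -
    let ?A = "\<lambda>y. mnorm p is (dyadic_max i (P + N) (- (2 ^ P)) (2 ^ P) F y) x"
    let ?B = "\<lambda>y. mnorm p is (dyadic_max i (P + N) (- (2 ^ P / 3)) (5 * 2 ^ P / 3) F y) x"
    have pos: "0 < (2::real) ^ P" by simp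
    have "(\<integral>\<^sup>+y. ennreal_powr (mnorm p is (coord_max_upto N i F) (update_coord x i y)) (p i) * indicator {- (2 ^ P / 3)..<2 ^ P} y \<partial>lborel) \<le>
      (\<integral>\<^sup>+y. ennreal (8 powr p i) * (ennreal_powr (?A y) (p i) * indicator {- (2 ^ P)..<2 ^ P} y + ennreal_powr (?B y) (p i) * indicator {- (2 ^ P / 3)..<5 * 2 ^ P / 3} y) \<partial>lborel)"
    proof (rule nn_integral_mono)
      fix y
      show "ennreal_powr (mnorm p is (coord_max_upto N i F) (update_coord x i y)) (p i) * indicator {- (2 ^ P / 3)..<2 ^ P} y \<le>
        ennreal (8 powr p i) * (ennreal_powr (?A y) (p i) * indicator {- (2 ^ P)..<2 ^ P} y + ennreal_powr (?B y) (p i) * indicator {- (2 ^ P / 3)..<5 * 2 ^ P / 3} y)"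
      proof (cases "y \<in> {- (2 ^ P / 3)..<2 ^ P}")
        case True
        then have y: "- (2 ^ P / 3) \<le> y" "y < 2 ^ P" by auto
        have "ennreal_powr (mnorm p is (coord_max_upto N i F) (update_coord x i y)) (p i) \<le> ennreal_powr (ennreal 4 * (?A y + ?B y)) (p i)"
          by (intro ennreal_powr_mono up P y p0)
        also have "\<dots> = ennreal (4 powr p i) * ennreal_powr (?A y + ?B y) (p i)"
          by (subst ennreal_powr_mult[OF p0], subst ennreal_powr_ennreal) auto
        also have "\<dots> \<le> ennreal (4 powr p i) * (ennreal (2 powr p i) * (ennreal_powr (?A y) (p i) + ennreal_powr (?B y) (p i)))"
          by (intro mult_left_mono ennreal_powr_add_le p0) simp
        also have "\<dots> = ennreal (8 powr p i) * (ennreal_powr (?A y) (p i) + ennreal_powr (?B y) (p i))"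
          by (simp add: mult.assoc[symmetric] ennreal_mult[symmetric] powr_mult[symmetric])
        finally show ?thesis using y pos by simp
      qed simp
    qed
    also have "\<dots> = ennreal (8 powr p i) * ((\<integral>\<^sup>+y. ennreal_powr (?A y) (p i) * indicator {- (2 ^ P)..<2 ^ P} y \<partial>lborel) +
       (\<integral>\<^sup>+y. ennreal_powr (?B y) (p i) * indicator {- (2 ^ P / 3)..<5 * 2 ^ P / 3} y \<partial>lborel))"
      by (subst nn_integral_cmult, measurable, subst nn_integral_add) auto
    also have "\<dots> \<le> ennreal (8 powr p i) * (ennreal C * ?J + ennreal C * ?J)"
      using pos by (intro mult_left_mono add_mono dyadic_max_bound p F i C) auto
    also have "\<dots> = ennreal (8 powr p i * (2 * C)) * ?J"
      using C by (simp add: ennreal_mult mult_2[symmetric] ac_simps)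
    finally show ?thesis .
  qed
  have bd2: "(\<integral>\<^sup>+y. ennreal_powr (mnorm p is (coord_max_upto N i F) (update_coord x i y)) (p i) \<partial>lborel) \<le>
    ennreal (8 powr p i * (2 * C)) * ?J" for N
  proof (rule nn_integral_le_exhaustion)
    show "(\<integral>\<^sup>+y. ennreal_powr (mnorm p is (coord_max_upto N i F) (update_coord x i y)) (p i) * indicator {- (2 ^ (P + (N + 2)) / 3)..<2 ^ (P + (N + 2))} y \<partial>lborel) \<le>
      ennreal (8 powr p i * (2 * C)) * ?J" for P
      by (rule bd) simp
    show "incseq (\<lambda>P. {- (2 ^ (P + (N + 2)) / 3)..<(2::real) ^ (P + (N + 2))})"
    proof (rule incseq_SucI)
      fix P
      have "0 < (2::real) ^ (P + (N + 2))" by simp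
      then show "{- (2 ^ (P + (N + 2)) / 3)..<2 ^ (P + (N + 2))} \<subseteq> {- (2 ^ (Suc P + (N + 2)) / 3)..<(2::real) ^ (Suc P + (N + 2))}"
        by (simp add: ivl_subset)
    qed
    show "(\<Union>P. {- (2 ^ (P + (N + 2)) / 3)..<(2::real) ^ (P + (N + 2))}) = UNIV"
    proof (rule UNIV_eq_I[symmetric])
      fix y :: real
      obtain M where M: "3 * \<bar>y\<bar> < 2 ^ M" using real_arch_pow[of 2 "3 * \<bar>y\<bar>"] by auto
      have "(2::real) ^ M \<le> 2 ^ (M + (N + 2))" by (rule power_increasing) auto
      then have "y \<in> {- (2 ^ (M + (N + 2)) / 3)..<2 ^ (M + (N + 2))}" using M by auto
      then show "y \<in> (\<Union>P. {- (2 ^ (P + (N + 2)) / 3)..<2 ^ (P + (N + 2))})" by blast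
    qed
  qed measurable
  have "mnorm p (i # is) (coord_max i F) x = mnorm p (i # is) (\<lambda>y. SUP N. coord_max_upto N i F y) x"
    by (rule mnorm_cong) (rule coord_max_eq_SUP)
  also have "\<dots> = (SUP N. mnorm p (i # is) (coord_max_upto N i F) x)"
    by (rule mnorm_SUP[OF _ _ p0])
       (auto simp: incseq_def le_fun_def coord_max_upto_def[abs_def] intro!: SUP_subset_mono)
  also have "\<dots> \<le> ennreal ((8 powr p i * (2 * C)) powr (1 / p i)) * mnorm p (i # is) F x"
  proof (rule SUP_least)
    fix N
    have "mnorm p (i # is) (coord_max_upto N i F) x \<le> ennreal_powr (ennreal (8 powr p i * (2 * C)) * ?J) (1 / p i)"
      using bd2[of N] p0[of i] by (auto intro!: ennreal_powr_mono)
    also have "\<dots> = ennreal ((8 powr p i * (2 * C)) powr (1 / p i)) * mnorm p (i # is) F x"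
      using p0[of i] C(2) by (subst ennreal_powr_mult, simp, subst ennreal_powr_ennreal) auto
    finally show "mnorm p (i # is) (coord_max_upto N i F) x \<le> ennreal ((8 powr p i * (2 * C)) powr (1 / p i)) * mnorm p (i # is) F x" .
  qed
  finally show ?thesis .
qed

text \<open>Used in place of a supremum over boxes: up to constants it dominates averages over cubes
  (\<open>cube_integral_le_iter_max\<close>), and its norm bounds follow one variable at a
  time.\<close>

primrec iter_max :: "'n::finite list \<Rightarrow> (real ^ 'n \<Rightarrow> ennreal) \<Rightarrow> real ^ 'n \<Rightarrow> ennreal" where
  "iter_max [] F = F"
| "iter_max (i # is) F = coord_max i (iter_max is F)"

lemma iter_max_measurable [measurable]:
  "F \<in> borel_measurable borel \<Longrightarrow> iter_max is F \<in> borel_measurable borel"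
  by (induction "is") auto

text \<open>The variables listed after \<open>i\<close> are integrated before it and make up the
  norm in \<open>coord_max_bound_inner\<close>; those listed before \<open>i\<close> enter through
  monotonicity.\<close>

proposition coord_max_bound:
  fixes p :: "'n::finite \<Rightarrow> real"
  assumes p: "\<And>i. 1 < p i" and "distinct is" "i \<in> set is"
  shows "\<exists>C\<ge>0. \<forall>F\<in>borel_measurable borel. \<forall>x. mnorm p is (coord_max i F) x \<le> ennreal C * mnorm p is F x"
proof -
  have p0: "0 < p i" for i using p[of i] by simp
  from assms(3) obtain as bs where "is": "is = as @ i # bs" by (meson split_list)
  then have bs: "i \<notin> set bs" using assms(2) by auto
  obtain C where C: "0 \<le> C" "tree_bound p bs (p i) C" using tree_bound_ex[of p "p i" bs, OF p p] by auto
  show ?thesis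
  proof (intro exI[of _ "(8 powr p i * (2 * C)) powr (1 / p i)"] conjI ballI allI)
    let ?K = "(8 powr p i * (2 * C)) powr (1 / p i)"
    fix F :: "real ^ 'n \<Rightarrow> ennreal" and x assume F[measurable]: "F \<in> borel_measurable borel"
    have "mnorm p is (coord_max i F) x = mnorm p as (mnorm p (i # bs) (coord_max i F)) x"
      by (simp only: "is" mnorm_append)
    also have "\<dots> \<le> mnorm p as (\<lambda>y. ennreal ?K * mnorm p (i # bs) F y) x"
      by (intro mnorm_mono p0 coord_max_bound_inner p F bs C)
    also have "\<dots> = ennreal ?K * mnorm p is F x"
      by (subst mnorm_cmult[OF _ p0]) (simp_all only: mnorm_measurable F "is" mnorm_append)
    finally show "mnorm p is (coord_max i F) x \<le> ennreal ?K * mnorm p is F x" .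
  qed simp
qed

theorem iter_max_bound:
  fixes p :: "'n::finite \<Rightarrow> real"
  assumes p: "\<And>i. 1 < p i" and "distinct is" "set js \<subseteq> set is"
  shows "\<exists>C\<ge>0. \<forall>F\<in>borel_measurable borel. \<forall>x. mnorm p is (iter_max js F) x \<le> ennreal C * mnorm p is F x"
  using assms(3)
proof (induction js)
  case Nil
  then show ?case by (intro exI[of _ 1]) auto
next
  case (Cons j js)
  then obtain C where C: "0 \<le> C"
    "\<And>F x. F \<in> borel_measurable borel \<Longrightarrow> mnorm p is (iter_max js F) x \<le> ennreal C * mnorm p is F x"
    by auto
  have "j \<in> set is" using Cons.prems by simp
  from coord_max_bound[of p "is" j, OF p assms(2) this] obtain K where K: "0 \<le> K"
    "\<And>F x. F \<in> borel_measurable borel \<Longrightarrow> mnorm p is (coord_max j F) x \<le> ennreal K * mnorm p is F x"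
    by auto
  show ?case
  proof (intro exI[of _ "K * C"] conjI ballI allI)
    fix F :: "real ^ 'n \<Rightarrow> ennreal" and x assume F[measurable]: "F \<in> borel_measurable borel"
    have "mnorm p is (iter_max (j # js) F) x \<le> ennreal K * mnorm p is (iter_max js F) x"
      using K(2)[of "iter_max js F"] by simp
    also have "\<dots> \<le> ennreal K * (ennreal C * mnorm p is F x)" by (intro mult_left_mono C) auto
    finally show "mnorm p is (iter_max (j # js) F) x \<le> ennreal (K * C) * mnorm p is F x"
      using K C by (simp add: ennreal_mult mult.assoc)
  qed (use K C in auto)
qed

section \<open>Smooth functions and mollification\<close>

lemma partial_derivs_append: "partial_derivs (as @ bs) f = partial_derivs as (partial_derivs bs f)"
  by (induction as) auto

lemma smooth_partial_derivs: "smooth f \<Longrightarrow> smooth (partial_derivs is f)"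
  unfolding smooth_def by (simp flip: partial_derivs_append)

lemma smooth_partial_deriv: "smooth f \<Longrightarrow> smooth (partial_deriv i f)"
  using smooth_partial_derivs[of f "[i]"] by simp

lemma smooth_differentiable: "smooth f \<Longrightarrow> f differentiable (at x)"
  unfolding smooth_def by (metis partial_derivs.simps(1))

lemma smooth_continuous_on: "smooth f \<Longrightarrow> continuous_on S f"
  by (meson differentiable_imp_continuous_on differentiable_on_def differentiable_at_withinI smooth_differentiable)

lemma smooth_coinduct:
  assumes "f \<in> A"
    and "\<And>g x. g \<in> A \<Longrightarrow> g differentiable (at x)"
    and "\<And>g i. g \<in> A \<Longrightarrow> partial_deriv i g \<in> A"
  shows "smooth f"
proof -
  have "partial_derivs is f \<in> A" for "is" by (induction "is") (auto intro: assms)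
  then show ?thesis by (auto simp: smooth_def intro: assms)
qed

lemma partial_deriv_eqI: "(f has_derivative f') (at x) \<Longrightarrow> partial_deriv i f x = f' (axis i 1)"
  unfolding partial_deriv_def using frechet_derivative_at by metis

lemma differentiable_has_derivative:
  assumes "f differentiable (at x)"
  shows "(f has_derivative (\<lambda>h. \<Sum>i\<in>UNIV. h $ i * partial_deriv i f x)) (at x)"
proof -
  let ?D = "frechet_derivative f (at x)"
  have D: "(f has_derivative ?D) (at x)" using assms frechet_derivative_works by blast
  then have lin: "linear ?D" by (rule has_derivative_linear)
  have "?D h = (\<Sum>i\<in>UNIV. h $ i * partial_deriv i f x)" for h
  proof -
    have "h = (\<Sum>i\<in>UNIV. h $ i *\<^sub>R axis i 1)"
      by (simp add: vec_eq_iff axis_def if_distrib[where f="\<lambda>x. _ * x"] cong: if_cong)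
    then have "?D h = ?D (\<Sum>i\<in>UNIV. h $ i *\<^sub>R axis i 1)" by simp
    also have "\<dots> = (\<Sum>i\<in>UNIV. h $ i * partial_deriv i f x)"
      by (simp add: linear_sum[OF lin] linear_scale[OF lin] partial_deriv_def)
    finally show ?thesis .
  qed
  then have "?D = (\<lambda>h. \<Sum>i\<in>UNIV. h $ i * partial_deriv i f x)" by blast
  then show ?thesis using D by simp
qed

lemmas smooth_has_derivative = differentiable_has_derivative[OF smooth_differentiable]

lemma partial_deriv_add:
  assumes "f differentiable (at x)" "g differentiable (at x)"
  shows "partial_deriv i (\<lambda>x. f x + g x) x = partial_deriv i f x + partial_deriv i g x"
  using partial_deriv_eqI[OF has_derivative_add[OF assms[THEN differentiable_has_derivative]], of i]
  by (simp add: axis_def if_distrib[where f="\<lambda>x. x * _"] cong: if_cong)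

lemma partial_deriv_mult:
  assumes "f differentiable (at x)" "g differentiable (at x)"
  shows "partial_deriv i (\<lambda>x. f x * g x) x = partial_deriv i f x * g x + f x * partial_deriv i g x"
  using partial_deriv_eqI[OF has_derivative_mult[OF assms[THEN differentiable_has_derivative]], of i]
  by (simp add: axis_def if_distrib[where f="\<lambda>x. x * _"] cong: if_cong)

lemma partial_deriv_compose:
  assumes "f differentiable (at x)" "(h has_real_derivative h') (at (f x))"
  shows "partial_deriv i (\<lambda>x. h (f x)) x = h' * partial_deriv i f x"
    and "(\<lambda>x. h (f x)) differentiable (at x)"
proof -
  have "((\<lambda>x. h (f x)) has_derivative (\<lambda>k. h' * (\<Sum>i\<in>UNIV. k $ i * partial_deriv i f x))) (at x)"
    using has_derivative_compose[OF differentiable_has_derivative[OF assms(1)], of h "(*) h'"] assms(2)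
    by (simp add: has_field_derivative_def)
  from partial_deriv_eqI[OF this, of i] this
  show "partial_deriv i (\<lambda>x. h (f x)) x = h' * partial_deriv i f x" "(\<lambda>x. h (f x)) differentiable (at x)"
    by (auto simp: differentiable_def axis_def if_distrib[where f="\<lambda>x. x * _"] cong: if_cong)
qed

lemma partial_deriv_const: "partial_deriv i (\<lambda>_. c) = (\<lambda>_. 0)"
  by (rule ext) (simp add: partial_deriv_eqI[OF has_derivative_const])

lemma smooth_const: "smooth (\<lambda>_. c)"
  by (rule smooth_coinduct[where A="range (\<lambda>c _. c)"]) (auto simp: partial_deriv_const differentiable_def intro: has_derivative_const)

lemma has_derivative_vec_nth: "((\<lambda>x. x $ j) has_derivative (\<lambda>h. h $ j)) (at x)"
  by (rule bounded_linear_imp_has_derivative) (rule bounded_linear_vec_nth)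

lemma partial_deriv_nth: "partial_deriv i (\<lambda>x. x $ j) = (\<lambda>_. if i = j then 1 else 0)"
  by (rule ext, subst partial_deriv_eqI[OF has_derivative_vec_nth]) (auto simp: axis_def)

lemma smooth_nth: "smooth (\<lambda>x. x $ j)"
  by (rule smooth_coinduct[where A="insert (\<lambda>x. x $ j) (range (\<lambda>c _. c))"])
     (auto simp: partial_deriv_const partial_deriv_nth differentiable_def intro: has_derivative_vec_nth has_derivative_const)

text \<open>The functions \<open>s\<^sup>-\<^sup>k e\<^sup>-\<^sup>1\<^sup>/\<^sup>s\<close> on the positive half line are closed under differentiation up to linear combinations.\<close>

definition flat :: "nat \<Rightarrow> real \<Rightarrow> real" where
  "flat k s = (if s > 0 then exp (- 1 / s) / s ^ k else 0)"

lemma flat_tendsto_0: "(flat k \<longlongrightarrow> 0) (at 0)"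
proof -
  have "((\<lambda>s. inverse s ^ k / exp (inverse s)) \<longlongrightarrow> (0::real)) (at_right 0)"
    using filterlim_compose[OF tendsto_power_div_exp_0 filterlim_inverse_at_top_right] .
  moreover have "\<forall>\<^sub>F s in at_right 0. inverse s ^ k / exp (inverse s) = flat k (s::real)"
    by (rule eventually_at_rightI[of 0 1]) (auto simp: flat_def exp_minus field_simps)
  ultimately have "(flat k \<longlongrightarrow> 0) (at_right 0)" using tendsto_cong by fastforce
  moreover have "(flat k \<longlongrightarrow> 0) (at_left 0)"
    by (rule tendsto_eventually) (auto simp: flat_def eventually_at_filter)
  ultimately show ?thesis by (simp add: filterlim_split_at)
qed

lemma flat_has_derivative:
  "(flat k has_real_derivative (- real k * flat (k + 1) s + flat (k + 2) s)) (at s)"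
proof -
  consider "s > 0" | "s < 0" | "s = 0" by linarith
  then show ?thesis
  proof cases
    case 1
    have "((\<lambda>s. exp (- 1 / s) / s ^ k) has_real_derivative
      (exp (- 1 / s) * (1 / s\<^sup>2) * s ^ k - exp (- 1 / s) * (real k * s ^ (k - 1))) / (s ^ k * s ^ k)) (at s)"
      using 1 by (auto intro!: derivative_eq_intros simp: power2_eq_square)
    also have "(exp (- 1 / s) * (1 / s\<^sup>2) * s ^ k - exp (- 1 / s) * (real k * s ^ (k - 1))) / (s ^ k * s ^ k) =
      - real k * flat (k + 1) s + flat (k + 2) s"
      using 1 by (cases k) (auto simp: flat_def field_simps power2_eq_square)
    finally show ?thesis
      by (rule DERIV_cong_ev[THEN iffD1, rotated -1])
         (use 1 in \<open>auto simp: flat_def intro!: eventually_mono[OF eventually_nhds_in_open[of "{0<..}"]]\<close>)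
  next
    case 2
    have "((\<lambda>s. 0) has_real_derivative 0) (at s)" by simp
    then have "(flat k has_real_derivative 0) (at s)"
      by (rule DERIV_cong_ev[THEN iffD1, rotated -1])
         (use 2 in \<open>auto simp: flat_def intro!: eventually_mono[OF eventually_nhds_in_open[of "{..<0}"]]\<close>)
    then show ?thesis using 2 by (simp add: flat_def)
  next
    case 3
    \<comment> \<open>At the origin the difference quotient of \<open>flat k\<close> is
      \<open>flat (k + 1)\<close>, which tends to zero.\<close>
    have "(\<lambda>h. (flat k (0 + h) - flat k 0) / h) = flat (k + 1)"
      by (auto simp: flat_def fun_eq_iff field_simps)
    then have "(flat k has_real_derivative 0) (at 0)"
      unfolding DERIV_def using flat_tendsto_0[of "k + 1"] by simp
    then show ?thesis using 3 by (simp add: flat_def)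
  qed
qed

lemma flat_nonneg: "0 \<le> flat k s" by (simp add: flat_def)

lemma flat_eq_0: "s \<le> 0 \<Longrightarrow> flat k s = 0" by (simp add: flat_def)

text \<open>Closed under partial derivatives, since the derivative of \<open>flat k\<close> is a
  combination of \<open>flat (k + 1)\<close> and \<open>flat (k + 2)\<close>; hence all members are
  smooth. The same closure yields sums and products of smooth functions.\<close>

inductive_set smooth_alg :: "(real ^ 'n \<Rightarrow> real) \<Rightarrow> (real ^ 'n::finite \<Rightarrow> real) set" for f where
  base: "smooth h \<Longrightarrow> h \<in> smooth_alg f"
| flat: "(\<lambda>x. flat k (f x)) \<in> smooth_alg f"
| add: "g \<in> smooth_alg f \<Longrightarrow> h \<in> smooth_alg f \<Longrightarrow> (\<lambda>x. g x + h x) \<in> smooth_alg f"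
| mult: "g \<in> smooth_alg f \<Longrightarrow> h \<in> smooth_alg f \<Longrightarrow> (\<lambda>x. g x * h x) \<in> smooth_alg f"

lemma smooth_alg_differentiable:
  assumes f: "smooth f" and "g \<in> smooth_alg f"
  shows "g differentiable (at x)"
  using assms(2)
proof (induction)
  case (flat k)
  show ?case by (rule partial_deriv_compose(2)[OF smooth_differentiable[OF f] flat_has_derivative])
qed (auto intro: smooth_differentiable differentiable_add differentiable_mult)

lemma smooth_alg_partial_deriv:
  assumes f: "smooth f" and "g \<in> smooth_alg f"
  shows "partial_deriv i g \<in> smooth_alg f"
  using assms(2)
proof (induction)
  case (flat k)
  have eq: "partial_deriv i (\<lambda>x. flat k (f x)) =
    (\<lambda>x. ((- real k) * flat (k + 1) (f x) + flat (k + 2) (f x)) * partial_deriv i f x)"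
    by (rule ext) (rule partial_deriv_compose(1)[OF smooth_differentiable[OF f] flat_has_derivative])
  have A: "(\<lambda>x. (- real k) * flat (k + 1) (f x) + flat (k + 2) (f x)) \<in> smooth_alg f"
    by (rule smooth_alg.add[OF smooth_alg.mult[OF smooth_alg.base[OF smooth_const] smooth_alg.flat] smooth_alg.flat])
  show ?case unfolding eq
    by (rule smooth_alg.mult[OF A smooth_alg.base[OF smooth_partial_deriv[OF f]]])
next
  case (add g h)
  have "partial_deriv i (\<lambda>x. g x + h x) = (\<lambda>x. partial_deriv i g x + partial_deriv i h x)"
    by (rule ext) (intro partial_deriv_add smooth_alg_differentiable[OF f] add)
  then show ?case using add by (auto intro: smooth_alg.add)
next
  case (mult g h)
  have "partial_deriv i (\<lambda>x. g x * h x) = (\<lambda>x. partial_deriv i g x * h x + g x * partial_deriv i h x)"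
    by (rule ext) (intro partial_deriv_mult smooth_alg_differentiable[OF f] mult)
  then show ?case using mult by (auto intro!: smooth_alg.add smooth_alg.mult)
qed (auto intro: smooth_alg.base smooth_partial_deriv)

lemma smooth_alg_smooth: "smooth f \<Longrightarrow> g \<in> smooth_alg f \<Longrightarrow> smooth g"
  by (rule smooth_coinduct[where A="smooth_alg f"]) (auto intro: smooth_alg_differentiable smooth_alg_partial_deriv)

lemma smooth_add: "smooth f \<Longrightarrow> smooth g \<Longrightarrow> smooth (\<lambda>x. f x + g x)"
  by (rule smooth_alg_smooth[of f]) (auto intro: smooth_alg.intros)

lemma smooth_mult: "smooth f \<Longrightarrow> smooth g \<Longrightarrow> smooth (\<lambda>x. f x * g x)"
  by (rule smooth_alg_smooth[of f]) (auto intro: smooth_alg.intros)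

lemma smooth_flat: "smooth f \<Longrightarrow> smooth (\<lambda>x. flat k (f x))"
  by (rule smooth_alg_smooth[of f]) (auto intro: smooth_alg.intros)

lemma smooth_sum: "finite A \<Longrightarrow> (\<And>a. a \<in> A \<Longrightarrow> smooth (f a)) \<Longrightarrow> smooth (\<lambda>x. \<Sum>a\<in>A. f a x)"
  by (induction A rule: finite_induct) (auto intro: smooth_add smooth_const)

lemma smooth_cmult: "smooth f \<Longrightarrow> smooth (\<lambda>x. c * f x)"
  by (intro smooth_mult smooth_const)

lemma partial_deriv_cmult:
  "f differentiable (at x) \<Longrightarrow> partial_deriv i (\<lambda>x. c * f x) x = c * partial_deriv i f x"
  by (subst partial_deriv_mult) (auto simp: partial_deriv_const)

lemma partial_deriv_sum:
  assumes "finite A" "\<And>a. a \<in> A \<Longrightarrow> smooth (f a)"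
  shows "partial_deriv i (\<lambda>x. \<Sum>a\<in>A. f a x) x = (\<Sum>a\<in>A. partial_deriv i (f a) x)"
  using assms
proof (induction A rule: finite_induct)
  case (insert a A)
  then show ?case
    by (simp, subst partial_deriv_add) (auto intro!: smooth_differentiable smooth_sum)
qed (simp add: partial_deriv_const)

lemma partial_deriv_affine:
  assumes "f differentiable (at (b + c *\<^sub>R x))"
  shows "partial_deriv i (\<lambda>x. f (b + c *\<^sub>R x)) x = c * partial_deriv i f (b + c *\<^sub>R x)"
    "(\<lambda>x. f (b + c *\<^sub>R x)) differentiable (at x)"
proof -
  have "((\<lambda>x. b + c *\<^sub>R x) has_derivative (\<lambda>h. c *\<^sub>R h)) (at x)"
    by (auto intro!: derivative_eq_intros)
  from has_derivative_compose[OF this differentiable_has_derivative[OF assms]]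
  have "((\<lambda>x. f (b + c *\<^sub>R x)) has_derivative (\<lambda>h. \<Sum>i\<in>UNIV. (c *\<^sub>R h) $ i * partial_deriv i f (b + c *\<^sub>R x))) (at x)" .
  from partial_deriv_eqI[OF this, of i] this
  show "partial_deriv i (\<lambda>x. f (b + c *\<^sub>R x)) x = c * partial_deriv i f (b + c *\<^sub>R x)"
    "(\<lambda>x. f (b + c *\<^sub>R x)) differentiable (at x)"
    by (auto simp: differentiable_def axis_def if_distrib[where f="\<lambda>x. _ * x"] if_distrib[where f="\<lambda>x. x * _"] cong: if_cong)
qed

lemma partial_derivs_affine:
  assumes f: "smooth f"
  shows "partial_derivs is (\<lambda>x. f (b + c *\<^sub>R x)) = (\<lambda>x. c ^ length is * partial_derivs is f (b + c *\<^sub>R x))"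
proof (induction "is")
  case (Cons i "is")
  have d: "partial_derivs is f differentiable (at y)" for y
    using f by (simp add: smooth_def)
  show ?case
    by (rule ext) (simp add: Cons.IH partial_deriv_cmult[OF partial_deriv_affine(2)[OF d]] partial_deriv_affine(1)[OF d])
qed simp

lemma smooth_affine:
  assumes f: "smooth f" shows "smooth (\<lambda>x. f (b + c *\<^sub>R x))"
  unfolding smooth_def partial_derivs_affine[OF f]
proof (intro allI)
  fix "is" x
  have "partial_derivs is f differentiable (at (b + c *\<^sub>R x))" using f by (simp add: smooth_def)
  from partial_deriv_affine(2)[OF this]
  show "(\<lambda>x. c ^ length is * partial_derivs is f (b + c *\<^sub>R x)) differentiable (at x)"
    by (intro differentiable_mult) auto
qed

lemma partial_derivs_cong_open:
  assumes "open U" "\<And>x. x \<in> U \<Longrightarrow> f x = g x" "smooth f"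
  shows "x \<in> U \<Longrightarrow> partial_derivs is f x = partial_derivs is g x"
proof (induction "is" arbitrary: x)
  case (Cons i "is")
  have "partial_derivs is f differentiable (at x)" using assms(3) by (simp add: smooth_def)
  from frechet_derivative_transform_within_open[OF this assms(1) Cons.prems]
  show ?case by (simp add: partial_deriv_def Cons.IH)
qed (use assms in auto)

text \<open>Second differences, evaluated by the mean value theorem in either order.\<close>

lemma partial_deriv_commute:
  assumes f: "smooth f"
  shows "partial_deriv i (partial_deriv j f) x = partial_deriv j (partial_deriv i f) x"
proof -
  have line: "((\<lambda>s. g (a + s *\<^sub>R axis k 1)) has_real_derivative partial_deriv k g (a + s *\<^sub>R axis k 1)) (at s)"
    if g: "smooth g" for g :: "real ^ 'a \<Rightarrow> real" and a k s
  proof -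
    have "((\<lambda>s. a + s *\<^sub>R axis k 1) has_derivative (\<lambda>h. h *\<^sub>R axis k 1)) (at s)"
      by (auto intro!: derivative_eq_intros)
    from has_derivative_compose[OF this smooth_has_derivative[OF g]]
    show ?thesis
      by (auto simp: has_field_derivative_def axis_def if_distrib[where f="\<lambda>x. _ * x"] if_distrib[where f="\<lambda>x. x * _"] fun_eq_iff mult.commute
          cong: if_cong elim!: has_derivative_eq_rhs)
  qed
  have sd: "\<exists>s t. 0 < s \<and> s < r \<and> 0 < t \<and> t < r \<and>
      f (x + r *\<^sub>R axis i 1 + r *\<^sub>R axis j 1) - f (x + r *\<^sub>R axis i 1) - f (x + r *\<^sub>R axis j 1) + f x =
      r * (r * partial_deriv i (partial_deriv j f) (x + s *\<^sub>R axis i 1 + t *\<^sub>R axis j 1))"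
    if r: "0 < r" for i j r
  proof -
    let ?g = "\<lambda>t. f (x + r *\<^sub>R axis i 1 + t *\<^sub>R axis j 1) - f (x + t *\<^sub>R axis j 1)"
    have "(?g has_real_derivative (partial_deriv j f (x + r *\<^sub>R axis i 1 + t *\<^sub>R axis j 1) - partial_deriv j f (x + t *\<^sub>R axis j 1))) (at t)" for t
      by (intro DERIV_diff line f)
    from MVT2[OF r this] obtain t where t: "0 < t" "t < r"
      "?g r - ?g 0 = (r - 0) * (partial_deriv j f (x + r *\<^sub>R axis i 1 + t *\<^sub>R axis j 1) - partial_deriv j f (x + t *\<^sub>R axis j 1))"
      by blast
    have "((\<lambda>s. partial_deriv j f ((x + t *\<^sub>R axis j 1) + s *\<^sub>R axis i 1)) has_real_derivative
      partial_deriv i (partial_deriv j f) ((x + t *\<^sub>R axis j 1) + s *\<^sub>R axis i 1)) (at s)" for s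
      by (intro line smooth_partial_deriv f)
    from MVT2[OF r this] obtain s where s: "0 < s" "s < r"
      "partial_deriv j f ((x + t *\<^sub>R axis j 1) + r *\<^sub>R axis i 1) - partial_deriv j f ((x + t *\<^sub>R axis j 1) + 0 *\<^sub>R axis i 1) =
        (r - 0) * partial_deriv i (partial_deriv j f) ((x + t *\<^sub>R axis j 1) + s *\<^sub>R axis i 1)" by blast
    show ?thesis using s t
      by (intro exI[of _ s] exI[of _ t]) (simp add: algebra_simps)
  qed
  have lim: "\<exists>r>0. \<forall>s t. 0 < s \<and> s < r \<and> 0 < t \<and> t < r \<longrightarrow>
      \<bar>partial_deriv i (partial_deriv j f) (x + s *\<^sub>R axis i 1 + t *\<^sub>R axis j 1) - partial_deriv i (partial_deriv j f) x\<bar> < e"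
    if e: "0 < e" for i j e
  proof -
    have "isCont (partial_deriv i (partial_deriv j f)) x"
      using smooth_continuous_on[OF smooth_partial_deriv[OF smooth_partial_deriv[OF f]], of UNIV i j]
      by (simp add: continuous_on_eq_continuous_at)
    then obtain d where d: "0 < d" "\<And>y. dist y x < d \<Longrightarrow> dist (partial_deriv i (partial_deriv j f) y) (partial_deriv i (partial_deriv j f) x) < e"
      using e unfolding continuous_at_eps_delta by (auto simp: dist_norm)
    show ?thesis
    proof (intro exI[of _ "d / 2"] conjI allI impI)
      fix s t assume st: "0 < s \<and> s < d / 2 \<and> 0 < t \<and> t < d / 2"
      have "dist (x + s *\<^sub>R axis i 1 + t *\<^sub>R axis j 1) x = norm (s *\<^sub>R axis i 1 + t *\<^sub>R axis j (1::real))"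
        by (simp add: dist_norm add.assoc)
      also have "\<dots> \<le> norm (s *\<^sub>R axis i (1::real)) + norm (t *\<^sub>R axis j (1::real))" by (rule norm_triangle_ineq)
      also have "\<dots> < d" using st by (simp add: norm_axis_1)
      finally show "\<bar>partial_deriv i (partial_deriv j f) (x + s *\<^sub>R axis i 1 + t *\<^sub>R axis j 1) - partial_deriv i (partial_deriv j f) x\<bar> < e"
        using d(2) by (simp add: dist_real_def)
    qed (use d in simp)
  qed
  show ?thesis
  proof (rule ccontr)
    let ?A = "partial_deriv i (partial_deriv j f)" and ?B = "partial_deriv j (partial_deriv i f)"
    assume ne: "?A x \<noteq> ?B x"
    define e where "e = \<bar>?A x - ?B x\<bar> / 2"
    have e: "0 < e" using ne by (simp add: e_def)
    obtain r1 where r1: "0 < r1" "\<And>s t. 0 < s \<and> s < r1 \<and> 0 < t \<and> t < r1 \<Longrightarrow> \<bar>?A (x + s *\<^sub>R axis i 1 + t *\<^sub>R axis j 1) - ?A x\<bar> < e"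
      using lim[OF e, of i j] by blast
    obtain r2 where r2: "0 < r2" "\<And>s t. 0 < s \<and> s < r2 \<and> 0 < t \<and> t < r2 \<Longrightarrow> \<bar>?B (x + s *\<^sub>R axis j 1 + t *\<^sub>R axis i 1) - ?B x\<bar> < e"
      using lim[OF e, of j i] by blast
    define r where "r = min r1 r2"
    have r: "0 < r" using r1 r2 by (simp add: r_def)
    from sd[OF r, of i j] obtain s t where st: "0 < s" "s < r" "0 < t" "t < r"
      "f (x + r *\<^sub>R axis i 1 + r *\<^sub>R axis j 1) - f (x + r *\<^sub>R axis i 1) - f (x + r *\<^sub>R axis j 1) + f x =
      r * (r * ?A (x + s *\<^sub>R axis i 1 + t *\<^sub>R axis j 1))" by blast
    from sd[OF r, of j i] obtain s' t' where st': "0 < s'" "s' < r" "0 < t'" "t' < r"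
      "f (x + r *\<^sub>R axis j 1 + r *\<^sub>R axis i 1) - f (x + r *\<^sub>R axis j 1) - f (x + r *\<^sub>R axis i 1) + f x =
      r * (r * ?B (x + s' *\<^sub>R axis j 1 + t' *\<^sub>R axis i 1))" by blast
    have "x + r *\<^sub>R axis j 1 + r *\<^sub>R axis i 1 = x + r *\<^sub>R axis i 1 + r *\<^sub>R axis j 1" by (simp add: add_ac)
    then have "f (x + r *\<^sub>R axis j 1 + r *\<^sub>R axis i 1) = f (x + r *\<^sub>R axis i 1 + r *\<^sub>R axis j 1)" by (rule arg_cong)
    then have "r * (r * ?A (x + s *\<^sub>R axis i 1 + t *\<^sub>R axis j 1)) = r * (r * ?B (x + s' *\<^sub>R axis j 1 + t' *\<^sub>R axis i 1))"
      using st(5) st'(5) by linarith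
    then have "?A (x + s *\<^sub>R axis i 1 + t *\<^sub>R axis j 1) = ?B (x + s' *\<^sub>R axis j 1 + t' *\<^sub>R axis i 1)"
      using r by simp
    moreover have "\<bar>?A (x + s *\<^sub>R axis i 1 + t *\<^sub>R axis j 1) - ?A x\<bar> < e"
      by (rule r1(2)) (use st in \<open>auto simp: r_def\<close>)
    moreover have "\<bar>?B (x + s' *\<^sub>R axis j 1 + t' *\<^sub>R axis i 1) - ?B x\<bar> < e"
      by (rule r2(2)) (use st' in \<open>auto simp: r_def\<close>)
    moreover have False if "a = b" "\<bar>a - A\<bar> < e" "\<bar>b - B\<bar> < e" "e = \<bar>A - B\<bar> / 2" for a b A B :: real
      using that by (auto simp: abs_if split: if_splits)
    ultimately show False using e_def by blast
  qed
qed

lemma smooth_Taylor2: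
  assumes f: "smooth f"
  obtains s where "0 \<le> s" "s \<le> 1"
    "f (a + h) = f a + (\<Sum>i\<in>UNIV. h $ i * partial_deriv i f a) +
      (\<Sum>i\<in>UNIV. \<Sum>j\<in>UNIV. h $ i * h $ j * partial_deriv j (partial_deriv i f) (a + s *\<^sub>R h)) / 2"
proof -
  have line: "((\<lambda>s. g (a + s *\<^sub>R h)) has_real_derivative (\<Sum>i\<in>UNIV. h $ i * partial_deriv i g (a + s *\<^sub>R h))) (at s)"
    if g: "smooth g" for g s
  proof -
    have "((\<lambda>s. a + s *\<^sub>R h) has_derivative (\<lambda>k. k *\<^sub>R h)) (at s)"
      by (auto intro!: derivative_eq_intros)
    from has_derivative_compose[OF this smooth_has_derivative[OF g]]
    show ?thesis
      by (auto simp: has_field_derivative_def sum_distrib_left sum_distrib_right fun_eq_iff ac_simps elim!: has_derivative_eq_rhs)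
  qed
  define diff where "diff m s = (if m = 0 then f (a + s *\<^sub>R h) else if m = 1 then (\<Sum>i\<in>UNIV. h $ i * partial_deriv i f (a + s *\<^sub>R h))
     else (\<Sum>i\<in>UNIV. h $ i * (\<Sum>j\<in>UNIV. h $ j * partial_deriv j (partial_deriv i f) (a + s *\<^sub>R h))))" for m :: nat and s
  have "\<forall>m t. m < 2 \<and> 0 \<le> t \<and> t \<le> 1 \<longrightarrow> DERIV (diff m) t :> diff (Suc m) t"
  proof (intro allI impI)
    fix m :: nat and t :: real assume "m < 2 \<and> 0 \<le> t \<and> t \<le> 1"
    then consider "m = 0" | "m = 1" by linarith
    then show "DERIV (diff m) t :> diff (Suc m) t"
    proof cases
      case 1
      then show ?thesis unfolding diff_def by (simp add: line[OF f])
    next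
      case 2
      then show ?thesis unfolding diff_def
        by simp (intro DERIV_sum DERIV_cmult line smooth_partial_deriv f)
    qed
  qed
  from Maclaurin[of 1 2 diff "diff 0", OF _ _ refl this] obtain s where "0 < s" "s < 1"
    "diff 0 1 = (\<Sum>m<2. diff m 0 / fact m * 1 ^ m) + diff 2 s / fact 2 * 1 ^ 2" by auto
  then show ?thesis
    by (intro that[of s]) (auto simp: diff_def numeral_2_eq_2 sum_distrib_left mult.assoc)
qed

lemma smooth_measurable [measurable_dest]: "smooth f \<Longrightarrow> f \<in> borel_measurable borel"
  by (intro borel_measurable_continuous_onI smooth_continuous_on)

section \<open>Differentiation under the integral\<close>

lemma integral_norm_le:
  fixes f :: "'a \<Rightarrow> real"
  assumes "integrable M f" "integrable M g" "\<And>x. x \<in> space M \<Longrightarrow> norm (f x) \<le> g x"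
  shows "norm (\<integral>x. f x \<partial>M) \<le> (\<integral>x. g x \<partial>M)"
  by (rule order_trans[OF integral_norm_bound integral_mono]) (use assms in auto)

lemma smooth_bounded_cball:
  assumes "smooth F" shows "\<exists>K\<ge>0. \<forall>x. norm x \<le> R \<longrightarrow> \<bar>F x\<bar> \<le> K"
proof -
  have "compact (F ` cball 0 R)"
    by (intro compact_continuous_image smooth_continuous_on assms compact_cball)
  then have "bounded (F ` cball 0 R)" by (rule compact_imp_bounded)
  then obtain K where "\<forall>y\<in>F ` cball 0 R. norm y \<le> K" unfolding bounded_iff by blast
  then have "\<forall>x. norm x \<le> R \<longrightarrow> \<bar>F x\<bar> \<le> max K 0" by (auto simp: le_max_iff_disj)
  then show ?thesis by (intro exI[of _ "max K 0"]) auto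
qed

text \<open>Two instances are in view: convolutions, with \<open>Y\<close> the identity and
  \<open>F\<close> a test function, and superpositions of bounded translates of a smooth
  \<open>F\<close>, with \<open>c\<close> integrable. A single integrable \<open>b\<close> dominates
  all derivatives, up to factors depending on the multi-index.\<close>

context
  fixes M :: "'b measure" and c :: "'b \<Rightarrow> real" and Y :: "'b \<Rightarrow> real ^ 'n::finite" and F :: "real ^ 'n \<Rightarrow> real"
  assumes c_meas[measurable]: "c \<in> borel_measurable M" and Y_meas[measurable]: "Y \<in> borel_measurable M" and F: "smooth F"
    and dominated: "\<And>R. \<exists>b. integrable M b \<and> (\<forall>is. \<exists>K. \<forall>x w. norm x \<le> R \<longrightarrow> w \<in> space M \<longrightarrow>
      \<bar>c w * partial_derivs is F (x - Y w)\<bar> \<le> K * b w)"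
begin

lemma translation_integrable: "integrable M (\<lambda>w. c w * partial_derivs is F (x - Y w))"
proof -
  have [measurable]: "partial_derivs is F \<in> borel_measurable borel"
    by (intro smooth_measurable smooth_partial_derivs F)
  from dominated[of "norm x"] obtain b K where b: "integrable M b"
    "\<And>w. w \<in> space M \<Longrightarrow> \<bar>c w * partial_derivs is F (x - Y w)\<bar> \<le> K * b w" by blast
  show ?thesis
  proof (rule Bochner_Integration.integrable_bound)
    show "integrable M (\<lambda>w. K * b w)" using b(1) by simp
    show "AE w in M. norm (c w * partial_derivs is F (x - Y w)) \<le> norm (K * b w)"
      using b(2) by (auto intro!: AE_I2 order_trans[OF _ abs_ge_self])
  qed measurable
qed

text \<open>The second derivatives are dominated as well, so by \<open>smooth_Taylor2\<close> the
  remainder is at most a constant times the square of \<open>norm h\<close>; no limit has to be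
  taken under the integral.\<close>

lemma translation_integral_has_derivative:
  "((\<lambda>x. \<integral>w. c w * partial_derivs is F (x - Y w) \<partial>M) has_derivative
    (\<lambda>h. \<Sum>i\<in>UNIV. h $ i * (\<integral>w. c w * partial_derivs (i # is) F (x - Y w) \<partial>M))) (at x)"
proof -
  let ?G = "partial_derivs is F"
  let ?I = "\<lambda>is x. \<integral>w. c w * partial_derivs is F (x - Y w) \<partial>M"
  have G: "smooth ?G" by (rule smooth_partial_derivs[OF F])
  \<comment> \<open>The radius \<open>norm x + 1\<close> leaves room for the intermediate points of
    Taylor's formula when \<open>dist y x < 1\<close>.\<close>
  from dominated[of "norm x + 1"] obtain b where b1: "integrable M b"
    and "\<forall>is. \<exists>K. \<forall>x' w. norm x' \<le> norm x + 1 \<longrightarrow> w \<in> space M \<longrightarrow> \<bar>c w * partial_derivs is F (x' - Y w)\<bar> \<le> K * b w"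
    by blast
  from choice[OF this(2)] obtain K0 where "\<forall>is. \<forall>x' w. norm x' \<le> norm x + 1 \<longrightarrow> w \<in> space M \<longrightarrow>
      \<bar>c w * partial_derivs is F (x' - Y w)\<bar> \<le> K0 is * b w" by blast
  then have b: "integrable M b"
    "\<And>is x' w. norm x' \<le> norm x + 1 \<Longrightarrow> w \<in> space M \<Longrightarrow> \<bar>c w * partial_derivs is F (x' - Y w)\<bar> \<le> K0 is * b w"
    using b1 by blast+
  define K where "K = (\<Sum>i\<in>UNIV. \<Sum>j\<in>UNIV. K0 (j # i # is)) / 2"
  have bd: "norm (?I is y - ?I is x - (\<Sum>i\<in>UNIV. (y - x) $ i * ?I (i # is) x)) / norm (y - x) \<le>
      norm (y - x) * (\<integral>w. K * b w \<partial>M)" if y: "y \<noteq> x" "dist y x < 1" for y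
  proof -
    define h where "h = y - x"
    have h: "y = x + h" "norm h < 1" "0 < norm h" using y by (auto simp: h_def dist_norm)
    have "?I is y - ?I is x - (\<Sum>i\<in>UNIV. h $ i * ?I (i # is) x) =
      (\<integral>w. c w * ?G (y - Y w) - c w * ?G (x - Y w) - (\<Sum>i\<in>UNIV. h $ i * (c w * partial_derivs (i # is) F (x - Y w))) \<partial>M)"
      using translation_integrable[of "is" y] translation_integrable[of "is" x] translation_integrable[of "_ # is" x]
      by (subst Bochner_Integration.integral_diff, simp, simp, subst Bochner_Integration.integral_diff, simp, simp,
          subst Bochner_Integration.integral_sum) auto
    also have "norm \<dots> \<le> (\<integral>w. (norm h)\<^sup>2 * (K * b w) \<partial>M)"
    proof (rule integral_norm_le)
      show "integrable M (\<lambda>w. c w * ?G (y - Y w) - c w * ?G (x - Y w) - (\<Sum>i\<in>UNIV. h $ i * (c w * partial_derivs (i # is) F (x - Y w))))"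
        using translation_integrable[of "is" y] translation_integrable[of "is" x] translation_integrable[of "_ # is" x] by auto
      show "integrable M (\<lambda>w. (norm h)\<^sup>2 * (K * b w))" using b(1) by simp
      fix w assume w: "w \<in> space M"
      obtain s where s: "0 \<le> s" "s \<le> 1" and T: "?G ((x - Y w) + h) = ?G (x - Y w) + (\<Sum>i\<in>UNIV. h $ i * partial_deriv i ?G (x - Y w)) +
        (\<Sum>i\<in>UNIV. \<Sum>j\<in>UNIV. h $ i * h $ j * partial_deriv j (partial_deriv i ?G) ((x - Y w) + s *\<^sub>R h)) / 2"
        by (rule smooth_Taylor2[OF G])
      have ns: "norm (x + s *\<^sub>R h) \<le> norm x + 1"
      proof -
        have "norm (x + s *\<^sub>R h) \<le> norm x + s * norm h" using norm_triangle_ineq[of x "s *\<^sub>R h"] s by simp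
        also have "s * norm h \<le> 1 * 1" using s h by (intro mult_mono) auto
        finally show ?thesis by simp
      qed
      have "c w * ?G (y - Y w) - c w * ?G (x - Y w) - (\<Sum>i\<in>UNIV. h $ i * (c w * partial_derivs (i # is) F (x - Y w))) =
        c w * (?G ((x - Y w) + h) - ?G (x - Y w) - (\<Sum>i\<in>UNIV. h $ i * partial_deriv i ?G (x - Y w)))"
        by (simp add: h(1) algebra_simps sum_distrib_left)
      also have "\<dots> = (\<Sum>i\<in>UNIV. \<Sum>j\<in>UNIV. (h $ i * h $ j) * (c w * partial_derivs (j # i # is) F ((x + s *\<^sub>R h) - Y w))) / 2"
        unfolding T by (simp add: sum_distrib_left algebra_simps)
      also have "norm \<dots> \<le> (\<Sum>i\<in>UNIV. \<Sum>j\<in>UNIV. (norm h)\<^sup>2 * (K0 (j # i # is) * b w)) / 2"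
      proof -
        have "norm ((h $ i * h $ j) * (c w * partial_derivs (j # i # is) F ((x + s *\<^sub>R h) - Y w))) \<le> (norm h)\<^sup>2 * (K0 (j # i # is) * b w)" for i j
        proof -
          have "\<bar>h $ i\<bar> * \<bar>h $ j\<bar> \<le> norm h * norm h" by (intro mult_mono component_le_norm_cart) auto
          then have hh: "\<bar>h $ i * h $ j\<bar> \<le> (norm h)\<^sup>2" by (simp add: abs_mult power2_eq_square)
          show ?thesis unfolding real_norm_def abs_mult[of "h $ i * h $ j"]
            by (rule mult_mono[OF hh b(2)[OF ns w]]) auto
        qed
        then show ?thesis by (simp, intro order_trans[OF sum_abs] sum_mono) auto
      qed
      also have "\<dots> = (norm h)\<^sup>2 * (K * b w)"
        by (simp add: K_def sum_distrib_left sum_distrib_right mult.assoc)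
      finally show "norm (c w * ?G (y - Y w) - c w * ?G (x - Y w) - (\<Sum>i\<in>UNIV. h $ i * (c w * partial_derivs (i # is) F (x - Y w))))
        \<le> (norm h)\<^sup>2 * (K * b w)" .
    qed
    also have "\<dots> = (norm h)\<^sup>2 * (\<integral>w. K * b w \<partial>M)" by simp
    finally show ?thesis using h(3) by (simp add: h_def[symmetric] divide_le_eq power2_eq_square ac_simps)
  qed
  show ?thesis
  proof (rule has_derivativeI_sandwich[of 1])
    show "bounded_linear (\<lambda>h. \<Sum>i\<in>UNIV. h $ i * ?I (i # is) x)"
      by (intro bounded_linear_sum bounded_linear_mult_const bounded_linear_vec_nth)
    show "((\<lambda>y. norm (y - x) * (\<integral>w. K * b w \<partial>M)) \<longlongrightarrow> 0) (at x)"
      by (auto intro!: tendsto_eq_intros)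
  qed (use bd in auto)
qed

lemma partial_derivs_translation_integral:
  "partial_derivs is (\<lambda>x. \<integral>w. c w * F (x - Y w) \<partial>M) = (\<lambda>x. \<integral>w. c w * partial_derivs is F (x - Y w) \<partial>M)"
proof (induction "is")
  case (Cons i "is")
  show ?case
    by (rule ext, simp only: partial_derivs.simps(2)[of i "is" "\<lambda>x. \<integral>w. c w * F (x - Y w) \<partial>M"] Cons.IH,
        subst partial_deriv_eqI[OF translation_integral_has_derivative])
       (simp add: axis_def if_distrib[where f="\<lambda>x. x * _"] cong: if_cong)
qed simp

lemma smooth_translation_integral: "smooth (\<lambda>x. \<integral>w. c w * F (x - Y w) \<partial>M)"
  unfolding smooth_def partial_derivs_translation_integral
  using translation_integral_has_derivative by (auto simp: differentiable_def)

end

section \<open>Test functions and convolution\<close>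

lemma partial_derivs_zero: "partial_derivs is (\<lambda>_. 0) = (\<lambda>_. 0)"
  by (induction "is") (auto simp: partial_deriv_const)

lemma partial_derivs_support:
  assumes "smooth F" "\<And>x. R < norm x \<Longrightarrow> F x = 0" "R < norm x"
  shows "partial_derivs is F x = 0"
proof -
  have "open {x :: real ^ 'a. R < norm x}" by (intro open_Collect_less continuous_intros)
  from partial_derivs_cong_open[OF this _ assms(1), of "\<lambda>_. 0" x "is"] show ?thesis
    using assms by (simp add: partial_derivs_zero)
qed

lemma test_function_support:
  assumes "test_function F" shows "\<exists>R>0. \<forall>x. R < norm x \<longrightarrow> F x = 0"
proof -
  have "compact (closure {x. F x \<noteq> 0})" using assms by (simp add: test_function_def)
  then have "bounded {x. F x \<noteq> 0}" by (rule bounded_subset[OF compact_imp_bounded closure_subset])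
  then obtain R where R: "R > 0" "\<forall>x\<in>{x. F x \<noteq> 0}. norm x \<le> R" unfolding bounded_pos by blast
  have "F x = 0" if "R < norm x" for x
  proof (rule ccontr)
    assume "F x \<noteq> 0"
    with R(2) have "norm x \<le> R" by simp
    with that show False by simp
  qed
  with R(1) show ?thesis by blast
qed

lemma test_functionI:
  assumes "smooth F" "\<And>x. R < norm x \<Longrightarrow> F x = 0" shows "test_function F"
proof -
  have "norm x \<le> R" if "x \<in> {x. F x \<noteq> 0}" for x using assms(2)[of x] that by force
  then have "bounded {x. F x \<noteq> 0}" by (rule boundedI)
  then show ?thesis using assms(1) by (simp add: test_function_def compact_closure)
qed

lemma test_function_smooth: "test_function F \<Longrightarrow> smooth F" by (simp add: test_function_def)

lemma test_function_partial_derivs: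
  assumes F: "test_function F" shows "test_function (partial_derivs is F)"
proof -
  obtain R where R: "\<And>x. R < norm x \<Longrightarrow> F x = 0" using test_function_support[OF F] by blast
  have "partial_derivs is F x = 0" if "R < norm x" for x
    by (rule partial_derivs_support[of F R x, OF test_function_smooth[OF F]]) (simp_all add: R that)
  then show ?thesis
    by (rule test_functionI[of "partial_derivs is F" R, OF smooth_partial_derivs[OF test_function_smooth[OF F]]])
qed

lemma test_function_partial_deriv: "test_function F \<Longrightarrow> test_function (partial_deriv i F)"
  using test_function_partial_derivs[of F "[i]"] by simp

lemma test_function_mult:
  assumes "test_function F" "smooth g" shows "test_function (\<lambda>x. F x * g x)"
proof -
  obtain R where "\<And>x. R < norm x \<Longrightarrow> F x = 0" using test_function_support[OF assms(1)] by auto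
  then show ?thesis
    using test_functionI[OF smooth_mult[OF test_function_smooth[OF assms(1)] assms(2)], of R] by simp
qed

lemma test_function_bounded:
  assumes "test_function F" shows "\<exists>K\<ge>0. \<forall>x. \<bar>F x\<bar> \<le> K"
proof -
  obtain R where R: "\<And>x. R < norm x \<Longrightarrow> F x = 0" using test_function_support[OF assms] by auto
  obtain K where "K \<ge> 0" "\<And>x. norm x \<le> R \<Longrightarrow> \<bar>F x\<bar> \<le> K"
    using smooth_bounded_cball[OF test_function_smooth[OF assms]] by blast
  then have "\<bar>F x\<bar> \<le> K" for x using R[of x] by (cases "R < norm x") auto
  with \<open>K \<ge> 0\<close> show ?thesis by blast
qed

lemma integrable_compact_support:
  fixes f :: "real ^ 'n::finite \<Rightarrow> real"
  assumes "continuous_on UNIV f" "\<And>x. R < norm x \<Longrightarrow> f x = 0"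
  shows "integrable lborel f"
proof -
  have "integrable lborel (\<lambda>x. indicator (cball 0 R) x *\<^sub>R f x)"
    by (rule borel_integrable_compact) (auto intro: continuous_on_subset[OF assms(1)])
  moreover have "(\<lambda>x. indicator (cball 0 R) x *\<^sub>R f x) = f"
    using assms(2) by (auto simp: fun_eq_iff indicator_def)
  ultimately show ?thesis by simp
qed

lemma test_function_integrable:
  assumes F: "test_function F" shows "integrable lborel F"
proof -
  obtain R where R: "\<And>x. R < norm x \<Longrightarrow> F x = 0" using test_function_support[OF F] by blast
  show ?thesis
    by (rule integrable_compact_support[of F R, OF smooth_continuous_on[OF test_function_smooth[OF F]]]) (rule R)
qed

section \<open>Changes of variables, mollification and integration by parts\<close>

lemma lborel_integral_affine:
  fixes f :: "real ^ 'n::finite \<Rightarrow> real"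
  assumes "c \<noteq> 0"
  shows "(\<integral>x. f x \<partial>lborel) = \<bar>c\<bar> ^ CARD('n) * (\<integral>x. f (t + c *\<^sub>R x) \<partial>lborel)"
proof (cases "f \<in> borel_measurable borel")
  case [measurable]: True
  have "(\<integral>x. f x \<partial>lborel) = (\<integral>x. f x \<partial>density (distr lborel borel (\<lambda>x. t + c *\<^sub>R x)) (\<lambda>_. \<bar>c\<bar> ^ DIM(real ^ 'n)))"
    by (subst lborel_affine[OF assms, of t]) simp
  also have "\<dots> = \<bar>c\<bar> ^ CARD('n) * (\<integral>x. f (t + c *\<^sub>R x) \<partial>lborel)"
    by (subst integral_density) (auto simp: integral_distr)
  finally show ?thesis .
next
  case False
  have "\<not> integrable lborel f" using False borel_measurable_integrable[of lborel f] by auto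
  moreover have "\<not> integrable lborel (\<lambda>x. f (t + c *\<^sub>R x))"
  proof
    assume "integrable lborel (\<lambda>x. f (t + c *\<^sub>R x))"
    then have [measurable]: "(\<lambda>x. f (t + c *\<^sub>R x)) \<in> borel_measurable borel"
      using borel_measurable_integrable by fastforce
    have "(\<lambda>y. (\<lambda>x. f (t + c *\<^sub>R x)) ((1 / c) *\<^sub>R (y - t))) \<in> borel_measurable borel" by measurable
    moreover have "(\<lambda>y. (\<lambda>x. f (t + c *\<^sub>R x)) ((1 / c) *\<^sub>R (y - t))) = f" using assms by auto
    ultimately show False using False by simp
  qed
  ultimately show ?thesis by (simp add: not_integrable_integral_eq)
qed

lemma lborel_integral_translate:
  fixes f :: "real ^ 'n::finite \<Rightarrow> real"
  shows "(\<integral>x. f (t + x) \<partial>lborel) = (\<integral>x. f x \<partial>lborel)"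
  using lborel_integral_affine[of 1 f t] by simp

lemma lborel_integral_reflect:
  fixes f :: "real ^ 'n::finite \<Rightarrow> real"
  shows "(\<integral>x. f (t - x) \<partial>lborel) = (\<integral>x. f x \<partial>lborel)"
  using lborel_integral_affine[of "-1" f t] by simp

abbreviation integrable_cball :: "real \<Rightarrow> (real ^ 'n::finite \<Rightarrow> real) \<Rightarrow> bool" where
  "integrable_cball R u \<equiv> integrable lborel (\<lambda>y. u y * indicator (cball 0 R) y)"

lemma mollification:
  fixes u :: "real ^ 'n::finite \<Rightarrow> real"
  assumes [measurable]: "u \<in> borel_measurable borel"
    and u: "\<And>R. integrable_cball R u" and F: "test_function F"
  shows "smooth (\<lambda>x. \<integral>y. u y * F (x - y) \<partial>lborel)"
    and "partial_derivs is (\<lambda>x. \<integral>y. u y * F (x - y) \<partial>lborel) = (\<lambda>x. \<integral>y. u y * partial_derivs is F (x - y) \<partial>lborel)"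
proof -
  obtain R0 where R0: "\<And>x. R0 < norm x \<Longrightarrow> F x = 0" using test_function_support[OF F] by auto
  have dom: "\<exists>b. integrable lborel b \<and> (\<forall>is. \<exists>K. \<forall>x w. norm x \<le> R \<longrightarrow> w \<in> space lborel \<longrightarrow>
      \<bar>u w * partial_derivs is F (x - w)\<bar> \<le> K * b w)" for R
  proof (intro exI[of _ "\<lambda>y. \<bar>u y * indicator (cball 0 (R + R0)) y\<bar>"] conjI allI)
    show "integrable lborel (\<lambda>y. \<bar>u y * indicator (cball 0 (R + R0)) y\<bar>)" using u by (intro integrable_abs)
    fix "is"
    obtain K where K: "K \<ge> 0" "\<And>x. \<bar>partial_derivs is F x\<bar> \<le> K"
      using test_function_bounded[OF test_function_partial_derivs[OF F]] by blast
    have "\<bar>u w * partial_derivs is F (x - w)\<bar> \<le> K * \<bar>u w * indicator (cball 0 (R + R0)) w\<bar>" if "norm x \<le> R" for x w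
    proof (cases "norm w \<le> R + R0")
      case True
      then show ?thesis using mult_left_mono[OF K(2)[of "x - w"], of "\<bar>u w\<bar>"] by (simp add: abs_mult mult.commute)
    next
      case False
      then have "R0 < norm (x - w)" using that norm_triangle_ineq3[of x w] by linarith
      then have "partial_derivs is F (x - w) = 0"
        by (intro partial_derivs_support[of F R0 "x - w", OF test_function_smooth[OF F]]) (simp_all add: R0)
      then show ?thesis using K by simp
    qed
    then show "\<exists>K. \<forall>x w. norm x \<le> R \<longrightarrow> w \<in> space lborel \<longrightarrow>
      \<bar>u w * partial_derivs is F (x - w)\<bar> \<le> K * \<bar>u w * indicator (cball 0 (R + R0)) w\<bar>" by blast
  qed
  show "smooth (\<lambda>x. \<integral>y. u y * F (x - y) \<partial>lborel)"
    by (rule smooth_translation_integral[OF _ _ test_function_smooth[OF F] dom]) auto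
  show "partial_derivs is (\<lambda>x. \<integral>y. u y * F (x - y) \<partial>lborel) = (\<lambda>x. \<integral>y. u y * partial_derivs is F (x - y) \<partial>lborel)"
    by (rule partial_derivs_translation_integral[OF _ _ test_function_smooth[OF F] dom]) auto
qed

lemma bounded_translation:
  fixes M :: "'b measure" and Y :: "'b \<Rightarrow> real ^ 'n::finite"
  assumes c: "integrable M c" and Y[measurable]: "Y \<in> borel_measurable M" and F: "smooth F"
    and B: "\<And>w. c w \<noteq> 0 \<Longrightarrow> norm (Y w) \<le> B"
  shows "smooth (\<lambda>x. \<integral>w. c w * F (x - Y w) \<partial>M)"
    and "partial_derivs is (\<lambda>x. \<integral>w. c w * F (x - Y w) \<partial>M) = (\<lambda>x. \<integral>w. c w * partial_derivs is F (x - Y w) \<partial>M)"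
    and "integrable M (\<lambda>w. c w * F (x - Y w))"
proof -
  have [measurable]: "c \<in> borel_measurable M" using c by (rule borel_measurable_integrable)
  have dom: "\<exists>b. integrable M b \<and> (\<forall>is. \<exists>K. \<forall>x w. norm x \<le> R \<longrightarrow> w \<in> space M \<longrightarrow>
      \<bar>c w * partial_derivs is F (x - Y w)\<bar> \<le> K * b w)" for R
  proof (intro exI[of _ "\<lambda>w. \<bar>c w\<bar>"] conjI allI)
    show "integrable M (\<lambda>w. \<bar>c w\<bar>)" using c by (rule integrable_abs)
    fix "is"
    obtain K where K: "K \<ge> 0" "\<And>x. norm x \<le> R + B \<Longrightarrow> \<bar>partial_derivs is F x\<bar> \<le> K"
      using smooth_bounded_cball[OF smooth_partial_derivs[OF F]] by blast
    have "\<bar>c w * partial_derivs is F (x - Y w)\<bar> \<le> K * \<bar>c w\<bar>" if "norm x \<le> R" for x w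
    proof (cases "c w = 0")
      case False
      have "norm (x - Y w) \<le> R + B" using B[OF False] that norm_triangle_ineq4[of x "Y w"] by linarith
      from mult_left_mono[OF K(2)[OF this], of "\<bar>c w\<bar>"] show ?thesis by (simp add: abs_mult mult.commute)
    qed simp
    then show "\<exists>K. \<forall>x w. norm x \<le> R \<longrightarrow> w \<in> space M \<longrightarrow> \<bar>c w * partial_derivs is F (x - Y w)\<bar> \<le> K * \<bar>c w\<bar>" by blast
  qed
  show "smooth (\<lambda>x. \<integral>w. c w * F (x - Y w) \<partial>M)"
    by (rule smooth_translation_integral[OF _ _ F dom]) auto
  show "partial_derivs is (\<lambda>x. \<integral>w. c w * F (x - Y w) \<partial>M) = (\<lambda>x. \<integral>w. c w * partial_derivs is F (x - Y w) \<partial>M)"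
    by (rule partial_derivs_translation_integral[OF _ _ F dom]) auto
  show "integrable M (\<lambda>w. c w * F (x - Y w))"
    using translation_integrable[OF _ _ F dom, of "[]" x] by simp
qed

text \<open>The convolution of \<open>h\<close> with the constant 1 is constant; differentiating it
  under the integral gives zero.\<close>

lemma integral_partial_deriv_eq_0:
  assumes h: "test_function h" shows "(\<integral>x. partial_deriv i h x \<partial>lborel) = 0"
proof -
  have int: "integrable lborel (\<lambda>y::real ^ 'a. 1 * indicator (cball 0 R) y :: real)" for R
    using emeasure_lborel_cball_finite[of 0 R] by (auto intro!: integrable_real_indicator)
  from mollification(2)[of "\<lambda>_. 1" h "[i]", OF _ int h]
  have "partial_deriv i (\<lambda>x. \<integral>y. 1 * h (x - y) \<partial>lborel) = (\<lambda>x. \<integral>y. 1 * partial_deriv i h (x - y) \<partial>lborel)" by simp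
  then have "(\<lambda>x::real ^ 'a. 0) = (\<lambda>x. \<integral>y. partial_deriv i h y \<partial>lborel)"
    by (simp add: lborel_integral_reflect partial_deriv_const)
  then show ?thesis by (simp add: fun_eq_iff)
qed

lemma integral_by_parts:
  assumes \<psi>: "test_function \<psi>" and q: "smooth q"
  shows "(\<integral>x. partial_deriv i \<psi> x * q x \<partial>lborel) = - (\<integral>x. \<psi> x * partial_deriv i q x \<partial>lborel)"
proof -
  have eq: "partial_deriv i (\<lambda>x. \<psi> x * q x) = (\<lambda>x. partial_deriv i \<psi> x * q x + \<psi> x * partial_deriv i q x)"
    by (rule ext) (intro partial_deriv_mult smooth_differentiable q test_function_smooth \<psi>)
  have "0 = (\<integral>x. partial_deriv i \<psi> x * q x + \<psi> x * partial_deriv i q x \<partial>lborel)"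
    using integral_partial_deriv_eq_0[OF test_function_mult[OF \<psi> q], of i] by (simp add: eq)
  also have "\<dots> = (\<integral>x. partial_deriv i \<psi> x * q x \<partial>lborel) + (\<integral>x. \<psi> x * partial_deriv i q x \<partial>lborel)"
    by (intro Bochner_Integration.integral_add test_function_integrable test_function_mult test_function_partial_deriv \<psi> q smooth_partial_deriv)
  finally show ?thesis by simp
qed

section \<open>A smooth bump and its potential\<close>

definition quad :: "real ^ 'n::finite \<Rightarrow> real" where "quad x = 1 - x \<bullet> x"

lemma quad_eq: "quad x = 1 + (-1) * (\<Sum>i\<in>UNIV. x $ i * x $ i)"
  by (simp add: quad_def inner_vec_def)

lemma smooth_quad: "smooth quad"
  unfolding quad_eq[abs_def] by (intro smooth_add smooth_const smooth_cmult smooth_sum smooth_mult smooth_nth) auto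

lemma partial_deriv_quad: "partial_deriv i quad x = - 2 * x $ i"
proof -
  have "(quad has_derivative (\<lambda>h. 0 - (x \<bullet> h + h \<bullet> x))) (at x)"
    unfolding quad_def[abs_def]
    by (intro has_derivative_diff has_derivative_const has_derivative_inner has_derivative_ident)
  from partial_deriv_eqI[OF this, of i] show ?thesis by (simp add: inner_axis inner_axis')
qed

lemma quad_le_0: "1 \<le> norm x \<Longrightarrow> quad x \<le> 0"
  by (simp add: quad_def power2_norm_eq_inner[symmetric])

lemma test_function_flat_quad: "test_function (\<lambda>x. c * flat k (quad x))"
  by (rule test_functionI[of _ 1]) (auto intro!: smooth_cmult smooth_flat smooth_quad simp: flat_eq_0 quad_le_0)

definition bump_mass :: "'n::finite itself \<Rightarrow> real" where
  "bump_mass _ = (\<integral>x. 2 * flat 2 (quad (x :: real ^ 'n)) \<partial>lborel)"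

lemma bump_mass_pos: "0 < bump_mass TYPE('n::finite)"
proof -
  let ?f = "\<lambda>x::real ^ 'n. 2 * flat 2 (quad x)"
  have "0 < 2 * exp (- 2) * measure lborel (ball (0::real ^ 'n) (1/2))"
    by (simp add: content_ball_pos)
  also have "\<dots> = (\<integral>x. 2 * exp (- 2) * indicator (ball (0::real ^ 'n) (1/2)) x \<partial>lborel)"
    by simp
  also have "\<dots> \<le> (\<integral>x. ?f x \<partial>lborel)"
  proof (rule integral_mono)
    show "integrable lborel (\<lambda>x. 2 * exp (- 2) * indicator (ball (0::real ^ 'n) (1/2)) x :: real)"
      using emeasure_lborel_ball_finite[of 0 "1/2"] by (auto intro!: integrable_real_indicator)
    show "integrable lborel ?f" by (rule test_function_integrable) (rule test_function_flat_quad)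
    fix x :: "real ^ 'n"
    show "2 * exp (- 2) * indicator (ball (0::real ^ 'n) (1/2)) x \<le> ?f x"
    proof (cases "x \<in> ball 0 (1/2)")
      case True
      then have "(norm x)\<^sup>2 \<le> (1/2)\<^sup>2" by (intro power_mono) auto
      then have "x \<bullet> x \<le> 1/4" unfolding power2_norm_eq_inner by (simp add: power2_eq_square)
      then have q: "1/2 \<le> quad x" "quad x \<le> 1" by (auto simp: quad_def)
      then have "- 2 \<le> - 1 / quad x" by (simp add: field_simps)
      then have "exp (- 2) \<le> exp (- 1 / quad x)" by simp
      also have "\<dots> \<le> exp (- 1 / quad x) / (quad x)\<^sup>2"
        using q by (simp add: le_divide_eq power_le_one)
      finally show ?thesis using True q by (simp add: flat_def)
    qed (simp add: flat_nonneg)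
  qed
  finally show ?thesis by (simp add: bump_mass_def)
qed

text \<open>\<open>bump\<close> is related to \<open>bump_pot\<close> by \<open>x bump(x) = - \<nabla> bump_pot(x)\<close>. Thus \<open>d/dt\<close> of the dilations of \<open>bump\<close> is \<open>t\<close> times the Laplacian of those of \<open>bump_pot\<close>.\<close>

definition bump :: "real ^ 'n::finite \<Rightarrow> real" where
  "bump x = 2 / bump_mass TYPE('n) * flat 2 (quad x)"

definition bump_pot :: "real ^ 'n::finite \<Rightarrow> real" where
  "bump_pot x = 1 / bump_mass TYPE('n) * flat 0 (quad x)"

lemma test_function_bump: "test_function bump"
  unfolding bump_def[abs_def] by (rule test_function_flat_quad)

lemma test_function_bump_pot: "test_function bump_pot"
  unfolding bump_pot_def[abs_def] by (rule test_function_flat_quad)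

lemma bump_nonneg: "0 \<le> bump x"
  using bump_mass_pos[where 'n='a] by (simp add: bump_def flat_nonneg)

lemma bump_eq_0: "1 \<le> norm x \<Longrightarrow> bump x = 0"
  by (simp add: bump_def flat_eq_0 quad_le_0)

lemma bump_pot_eq_0: "1 \<le> norm x \<Longrightarrow> bump_pot x = 0"
  by (simp add: bump_pot_def flat_eq_0 quad_le_0)

lemma integral_bump: "(\<integral>x. bump (x :: real ^ 'n::finite) \<partial>lborel) = 1"
proof -
  have "(\<integral>x. bump (x :: real ^ 'n) \<partial>lborel) = (\<integral>x. 1 / bump_mass TYPE('n) * (2 * flat 2 (quad (x :: real ^ 'n))) \<partial>lborel)"
    by (simp add: bump_def)
  also have "\<dots> = 1 / bump_mass TYPE('n) * bump_mass TYPE('n)"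
    unfolding bump_mass_def by (rule integral_mult_right_zero)
  also have "\<dots> = 1" using bump_mass_pos[where 'n='n] by simp
  finally show ?thesis .
qed

lemma partial_deriv_bump_pot: "partial_deriv i bump_pot x = - x $ i * bump x"
proof -
  have d: "(\<lambda>x. flat 0 (quad x)) differentiable (at x)"
    by (rule smooth_differentiable[OF smooth_flat[OF smooth_quad]])
  have "partial_deriv i bump_pot x = 1 / bump_mass TYPE('a) * partial_deriv i (\<lambda>x. flat 0 (quad x)) x"
    unfolding bump_pot_def[abs_def] by (rule partial_deriv_cmult[OF d])
  also have "partial_deriv i (\<lambda>x. flat 0 (quad x)) x = flat 2 (quad x) * (- 2 * x $ i)"
    using partial_deriv_compose(1)[OF smooth_differentiable[OF smooth_quad, of x] flat_has_derivative[of 0], of i]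
    by (simp add: partial_deriv_quad numeral_2_eq_2)
  finally show ?thesis by (simp add: bump_def)
qed

section \<open>Averages over dilations, and the energy identity\<close>

definition laplacian :: "(real ^ 'n::finite \<Rightarrow> real) \<Rightarrow> real ^ 'n \<Rightarrow> real" where
  "laplacian f x = (\<Sum>i\<in>UNIV. partial_derivs [i, i] f x)"

lemma smooth_laplacian: "smooth f \<Longrightarrow> smooth (laplacian f)"
  unfolding laplacian_def[abs_def] by (intro smooth_sum smooth_partial_derivs) auto

lemma smooth_dilate: "smooth q \<Longrightarrow> smooth (\<lambda>z. q (x - t *\<^sub>R z))"
  using smooth_affine[of q x "- t"] by simp

lemma partial_derivs_dilate:
  "smooth q \<Longrightarrow> partial_derivs is (\<lambda>z. q (x - t *\<^sub>R z)) = (\<lambda>z. (- t) ^ length is * partial_derivs is q (x - t *\<^sub>R z))"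
  using partial_derivs_affine[of q "is" x "- t"] by simp

lemma integrable_dilate:
  "test_function \<kappa> \<Longrightarrow> smooth q \<Longrightarrow> integrable lborel (\<lambda>z. \<kappa> z * q (x - t *\<^sub>R z))"
  by (intro test_function_integrable test_function_mult smooth_dilate)

text \<open>The remainder of Taylor's formula is at most a constant times the square of the
  increment of \<open>t\<close>: the compact support of \<open>\<kappa>\<close> confines the points
  \<open>x - t *\<^sub>R z\<close> to a ball on which the second derivatives of \<open>q\<close> are
  bounded.\<close>

lemma dilated_avg_derivative:
  fixes q :: "real ^ 'n::finite \<Rightarrow> real"
  assumes \<kappa>: "test_function \<kappa>" and q: "smooth q"
  shows "((\<lambda>t. \<integral>z. \<kappa> z * q (x - t *\<^sub>R z) \<partial>lborel) has_real_derivative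
    (\<Sum>i\<in>UNIV. \<integral>z. \<kappa> z * (- z $ i) * partial_deriv i q (x - t *\<^sub>R z) \<partial>lborel)) (at t)"
proof -
  obtain R where R: "\<And>z. R < norm z \<Longrightarrow> \<kappa> z = 0" "R > 0" using test_function_support[OF \<kappa>] by blast
  have \<kappa>i: "test_function (\<lambda>z. \<kappa> z * (- z $ i))" for i
    using test_function_mult[OF \<kappa> smooth_cmult[OF smooth_nth, of "-1" i]] by simp
  have "\<forall>ij. \<exists>K. \<forall>y. norm y \<le> norm x + (\<bar>t\<bar> + 1) * R \<longrightarrow> \<bar>partial_deriv (snd ij) (partial_deriv (fst ij) q) y\<bar> \<le> K"
    using smooth_bounded_cball[OF smooth_partial_deriv[OF smooth_partial_deriv[OF q]]] by blast
  from choice[OF this] obtain K0 where K0: "\<And>i j y. norm y \<le> norm x + (\<bar>t\<bar> + 1) * R \<Longrightarrow> \<bar>partial_deriv j (partial_deriv i q) y\<bar> \<le> K0 (i, j)"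
    by fastforce
  define K where "K = (\<Sum>i\<in>UNIV. \<Sum>j\<in>UNIV. R\<^sup>2 * K0 (i, j)) / 2"
  let ?A = "\<lambda>t. \<integral>z. \<kappa> z * q (x - t *\<^sub>R z) \<partial>lborel"
  let ?D = "\<Sum>i\<in>UNIV. \<integral>z. \<kappa> z * (- z $ i) * partial_deriv i q (x - t *\<^sub>R z) \<partial>lborel"
  have int0: "integrable lborel (\<lambda>z. \<kappa> z * q (x - t *\<^sub>R z))" for t
    by (rule integrable_dilate[OF \<kappa> q])
  have int1: "integrable lborel (\<lambda>z. \<kappa> z * (- z $ i) * partial_deriv i q (x - t *\<^sub>R z))" for i
    by (rule integrable_dilate[OF \<kappa>i smooth_partial_deriv[OF q]])
  have int1': "integrable lborel (\<lambda>z. s * (\<Sum>i\<in>UNIV. \<kappa> z * (- z $ i) * partial_deriv i q (x - t *\<^sub>R z)))" for s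
    by (intro integrable_mult_right Bochner_Integration.integrable_sum int1)
  have bd: "norm (?A (t + s) - ?A t - s * ?D) \<le> s\<^sup>2 * (\<integral>z. K * \<bar>\<kappa> z\<bar> \<partial>lborel)" if s: "\<bar>s\<bar> \<le> 1" for s
  proof -
    have "?A (t + s) - ?A t - s * ?D = (\<integral>z. \<kappa> z * q (x - (t + s) *\<^sub>R z) - \<kappa> z * q (x - t *\<^sub>R z) -
        s * (\<Sum>i\<in>UNIV. \<kappa> z * (- z $ i) * partial_deriv i q (x - t *\<^sub>R z)) \<partial>lborel)"
      using int0 int1 int1' by (simp add: Bochner_Integration.integral_sum)
    also have "norm \<dots> \<le> (\<integral>z. s\<^sup>2 * (K * \<bar>\<kappa> z\<bar>) \<partial>lborel)"
    proof (rule integral_norm_le)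
      show "integrable lborel (\<lambda>z. \<kappa> z * q (x - (t + s) *\<^sub>R z) - \<kappa> z * q (x - t *\<^sub>R z) -
        s * (\<Sum>i\<in>UNIV. \<kappa> z * (- z $ i) * partial_deriv i q (x - t *\<^sub>R z)))"
        by (intro Bochner_Integration.integrable_diff int0 int1')
      show "integrable lborel (\<lambda>z. s\<^sup>2 * (K * \<bar>\<kappa> z\<bar>))"
        using test_function_integrable[OF \<kappa>] by simp
      fix z :: "real ^ 'n"
      show "norm (\<kappa> z * q (x - (t + s) *\<^sub>R z) - \<kappa> z * q (x - t *\<^sub>R z) -
        s * (\<Sum>i\<in>UNIV. \<kappa> z * (- z $ i) * partial_deriv i q (x - t *\<^sub>R z))) \<le> s\<^sup>2 * (K * \<bar>\<kappa> z\<bar>)"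
      proof (cases "\<kappa> z = 0")
        case False
        then have z: "norm z \<le> R" using R(1)[of z] by fastforce
        obtain r where r: "0 \<le> r" "r \<le> 1" and T: "q ((x - t *\<^sub>R z) + (- s) *\<^sub>R z) = q (x - t *\<^sub>R z) +
            (\<Sum>i\<in>UNIV. ((- s) *\<^sub>R z) $ i * partial_deriv i q (x - t *\<^sub>R z)) +
            (\<Sum>i\<in>UNIV. \<Sum>j\<in>UNIV. ((- s) *\<^sub>R z) $ i * ((- s) *\<^sub>R z) $ j * partial_deriv j (partial_deriv i q) ((x - t *\<^sub>R z) + r *\<^sub>R ((- s) *\<^sub>R z))) / 2"
          by (rule smooth_Taylor2[OF q])
        let ?y = "(x - t *\<^sub>R z) + r *\<^sub>R ((- s) *\<^sub>R z)"
        have y: "norm ?y \<le> norm x + (\<bar>t\<bar> + 1) * R"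
        proof -
          have "?y = x - (t + r * s) *\<^sub>R z" by (simp add: algebra_simps)
          then have "norm ?y \<le> norm x + norm ((t + r * s) *\<^sub>R z)" by (simp only: norm_triangle_ineq4)
          then have "norm ?y \<le> norm x + \<bar>t + r * s\<bar> * norm z" by (simp only: norm_scaleR)
          moreover have "\<bar>r * s\<bar> \<le> 1 * 1" unfolding abs_mult using r s by (intro mult_mono) auto
          then have "\<bar>t + r * s\<bar> * norm z \<le> (\<bar>t\<bar> + 1) * R" using z by (intro mult_mono) auto
          ultimately show ?thesis by linarith
        qed
        have "\<kappa> z * q (x - (t + s) *\<^sub>R z) - \<kappa> z * q (x - t *\<^sub>R z) - s * (\<Sum>i\<in>UNIV. \<kappa> z * (- z $ i) * partial_deriv i q (x - t *\<^sub>R z)) =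
          \<kappa> z * (q ((x - t *\<^sub>R z) + (- s) *\<^sub>R z) - q (x - t *\<^sub>R z) - (\<Sum>i\<in>UNIV. ((- s) *\<^sub>R z) $ i * partial_deriv i q (x - t *\<^sub>R z)))"
          by (simp add: algebra_simps sum_distrib_left sum_negf)
        also have "\<dots> = s\<^sup>2 * (\<kappa> z * ((\<Sum>i\<in>UNIV. \<Sum>j\<in>UNIV. (z $ i * z $ j) * partial_deriv j (partial_deriv i q) ?y) / 2))"
          unfolding T by (simp add: sum_distrib_left power2_eq_square algebra_simps)
        also have "norm \<dots> \<le> s\<^sup>2 * (\<bar>\<kappa> z\<bar> * K)"
        proof -
          have "\<bar>(z $ i * z $ j) * partial_deriv j (partial_deriv i q) ?y\<bar> \<le> R\<^sup>2 * K0 (i, j)" for i j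
          proof -
            have "\<bar>z $ i\<bar> * \<bar>z $ j\<bar> \<le> R * R"
              using component_le_norm_cart[of z i] component_le_norm_cart[of z j] z R(2) by (intro mult_mono) auto
            then show ?thesis unfolding abs_mult[of "z $ i * z $ j"]
              by (intro mult_mono K0 y) (auto simp: abs_mult power2_eq_square)
          qed
          then have "\<bar>\<Sum>i\<in>UNIV. \<Sum>j\<in>UNIV. (z $ i * z $ j) * partial_deriv j (partial_deriv i q) ?y\<bar> \<le> (\<Sum>i\<in>UNIV. \<Sum>j\<in>UNIV. R\<^sup>2 * K0 (i, j))"
            by (intro order_trans[OF sum_abs] sum_mono) auto
          then have "\<bar>(\<Sum>i\<in>UNIV. \<Sum>j\<in>UNIV. (z $ i * z $ j) * partial_deriv j (partial_deriv i q) ?y) / 2\<bar> \<le> K"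
            by (simp add: K_def)
          then show ?thesis unfolding real_norm_def abs_mult[of "s\<^sup>2"] abs_mult[of "\<kappa> z"] abs_power2
            by (intro mult_left_mono) auto
        qed
        finally show ?thesis by (simp add: mult.commute)
      qed simp
    qed
    finally show ?thesis by simp
  qed
  have "((\<lambda>t. ?A t) has_derivative (\<lambda>s. s * ?D)) (at t)"
  proof (rule has_derivativeI_sandwich[of 1])
    show "bounded_linear (\<lambda>s. s * ?D)" by (rule bounded_linear_mult_left)
    show "((\<lambda>s. norm (s - t) * (\<integral>z. K * \<bar>\<kappa> z\<bar> \<partial>lborel)) \<longlongrightarrow> 0) (at t)"
      by (auto intro!: tendsto_eq_intros)
    fix s assume s: "s \<noteq> t" "dist s t < 1"
    have pos: "0 < norm (s - t)" using s by simp
    have "norm (?A s - ?A t - (s - t) * ?D) \<le> (s - t)\<^sup>2 * (\<integral>z. K * \<bar>\<kappa> z\<bar> \<partial>lborel)"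
      using bd[of "s - t"] s by (simp add: dist_real_def)
    also have "(s - t)\<^sup>2 = norm (s - t) * norm (s - t)" by (simp add: power2_eq_square)
    finally show "norm (?A s - ?A t - (s - t) * ?D) / norm (s - t) \<le> norm (s - t) * (\<integral>z. K * \<bar>\<kappa> z\<bar> \<partial>lborel)"
      unfolding pos_divide_le_eq[OF pos] by (simp only: ac_simps)
  qed simp
  then show ?thesis unfolding has_field_derivative_def mult.commute[of ?D] .
qed

text \<open>The factor \<open>- z $ i * bump z\<close> is a derivative of \<open>bump_pot\<close>.
  Moving this derivative onto \<open>q (x - t *\<^sub>R z)\<close> produces a factor
  \<open>t\<close> and the second derivative in direction \<open>i\<close>; the sum over
  \<open>i\<close> is the Laplacian.\<close>

lemma bump_avg_derivative:
  fixes q :: "real ^ 'n::finite \<Rightarrow> real"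
  assumes q: "smooth q"
  shows "((\<lambda>t. \<integral>z. bump z * q (x - t *\<^sub>R z) \<partial>lborel) has_real_derivative
    t * (\<integral>z. bump_pot z * laplacian q (x - t *\<^sub>R z) \<partial>lborel)) (at t)"
proof -
  have "(\<integral>z. bump z * (- z $ i) * partial_deriv i q (x - t *\<^sub>R z) \<partial>lborel) =
    t * (\<integral>z. bump_pot z * partial_derivs [i, i] q (x - t *\<^sub>R z) \<partial>lborel)" for i
  proof -
    have "(\<integral>z. bump z * (- z $ i) * partial_deriv i q (x - t *\<^sub>R z) \<partial>lborel) =
      (\<integral>z. partial_deriv i bump_pot z * partial_deriv i q (x - t *\<^sub>R z) \<partial>lborel)"
      by (simp add: partial_deriv_bump_pot mult.commute)
    also have "\<dots> = - (\<integral>z. bump_pot z * partial_deriv i (\<lambda>z. partial_deriv i q (x - t *\<^sub>R z)) z \<partial>lborel)"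
      by (rule integral_by_parts[OF test_function_bump_pot smooth_dilate[OF smooth_partial_deriv[OF q]]])
    also have "\<dots> = - (\<integral>z. - t * (bump_pot z * partial_derivs [i, i] q (x - t *\<^sub>R z)) \<partial>lborel)"
      using partial_derivs_dilate[OF smooth_partial_deriv[OF q], of "[i]" i x t] by (simp add: ac_simps)
    also have "\<dots> = t * (\<integral>z. bump_pot z * partial_derivs [i, i] q (x - t *\<^sub>R z) \<partial>lborel)"
      by (subst integral_mult_right_zero) simp
    finally show ?thesis .
  qed
  then have "(\<Sum>i\<in>UNIV. \<integral>z. bump z * (- z $ i) * partial_deriv i q (x - t *\<^sub>R z) \<partial>lborel) =
     t * (\<Sum>i\<in>UNIV. \<integral>z. bump_pot z * partial_derivs [i, i] q (x - t *\<^sub>R z) \<partial>lborel)"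
    by (simp only: sum_distrib_left)
  also have "(\<Sum>i\<in>UNIV. \<integral>z. bump_pot z * partial_derivs [i, i] q (x - t *\<^sub>R z) \<partial>lborel) =
      (\<integral>z. bump_pot z * laplacian q (x - t *\<^sub>R z) \<partial>lborel)"
    unfolding laplacian_def sum_distrib_left
    by (rule Bochner_Integration.integral_sum[symmetric])
       (intro integrable_dilate test_function_bump_pot smooth_partial_derivs q)
  finally show ?thesis using dilated_avg_derivative[OF test_function_bump q, of x t] by simp
qed

text \<open>Two integrations by parts turn the integral of the square of \<open>D_ij q\<close> into
  that of \<open>D_ii q * D_jj q\<close>, and the sum of these over all pairs is the integral of the
  squared Laplacian. The square for one pair is one of the nonnegative summands.\<close>

lemma second_derivs_energy:
  fixes q :: "real ^ 'n::finite \<Rightarrow> real"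
  assumes q: "test_function q"
  shows "(\<integral>x. (partial_derivs [i, j] q x)\<^sup>2 \<partial>lborel) \<le> (\<integral>x. (laplacian q x)\<^sup>2 \<partial>lborel)"
proof -
  note sq = test_function_smooth[OF q]
  have commute: "partial_deriv i (partial_deriv j f) = partial_deriv j (partial_deriv i f)" if "smooth f" for f :: "real ^ 'n \<Rightarrow> real" and i j
    using partial_deriv_commute[OF that] by blast
  have T: "test_function (\<lambda>x. partial_derivs is q x * partial_derivs js q x)" for "is" js
    by (intro test_function_mult test_function_partial_derivs q smooth_partial_derivs sq)
  have eq: "(\<integral>x. partial_derivs [i, j] q x * partial_derivs [i, j] q x \<partial>lborel) =
      (\<integral>x. partial_derivs [i, i] q x * partial_derivs [j, j] q x \<partial>lborel)" for i j
  proof -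
    have "(\<integral>x. partial_derivs [i, j] q x * partial_derivs [i, j] q x \<partial>lborel) =
      - (\<integral>x. partial_deriv j q x * partial_deriv i (partial_derivs [i, j] q) x \<partial>lborel)"
      using integral_by_parts[OF test_function_partial_deriv[OF q] smooth_partial_derivs[OF sq], of i j "[i, j]"] by simp
    also have "partial_deriv i (partial_derivs [i, j] q) = partial_deriv j (partial_derivs [i, i] q)"
      using sq by (simp add: commute[of _ i j] smooth_partial_deriv)
    also have "- (\<integral>x. partial_deriv j q x * partial_deriv j (partial_derivs [i, i] q) x \<partial>lborel) =
      (\<integral>x. partial_derivs [j, j] q x * partial_derivs [i, i] q x \<partial>lborel)"
      using integral_by_parts[OF test_function_partial_deriv[OF q] smooth_partial_derivs[OF sq], of j j "[i, i]"] by simp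
    finally show ?thesis by (simp add: mult.commute)
  qed
  have "(\<integral>x. (partial_derivs [i, j] q x)\<^sup>2 \<partial>lborel) \<le> (\<Sum>j\<in>UNIV. \<integral>x. (partial_derivs [i, j] q x)\<^sup>2 \<partial>lborel)"
    by (rule member_le_sum) auto
  also have "\<dots> \<le> (\<Sum>i\<in>UNIV. \<Sum>j\<in>UNIV. \<integral>x. (partial_derivs [i, j] q x)\<^sup>2 \<partial>lborel)"
    by (rule member_le_sum[where f="\<lambda>i. \<Sum>j\<in>UNIV. \<integral>x. (partial_derivs [i, j] q x)\<^sup>2 \<partial>lborel"]) (auto intro!: sum_nonneg)
  also have "\<dots> = (\<Sum>i\<in>UNIV. \<Sum>j\<in>UNIV. \<integral>x. partial_derivs [i, i] q x * partial_derivs [j, j] q x \<partial>lborel)"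
    by (simp only: power2_eq_square eq)
  also have "\<dots> = (\<integral>x. (\<Sum>i\<in>UNIV. \<Sum>j\<in>UNIV. partial_derivs [i, i] q x * partial_derivs [j, j] q x) \<partial>lborel)"
    using test_function_integrable[OF T] by (simp only: Bochner_Integration.integral_sum Bochner_Integration.integrable_sum)
  also have "\<dots> = (\<integral>x. (laplacian q x)\<^sup>2 \<partial>lborel)"
    by (simp only: laplacian_def power2_eq_square sum_product)
  finally show ?thesis .
qed

section \<open>Mean oscillation of second derivatives\<close>

definition ccube :: "real \<Rightarrow> (real ^ 'n::finite) set" where
  "ccube r = cbox (\<chi> i. - r) (\<chi> i. r)"

lemma mem_ccube: "x \<in> ccube r \<longleftrightarrow> (\<forall>i. \<bar>x $ i\<bar> \<le> r)"
  by (auto simp: ccube_def mem_box_cart abs_le_iff minus_le_iff)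

lemma indicator_ccube_mono: "r \<le> s \<Longrightarrow> indicator (ccube r) x \<le> (indicator (ccube s) x :: ennreal)"
  unfolding indicator_def mem_ccube by (auto intro: order_trans)

text \<open>The condition at infinity. For the second derivatives of \<open>w\<close> it excludes
  nonzero constants, as they arise from harmonic quadratic polynomials, which the Laplacian does not
  see.\<close>

abbreviation vanishing_means :: "(real ^ 'n::finite \<Rightarrow> real) \<Rightarrow> bool" where
  "vanishing_means H \<equiv> ((\<lambda>r. (\<integral>y. indicator (ccube r) y * \<bar>H y\<bar> \<partial>lborel) / r ^ CARD('n)) \<longlongrightarrow> 0) at_top"

lemma compact_ccube: "compact (ccube r)" by (simp add: ccube_def)

lemma ccube_sets [measurable]: "ccube r \<in> sets borel" by (simp add: ccube_def)

lemma measure_ccube: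
  assumes "0 \<le> r" shows "measure lborel (ccube r :: (real ^ 'n::finite) set) = (2 * r) ^ CARD('n)"
proof -
  have "cbox (\<chi> i. - r) (\<chi> i. r) \<noteq> ({} :: (real ^ 'n) set)" using assms by (simp add: interval_ne_empty_cart)
  from content_cbox_cart[OF this] show ?thesis by (simp add: ccube_def)
qed

lemma emeasure_ccube_finite: "emeasure lborel (ccube r) < top"
  using emeasure_compact_finite[OF compact_ccube] by simp

lemma integrable_ccube:
  fixes g :: "real ^ 'n::finite \<Rightarrow> real"
  assumes "continuous_on UNIV g" shows "integrable lborel (\<lambda>x. indicator (ccube r) x * g x)"
  using borel_integrable_compact[OF compact_ccube[of r] continuous_on_subset[OF assms subset_UNIV]] by simp

lemma integrable_indicator_ccube: "integrable lborel (\<lambda>x. indicator (ccube r) x * c :: real)"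
  by (rule integrable_ccube) simp

lemma integral_indicator_ccube:
  "0 \<le> r \<Longrightarrow> (\<integral>x. indicator (ccube r) (x :: real ^ 'n::finite) * c \<partial>lborel) = (2 * r) ^ CARD('n) * c"
  by (simp add: measure_ccube)

lemma ccube_norm_le: "x \<in> ccube r \<Longrightarrow> norm (x :: real ^ 'n::finite) \<le> real CARD('n) * r"
  using norm_le_l1_cart[of x] sum_mono[of UNIV "\<lambda>i. \<bar>x $ i\<bar>" "\<lambda>_. r"] by (simp add: mem_ccube)

lemma notin_ccube_norm: "x \<notin> ccube r \<Longrightarrow> r < norm x"
  using component_le_norm_cart[of x] by (auto simp: mem_ccube not_le intro: less_le_trans)

text \<open>AM-GM: \<open>\<bar>f\<bar> \<le> (f\<^sup>2/m + m)/2\<close>.\<close>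

lemma integral_abs_le_of_square:
  fixes f :: "real ^ 'n::finite \<Rightarrow> real"
  assumes f: "continuous_on UNIV f" and m: "0 < m" and r: "0 \<le> r"
    and sq: "(\<integral>x. indicator (ccube r) x * (f x)\<^sup>2 \<partial>lborel) \<le> m\<^sup>2 * K"
  shows "(\<integral>x. indicator (ccube r) x * \<bar>f x\<bar> \<partial>lborel) \<le> m * (K + (2 * r) ^ CARD('n)) / 2"
proof -
  have f2: "continuous_on UNIV (\<lambda>x. (f x)\<^sup>2)" "continuous_on UNIV (\<lambda>x. \<bar>f x\<bar>)"
    using f by (auto intro!: continuous_intros)
  have "(\<integral>x. indicator (ccube r) x * \<bar>f x\<bar> \<partial>lborel) \<le>
    (\<integral>x. (1 / (2 * m)) * (indicator (ccube r) x * (f x)\<^sup>2) + indicator (ccube r) x * (m / 2) \<partial>lborel)"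
  proof (rule integral_mono)
    show "integrable lborel (\<lambda>x. (1 / (2 * m)) * (indicator (ccube r) x * (f x)\<^sup>2) + indicator (ccube r) x * (m / 2))"
      by (intro Bochner_Integration.integrable_add integrable_mult_right integrable_ccube f2 integrable_indicator_ccube)
    fix x
    have "0 \<le> (\<bar>f x\<bar> - m)\<^sup>2" by simp
    then have "2 * m * \<bar>f x\<bar> \<le> (f x)\<^sup>2 + m\<^sup>2" by (simp add: power2_diff algebra_simps)
    then have "\<bar>f x\<bar> \<le> ((f x)\<^sup>2 + m\<^sup>2) / (2 * m)"
      using m by (simp add: pos_le_divide_eq mult.commute)
    also have "\<dots> = (1 / (2 * m)) * (f x)\<^sup>2 + m / 2"
      using m by (simp add: field_simps power2_eq_square)
    finally have "indicator (ccube r) x * \<bar>f x\<bar> \<le> indicator (ccube r) x * ((1 / (2 * m)) * (f x)\<^sup>2 + m / 2)"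
      by (intro mult_left_mono) auto
    then show "indicator (ccube r) x * \<bar>f x\<bar> \<le> (1 / (2 * m)) * (indicator (ccube r) x * (f x)\<^sup>2) + indicator (ccube r) x * (m / 2)"
      by (simp add: algebra_simps)
  qed (intro integrable_ccube f2)
  also have "\<dots> = (1 / (2 * m)) * (\<integral>x. indicator (ccube r) x * (f x)\<^sup>2 \<partial>lborel) + (2 * r) ^ CARD('n) * (m / 2)"
    by (subst Bochner_Integration.integral_add[OF integrable_mult_right[OF integrable_ccube[OF f2(1)]] integrable_indicator_ccube])
       (simp only: integral_indicator_ccube[OF r] integral_mult_right_zero)
  also have "\<dots> \<le> (1 / (2 * m)) * (m\<^sup>2 * K) + (2 * r) ^ CARD('n) * (m / 2)"
    using m sq by (intro add_right_mono mult_left_mono) auto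
  also have "\<dots> = m * (K + (2 * r) ^ CARD('n)) / 2"
    using m by (simp add: field_simps power2_eq_square)
  finally show ?thesis .
qed

lemma integral_ccube_dilate:
  fixes f :: "real ^ 'n::finite \<Rightarrow> real"
  assumes t: "0 < t"
  shows "(\<integral>z. indicator (ccube r) z * f (- t *\<^sub>R z) \<partial>lborel) = (\<integral>x. indicator (ccube (t * r)) x * f x \<partial>lborel) / t ^ CARD('n)"
proof -
  have "(\<integral>x. indicator (ccube (t * r)) x * f x \<partial>lborel) = t ^ CARD('n) * (\<integral>z. indicator (ccube (t * r)) (- t *\<^sub>R z) * f (- t *\<^sub>R z) \<partial>lborel)"
    using lborel_integral_affine[of "- t" "\<lambda>x. indicator (ccube (t * r)) x * f x" 0] t by simp
  moreover have "indicator (ccube (t * r)) (- t *\<^sub>R z) = (indicator (ccube r) z :: real)" for z :: "real ^ 'n"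
    using t by (auto simp: indicator_def mem_ccube abs_mult)
  ultimately show ?thesis using t by (simp add: field_simps)
qed

lemma test_function_Lipschitz:
  assumes \<kappa>: "test_function \<kappa>"
  shows "\<exists>L\<ge>0. \<forall>x h. \<bar>\<kappa> (x + h) - \<kappa> x\<bar> \<le> L * norm h"
proof -
  have "\<forall>i. \<exists>K. 0 \<le> K \<and> (\<forall>x. \<bar>partial_deriv i \<kappa> x\<bar> \<le> K)"
    using test_function_bounded[OF test_function_partial_deriv[OF \<kappa>]] by blast
  from choice[OF this] obtain K where K: "\<And>i. 0 \<le> K i" "\<And>i x. \<bar>partial_deriv i \<kappa> x\<bar> \<le> K i" by blast
  have "\<bar>\<kappa> (x + h) - \<kappa> x\<bar> \<le> (\<Sum>i\<in>UNIV. K i) * norm h" for x h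
  proof -
    have "((\<lambda>s. \<kappa> (x + s *\<^sub>R h)) has_real_derivative (\<Sum>i\<in>UNIV. h $ i * partial_deriv i \<kappa> (x + s *\<^sub>R h))) (at s)" for s
    proof -
      have "((\<lambda>s. x + s *\<^sub>R h) has_derivative (\<lambda>k. k *\<^sub>R h)) (at s)"
        by (auto intro!: derivative_eq_intros)
      from has_derivative_compose[OF this smooth_has_derivative[OF test_function_smooth[OF \<kappa>]]]
      show ?thesis
        by (auto simp: has_field_derivative_def sum_distrib_left sum_distrib_right fun_eq_iff ac_simps elim!: has_derivative_eq_rhs)
    qed
    from MVT2[of 0 1, OF _ this] obtain s where
      "\<kappa> (x + 1 *\<^sub>R h) - \<kappa> (x + 0 *\<^sub>R h) = (1 - 0) * (\<Sum>i\<in>UNIV. h $ i * partial_deriv i \<kappa> (x + s *\<^sub>R h))" by auto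
    then have "\<bar>\<kappa> (x + h) - \<kappa> x\<bar> = \<bar>\<Sum>i\<in>UNIV. h $ i * partial_deriv i \<kappa> (x + s *\<^sub>R h)\<bar>" by simp
    also have "\<dots> \<le> (\<Sum>i\<in>UNIV. \<bar>h $ i * partial_deriv i \<kappa> (x + s *\<^sub>R h)\<bar>)" by (rule sum_abs)
    also have "\<dots> \<le> (\<Sum>i\<in>UNIV. norm h * K i)"
      unfolding abs_mult by (intro sum_mono mult_mono component_le_norm_cart K) auto
    also have "\<dots> = (\<Sum>i\<in>UNIV. K i) * norm h"
      by (subst sum_distrib_left[symmetric]) (rule mult.commute)
    finally show ?thesis .
  qed
  moreover have "0 \<le> (\<Sum>i\<in>UNIV. K i)" by (intro sum_nonneg K)
  ultimately show ?thesis by blast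
qed

lemma laplacian_partial_derivs_commute:
  assumes w: "smooth w"
  shows "laplacian (partial_derivs [i, j] w) = partial_derivs [i, j] (laplacian w)"
proof
  fix x
  have commute: "partial_deriv i (partial_deriv j f) = partial_deriv j (partial_deriv i f)" if "smooth f" for f :: "real ^ 'a \<Rightarrow> real" and i j
    using partial_deriv_commute[OF that] by blast
  have s: "smooth (partial_derivs is w)" for "is" by (rule smooth_partial_derivs[OF w])
  have s2: "smooth (partial_deriv a (partial_deriv b w))" "smooth (partial_deriv c (partial_deriv a (partial_deriv b w)))" for a b c
    using s[of "[a, b]"] s[of "[c, a, b]"] by auto
  have c1: "partial_derivs [k, k, i, j] w = partial_derivs [i, j, k, k] w" for k
  proof -
    have "partial_derivs [k, k, i, j] w = partial_derivs [k, i, k, j] w"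
      using commute[OF s[of "[j]"], of k i] by simp
    also have "\<dots> = partial_derivs [i, k, k, j] w"
      using commute[OF s[of "[k, j]"], of k i] by simp
    also have "\<dots> = partial_derivs [i, k, j, k] w"
      using commute[OF w, of k j] by simp
    also have "\<dots> = partial_derivs [i, j, k, k] w"
      using commute[OF s[of "[k]"], of k j] by simp
    finally show ?thesis .
  qed
  have "partial_deriv j (laplacian w) = (\<lambda>x. \<Sum>k\<in>UNIV. partial_derivs [j, k, k] w x)"
    unfolding laplacian_def[abs_def] by (rule ext, subst partial_deriv_sum) (use s2 in auto)
  then have "partial_derivs [i, j] (laplacian w) x = partial_deriv i (\<lambda>x. \<Sum>k\<in>UNIV. partial_derivs [j, k, k] w x) x" by simp
  also have "\<dots> = (\<Sum>k\<in>UNIV. partial_derivs [i, j, k, k] w x)"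
    by (subst partial_deriv_sum) (use s2 in auto)
  finally show "laplacian (partial_derivs [i, j] w) x = partial_derivs [i, j] (laplacian w) x"
    by (simp only: laplacian_def partial_derivs_append[symmetric] append_Cons append_Nil c1)
qed

section \<open>Far field: averages at scales above one\<close>

definition bump_avg :: "real \<Rightarrow> (real ^ 'n::finite \<Rightarrow> real) \<Rightarrow> real ^ 'n \<Rightarrow> real" where
  "bump_avg t q x = (\<integral>z. bump z * q (x - t *\<^sub>R z) \<partial>lborel)"

lemma bump_avg_0: "bump_avg 0 q x = q x"
  by (simp add: bump_avg_def integral_bump)

text \<open>The derivative in \<open>t\<close> is \<open>t\<close> times an average of
  \<open>D_ij\<close> of the Laplacian. Both derivatives are moved onto \<open>bump_pot\<close>,
  each at the price of \<open>1 / t\<close>, so that the Laplacian remains without further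
  derivatives and the net factor is \<open>1 / t\<close>.\<close>

lemma bump_avg_second_deriv_derivative:
  assumes w: "smooth w" and t: "0 < t"
  shows "((\<lambda>t. bump_avg t (partial_derivs [i, j] w) x) has_real_derivative
    (\<integral>z. partial_derivs [j, i] bump_pot z * laplacian w (x - t *\<^sub>R z) \<partial>lborel) / t) (at t)"
proof -
  let ?f = "laplacian w" and ?k = "bump_pot"
  have f: "smooth ?f" by (rule smooth_laplacian[OF w])
  let ?g = "\<lambda>z. ?f (x - t *\<^sub>R z)"
  have g: "smooth ?g" by (rule smooth_dilate[OF f])
  have "(\<integral>z. partial_derivs [j, i] ?k z * ?g z \<partial>lborel) = - (\<integral>z. partial_deriv i ?k z * partial_deriv j ?g z \<partial>lborel)"
    using integral_by_parts[OF test_function_partial_deriv[OF test_function_bump_pot] g, of j i] by simp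
  also have "\<dots> = (\<integral>z. ?k z * partial_derivs [i, j] ?g z \<partial>lborel)"
    using integral_by_parts[OF test_function_bump_pot smooth_partial_deriv[OF g], of i j] by simp
  also have "\<dots> = (\<integral>z. t\<^sup>2 * (?k z * partial_derivs [i, j] ?f (x - t *\<^sub>R z)) \<partial>lborel)"
    unfolding partial_derivs_dilate[OF f]
    by (intro Bochner_Integration.integral_cong refl) (simp add: ac_simps power2_eq_square)
  also have "\<dots> = t\<^sup>2 * (\<integral>z. ?k z * laplacian (partial_derivs [i, j] w) (x - t *\<^sub>R z) \<partial>lborel)"
    unfolding laplacian_partial_derivs_commute[OF w] by (rule integral_mult_right_zero)
  finally have "(\<integral>z. partial_derivs [j, i] ?k z * ?g z \<partial>lborel) / t =
      t * (\<integral>z. ?k z * laplacian (partial_derivs [i, j] w) (x - t *\<^sub>R z) \<partial>lborel)"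
    using t by (simp add: power2_eq_square)
  then show ?thesis
    using bump_avg_derivative[OF smooth_partial_derivs[OF w, of "[i, j]"], of x t] by (simp add: bump_avg_def)
qed

text \<open>\<open>bump\<close> is bounded and supported in the unit ball; for \<open>x\<close> in
  the unit cube and \<open>t \<ge> 1\<close> the points \<open>x - t *\<^sub>R z\<close> stay in
  \<open>ccube (2 * t)\<close>, over which the means of \<open>H\<close> tend to zero.\<close>

lemma bump_avg_decay:
  fixes H :: "real ^ 'n::finite \<Rightarrow> real"
  assumes H: "smooth H"
    and decay: "vanishing_means H"
    and x: "x \<in> ccube 1"
  shows "((\<lambda>t. bump_avg t H x) \<longlongrightarrow> 0) at_top"
proof -
  obtain K where K: "0 \<le> K" "\<And>z. \<bar>bump (z :: real ^ 'n)\<bar> \<le> K" using test_function_bounded[OF test_function_bump] by blast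
  have cH: "continuous_on UNIV (\<lambda>y. \<bar>H y\<bar>)" using smooth_continuous_on[OF H] by (intro continuous_intros)
  have bd: "norm (bump_avg t H x) \<le> K * 2 ^ CARD('n) * ((\<integral>y. indicator (ccube (2 * t)) y * \<bar>H y\<bar> \<partial>lborel) / (2 * t) ^ CARD('n))"
    if t: "1 \<le> t" for t
  proof -
    have cHt: "continuous_on UNIV (\<lambda>z. \<bar>H (x - t *\<^sub>R z)\<bar>)"
      using smooth_continuous_on[OF smooth_dilate[OF H]] by (intro continuous_intros)
    have "norm (bump_avg t H x) \<le> (\<integral>z. K * (indicator (ccube 1) z * \<bar>H (x - t *\<^sub>R z)\<bar>) \<partial>lborel)"
      unfolding bump_avg_def
    proof (rule integral_norm_le)
      fix z
      show "norm (bump z * H (x - t *\<^sub>R z)) \<le> K * (indicator (ccube 1) z * \<bar>H (x - t *\<^sub>R z)\<bar>)"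
        using K(2)[of z] bump_eq_0[of z] notin_ccube_norm[of z 1]
        by (cases "z \<in> ccube 1") (auto simp: abs_mult mult_right_mono)
    qed (use integrable_dilate[OF test_function_bump H] integrable_ccube[OF cHt] in auto)
    also have "\<dots> = K * (\<integral>z. indicator (ccube 1) z * \<bar>H (x - t *\<^sub>R z)\<bar> \<partial>lborel)" by simp
    also have "(\<integral>z. indicator (ccube 1) z * \<bar>H (x - t *\<^sub>R z)\<bar> \<partial>lborel) \<le> (\<integral>y. indicator (ccube (2 * t)) y * \<bar>H y\<bar> \<partial>lborel) / t ^ CARD('n)"
    proof -
      let ?g = "\<lambda>y. indicator (ccube (2 * t)) y * \<bar>H y\<bar>"
      have le: "indicator (ccube 1) z * \<bar>H (x - t *\<^sub>R z)\<bar> \<le> ?g (x + (- t) *\<^sub>R z)" for z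
      proof (cases "z \<in> ccube 1")
        case True
        have "\<bar>x $ i - t * z $ i\<bar> \<le> 2 * t" for i
        proof -
          have "\<bar>x $ i\<bar> \<le> 1" "\<bar>z $ i\<bar> \<le> 1" using True x by (auto simp: mem_ccube)
          then have "\<bar>t * z $ i\<bar> \<le> t" using t by (simp add: abs_mult mult_left_le)
          with \<open>\<bar>x $ i\<bar> \<le> 1\<close> t show ?thesis by linarith
        qed
        then have "x - t *\<^sub>R z \<in> ccube (2 * t)" by (simp add: mem_ccube)
        then show ?thesis by (simp add: indicator_def)
      qed simp
      have sm: "smooth (\<lambda>z. H (x + (- t) *\<^sub>R z))" by (rule smooth_affine[OF H])
      have "integrable lborel ?g" by (rule integrable_ccube[OF cH])
      then have "integrable lborel (\<lambda>z. ?g (x + (- t) *\<^sub>R z))"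
      proof -
        have "(\<lambda>z. ?g (x + (- t) *\<^sub>R z)) = (\<lambda>z. indicator {z. x + (- t) *\<^sub>R z \<in> ccube (2 * t)} z * \<bar>H (x + (- t) *\<^sub>R z)\<bar>)"
          by (auto simp: indicator_def fun_eq_iff)
        moreover have "compact {z. x + (- t) *\<^sub>R z \<in> ccube (2 * t)}"
        proof -
          have "{z. x + (- t) *\<^sub>R z \<in> ccube (2 * t)} = (\<lambda>y. (1 / t) *\<^sub>R (x - y)) ` ccube (2 * t)"
          proof (intro set_eqI iffI)
            fix z assume "z \<in> {z. x + (- t) *\<^sub>R z \<in> ccube (2 * t)}"
            then show "z \<in> (\<lambda>y. (1 / t) *\<^sub>R (x - y)) ` ccube (2 * t)"
              using t by (intro image_eqI[of _ _ "x + (- t) *\<^sub>R z"]) auto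
          qed (use t in auto)
          then show ?thesis by (auto intro!: compact_continuous_image continuous_intros compact_ccube)
        qed
        ultimately show ?thesis
          using borel_integrable_compact[of "{z. x + (- t) *\<^sub>R z \<in> ccube (2 * t)}" "\<lambda>z. \<bar>H (x + (- t) *\<^sub>R z)\<bar>"]
            continuous_on_rabs[OF smooth_continuous_on[OF sm]] by simp
      qed
      then have "(\<integral>z. indicator (ccube 1) z * \<bar>H (x - t *\<^sub>R z)\<bar> \<partial>lborel) \<le> (\<integral>z. ?g (x + (- t) *\<^sub>R z) \<partial>lborel)"
        using le by (intro integral_mono integrable_ccube cHt) auto
      also have "\<dots> = (\<integral>y. ?g y \<partial>lborel) / t ^ CARD('n)"
        using lborel_integral_affine[of "- t" ?g x] t by simp
      finally show ?thesis .
    qed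
    finally show ?thesis using K t by (simp add: mult_left_mono power_mult_distrib)
  qed
  have "filterlim (\<lambda>t::real. 2 * t) at_top at_top"
    by (rule filterlim_tendsto_pos_mult_at_top[OF tendsto_const]) (auto simp: filterlim_ident)
  from filterlim_compose[OF decay this]
  have "((\<lambda>t. K * 2 ^ CARD('n) * ((\<integral>y. indicator (ccube (2 * t)) y * \<bar>H y\<bar> \<partial>lborel) / (2 * t) ^ CARD('n))) \<longlongrightarrow> K * 2 ^ CARD('n) * 0) at_top"
    by (intro tendsto_mult tendsto_const)
  then have "((\<lambda>t. K * 2 ^ CARD('n) * ((\<integral>y. indicator (ccube (2 * t)) y * \<bar>H y\<bar> \<partial>lborel) / (2 * t) ^ CARD('n))) \<longlongrightarrow> 0) at_top" by simp
  then show ?thesis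
    by (rule Lim_null_comparison[rotated]) (use bd in \<open>auto intro!: eventually_at_top_linorderI[of 1]\<close>)
qed

text \<open>A shift of \<open>z\<close> by \<open>x / t\<close> makes both averages see the
  Laplacian at the same points; they then differ in the kernel only, by at most its Lipschitz
  constant times \<open>norm x / t\<close>. So the derivative in \<open>t\<close> of the difference
  of the averages is at most \<open>C * m / t\<^sup>2\<close>, which is integrable up to infinity,
  where the difference vanishes.\<close>

lemma far_field:
  fixes i j :: "'n::finite"
  obtains C where "0 \<le> C"
    "\<And>w m x. smooth w \<Longrightarrow> 0 < m \<Longrightarrow>
      (\<And>r. 1 \<le> r \<Longrightarrow> (\<integral>y. indicator (ccube r) y * (laplacian w y)\<^sup>2 \<partial>lborel) \<le> m\<^sup>2 * (2 * r) ^ CARD('n)) \<Longrightarrow>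
      vanishing_means (partial_derivs [i, j] w) \<Longrightarrow>
      x \<in> ccube 1 \<Longrightarrow>
      \<bar>bump_avg 1 (partial_derivs [i, j] w) x - bump_avg 1 (partial_derivs [i, j] w) (0 :: real ^ 'n)\<bar> \<le> C * m"
proof -
  let ?n = "CARD('n)"
  let ?k = "partial_derivs [j, i] (bump_pot :: real ^ 'n \<Rightarrow> real)"
  have tk: "test_function ?k" by (rule test_function_partial_derivs[OF test_function_bump_pot])
  obtain L where L: "0 \<le> L" "\<And>x h. \<bar>?k (x + h) - ?k x\<bar> \<le> L * norm h" using test_function_Lipschitz[OF tk] by blast
  have k0: "?k z = 0" if "1 < norm z" for z
    by (rule partial_derivs_support[OF test_function_smooth[OF test_function_bump_pot] _ that]) (simp add: bump_pot_eq_0)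
  \<comment> \<open>\<open>L\<close> is the Lipschitz constant, \<open>real ?n\<close> bounds the
    norm on the unit cube, and \<open>4 ^ ?n\<close> is the volume of \<open>ccube (2 * t)\<close>
    divided by \<open>t ^ ?n\<close>.\<close>
  define C where "C = L * real ?n * 4 ^ ?n"
  show ?thesis
  proof (rule that[of C])
    show "0 \<le> C" using L by (simp add: C_def)
    fix w :: "real ^ 'n \<Rightarrow> real" and m and x :: "real ^ 'n"
    assume w: "smooth w" and m: "0 < m"
      and sq: "\<And>r. 1 \<le> r \<Longrightarrow> (\<integral>y. indicator (ccube r) y * (laplacian w y)\<^sup>2 \<partial>lborel) \<le> m\<^sup>2 * (2 * r) ^ ?n"
      and decay: "vanishing_means (partial_derivs [i, j] w)"
      and x: "x \<in> ccube 1"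
    let ?H = "partial_derivs [i, j] w" and ?f = "laplacian w"
    have f: "smooth ?f" by (rule smooth_laplacian[OF w])
    have cf: "continuous_on UNIV ?f" "continuous_on UNIV (\<lambda>z. \<bar>?f z\<bar>)"
      using smooth_continuous_on[OF f] by (auto intro: continuous_intros)
    define g where "g t = bump_avg t ?H x - bump_avg t ?H 0" for t
    define g' where "g' t = ((\<integral>z. ?k z * ?f (x - t *\<^sub>R z) \<partial>lborel) - (\<integral>z. ?k z * ?f (0 - t *\<^sub>R z) \<partial>lborel)) / t" for t
    have der: "(g has_real_derivative g' t) (at t)" if "0 < t" for t
      unfolding g_def g'_def diff_divide_distrib
      by (intro DERIV_diff bump_avg_second_deriv_derivative w that)
    have bd: "\<bar>g' t\<bar> \<le> C * m / t\<^sup>2" if t: "1 \<le> t" for t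
    proof -
      have cft: "continuous_on UNIV (\<lambda>z. \<bar>?f (- t *\<^sub>R z)\<bar>)"
        using smooth_continuous_on[OF smooth_affine[OF f, of 0 "-t"]] by (auto intro: continuous_intros)
      have i1: "integrable lborel (\<lambda>z. ?k ((1 / t) *\<^sub>R x + z) * ?f (- t *\<^sub>R z))"
      proof -
        have "test_function (\<lambda>z. ?k ((1 / t) *\<^sub>R x + 1 *\<^sub>R z))"
        proof (rule test_functionI[OF smooth_affine[OF test_function_smooth[OF tk]]])
          fix z :: "real ^ 'n" assume "1 + norm ((1 / t) *\<^sub>R x) < norm z"
          then have "1 < norm ((1 / t) *\<^sub>R x + 1 *\<^sub>R z)"
            using norm_diff_ineq[of z "(1 / t) *\<^sub>R x"] by (simp add: add.commute)
          then show "?k ((1 / t) *\<^sub>R x + 1 *\<^sub>R z) = 0" by (rule k0)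
        qed
        from integrable_dilate[OF this f, of 0 t] show ?thesis by simp
      qed
      have i2: "integrable lborel (\<lambda>z. ?k z * ?f (- t *\<^sub>R z))"
        using integrable_dilate[OF tk f, of 0 t] by simp
      have "(\<integral>z. ?k z * ?f (x - t *\<^sub>R z) \<partial>lborel) = (\<integral>z. ?k ((1 / t) *\<^sub>R x + z) * ?f (x - t *\<^sub>R ((1 / t) *\<^sub>R x + z)) \<partial>lborel)"
        by (rule lborel_integral_translate[symmetric, of "\<lambda>z. ?k z * ?f (x - t *\<^sub>R z)"])
      also have "\<dots> = (\<integral>z. ?k ((1 / t) *\<^sub>R x + z) * ?f (- t *\<^sub>R z) \<partial>lborel)"
        using t by (simp add: scaleR_right_distrib)
      finally have "(\<integral>z. ?k z * ?f (x - t *\<^sub>R z) \<partial>lborel) - (\<integral>z. ?k z * ?f (0 - t *\<^sub>R z) \<partial>lborel) =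
        (\<integral>z. (?k ((1 / t) *\<^sub>R x + z) * ?f (- t *\<^sub>R z) - ?k z * ?f (- t *\<^sub>R z)) \<partial>lborel)"
        using i1 i2 by (simp del: partial_derivs.simps)
      also have "norm \<dots> \<le> (\<integral>z. (L * (real ?n / t)) * (indicator (ccube 2) z * \<bar>?f (- t *\<^sub>R z)\<bar>) \<partial>lborel)"
      proof (rule integral_norm_le)
        show "integrable lborel (\<lambda>z. ?k ((1 / t) *\<^sub>R x + z) * ?f (- t *\<^sub>R z) - ?k z * ?f (- t *\<^sub>R z))"
          using i1 i2 by (intro Bochner_Integration.integrable_diff)
        show "integrable lborel (\<lambda>z. (L * (real ?n / t)) * (indicator (ccube 2) z * \<bar>?f (- t *\<^sub>R z)\<bar>))"
          by (intro integrable_mult_right integrable_ccube cft)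
        fix z
        have nx: "norm ((1 / t) *\<^sub>R x) \<le> real ?n / t"
          using ccube_norm_le[OF x] t by (simp add: divide_right_mono)
        have "\<bar>?k ((1 / t) *\<^sub>R x + z) - ?k z\<bar> \<le> (L * (real ?n / t)) * indicator (ccube 2) z"
        proof (cases "z \<in> ccube 2")
          case True
          have "\<bar>?k ((1 / t) *\<^sub>R x + z) - ?k z\<bar> \<le> L * norm ((1 / t) *\<^sub>R x)"
            using L(2)[of z "(1 / t) *\<^sub>R x"] by (simp only: add.commute)
          also have "\<dots> \<le> L * (real ?n / t)" using nx L(1) by (intro mult_left_mono)
          finally show ?thesis using True by simp
        next
          case False
          \<comment> \<open>A coordinate of \<open>z\<close> above 2 in modulus stays above 1 after
            the shift by \<open>x / t\<close>, so both kernel values vanish.\<close>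
          then obtain l where l: "2 < \<bar>z $ l\<bar>" by (auto simp: mem_ccube not_le)
          have "\<bar>x $ l / t\<bar> \<le> 1" using x t by (simp add: mem_ccube abs_mult divide_le_eq) (meson order_trans)
          then have "1 < \<bar>x $ l / t + z $ l\<bar>" using l by linarith
          then have "1 < \<bar>((1 / t) *\<^sub>R x + z) $ l\<bar>" by simp
          then have "1 < norm ((1 / t) *\<^sub>R x + z)" using component_le_norm_cart less_le_trans by blast
          moreover have "1 < norm z" using l component_le_norm_cart[of z l] by linarith
          ultimately show ?thesis using k0 False by (simp del: partial_derivs.simps)
        qed
        from mult_right_mono[OF this, of "\<bar>?f (- t *\<^sub>R z)\<bar>"]
        show "norm (?k ((1 / t) *\<^sub>R x + z) * ?f (- t *\<^sub>R z) - ?k z * ?f (- t *\<^sub>R z)) \<le>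
          (L * (real ?n / t)) * (indicator (ccube 2) z * \<bar>?f (- t *\<^sub>R z)\<bar>)"
          unfolding left_diff_distrib[symmetric] real_norm_def abs_mult by (simp only: mult.assoc)
      qed
      also have "\<dots> = (L * (real ?n / t)) * ((\<integral>y. indicator (ccube (t * 2)) y * \<bar>?f y\<bar> \<partial>lborel) / t ^ ?n)"
        using integral_ccube_dilate[of t 2 "\<lambda>y. \<bar>?f y\<bar>"] t by simp
      also have "(\<integral>y. indicator (ccube (t * 2)) y * \<bar>?f y\<bar> \<partial>lborel) \<le> m * ((2 * (t * 2)) ^ ?n + (2 * (t * 2)) ^ ?n) / 2"
        by (rule integral_abs_le_of_square[OF cf(1) m]) (use t in simp, rule sq, use t in simp)
      also have "m * ((2 * (t * 2)) ^ ?n + (2 * (t * 2)) ^ ?n) / 2 = (m * 4 ^ ?n) * t ^ ?n"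
      proof -
        have "2 * (t * 2) = 4 * t" by simp
        then show ?thesis by (simp only: power_mult_distrib) simp
      qed
      finally have "norm ((\<integral>z. ?k z * ?f (x - t *\<^sub>R z) \<partial>lborel) - (\<integral>z. ?k z * ?f (0 - t *\<^sub>R z) \<partial>lborel)) \<le> (L * (real ?n / t)) * (m * 4 ^ ?n)"
        using L t by (simp add: mult_left_mono divide_right_mono)
      from divide_right_mono[OF this, of t] have "\<bar>g' t\<bar> \<le> ((L * (real ?n / t)) * (m * 4 ^ ?n)) / t"
        unfolding g'_def abs_divide using t by (simp del: partial_derivs.simps)
      also have "\<dots> = C * m / t\<^sup>2" by (simp add: C_def power2_eq_square field_simps)
      finally show ?thesis .
    qed
    have "\<bar>g 1\<bar> \<le> C * m + \<bar>g s\<bar>" if s: "1 \<le> s" for s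
    proof -
      \<comment> \<open>The bound for \<open>g'\<close> is integrated by comparison with an
        antiderivative: this function plus or minus \<open>g\<close> is nondecreasing.\<close>
      have d1: "((\<lambda>t. - (C * m) / t) has_real_derivative C * m / t\<^sup>2) (at t)" if "0 < t" for t :: real
        using that by (auto intro!: derivative_eq_intros simp: power2_eq_square)
      have "- (C * m) / 1 - g 1 \<le> - (C * m) / s - g s"
      proof (rule DERIV_nonneg_imp_nondecreasing[OF s])
        fix t assume t: "1 \<le> t" "t \<le> s"
        then show "\<exists>y. ((\<lambda>t. - (C * m) / t - g t) has_real_derivative y) (at t) \<and> 0 \<le> y"
          using bd[of t] by (intro exI[of _ "C * m / t\<^sup>2 - g' t"] conjI DERIV_diff d1 der) auto
      qed
      moreover have "- (C * m) / 1 + g 1 \<le> - (C * m) / s + g s"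
      proof (rule DERIV_nonneg_imp_nondecreasing[OF s])
        fix t assume t: "1 \<le> t" "t \<le> s"
        then show "\<exists>y. ((\<lambda>t. - (C * m) / t + g t) has_real_derivative y) (at t) \<and> 0 \<le> y"
          using bd[of t] by (intro exI[of _ "C * m / t\<^sup>2 + g' t"] conjI DERIV_add d1 der) auto
      qed
      moreover have "0 \<le> C * m / s" using s m \<open>0 \<le> C\<close> by simp
      ultimately show ?thesis by simp
    qed
    then have "\<forall>\<^sub>F s in at_top. \<bar>g 1\<bar> \<le> C * m + \<bar>g s\<bar>" by (auto intro!: eventually_at_top_linorderI[of 1])
    moreover have "(g \<longlongrightarrow> 0 - 0) at_top"
      unfolding g_def[abs_def]
      by (intro tendsto_diff bump_avg_decay smooth_partial_derivs w decay x) (simp add: mem_ccube)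
    then have "((\<lambda>s. C * m + \<bar>g s\<bar>) \<longlongrightarrow> C * m + \<bar>0 - 0\<bar>) at_top" by (intro tendsto_intros)
    ultimately have "\<bar>g 1\<bar> \<le> C * m + \<bar>0 - 0\<bar>"
      by (intro tendsto_le[OF _ _ tendsto_const]) auto
    then show "\<bar>bump_avg 1 ?H x - bump_avg 1 ?H 0\<bar> \<le> C * m" by (simp add: g_def)
  qed
qed

section \<open>Near field: a localized parametrix of the Laplacian\<close>

lemma bump_pot_average_FTC:
  fixes q :: "real ^ 'n::finite \<Rightarrow> real"
  assumes q: "smooth q"
  shows "(\<integral>t. indicator {0..1} t * (t * (\<integral>z. bump_pot z * laplacian q (x - t *\<^sub>R z) \<partial>lborel)) \<partial>lborel) = bump_avg 1 q x - q x"
proof -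
  let ?g = "\<lambda>t. t * (\<integral>z. bump_pot z * laplacian q (x - t *\<^sub>R z) \<partial>lborel)"
  have c: "continuous_on {0..1} ?g"
  proof (intro continuous_intros continuous_at_imp_continuous_on ballI)
    fix t
    show "isCont (\<lambda>t. \<integral>z. bump_pot z * laplacian q (x - t *\<^sub>R z) \<partial>lborel) t"
      by (rule DERIV_isCont) (rule dilated_avg_derivative[OF test_function_bump_pot smooth_laplacian[OF q]])
  qed
  have "(\<integral>t. indicator {0..1} t *\<^sub>R ?g t \<partial>lborel) = bump_avg 1 q x - bump_avg 0 q x"
  proof (rule integral_FTC_atLeastAtMost[OF _ _ c])
    fix t :: real
    have "((\<lambda>t. bump_avg t q x) has_real_derivative ?g t) (at t)"
      unfolding bump_avg_def by (rule bump_avg_derivative[OF q])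
    then show "((\<lambda>t. bump_avg t q x) has_vector_derivative ?g t) (at t within {0..1})"
      by (simp add: has_real_derivative_iff_has_vector_derivative has_vector_derivative_at_within)
  qed simp
  then show ?thesis by (simp add: bump_avg_0)
qed

definition newton_weight :: "real \<times> (real ^ 'n::finite) \<Rightarrow> real" where
  "newton_weight w = indicator {0..1} (fst w) * fst w * bump_pot (snd w)"

text \<open>A parametrix of the Laplacian: \<open>laplacian_newton\<close> shows that its Laplacian
  is \<open>bump_avg 1 F - F\<close>. Unlike the Newtonian potential it preserves compact support,
  as it looks no further than distance one, so the energy identity is available for it. The product
  measure makes it an instance of \<open>bounded_translation\<close>.\<close>

definition newton :: "(real ^ 'n::finite \<Rightarrow> real) \<Rightarrow> real ^ 'n \<Rightarrow> real" where
  "newton F x = (\<integral>w. newton_weight w * F (x - fst w *\<^sub>R snd w) \<partial>(lborel \<Otimes>\<^sub>M lborel))"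

lemma newton_weight_integrable: "integrable (lborel \<Otimes>\<^sub>M lborel) (newton_weight :: real \<times> (real ^ 'n::finite) \<Rightarrow> real)"
proof -
  obtain K where K: "0 \<le> K" "\<And>z. \<bar>bump_pot (z :: real ^ 'n)\<bar> \<le> K"
    using test_function_bounded[OF test_function_bump_pot] by blast
  have [measurable]: "(bump_pot :: real ^ 'n \<Rightarrow> real) \<in> borel_measurable borel"
    by (rule smooth_measurable[OF test_function_smooth[OF test_function_bump_pot]])
  have "compact ({0..1::real} \<times> cball (0 :: real ^ 'n) 1)" by (intro compact_Times) auto
  from emeasure_compact_finite[OF this]
  have int: "integrable (lborel \<Otimes>\<^sub>M lborel) (\<lambda>w. K * indicator ({0..1::real} \<times> cball (0 :: real ^ 'n) 1) w)"
    unfolding lborel_prod by (auto intro!: integrable_real_indicator borel_closed closed_Times)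
  show ?thesis
  proof (rule Bochner_Integration.integrable_bound[OF int])
    show "newton_weight \<in> borel_measurable (lborel \<Otimes>\<^sub>M (lborel :: (real ^ 'n) measure))"
      unfolding newton_weight_def[abs_def] by measurable
    show "AE w in lborel \<Otimes>\<^sub>M lborel. norm (newton_weight w) \<le> norm (K * indicator ({0..1::real} \<times> cball (0 :: real ^ 'n) 1) w)"
    proof (rule AE_I2)
      fix w :: "real \<times> (real ^ 'n)"
      have "\<bar>fst w\<bar> * \<bar>bump_pot (snd w)\<bar> \<le> 1 * K" if "fst w \<in> {0..1}"
        using that K by (intro mult_mono) auto
      then show "norm (newton_weight w) \<le> norm (K * indicator ({0..1::real} \<times> cball (0 :: real ^ 'n) 1) w)"
        using K(1) bump_pot_eq_0[of "snd w"]
        by (cases w) (auto simp: newton_weight_def abs_mult indicator_def not_le)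
    qed
  qed
qed

lemma newton_support: "newton_weight w \<noteq> 0 \<Longrightarrow> norm (fst w *\<^sub>R snd w) \<le> 1"
proof -
  assume "newton_weight w \<noteq> 0"
  then have "0 \<le> fst w" "fst w \<le> 1" "bump_pot (snd w) \<noteq> 0"
    by (auto simp: newton_weight_def indicator_def split: if_splits)
  moreover from this have "norm (snd w) < 1" using bump_pot_eq_0[of "snd w"] by fastforce
  ultimately show ?thesis by (simp add: mult_le_one)
qed

lemma newton_partial_derivs:
  assumes F: "smooth F"
  shows "smooth (newton F)" "partial_derivs is (newton F) = newton (partial_derivs is F)"
proof -
  have Y: "(\<lambda>w. fst w *\<^sub>R snd w) \<in> borel_measurable (lborel \<Otimes>\<^sub>M lborel)" by measurable
  show "smooth (newton F)"
    unfolding newton_def[abs_def]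
    by (rule bounded_translation(1)[OF newton_weight_integrable Y F newton_support])
  show "partial_derivs is (newton F) = newton (partial_derivs is F)"
    unfolding newton_def[abs_def]
    by (rule bounded_translation(2)[OF newton_weight_integrable Y F newton_support])
qed

lemma newton_eq:
  fixes F :: "real ^ 'n::finite \<Rightarrow> real"
  assumes F: "smooth F"
  shows "newton F x = (\<integral>t. indicator {0..1} t * (t * (\<integral>z. bump_pot z * F (x - t *\<^sub>R z) \<partial>lborel)) \<partial>lborel)"
proof -
  have Y: "(\<lambda>w. fst w *\<^sub>R snd w) \<in> borel_measurable (lborel \<Otimes>\<^sub>M (lborel :: (real ^ 'n) measure))" by measurable
  have "integrable (lborel \<Otimes>\<^sub>M lborel) (\<lambda>w. newton_weight w * F (x - fst w *\<^sub>R snd w))"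
    by (rule bounded_translation(3)[OF newton_weight_integrable Y F newton_support])
  from lborel_pair.integral_fst'[OF this]
  have "newton F x = (\<integral>t. (\<integral>z. newton_weight (t, z) * F (x - t *\<^sub>R z) \<partial>lborel) \<partial>lborel)"
    by (simp add: newton_def)
  also have "\<dots> = (\<integral>t. indicator {0..1} t * (t * (\<integral>z. bump_pot z * F (x - t *\<^sub>R z) \<partial>lborel)) \<partial>lborel)"
    by (simp add: newton_weight_def mult.assoc)
  finally show ?thesis .
qed

lemma laplacian_newton:
  assumes F: "smooth F"
  shows "laplacian (newton F) x = bump_avg 1 F x - F x"
proof -
  have Y: "(\<lambda>w. fst w *\<^sub>R snd w) \<in> borel_measurable (lborel \<Otimes>\<^sub>M lborel)" by measurable
  have int: "integrable (lborel \<Otimes>\<^sub>M lborel) (\<lambda>w. newton_weight w * partial_derivs is F (x - fst w *\<^sub>R snd w))" for "is"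
    by (rule bounded_translation(3)[OF newton_weight_integrable Y smooth_partial_derivs[OF F] newton_support])
  have "laplacian (newton F) x = (\<Sum>i\<in>UNIV. newton (partial_derivs [i, i] F) x)"
    by (simp only: laplacian_def newton_partial_derivs(2)[OF F])
  also have "\<dots> = newton (laplacian F) x"
    unfolding newton_def laplacian_def sum_distrib_left
    by (rule Bochner_Integration.integral_sum[symmetric]) (rule int)
  also have "\<dots> = bump_avg 1 F x - F x"
    by (simp only: newton_eq[OF smooth_laplacian[OF F]] bump_pot_average_FTC[OF F])
  finally show ?thesis .
qed

lemma test_function_newton:
  fixes F :: "real ^ 'n::finite \<Rightarrow> real"
  assumes F: "test_function F" shows "test_function (newton F)"
proof -
  obtain R where R: "\<And>x. R < norm x \<Longrightarrow> F x = 0" using test_function_support[OF F] by blast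
  show ?thesis
  proof (rule test_functionI[OF newton_partial_derivs(1)[OF test_function_smooth[OF F]]])
    fix x :: "real ^ 'n" assume x: "R + 1 < norm x"
    have "newton_weight w * F (x - fst w *\<^sub>R snd w) = 0" for w
    proof (cases "newton_weight w = 0")
      case False
      have "R < norm (x - fst w *\<^sub>R snd w)"
        using newton_support[OF False] x norm_triangle_ineq2[of x "fst w *\<^sub>R snd w"] by linarith
      then show ?thesis using R by simp
    qed simp
    then show "newton F x = 0" by (simp only: newton_def Bochner_Integration.integral_zero)
  qed
qed

lemma bump_avg_eq_translation: "bump_avg 1 F = (\<lambda>x. \<integral>z. bump z * F (x - z) \<partial>lborel)"
  by (simp add: bump_avg_def fun_eq_iff)

lemma smooth_bump_avg:
  assumes F: "smooth F" shows "smooth (bump_avg 1 F)"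
  unfolding bump_avg_eq_translation
proof (rule bounded_translation(1)[OF test_function_integrable[OF test_function_bump] _ F])
  show "norm w \<le> 1" if "bump w \<noteq> 0" for w using bump_eq_0[of w] that by fastforce
qed simp

lemma test_function_bump_avg:
  fixes F :: "real ^ 'n::finite \<Rightarrow> real"
  assumes F: "test_function F" shows "test_function (bump_avg 1 F)"
proof -
  obtain R where R: "\<And>x. R < norm x \<Longrightarrow> F x = 0" using test_function_support[OF F] by blast
  show ?thesis
  proof (rule test_functionI[OF smooth_bump_avg[OF test_function_smooth[OF F]]])
    fix x :: "real ^ 'n" assume x: "R + 1 < norm x"
    have "bump w * F (x - w) = 0" for w
    proof (cases "norm w < 1")
      case True
      have "R < norm (x - w)"
        using True x norm_triangle_ineq2[of x w] by linarith
      then show ?thesis using R by simp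
    qed (simp add: bump_eq_0)
    then show "bump_avg 1 F x = 0" by (simp only: bump_avg_eq_translation Bochner_Integration.integral_zero)
  qed
qed

text \<open>Jensen's inequality, obtained by expanding the nonnegative variance of
  \<open>F (x - z)\<close> under the probability density \<open>bump\<close>.\<close>

lemma bump_avg_square_le:
  assumes F: "test_function F"
  shows "(bump_avg 1 F x)\<^sup>2 \<le> bump_avg 1 (\<lambda>y. (F y)\<^sup>2) x"
proof -
  have sF: "smooth F" "smooth (\<lambda>y. (F y)\<^sup>2)"
    using test_function_smooth[OF F] by (auto simp: power2_eq_square intro: smooth_mult)
  have int: "integrable lborel (\<lambda>z. bump z * F (x - z))" "integrable lborel (\<lambda>z. bump z * (F (x - z))\<^sup>2)"
    using integrable_dilate[OF test_function_bump sF(1), of x 1] integrable_dilate[OF test_function_bump sF(2), of x 1] by auto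
  define a where "a = bump_avg 1 F x"
  have a: "a = (\<integral>z. bump z * F (x - z) \<partial>lborel)" by (simp add: a_def bump_avg_eq_translation)
  have "0 \<le> (\<integral>z. bump z * (F (x - z) - a)\<^sup>2 \<partial>lborel)"
    by (intro Bochner_Integration.integral_nonneg mult_nonneg_nonneg bump_nonneg) simp
  also have "\<dots> = (\<integral>z. bump z * (F (x - z))\<^sup>2 - 2 * a * (bump z * F (x - z)) + a\<^sup>2 * bump z \<partial>lborel)"
    by (intro Bochner_Integration.integral_cong) (auto simp: power2_diff algebra_simps)
  also have "\<dots> = (\<integral>z. bump z * (F (x - z))\<^sup>2 \<partial>lborel) - 2 * a * a + a\<^sup>2"
    unfolding Bochner_Integration.integral_add[OF Bochner_Integration.integrable_diff[OF int(2) integrable_mult_right[OF int(1)]]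
        integrable_mult_right[OF test_function_integrable[OF test_function_bump]]]
      Bochner_Integration.integral_diff[OF int(2) integrable_mult_right[OF int(1)]] integral_mult_right_zero a[symmetric] integral_bump
    by simp
  finally show ?thesis by (simp add: bump_avg_eq_translation a_def power2_eq_square)
qed

lemma integral_bump_avg:
  fixes F :: "real ^ 'n::finite \<Rightarrow> real"
  assumes F: "test_function F" and nn: "\<And>x. 0 \<le> F x"
  shows "(\<integral>x. bump_avg 1 F x \<partial>lborel) = (\<integral>x. F x \<partial>lborel)"
proof -
  have [measurable]: "F \<in> borel_measurable borel" "(bump :: real ^ 'n \<Rightarrow> real) \<in> borel_measurable borel"
    by (intro smooth_measurable test_function_smooth F test_function_bump)+
  have "integrable (lborel \<Otimes>\<^sub>M lborel) (\<lambda>(x, z). bump z * F (x - z))"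
  proof (rule lborel_pair.Fubini_integrable)
    show "integrable lborel (\<lambda>x. \<integral>z. norm (case (x, z) of (x, z) \<Rightarrow> bump z * F (x - z)) \<partial>lborel)"
      using test_function_integrable[OF test_function_bump_avg[OF F]]
      by (simp add: bump_avg_eq_translation bump_nonneg nn)
    show "AE x in lborel. integrable lborel (\<lambda>z. case (x, z) of (x, z) \<Rightarrow> bump z * F (x - z))"
      using integrable_dilate[OF test_function_bump test_function_smooth[OF F], of _ 1] by simp
  qed measurable
  from lborel_pair.Fubini_integral[OF this]
  have "(\<integral>x. bump_avg 1 F x \<partial>lborel) = (\<integral>z. (\<integral>x. bump z * F (x - z) \<partial>lborel) \<partial>lborel)"
    by (simp add: bump_avg_eq_translation)
  also have "\<dots> = (\<integral>z. bump (z :: real ^ 'n) * (\<integral>x. F x \<partial>lborel) \<partial>lborel)"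
    using lborel_integral_translate[of F "- _"] by simp
  also have "\<dots> = (\<integral>x. F x \<partial>lborel)" by (simp add: integral_bump)
  finally show ?thesis .
qed

text \<open>The indicator of \<open>ccube 4\<close> is mollified by \<open>bump\<close>, which moves
  points by less than one.\<close>

lemma plateau:
  obtains \<eta> :: "real ^ 'n::finite \<Rightarrow> real" where "test_function \<eta>" "\<And>x. 0 \<le> \<eta> x" "\<And>x. \<eta> x \<le> 1"
    "\<And>x. x \<in> ccube 3 \<Longrightarrow> \<eta> x = 1" "\<And>x. x \<notin> ccube 5 \<Longrightarrow> \<eta> x = 0"
proof -
  let ?\<eta> = "\<lambda>x. \<integral>y. indicator (ccube 4) y * bump (x - y) \<partial>(lborel :: (real ^ 'n) measure)"
  have "integrable lborel (\<lambda>y :: real ^ 'n. indicator (ccube 4) y * indicator (cball 0 R) y :: real)" for R :: real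
  proof -
    have "integrable lborel (indicator (ccube 4 \<inter> cball 0 R) :: real ^ 'n \<Rightarrow> real)"
      using emeasure_compact_finite[OF compact_Int[OF compact_ccube compact_cball], of 4 0 R]
      by (auto intro!: integrable_real_indicator)
    moreover have "indicator (ccube 4 \<inter> cball 0 R) = (\<lambda>y :: real ^ 'n. indicator (ccube 4) y * indicator (cball 0 R) y :: real)"
      by (auto simp: indicator_def fun_eq_iff)
    ultimately show ?thesis by simp
  qed
  from mollification(1)[OF _ this test_function_bump]
  have s: "smooth ?\<eta>" by measurable
  have near: "\<bar>x $ i - y $ i\<bar> < 1" if "bump (x - y) \<noteq> 0" for x y :: "real ^ 'n" and i
  proof -
    have "norm (x - y) < 1" using bump_eq_0[of "x - y"] that by fastforce
    then show ?thesis using component_le_norm_cart[of "x - y" i] by simp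
  qed
  have one: "(\<integral>y. bump (x - y) \<partial>lborel) = 1" for x :: "real ^ 'n"
    using lborel_integral_reflect[of bump x] by (simp add: integral_bump)
  have int: "integrable lborel (\<lambda>y. bump (x - y))" for x :: "real ^ 'n"
  proof -
    have "test_function (\<lambda>y. bump (x + (- 1) *\<^sub>R y))"
    proof (rule test_functionI[OF smooth_affine[OF test_function_smooth[OF test_function_bump]]])
      fix y :: "real ^ 'n" assume "1 + norm x < norm y"
      then have "1 \<le> norm (x + (- 1) *\<^sub>R y)" using norm_triangle_ineq3[of x y] by simp
      then show "bump (x + (- 1) *\<^sub>R y) = 0" by (rule bump_eq_0)
    qed
    from test_function_integrable[OF this] show ?thesis by simp
  qed
  have zero: "?\<eta> x = 0" if "x \<notin> ccube 5" for x
  proof -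
    have "indicator (ccube 4) y * bump (x - y) = 0" for y
    proof (rule ccontr)
      assume "\<not> ?thesis"
      then have y: "y \<in> ccube 4" "bump (x - y) \<noteq> 0" by (auto simp: indicator_def split: if_splits)
      have "\<bar>x $ i\<bar> \<le> 5" for i
      proof -
        have "\<bar>y $ i\<bar> \<le> 4" using y(1) by (simp add: mem_ccube)
        then show ?thesis using near[OF y(2), of i] by linarith
      qed
      then show False using that by (simp add: mem_ccube)
    qed
    then show ?thesis by (simp only: Bochner_Integration.integral_zero)
  qed
  show thesis
  proof (rule that[of ?\<eta>])
    show "test_function ?\<eta>"
    proof (rule test_functionI[OF s])
      fix x :: "real ^ 'n" assume "real CARD('n) * 5 < norm x"
      then have "x \<notin> ccube 5" using ccube_norm_le[of x 5] by fastforce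
      then show "?\<eta> x = 0" by (rule zero)
    qed
    show "0 \<le> ?\<eta> x" for x by (intro Bochner_Integration.integral_nonneg mult_nonneg_nonneg bump_nonneg) simp
    show "?\<eta> x \<le> 1" for x
    proof -
      have "?\<eta> x \<le> (\<integral>y. bump (x - y) \<partial>lborel)"
        by (rule integral_mono'[OF int]) (auto simp: indicator_def bump_nonneg)
      then show ?thesis by (simp only: one)
    qed
    show "?\<eta> x = 1" if x: "x \<in> ccube 3" for x
    proof -
      have "indicator (ccube 4) y * bump (x - y) = bump (x - y)" for y
      proof (cases "bump (x - y) = 0")
        case False
        have "\<bar>y $ i\<bar> \<le> 4" for i
        proof -
          have "\<bar>x $ i\<bar> \<le> 3" using x by (simp add: mem_ccube)
          then show ?thesis using near[OF False, of i] by linarith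
        qed
        then show ?thesis by (simp add: mem_ccube)
      qed simp
      then show ?thesis by (simp only: one)
    qed
  qed (rule zero)
qed

text \<open>On the unit cube the difference is \<open>D_ij\<close> of \<open>newton F\<close>, where
  \<open>F\<close> is the Laplacian of \<open>w\<close> cut off by \<open>\<eta>\<close>. The
  Laplacian of \<open>newton F\<close> is \<open>bump_avg 1 F - F\<close>, so the energy inequality
  bounds the integral of the squared second derivative by 4 times that of the square of
  \<open>F\<close>. The power \<open>10 ^ CARD('n)\<close> is the volume of
  \<open>ccube 5\<close>.\<close>

lemma near_field:
  fixes w :: "real ^ 'n::finite \<Rightarrow> real"
  assumes w: "smooth w" and m: "0 < m"
    and sq: "(\<integral>y. indicator (ccube 5) y * (laplacian w y)\<^sup>2 \<partial>lborel) \<le> m\<^sup>2 * 10 ^ CARD('n)"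
  shows "(\<integral>x. indicator (ccube 1) x * \<bar>bump_avg 1 (partial_derivs [i, j] w) x - partial_derivs [i, j] w x\<bar> \<partial>lborel)
    \<le> m * (4 * 10 ^ CARD('n) + 2 ^ CARD('n)) / 2"
proof -
  let ?f = "laplacian w" and ?n = "CARD('n)"
  have f: "smooth ?f" by (rule smooth_laplacian[OF w])
  obtain \<eta> :: "real ^ 'n \<Rightarrow> real" where \<eta>: "test_function \<eta>" "\<And>x. 0 \<le> \<eta> x" "\<And>x. \<eta> x \<le> 1"
    "\<And>x. x \<in> ccube 3 \<Longrightarrow> \<eta> x = 1" "\<And>x. x \<notin> ccube 5 \<Longrightarrow> \<eta> x = 0" by (rule plateau) blast
  define F where "F x = \<eta> x * ?f x" for x
  have F: "test_function F" unfolding F_def[abs_def] by (rule test_function_mult[OF \<eta>(1) f])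
  note sF = test_function_smooth[OF F]
  let ?V = "newton F"
  have V: "test_function ?V" by (rule test_function_newton[OF F])
  have F2: "test_function (\<lambda>x. (F x)\<^sup>2)"
    using test_function_mult[OF F sF] by (simp add: power2_eq_square)
  have A2: "test_function (\<lambda>x. (bump_avg 1 F x)\<^sup>2)"
    using test_function_mult[OF test_function_bump_avg[OF F] test_function_smooth[OF test_function_bump_avg[OF F]]]
    by (simp add: power2_eq_square)
  have V2: "test_function (\<lambda>x. (partial_derivs [i, j] ?V x)\<^sup>2)"
    using test_function_mult[OF test_function_partial_derivs[OF V] smooth_partial_derivs[OF test_function_smooth[OF V]], of "[i, j]" "[i, j]"]
    by (simp only: power2_eq_square)
  have cV: "continuous_on UNIV (partial_derivs [i, j] ?V)"
    by (rule smooth_continuous_on[OF smooth_partial_derivs[OF test_function_smooth[OF V]]])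
  have eq: "bump_avg 1 (partial_derivs [i, j] w) x - partial_derivs [i, j] w x = partial_derivs [i, j] ?V x" if x: "x \<in> ccube 1" for x
  proof -
    \<comment> \<open>The points \<open>x - t *\<^sub>R z\<close> lie in an open cube on which
      \<open>\<eta>\<close> is one, so the derivatives of \<open>F\<close> and of the Laplacian
      agree there.\<close>
    have loc: "bump_pot z * partial_derivs [i, j] F (x - t *\<^sub>R z) = bump_pot z * partial_derivs [i, j] ?f (x - t *\<^sub>R z)" if t: "t \<in> {0..1}" for t z
    proof (cases "norm z < 1")
      case True
      let ?U = "box (\<chi> i. - 3) (\<chi> i. 3) :: (real ^ 'n) set"
      have "x - t *\<^sub>R z \<in> ?U"
      proof -
        have "- 3 < x $ l - t * z $ l \<and> x $ l - t * z $ l < 3" for l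
        proof -
          have "\<bar>x $ l\<bar> \<le> 1" using x by (simp add: mem_ccube)
          moreover have "\<bar>z $ l\<bar> \<le> 1" using True component_le_norm_cart[of z l] by linarith
          then have "\<bar>t * z $ l\<bar> \<le> 1 * 1" unfolding abs_mult using t by (intro mult_mono) auto
          ultimately show ?thesis by linarith
        qed
        then show ?thesis by (simp add: mem_box_cart)
      qed
      moreover have "F y = ?f y" if "y \<in> ?U" for y
      proof -
        have "\<bar>y $ l\<bar> \<le> 3" for l
        proof -
          have "- 3 < y $ l" "y $ l < 3" using that by (simp_all add: mem_box_cart)
          then show ?thesis by linarith
        qed
        then have "y \<in> ccube 3" by (simp add: mem_ccube)
        then show ?thesis by (simp add: F_def \<eta>(4))
      qed
      ultimately show ?thesis using partial_derivs_cong_open[OF open_box _ sF, of "\<chi> i. - 3" "\<chi> i. 3" ?f] by metis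
    qed (simp add: bump_pot_eq_0)
    have "partial_derivs [i, j] ?V x = newton (partial_derivs [i, j] F) x"
      by (simp only: newton_partial_derivs(2)[OF sF])
    also have "\<dots> = (\<integral>t. indicator {0..1} t * (t * (\<integral>z. bump_pot z * partial_derivs [i, j] F (x - t *\<^sub>R z) \<partial>lborel)) \<partial>lborel)"
      by (rule newton_eq[OF smooth_partial_derivs[OF sF]])
    also have "\<dots> = (\<integral>t. indicator {0..1} t * (t * (\<integral>z. bump_pot z * laplacian (partial_derivs [i, j] w) (x - t *\<^sub>R z) \<partial>lborel)) \<partial>lborel)"
    proof (rule Bochner_Integration.integral_cong[OF refl])
      fix t :: real
      show "indicator {0..1} t * (t * (\<integral>z. bump_pot z * partial_derivs [i, j] F (x - t *\<^sub>R z) \<partial>lborel)) =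
        indicator {0..1} t * (t * (\<integral>z. bump_pot z * laplacian (partial_derivs [i, j] w) (x - t *\<^sub>R z) \<partial>lborel))"
      proof (cases "t \<in> {0..1}")
        case True
        then show ?thesis by (simp only: loc laplacian_partial_derivs_commute[OF w])
      next
        case False
        then have "indicator {0..1} t = (0::real)" by (rule indicator_simps)
        then show ?thesis by (simp only: mult_zero_left)
      qed
    qed
    also have "\<dots> = bump_avg 1 (partial_derivs [i, j] w) x - partial_derivs [i, j] w x"
      by (rule bump_pot_average_FTC[OF smooth_partial_derivs[OF w]])
    finally show ?thesis by simp
  qed
  have "(\<integral>x. (laplacian ?V x)\<^sup>2 \<partial>lborel) \<le> (\<integral>x. 2 * (bump_avg 1 F x)\<^sup>2 + 2 * (F x)\<^sup>2 \<partial>lborel)"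
  proof (rule integral_mono')
    show "integrable lborel (\<lambda>x. 2 * (bump_avg 1 F x)\<^sup>2 + 2 * (F x)\<^sup>2)"
      using test_function_integrable[OF F2] test_function_integrable[OF A2] by simp
    fix x
    have "0 \<le> (bump_avg 1 F x + F x)\<^sup>2" by simp
    then show "(laplacian ?V x)\<^sup>2 \<le> 2 * (bump_avg 1 F x)\<^sup>2 + 2 * (F x)\<^sup>2"
      by (simp add: laplacian_newton[OF sF] power2_sum power2_diff)
  qed simp
  also have "\<dots> = 2 * (\<integral>x. (bump_avg 1 F x)\<^sup>2 \<partial>lborel) + 2 * (\<integral>x. (F x)\<^sup>2 \<partial>lborel)"
    using test_function_integrable[OF F2] test_function_integrable[OF A2] by simp
  also have "(\<integral>x. (bump_avg 1 F x)\<^sup>2 \<partial>lborel) \<le> (\<integral>x. bump_avg 1 (\<lambda>y. (F y)\<^sup>2) x \<partial>lborel)"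
    by (rule integral_mono[OF test_function_integrable[OF A2] test_function_integrable[OF test_function_bump_avg[OF F2]]])
       (rule bump_avg_square_le[OF F])
  also have "\<dots> = (\<integral>x. (F x)\<^sup>2 \<partial>lborel)"
    by (rule integral_bump_avg[OF F2]) simp
  also have "(\<integral>x. (F x)\<^sup>2 \<partial>lborel) \<le> (\<integral>y. indicator (ccube 5) y * (?f y)\<^sup>2 \<partial>lborel)"
  proof (rule integral_mono'[OF integrable_ccube])
    show "continuous_on UNIV (\<lambda>y. (?f y)\<^sup>2)" using smooth_continuous_on[OF f] by (intro continuous_intros)
    fix x
    show "(F x)\<^sup>2 \<le> indicator (ccube 5) x * (?f x)\<^sup>2"
    proof (cases "x \<in> ccube 5")
      case True
      have "(\<eta> x)\<^sup>2 \<le> 1" using \<eta>(2,3)[of x] by (simp add: power_le_one)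
      then have "(\<eta> x)\<^sup>2 * (?f x)\<^sup>2 \<le> 1 * (?f x)\<^sup>2" by (intro mult_right_mono) auto
      then show ?thesis using True by (simp add: F_def power_mult_distrib)
    qed (simp add: F_def \<eta>(5))
  qed simp
  also note sq
  finally have LV: "(\<integral>x. (laplacian ?V x)\<^sup>2 \<partial>lborel) \<le> m\<^sup>2 * (4 * 10 ^ ?n)" by simp
  have "(\<integral>x. indicator (ccube 1) x * (partial_derivs [i, j] ?V x)\<^sup>2 \<partial>lborel) \<le> (\<integral>x. (partial_derivs [i, j] ?V x)\<^sup>2 \<partial>lborel)"
    by (rule integral_mono'[OF test_function_integrable[OF V2]]) (auto simp: indicator_def)
  also have "\<dots> \<le> (\<integral>x. (laplacian ?V x)\<^sup>2 \<partial>lborel)" by (rule second_derivs_energy[OF V])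
  also note LV
  finally have "(\<integral>x. indicator (ccube 1) x * \<bar>partial_derivs [i, j] ?V x\<bar> \<partial>lborel) \<le> m * (4 * 10 ^ ?n + (2 * 1) ^ ?n) / 2"
    by (rule integral_abs_le_of_square[OF cV m zero_le_one])
  moreover have "(\<integral>x. indicator (ccube 1) x * \<bar>bump_avg 1 (partial_derivs [i, j] w) x - partial_derivs [i, j] w x\<bar> \<partial>lborel) =
    (\<integral>x. indicator (ccube 1) x * \<bar>partial_derivs [i, j] ?V x\<bar> \<partial>lborel)"
  proof (rule Bochner_Integration.integral_cong[OF refl])
    fix x
    show "indicator (ccube 1) x * \<bar>bump_avg 1 (partial_derivs [i, j] w) x - partial_derivs [i, j] w x\<bar> =
      indicator (ccube 1) x * \<bar>partial_derivs [i, j] ?V x\<bar>"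
    proof (cases "x \<in> ccube 1")
      case True
      then show ?thesis by (simp only: eq)
    next
      case False
      then have "indicator (ccube 1) x = (0::real)" by (rule indicator_simps)
      then show ?thesis by (simp only: mult_zero_left)
    qed
  qed
  ultimately show ?thesis by simp
qed

text \<open>The constant subtracted is the average at scale one at the origin:
  \<open>near_field\<close> compares the function with its averages at scale one, and
  \<open>far_field\<close> compares these averages at different points.\<close>

proposition unit_oscillation:
  fixes i j :: "'n::finite"
  obtains C where "0 \<le> C"
    "\<And>w m. smooth (w :: real ^ 'n \<Rightarrow> real) \<Longrightarrow> 0 < m \<Longrightarrow>
      (\<And>r. 1 \<le> r \<Longrightarrow> (\<integral>y. indicator (ccube r) y * (laplacian w y)\<^sup>2 \<partial>lborel) \<le> m\<^sup>2 * (2 * r) ^ CARD('n)) \<Longrightarrow>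
      vanishing_means (partial_derivs [i, j] w) \<Longrightarrow>
      (\<integral>x. indicator (ccube 1) x * \<bar>partial_derivs [i, j] w x - bump_avg 1 (partial_derivs [i, j] w) 0\<bar> \<partial>lborel) \<le> C * m"
proof -
  let ?n = "CARD('n)"
  obtain C where C: "0 \<le> C"
    "\<And>w m x. smooth w \<Longrightarrow> 0 < m \<Longrightarrow>
      (\<And>r. 1 \<le> r \<Longrightarrow> (\<integral>y. indicator (ccube r) y * (laplacian w y)\<^sup>2 \<partial>lborel) \<le> m\<^sup>2 * (2 * r) ^ CARD('n)) \<Longrightarrow>
      vanishing_means (partial_derivs [i, j] w) \<Longrightarrow>
      x \<in> ccube 1 \<Longrightarrow>
      \<bar>bump_avg 1 (partial_derivs [i, j] w) x - bump_avg 1 (partial_derivs [i, j] w) (0 :: real ^ 'n)\<bar> \<le> C * m"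
    by (rule far_field[of i j]) blast
  let ?D = "(4 * 10 ^ ?n + 2 ^ ?n) / 2 + 2 ^ ?n * C"
  show thesis
  proof (rule that[of ?D])
    show "0 \<le> ?D" using C(1) by simp
    fix w :: "real ^ 'n \<Rightarrow> real" and m
    assume w: "smooth w" and m: "0 < m"
      and sq: "\<And>r. 1 \<le> r \<Longrightarrow> (\<integral>y. indicator (ccube r) y * (laplacian w y)\<^sup>2 \<partial>lborel) \<le> m\<^sup>2 * (2 * r) ^ ?n"
      and decay: "vanishing_means (partial_derivs [i, j] w)"
    let ?H = "partial_derivs [i, j] w"
    have H: "smooth ?H" by (rule smooth_partial_derivs[OF w])
    define c where "c = bump_avg 1 ?H 0"
    have cont: "continuous_on UNIV (\<lambda>x. \<bar>bump_avg 1 ?H x - ?H x\<bar>)" "continuous_on UNIV (\<lambda>x. \<bar>?H x - c\<bar>)"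
      using smooth_continuous_on[OF H] smooth_continuous_on[OF smooth_bump_avg[OF H]] by (auto intro!: continuous_intros)
    have "(\<integral>x. indicator (ccube 1) x * \<bar>?H x - c\<bar> \<partial>lborel) \<le>
      (\<integral>x. indicator (ccube 1) x * \<bar>bump_avg 1 ?H x - ?H x\<bar> + indicator (ccube 1) x * (C * m) \<partial>lborel)"
    proof (rule integral_mono)
      show "integrable lborel (\<lambda>x. indicator (ccube 1) x * \<bar>bump_avg 1 ?H x - ?H x\<bar> + indicator (ccube 1) x * (C * m))"
        by (intro Bochner_Integration.integrable_add integrable_ccube cont integrable_indicator_ccube)
      show "integrable lborel (\<lambda>x. indicator (ccube 1) x * \<bar>?H x - c\<bar>)"
        by (intro integrable_ccube cont)
      fix x
      show "indicator (ccube 1) x * \<bar>?H x - c\<bar> \<le> indicator (ccube 1) x * \<bar>bump_avg 1 ?H x - ?H x\<bar> + indicator (ccube 1) x * (C * m)"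
      proof (cases "x \<in> ccube 1")
        case True
        have "\<bar>bump_avg 1 ?H x - c\<bar> \<le> C * m" unfolding c_def by (rule C(2)[OF w m sq decay True])
        then have "\<bar>?H x - c\<bar> \<le> \<bar>bump_avg 1 ?H x - ?H x\<bar> + C * m" by linarith
        then show ?thesis using True by (simp del: partial_derivs.simps)
      qed simp
    qed
    also have "\<dots> = (\<integral>x. indicator (ccube 1) x * \<bar>bump_avg 1 ?H x - ?H x\<bar> \<partial>lborel) + (2 * 1) ^ ?n * (C * m)"
      by (subst Bochner_Integration.integral_add[OF integrable_ccube[OF cont(1)] integrable_indicator_ccube])
         (simp only: integral_indicator_ccube[OF zero_le_one])
    also have "(\<integral>x. indicator (ccube 1) x * \<bar>bump_avg 1 ?H x - ?H x\<bar> \<partial>lborel) \<le> m * (4 * 10 ^ ?n + 2 ^ ?n) / 2"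
      using sq[of 5] by (intro near_field[OF w m]) simp
    finally show "(\<integral>x. indicator (ccube 1) x * \<bar>?H x - bump_avg 1 ?H 0\<bar> \<partial>lborel) \<le> ?D * m"
      unfolding c_def by (simp add: algebra_simps del: partial_derivs.simps)
  qed
qed

section \<open>Duality by stopping times\<close>

definition hcube :: "real ^ 'n::finite \<Rightarrow> real \<Rightarrow> (real ^ 'n) set" where
  "hcube z l = {x. \<forall>i. z $ i \<le> x $ i \<and> x $ i < z $ i + l}"

text \<open>The children of a cube are indexed by the finite type of functions \<open>b\<close>,
  which choose the lower or the upper half in each coordinate; as the cubes are half-open, the
  children form a partition.\<close>

definition corner :: "real ^ 'n::finite \<Rightarrow> real \<Rightarrow> ('n \<Rightarrow> bool) \<Rightarrow> real ^ 'n" where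
  "corner z l b = (\<chi> i. if b i then z $ i + l / 2 else z $ i)"

lemma hcube_sets [measurable]: "hcube z l \<in> sets borel"
proof -
  show ?thesis unfolding hcube_def by measurable
qed

lemma hcube_subset_cbox: "hcube z l \<subseteq> cbox z (z + (\<chi> i. l))"
  by (auto simp: hcube_def mem_box_cart less_imp_le)

lemma emeasure_hcube_finite: "emeasure lborel (hcube z l) < top"
  using emeasure_mono[OF hcube_subset_cbox[of z l], of lborel] emeasure_compact_finite[OF compact_cbox[of z "z + (\<chi> i. l)"]]
  by (simp add: le_less_trans)

lemma sum_indicator_corners:
  assumes "0 < l"
  shows "(\<Sum>b\<in>UNIV. indicator (hcube (corner z l b) (l / 2)) x) = (indicator (hcube z l) x :: real)"
proof -
  define b0 where "b0 = (\<lambda>i. z $ i + l / 2 \<le> x $ i)"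
  have "x \<in> hcube (corner z l b) (l / 2) \<longleftrightarrow> x \<in> hcube z l \<and> b = b0" for b
  proof -
    have "(corner z l b $ i \<le> x $ i \<and> x $ i < corner z l b $ i + l / 2) \<longleftrightarrow>
      (z $ i \<le> x $ i \<and> x $ i < z $ i + l) \<and> b i = b0 i" for i
      using assms by (auto simp: corner_def b0_def)
    then show ?thesis by (auto simp: hcube_def fun_eq_iff)
  qed
  then have "indicator (hcube (corner z l b) (l / 2)) x = (if b = b0 then indicator (hcube z l) x else (0::real))" for b
    by (auto simp: indicator_def)
  then show ?thesis by simp
qed

lemma integrable_hcube_bounded:
  fixes h :: "real ^ 'n::finite \<Rightarrow> real"
  assumes [measurable]: "h \<in> borel_measurable borel" and "\<And>x. x \<in> hcube z l \<Longrightarrow> \<bar>h x\<bar> \<le> K"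
  shows "integrable lborel (\<lambda>x. indicator (hcube z l) x * h x)"
proof (rule Bochner_Integration.integrable_bound)
  show "integrable lborel (\<lambda>x. \<bar>K\<bar> * indicator (hcube z l) x)"
    using emeasure_hcube_finite[of z l] by (auto intro!: integrable_real_indicator)
  show "AE x in lborel. norm (indicator (hcube z l) x * h x) \<le> norm (\<bar>K\<bar> * indicator (hcube z l) x)"
    using assms(2) by (auto intro!: AE_I2 simp: indicator_def intro: order_trans[OF _ abs_ge_self])
qed measurable

lemma measure_hcube:
  assumes "0 \<le> l" shows "measure lborel (hcube z l :: (real ^ 'n::finite) set) = l ^ CARD('n)"
proof -
  have sub: "box z (z + (\<chi> i. l)) \<subseteq> hcube z l" by (auto simp: hcube_def mem_box_cart less_imp_le)
  have ne: "cbox z (z + (\<chi> i. l)) \<noteq> ({} :: (real ^ 'n) set)" using assms by (simp add: interval_ne_empty_cart)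
  have "measure lborel (hcube z l) \<le> measure lborel (cbox z (z + (\<chi> i. l)))"
    by (rule measure_mono_fmeasurable[OF hcube_subset_cbox]) auto
  also have c: "measure lborel (cbox z (z + (\<chi> i. l))) = l ^ CARD('n)"
    using content_cbox_cart[OF ne] by simp
  finally have "measure lborel (hcube z l) \<le> l ^ CARD('n)" .
  moreover have "l ^ CARD('n) = measure lborel (box z (z + (\<chi> i. l)))"
    using c by (simp add: measure_lborel_box_eq measure_lborel_cbox_eq box_subset_cbox)
  moreover have "measure lborel (box z (z + (\<chi> i. l))) \<le> measure lborel (hcube z l)"
    using emeasure_hcube_finite[of z l] by (intro measure_mono_fmeasurable[OF sub]) (auto simp: fmeasurable_def)
  ultimately show ?thesis by simp
qed

text \<open>\<open>Q\<close> stands for a bound of the mean oscillation of \<open>H\<close> over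
  cubes containing a point, \<open>G\<close> for one of the maximal function of \<open>g\<close>. In
  \<open>osc\<close> one constant \<open>c\<close> serves all points of the cube, so that the
  inequality can be integrated over the cube.\<close>

locale cube_duality =
  fixes H g :: "real ^ 'n::finite \<Rightarrow> real" and Q G :: "real ^ 'n \<Rightarrow> ennreal" and K :: real
  assumes H: "continuous_on UNIV H" and g_meas [measurable]: "g \<in> borel_measurable borel"
    and g_bound: "\<And>x. \<bar>g x\<bar> \<le> K"
    and Q_meas [measurable]: "Q \<in> borel_measurable borel" and G_meas [measurable]: "G \<in> borel_measurable borel"
    and osc: "\<And>z l. 0 < l \<Longrightarrow> \<exists>c. \<forall>x\<in>hcube z l.
      ennreal (\<integral>y. indicator (hcube z l) y * \<bar>H y - c\<bar> \<partial>lborel) \<le> ennreal (l ^ CARD('n)) * Q x"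
    and max_ge: "\<And>z l x. 0 < l \<Longrightarrow> x \<in> hcube z l \<Longrightarrow>
      ennreal ((\<integral>y. indicator (hcube z l) y * \<bar>g y\<bar> \<partial>lborel) / l ^ CARD('n)) \<le> G x"
begin

definition mean_on :: "real ^ 'n \<Rightarrow> real \<Rightarrow> real" where
  "mean_on z l = (\<integral>y. indicator (hcube z l) y * g y \<partial>lborel) / l ^ CARD('n)"

definition abs_mean_on :: "real ^ 'n \<Rightarrow> real \<Rightarrow> real" where
  "abs_mean_on z l = (\<integral>y. indicator (hcube z l) y * \<bar>g y\<bar> \<partial>lborel) / l ^ CARD('n)"

text \<open>The conditional expectation of \<open>g\<close> at a stopping time: the first generation
  in which the average of \<open>\<bar>g\<bar>\<close> exceeds \<open>c\<close>, or generation
  \<open>m\<close> at the latest.\<close>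

primrec truncation :: "nat \<Rightarrow> real \<Rightarrow> real ^ 'n \<Rightarrow> real \<Rightarrow> real ^ 'n \<Rightarrow> real" where
  "truncation 0 c z l x = indicator (hcube z l) x * mean_on z l"
| "truncation (Suc m) c z l x = (if abs_mean_on z l > c then indicator (hcube z l) x * mean_on z l
     else \<Sum>b\<in>UNIV. truncation m c (corner z l b) (l / 2) x)"

lemma H_meas [measurable]: "H \<in> borel_measurable borel"
  using H by (rule borel_measurable_continuous_onI)

lemma g_integrable: "integrable lborel (\<lambda>x. indicator (hcube z l) x * g x)"
  "integrable lborel (\<lambda>x. indicator (hcube z l) x * \<bar>g x\<bar>)"
  using g_bound by (auto intro!: integrable_hcube_bounded)

lemma H_bounded_hcube: "\<exists>B. \<forall>x\<in>hcube z l. \<bar>H x\<bar> \<le> B"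
proof -
  have "compact (H ` cbox z (z + (\<chi> i. l)))"
    by (intro compact_continuous_image continuous_on_subset[OF H] compact_cbox) simp
  then have "bounded (H ` cbox z (z + (\<chi> i. l)))" by (rule compact_imp_bounded)
  then obtain B where "\<forall>y\<in>H ` cbox z (z + (\<chi> i. l)). norm y \<le> B" unfolding bounded_iff by blast
  then show ?thesis using hcube_subset_cbox[of z l] by (intro exI[of _ B]) auto
qed

lemma mean_on_le: "0 < l \<Longrightarrow> \<bar>mean_on z l\<bar> \<le> abs_mean_on z l"
proof -
  assume l: "0 < l"
  have "\<bar>\<integral>y. indicator (hcube z l) y * g y \<partial>lborel\<bar> \<le> (\<integral>y. indicator (hcube z l) y * \<bar>g y\<bar> \<partial>lborel)"
    using integral_norm_le[OF g_integrable(1)[of z l] g_integrable(2)[of z l]] by (simp add: abs_mult)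
  then show ?thesis using l by (simp add: mean_on_def abs_mean_on_def abs_divide divide_right_mono)
qed

lemma abs_mean_on_le: "0 < l \<Longrightarrow> abs_mean_on z l \<le> K"
proof -
  assume l: "0 < l"
  have "(\<integral>y. indicator (hcube z l) y * \<bar>g y\<bar> \<partial>lborel) \<le> (\<integral>y. indicator (hcube z l) y * K \<partial>lborel)"
    using g_bound emeasure_hcube_finite[of z l]
    by (intro integral_mono g_integrable) (auto intro!: integrable_real_indicator mult_left_mono)
  also have "\<dots> = l ^ CARD('n) * K" using l by (simp add: measure_hcube)
  finally show ?thesis using l by (simp add: abs_mean_on_def divide_le_eq mult.commute)
qed

lemma sum_corners_integral:
  fixes h :: "real ^ 'n \<Rightarrow> real"
  assumes l: "0 < l" and int: "\<And>z l. integrable lborel (\<lambda>x. indicator (hcube z l) x * h x)"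
  shows "(\<Sum>b\<in>UNIV. \<integral>x. indicator (hcube (corner z l b) (l / 2)) x * h x \<partial>lborel) = (\<integral>x. indicator (hcube z l) x * h x \<partial>lborel)"
proof -
  have "(\<Sum>b\<in>UNIV. \<integral>x. indicator (hcube (corner z l b) (l / 2)) x * h x \<partial>lborel) =
    (\<integral>x. (\<Sum>b\<in>UNIV. indicator (hcube (corner z l b) (l / 2)) x * h x) \<partial>lborel)"
    using int by (intro Bochner_Integration.integral_sum[symmetric])
  then show ?thesis by (simp only: sum_distrib_right[symmetric] sum_indicator_corners[OF l])
qed

lemma abs_mean_on_corner:
  assumes l: "0 < l" shows "abs_mean_on (corner z l b) (l / 2) \<le> 2 ^ CARD('n) * abs_mean_on z l"
proof -
  have "(\<integral>y. indicator (hcube (corner z l b) (l / 2)) y * \<bar>g y\<bar> \<partial>lborel) \<le>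
    (\<Sum>b\<in>UNIV. \<integral>y. indicator (hcube (corner z l b) (l / 2)) y * \<bar>g y\<bar> \<partial>lborel)"
    by (rule member_le_sum) (auto intro!: Bochner_Integration.integral_nonneg)
  also have "\<dots> = (\<integral>y. indicator (hcube z l) y * \<bar>g y\<bar> \<partial>lborel)"
    by (rule sum_corners_integral[OF l g_integrable(2)])
  finally show ?thesis using l by (simp add: abs_mean_on_def power_divide divide_right_mono mult.commute)
qed

text \<open>A cube that is not stopped has average at most \<open>c\<close>, and passing to a child
  raises the average by a factor of at most \<open>2 ^ CARD('n)\<close>.\<close>

lemma truncation_bound:
  "0 < l \<Longrightarrow> abs_mean_on z l \<le> 2 ^ CARD('n) * c \<Longrightarrow> \<bar>truncation m c z l x\<bar> \<le> 2 ^ CARD('n) * c * indicator (hcube z l) x"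
proof (induction m arbitrary: z l)
  case 0
  then show ?case using mean_on_le[of l z] by (auto simp: indicator_def)
next
  case (Suc m)
  show ?case
  proof (cases "abs_mean_on z l > c")
    case True
    then show ?thesis using mean_on_le[of l z] Suc.prems by (auto simp: indicator_def)
  next
    case False
    have "\<bar>truncation m c (corner z l b) (l / 2) x\<bar> \<le> 2 ^ CARD('n) * c * indicator (hcube (corner z l b) (l / 2)) x" for b
    proof (rule Suc.IH)
      have "abs_mean_on (corner z l b) (l / 2) \<le> 2 ^ CARD('n) * abs_mean_on z l"
        by (rule abs_mean_on_corner) (use Suc.prems in simp)
      also have "\<dots> \<le> 2 ^ CARD('n) * c" using False by (intro mult_left_mono) auto
      finally show "abs_mean_on (corner z l b) (l / 2) \<le> 2 ^ CARD('n) * c" .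
    qed (use Suc.prems in simp)
    then have "\<bar>\<Sum>b\<in>UNIV. truncation m c (corner z l b) (l / 2) x\<bar> \<le> (\<Sum>b\<in>UNIV. 2 ^ CARD('n) * c * indicator (hcube (corner z l b) (l / 2)) x)"
      by (intro order_trans[OF sum_abs] sum_mono)
    also have "\<dots> = 2 ^ CARD('n) * c * indicator (hcube z l) x"
      by (simp only: sum_distrib_left[symmetric] sum_indicator_corners[OF Suc.prems(1)])
    finally show ?thesis using False by simp
  qed
qed

lemma truncation_H_integrable:
  "0 < l \<Longrightarrow> integrable lborel (\<lambda>x. truncation m c z l x)"
  "0 < l \<Longrightarrow> integrable lborel (\<lambda>x. H x * truncation m c z l x)"
proof (induction m arbitrary: z l)
  case 0
  { case 1
    show ?case using integrable_hcube_bounded[of "\<lambda>_. mean_on z l" z l "\<bar>mean_on z l\<bar>"] by simp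
  next
    case 2
    obtain B where "\<forall>x\<in>hcube z l. \<bar>H x\<bar> \<le> B" using H_bounded_hcube by blast
    then have "integrable lborel (\<lambda>x. (indicator (hcube z l) x * H x) * mean_on z l)"
      by (intro integrable_mult_left integrable_hcube_bounded[where K=B]) auto
    then show ?case by (simp add: ac_simps)
  }
next
  case (Suc m)
  { case 1
    show ?case
    proof (cases "abs_mean_on z l > c")
      case True
      then show ?thesis using integrable_hcube_bounded[of "\<lambda>_. mean_on z l" z l "\<bar>mean_on z l\<bar>"] by simp
    next
      case False
      then show ?thesis using Suc.IH(1)[of "l / 2"] 1 by simp
    qed
  next
    case 2
    show ?case
    proof (cases "abs_mean_on z l > c")
      case True
      obtain B where "\<forall>x\<in>hcube z l. \<bar>H x\<bar> \<le> B" using H_bounded_hcube by blast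
      then have "integrable lborel (\<lambda>x. (indicator (hcube z l) x * H x) * mean_on z l)"
        by (intro integrable_mult_left integrable_hcube_bounded[where K=B]) auto
      then show ?thesis using True by (simp add: ac_simps)
    next
      case False
      then show ?thesis using Suc.IH(2)[of "l / 2"] 2 by (simp add: sum_distrib_left)
    qed
  }
qed

lemma integral_truncation:
  "0 < l \<Longrightarrow> (\<integral>x. truncation m c z l x \<partial>lborel) = (\<integral>x. indicator (hcube z l) x * g x \<partial>lborel)"
proof (induction m arbitrary: z l)
  case 0
  then show ?case by (simp add: measure_hcube mean_on_def)
next
  case (Suc m)
  show ?case
  proof (cases "abs_mean_on z l > c")
    case True
    then show ?thesis using Suc.prems by (simp add: measure_hcube mean_on_def)
  next
    case False
    have "(\<integral>x. truncation (Suc m) c z l x \<partial>lborel) = (\<Sum>b\<in>UNIV. \<integral>x. truncation m c (corner z l b) (l / 2) x \<partial>lborel)"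
      using False Suc.prems truncation_H_integrable(1)[of "l / 2"] by (simp add: Bochner_Integration.integral_sum)
    also have "\<dots> = (\<Sum>b\<in>UNIV. \<integral>x. indicator (hcube (corner z l b) (l / 2)) x * g x \<partial>lborel)"
      using Suc.IH[of "l / 2"] Suc.prems by simp
    also have "\<dots> = (\<integral>x. indicator (hcube z l) x * g x \<partial>lborel)"
      by (rule sum_corners_integral[OF Suc.prems g_integrable(1)])
    finally show ?thesis .
  qed
qed

lemma nn_integral_sum_corners:
  assumes l: "0 < l" and [measurable]: "h \<in> borel_measurable borel"
  shows "(\<Sum>b\<in>UNIV. \<integral>\<^sup>+x. indicator (hcube (corner z l b) (l / 2)) x * h x \<partial>lborel) = (\<integral>\<^sup>+x. indicator (hcube z l) x * h x \<partial>lborel)"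
proof -
  have ind: "(\<Sum>b\<in>UNIV. indicator (hcube (corner z l b) (l / 2)) x) = (indicator (hcube z l) x :: ennreal)" for x
  proof -
    have "(\<Sum>b\<in>UNIV. ennreal (indicator (hcube (corner z l b) (l / 2)) x)) = ennreal (indicator (hcube z l) x)"
      by (subst sum_ennreal) (auto simp: sum_indicator_corners[OF l])
    then show ?thesis by (simp add: ennreal_indicator)
  qed
  have "(\<Sum>b\<in>UNIV. \<integral>\<^sup>+x. indicator (hcube (corner z l b) (l / 2)) x * h x \<partial>lborel) =
    (\<integral>\<^sup>+x. (\<Sum>b\<in>UNIV. indicator (hcube (corner z l b) (l / 2)) x * h x) \<partial>lborel)"
    by (rule nn_integral_sum[symmetric]) measurable
  then show ?thesis by (simp only: sum_distrib_right[symmetric] ind)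
qed

text \<open>On a cube where the average of \<open>\<bar>g\<bar>\<close> exceeds \<open>a\<close> for the first time, the difference of the
  truncations at the levels \<open>c\<close> and \<open>a\<close> has mean zero, so \<open>H\<close> may be replaced by its oscillation there.\<close>

lemma truncation_difference:
  assumes ac: "0 \<le> a" "a \<le> c" "0 < c"
  shows "0 < l \<Longrightarrow> abs_mean_on z l \<le> 2 ^ CARD('n) * c \<Longrightarrow>
    ennreal \<bar>\<integral>x. H x * (truncation m c z l x - truncation m a z l x) \<partial>lborel\<bar> \<le>
    ennreal (2 * 2 ^ CARD('n) * c) * (\<integral>\<^sup>+x. indicator (hcube z l) x * (Q x * indicator {x. ennreal a < G x} x) \<partial>lborel)"
proof (induction m arbitrary: z l)
  case (Suc m)
  note l = Suc.prems(1)
  let ?n = "CARD('n)"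
  have [measurable]: "{x. ennreal a < G x} \<in> sets borel" by measurable
  show ?case
  proof (cases "abs_mean_on z l > a")
    case True
    obtain d where d: "\<And>x. x \<in> hcube z l \<Longrightarrow>
      ennreal (\<integral>y. indicator (hcube z l) y * \<bar>H y - d\<bar> \<partial>lborel) \<le> ennreal (l ^ ?n) * Q x"
      using osc[OF l, of z] by blast
    let ?T = "truncation (Suc m) c z l" and ?M = "\<lambda>x. indicator (hcube z l) x * mean_on z l"
    have T: "\<bar>?T x\<bar> \<le> 2 ^ ?n * c * indicator (hcube z l) x" for x by (rule truncation_bound[OF Suc.prems])
    have M: "\<bar>?M x\<bar> \<le> 2 ^ ?n * c * indicator (hcube z l) x" for x
      using mean_on_le[OF l, of z] Suc.prems by (auto simp: indicator_def)
    have iT: "integrable lborel ?T" "integrable lborel (\<lambda>x. H x * ?T x)" by (rule truncation_H_integrable[OF l])+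
    have iM: "integrable lborel ?M" "integrable lborel (\<lambda>x. H x * ?M x)"
      using truncation_H_integrable[OF l, of 0 c z] by simp_all
    obtain B where B: "\<forall>x\<in>hcube z l. \<bar>H x\<bar> \<le> B" using H_bounded_hcube by blast
    have iH: "integrable lborel (\<lambda>y. indicator (hcube z l) y * \<bar>H y - d\<bar>)"
    proof (rule integrable_hcube_bounded)
      fix x assume "x \<in> hcube z l"
      with B have "\<bar>H x\<bar> \<le> B" by blast
      then show "\<bar>\<bar>H x - d\<bar>\<bar> \<le> B + \<bar>d\<bar>" by linarith
    qed measurable
    have "(\<integral>x. ?T x - ?M x \<partial>lborel) = 0"
      using l by (subst Bochner_Integration.integral_diff[OF iT(1) iM(1)], subst integral_truncation[OF l])
        (simp add: measure_hcube mean_on_def)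
    then have "(\<integral>x. H x * (?T x - ?M x) \<partial>lborel) = (\<integral>x. H x * (?T x - ?M x) \<partial>lborel) - (\<integral>x. d * (?T x - ?M x) \<partial>lborel)"
      by (simp only: integral_mult_right_zero)
    also have "\<dots> = (\<integral>x. H x * (?T x - ?M x) - d * (?T x - ?M x) \<partial>lborel)"
      using iT iM by (subst Bochner_Integration.integral_diff) (auto simp: right_diff_distrib simp del: truncation.simps)
    finally have eq: "(\<integral>x. H x * (?T x - ?M x) \<partial>lborel) = (\<integral>x. (H x - d) * (?T x - ?M x) \<partial>lborel)"
      by (simp only: left_diff_distrib)
    have "norm (\<integral>x. (H x - d) * (?T x - ?M x) \<partial>lborel) \<le> (\<integral>x. (2 * 2 ^ ?n * c) * (indicator (hcube z l) x * \<bar>H x - d\<bar>) \<partial>lborel)"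
    proof (rule integral_norm_le)
      show "integrable lborel (\<lambda>x. (H x - d) * (?T x - ?M x))"
      proof -
        have "integrable lborel (\<lambda>x. (H x * ?T x - H x * ?M x) - (d * ?T x - d * ?M x))"
          using iT iM by (intro Bochner_Integration.integrable_diff integrable_mult_right)
        moreover have "(\<lambda>x. (H x * ?T x - H x * ?M x) - (d * ?T x - d * ?M x)) = (\<lambda>x. (H x - d) * (?T x - ?M x))"
          by (simp add: fun_eq_iff algebra_simps del: truncation.simps)
        ultimately show ?thesis by (simp only:)
      qed
      show "integrable lborel (\<lambda>x. (2 * 2 ^ ?n * c) * (indicator (hcube z l) x * \<bar>H x - d\<bar>))"
        using iH by (intro integrable_mult_right)
      fix x
      have "\<bar>?T x - ?M x\<bar> \<le> 2 * 2 ^ ?n * c * indicator (hcube z l) x"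
        using abs_triangle_ineq4[of "?T x" "?M x"] T[of x] M[of x] by linarith
      from mult_left_mono[OF this, of "\<bar>H x - d\<bar>"]
      show "norm ((H x - d) * (?T x - ?M x)) \<le> (2 * 2 ^ ?n * c) * (indicator (hcube z l) x * \<bar>H x - d\<bar>)"
        unfolding real_norm_def abs_mult[of "H x - d"] by (simp only: ac_simps abs_ge_zero)
    qed
    also have "\<dots> = (2 * 2 ^ ?n * c) * (\<integral>x. indicator (hcube z l) x * \<bar>H x - d\<bar> \<partial>lborel)"
      by (rule integral_mult_right_zero)
    finally have 1: "\<bar>\<integral>x. H x * (?T x - ?M x) \<partial>lborel\<bar> \<le> (2 * 2 ^ ?n * c) * (\<integral>x. indicator (hcube z l) x * \<bar>H x - d\<bar> \<partial>lborel)"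
      unfolding eq by simp
    let ?I = "\<integral>x. indicator (hcube z l) x * \<bar>H x - d\<bar> \<partial>lborel"
    have "ennreal ?I = ennreal (1 / l ^ ?n) * (ennreal ?I * ennreal (l ^ ?n))"
      using l by (simp add: ennreal_mult'[symmetric] mult.assoc[symmetric] mult.commute)
    also have "ennreal ?I * ennreal (l ^ ?n) = (\<integral>\<^sup>+x. ennreal ?I * indicator (hcube z l) x \<partial>lborel)"
      using l emeasure_hcube_finite[of z l] by (simp add: nn_integral_cmult emeasure_eq_ennreal_measure measure_hcube)
    also have "\<dots> \<le> (\<integral>\<^sup>+x. ennreal (l ^ ?n) * (indicator (hcube z l) x * (Q x * indicator {x. ennreal a < G x} x)) \<partial>lborel)"
    proof (rule nn_integral_mono)
      fix x
      show "ennreal ?I * indicator (hcube z l) x \<le> ennreal (l ^ ?n) * (indicator (hcube z l) x * (Q x * indicator {x. ennreal a < G x} x))"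
      proof (cases "x \<in> hcube z l")
        case x: True
        have "ennreal a < ennreal (abs_mean_on z l)" using True ac(1) by (simp add: ennreal_less_iff)
        also have "\<dots> \<le> G x" unfolding abs_mean_on_def by (rule max_ge[OF l x])
        finally show ?thesis using d[OF x] x by simp
      qed simp
    qed
    also have "\<dots> = ennreal (l ^ ?n) * (\<integral>\<^sup>+x. indicator (hcube z l) x * (Q x * indicator {x. ennreal a < G x} x) \<partial>lborel)"
      by (rule nn_integral_cmult) measurable
    finally have 2: "ennreal ?I \<le> (\<integral>\<^sup>+x. indicator (hcube z l) x * (Q x * indicator {x. ennreal a < G x} x) \<partial>lborel)"
      using l by (simp add: mult_left_mono mult.assoc[symmetric] ennreal_mult[symmetric])
    have "ennreal \<bar>\<integral>x. H x * (?T x - ?M x) \<partial>lborel\<bar> \<le> ennreal (2 * 2 ^ ?n * c) * ennreal ?I"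
    proof -
      have "ennreal ((2 * 2 ^ ?n * c) * ?I) = ennreal (2 * 2 ^ ?n * c) * ennreal ?I"
        using ac by (intro ennreal_mult') simp
      with ennreal_leI[OF 1] show ?thesis by (simp only:)
    qed
    also have "\<dots> \<le> ennreal (2 * 2 ^ ?n * c) * (\<integral>\<^sup>+x. indicator (hcube z l) x * (Q x * indicator {x. ennreal a < G x} x) \<partial>lborel)"
      by (rule mult_left_mono[OF 2]) simp
    finally show ?thesis using True by (simp del: truncation.simps(2)[of _ c])
  next
    case False
    have int: "integrable lborel (\<lambda>x. H x * (truncation m c (corner z l b) (l / 2) x - truncation m a (corner z l b) (l / 2) x))" for b
      unfolding right_diff_distrib using truncation_H_integrable(2)[of "l / 2"] l by (intro Bochner_Integration.integrable_diff) auto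
    have "(\<integral>x. H x * (truncation (Suc m) c z l x - truncation (Suc m) a z l x) \<partial>lborel) =
      (\<integral>x. (\<Sum>b\<in>UNIV. H x * (truncation m c (corner z l b) (l / 2) x - truncation m a (corner z l b) (l / 2) x)) \<partial>lborel)"
      using False ac by (simp add: sum_subtractf sum_distrib_left right_diff_distrib)
    also have "\<dots> = (\<Sum>b\<in>UNIV. \<integral>x. H x * (truncation m c (corner z l b) (l / 2) x - truncation m a (corner z l b) (l / 2) x) \<partial>lborel)"
      using int by (rule Bochner_Integration.integral_sum)
    finally have "ennreal \<bar>\<integral>x. H x * (truncation (Suc m) c z l x - truncation (Suc m) a z l x) \<partial>lborel\<bar> \<le>
      (\<Sum>b\<in>UNIV. ennreal \<bar>\<integral>x. H x * (truncation m c (corner z l b) (l / 2) x - truncation m a (corner z l b) (l / 2) x) \<partial>lborel\<bar>)"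
      by (subst sum_ennreal) (auto intro!: ennreal_leI sum_abs)
    also have "\<dots> \<le> (\<Sum>b\<in>UNIV. ennreal (2 * 2 ^ ?n * c) * (\<integral>\<^sup>+x. indicator (hcube (corner z l b) (l / 2)) x * (Q x * indicator {x. ennreal a < G x} x) \<partial>lborel))"
    proof (rule sum_mono, rule Suc.IH)
      fix b
      have "abs_mean_on (corner z l b) (l / 2) \<le> 2 ^ ?n * abs_mean_on z l" by (rule abs_mean_on_corner[OF l])
      also have "\<dots> \<le> 2 ^ ?n * c" using False ac by (intro mult_left_mono) auto
      finally show "abs_mean_on (corner z l b) (l / 2) \<le> 2 ^ ?n * c" .
    qed (use l in simp)
    also have "\<dots> = ennreal (2 * 2 ^ ?n * c) * (\<integral>\<^sup>+x. indicator (hcube z l) x * (Q x * indicator {x. ennreal a < G x} x) \<partial>lborel)"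
      by (subst sum_distrib_left[symmetric], subst nn_integral_sum_corners[OF l]) auto
    finally show ?thesis .
  qed
qed simp

lemma hcube_corner_subset:
  assumes "0 < l" shows "hcube (corner z l b) (l / 2) \<subseteq> hcube z l"
proof
  fix x assume x: "x \<in> hcube (corner z l b) (l / 2)"
  have "indicator (hcube (corner z l b) (l / 2)) x \<le> (\<Sum>b\<in>UNIV. indicator (hcube (corner z l b) (l / 2)) x :: real)"
    by (rule member_le_sum) auto
  then have "1 \<le> (indicator (hcube z l) x :: real)" using x by (simp add: sum_indicator_corners[OF assms])
  moreover have "indicator (hcube z l) x = (0::real)" if "x \<notin> hcube z l" using that by (rule indicator_simps)
  ultimately show "x \<in> hcube z l" by linarith
qed

lemma H_g_integrable: "integrable lborel (\<lambda>x. H x * (indicator (hcube z l) x * g x))"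
proof -
  obtain B where B: "\<forall>x\<in>hcube z l. \<bar>H x\<bar> \<le> B" using H_bounded_hcube by blast
  have "integrable lborel (\<lambda>x. indicator (hcube z l) x * (H x * g x))"
  proof (rule integrable_hcube_bounded[of _ z l "\<bar>B\<bar> * \<bar>K\<bar>"])
    fix x assume "x \<in> hcube z l"
    with B g_bound[of x] show "\<bar>H x * g x\<bar> \<le> \<bar>B\<bar> * \<bar>K\<bar>"
      unfolding abs_mult by (intro mult_mono) (auto intro: order_trans[OF _ abs_ge_self])
  qed measurable
  then show ?thesis by (simp add: ac_simps)
qed

text \<open>From the level \<open>K\<close> on no cube is stopped, so the truncation is the average
  of \<open>g\<close> over the cells of generation \<open>m\<close>. On each cell it has the same
  integral as \<open>g\<close>, and \<open>H\<close> varies by at most \<open>d\<close>; the factor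
  2 counts the average and \<open>g\<close> itself.\<close>

lemma truncation_approx:
  assumes c: "K \<le> c" and d: "0 \<le> d"
  shows "0 < l \<Longrightarrow> (\<And>x y. x \<in> hcube z l \<Longrightarrow> y \<in> hcube z l \<Longrightarrow> (\<And>i. \<bar>x $ i - y $ i\<bar> \<le> l / 2 ^ m) \<Longrightarrow> \<bar>H x - H y\<bar> \<le> d) \<Longrightarrow>
    \<bar>\<integral>x. H x * (truncation m c z l x - indicator (hcube z l) x * g x) \<partial>lborel\<bar> \<le> 2 * d * (\<integral>x. indicator (hcube z l) x * \<bar>g x\<bar> \<partial>lborel)"
proof (induction m arbitrary: z l)
  case 0
  note l = 0(1)
  let ?T = "\<lambda>x. indicator (hcube z l) x * mean_on z l" and ?g = "\<lambda>x. indicator (hcube z l) x * g x"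
  have iT: "integrable lborel ?T" "integrable lborel (\<lambda>x. H x * ?T x)"
    using truncation_H_integrable[OF l, of 0 c z] by simp_all
  note ig = g_integrable(1)[of z l] H_g_integrable[of z l]
  have z: "z \<in> hcube z l" using l by (simp add: hcube_def)
  have zero: "(\<integral>x. ?T x - ?g x \<partial>lborel) = 0"
    using l by (subst Bochner_Integration.integral_diff[OF iT(1) ig(1)]) (simp add: measure_hcube mean_on_def)
  have i: "integrable lborel (\<lambda>x. H x * (?T x - ?g x))" "integrable lborel (\<lambda>x. H z * (?T x - ?g x))"
    using iT ig by (simp_all add: right_diff_distrib)
  have "(\<integral>x. H x * (?T x - ?g x) \<partial>lborel) = (\<integral>x. H x * (?T x - ?g x) \<partial>lborel) - (\<integral>x. H z * (?T x - ?g x) \<partial>lborel)"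
    by (simp only: integral_mult_right_zero zero mult_zero_right diff_zero)
  also have "\<dots> = (\<integral>x. H x * (?T x - ?g x) - H z * (?T x - ?g x) \<partial>lborel)"
    by (rule Bochner_Integration.integral_diff[symmetric, OF i])
  finally have eq: "(\<integral>x. H x * (?T x - ?g x) \<partial>lborel) = (\<integral>x. H x * (?T x - ?g x) - H z * (?T x - ?g x) \<partial>lborel)" .
  have "\<bar>\<integral>x. H x * (?T x - ?g x) - H z * (?T x - ?g x) \<partial>lborel\<bar> \<le> (\<integral>x. d * (indicator (hcube z l) x * abs_mean_on z l + indicator (hcube z l) x * \<bar>g x\<bar>) \<partial>lborel)"
  proof (rule integral_norm_le[unfolded real_norm_def])
    show "integrable lborel (\<lambda>x. H x * (?T x - ?g x) - H z * (?T x - ?g x))"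
      using i by (rule Bochner_Integration.integrable_diff)
    show "integrable lborel (\<lambda>x. d * (indicator (hcube z l) x * abs_mean_on z l + indicator (hcube z l) x * \<bar>g x\<bar>))"
      using integrable_hcube_bounded[of "\<lambda>_. abs_mean_on z l" z l "\<bar>abs_mean_on z l\<bar>"] g_integrable(2)[of z l]
      by (intro integrable_mult_right Bochner_Integration.integrable_add) auto
    fix x
    show "\<bar>H x * (?T x - ?g x) - H z * (?T x - ?g x)\<bar> \<le> d * (indicator (hcube z l) x * abs_mean_on z l + indicator (hcube z l) x * \<bar>g x\<bar>)"
    proof (cases "x \<in> hcube z l")
      case True
      have "\<bar>x $ i - z $ i\<bar> \<le> l / 2 ^ 0" for i using True by (auto simp: hcube_def) (smt (verit))
      then have "\<bar>H x - H z\<bar> \<le> d" using 0(2)[OF True z] by blast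
      moreover have "\<bar>mean_on z l - g x\<bar> \<le> abs_mean_on z l + \<bar>g x\<bar>" using mean_on_le[OF l, of z] by linarith
      ultimately have "\<bar>H x - H z\<bar> * \<bar>mean_on z l - g x\<bar> \<le> d * (abs_mean_on z l + \<bar>g x\<bar>)"
        using d by (intro mult_mono) auto
      moreover have "H x * (?T x - ?g x) - H z * (?T x - ?g x) = (H x - H z) * (mean_on z l - g x)"
        using True by (simp add: algebra_simps)
      ultimately show ?thesis using True by (simp add: abs_mult)
    qed simp
  qed
  also have "\<dots> = d * ((\<integral>x. indicator (hcube z l) x * abs_mean_on z l \<partial>lborel) + (\<integral>x. indicator (hcube z l) x * \<bar>g x\<bar> \<partial>lborel))"
  proof -
    have "integrable lborel (\<lambda>x. indicator (hcube z l) x * abs_mean_on z l)"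
      by (rule integrable_hcube_bounded[of "\<lambda>_. abs_mean_on z l" z l "\<bar>abs_mean_on z l\<bar>"]) auto
    then show ?thesis
      unfolding integral_mult_right_zero by (simp only: Bochner_Integration.integral_add[OF _ g_integrable(2)])
  qed
  also have "(\<integral>x. indicator (hcube z l) x * abs_mean_on z l \<partial>lborel) = (\<integral>x. indicator (hcube z l) x * \<bar>g x\<bar> \<partial>lborel)"
    using l by (simp add: measure_hcube abs_mean_on_def)
  finally show ?case by (simp add: eq)
next
  case (Suc m)
  note l = Suc.prems(1)
  have "\<not> abs_mean_on z l > c" using abs_mean_on_le[OF l, of z] c by linarith
  then have T: "truncation (Suc m) c z l x - indicator (hcube z l) x * g x =
      (\<Sum>b\<in>UNIV. truncation m c (corner z l b) (l / 2) x - indicator (hcube (corner z l b) (l / 2)) x * g x)" for x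
    by (simp add: sum_subtractf sum_distrib_right[symmetric] sum_indicator_corners[OF l])
  have int: "integrable lborel (\<lambda>x. H x * (truncation m c (corner z l b) (l / 2) x - indicator (hcube (corner z l b) (l / 2)) x * g x))" for b
    unfolding right_diff_distrib using l
    by (intro Bochner_Integration.integrable_diff truncation_H_integrable(2) H_g_integrable) simp
  have eq: "(\<integral>x. H x * (truncation (Suc m) c z l x - indicator (hcube z l) x * g x) \<partial>lborel) =
    (\<Sum>b\<in>UNIV. \<integral>x. H x * (truncation m c (corner z l b) (l / 2) x - indicator (hcube (corner z l b) (l / 2)) x * g x) \<partial>lborel)"
    unfolding T sum_distrib_left using int by (rule Bochner_Integration.integral_sum)
  have "\<bar>\<integral>x. H x * (truncation (Suc m) c z l x - indicator (hcube z l) x * g x) \<partial>lborel\<bar> \<le> (\<Sum>b\<in>UNIV. \<bar>\<integral>x. H x * (truncation m c (corner z l b) (l / 2) x - indicator (hcube (corner z l b) (l / 2)) x * g x) \<partial>lborel\<bar>)"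
    unfolding eq by (rule sum_abs)
  also have "\<dots> \<le> (\<Sum>b\<in>UNIV. 2 * d * (\<integral>x. indicator (hcube (corner z l b) (l / 2)) x * \<bar>g x\<bar> \<partial>lborel))"
  proof (rule sum_mono, rule Suc.IH)
    fix b x y
    assume "x \<in> hcube (corner z l b) (l / 2)" "y \<in> hcube (corner z l b) (l / 2)" "\<And>i. \<bar>x $ i - y $ i\<bar> \<le> l / 2 / 2 ^ m"
    then show "\<bar>H x - H y\<bar> \<le> d"
      using hcube_corner_subset[OF l, of z b] by (intro Suc.prems(2)) auto
  qed (use l in simp)
  also have "\<dots> = 2 * d * (\<integral>x. indicator (hcube z l) x * \<bar>g x\<bar> \<partial>lborel)"
    by (simp only: sum_distrib_left[symmetric] sum_corners_integral[OF l g_integrable(2)])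
  finally show ?case .
qed

text \<open>A sum of powers of two is at most twice its largest term, and here this term lies below
  \<open>y\<close>.\<close>

lemma dyadic_layer_sum:
  fixes y :: ennreal
  assumes "0 < a"
  shows "(\<Sum>k<N. ennreal (2 ^ k * a) * (if ennreal (2 ^ k * a) < y then 1 else 0)) \<le> 2 * y"
proof (induction N)
  case (Suc N)
  have tot: "(\<Sum>k<N. ennreal (2 ^ k * a) * (if ennreal (2 ^ k * a) < y then 1 else 0)) \<le> ennreal (2 ^ N * a)" for N
  proof (induction N)
    case (Suc N)
    have "(\<Sum>k<Suc N. ennreal (2 ^ k * a) * (if ennreal (2 ^ k * a) < y then 1 else 0)) \<le> ennreal (2 ^ N * a) + ennreal (2 ^ N * a) * 1"
      unfolding sum.lessThan_Suc by (intro add_mono Suc.IH mult_left_mono) auto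
    also have "\<dots> = ennreal (2 ^ Suc N * a)" using assms by (simp add: ennreal_plus[symmetric] del: ennreal_plus)
    finally show ?case .
  qed simp
  show ?case
  proof (cases "ennreal (2 ^ N * a) < y")
    case True
    have "(\<Sum>k<Suc N. ennreal (2 ^ k * a) * (if ennreal (2 ^ k * a) < y then 1 else 0)) \<le> ennreal (2 ^ Suc N * a)"
      by (rule tot)
    also have "\<dots> = 2 * ennreal (2 ^ N * a)" using assms by (simp add: ennreal_mult[symmetric] flip: ennreal_numeral)
    also have "\<dots> \<le> 2 * y" using True by (intro mult_left_mono) auto
    finally show ?thesis .
  next
    case False
    then show ?thesis using Suc by simp
  qed
qed simp

text \<open>A telescoping sum over the truncation levels \<open>2 ^ k * a\<close>: the step above
  level \<open>k\<close> costs this level times the integral of \<open>Q\<close> over the set where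
  \<open>G\<close> exceeds it, and the levels below \<open>G\<close> add up to at most
  \<open>2 * G\<close>. At level \<open>N\<close> the truncation is close to \<open>g\<close>; level
  0 is bounded by \<open>2 ^ CARD('n) * a\<close> and leaves the term with the integral of
  \<open>\<bar>H\<bar>\<close>.\<close>

lemma duality_on_cube:
  assumes l: "0 < l" and a: "0 < a" "abs_mean_on z l \<le> a"
  shows "ennreal \<bar>\<integral>x. H x * (indicator (hcube z l) x * g x) \<partial>lborel\<bar> \<le>
    ennreal (2 ^ CARD('n) * a * (\<integral>x. indicator (hcube z l) x * \<bar>H x\<bar> \<partial>lborel)) +
    ennreal (8 * 2 ^ CARD('n)) * (\<integral>\<^sup>+x. Q x * G x \<partial>lborel)"
proof -
  let ?n = "CARD('n)" and ?X = "\<integral>x. H x * (indicator (hcube z l) x * g x) \<partial>lborel"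
  let ?A = "2 ^ ?n * a * (\<integral>x. indicator (hcube z l) x * \<bar>H x\<bar> \<partial>lborel)"
  let ?B = "ennreal (8 * 2 ^ ?n) * (\<integral>\<^sup>+x. Q x * G x \<partial>lborel)"
  let ?J = "\<integral>x. indicator (hcube z l) x * \<bar>g x\<bar> \<partial>lborel"
  obtain B where B: "\<forall>x\<in>hcube z l. \<bar>H x\<bar> \<le> B" using H_bounded_hcube by blast
  have iH: "integrable lborel (\<lambda>y. indicator (hcube z l) y * \<bar>H y\<bar>)"
    using B by (intro integrable_hcube_bounded[where K=B]) auto
  obtain N where N: "K / a < 2 ^ N" using real_arch_pow[of 2 "K / a"] by auto
  then have KN: "K \<le> 2 ^ N * a" using a by (simp add: field_simps)
  have key: "ennreal \<bar>?X\<bar> \<le> ennreal (2 * d * ?J) + (ennreal ?A + ?B)" if d: "0 < d" for d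
  proof -
    have "uniformly_continuous_on (cbox z (z + (\<chi> i. l))) H"
      by (intro compact_uniformly_continuous continuous_on_subset[OF H]) auto
    then obtain e where e: "0 < e" "\<And>x y. x \<in> cbox z (z + (\<chi> i. l)) \<Longrightarrow> y \<in> cbox z (z + (\<chi> i. l)) \<Longrightarrow> dist y x < e \<Longrightarrow> dist (H y) (H x) < d"
      unfolding uniformly_continuous_on_def using d by metis
    \<comment> \<open>The generation \<open>m\<close> depends on \<open>d\<close> through the
      modulus of continuity of \<open>H\<close>, whereas the number \<open>N\<close> of levels is
      already fixed; the bounds for the levels are uniform in \<open>m\<close>.\<close>
    obtain m where m: "real ?n * l / e < 2 ^ m" using real_arch_pow[of 2 "real ?n * l / e"] by auto
    have close: "\<bar>H x - H y\<bar> \<le> d" if "x \<in> hcube z l" "y \<in> hcube z l" "\<And>i. \<bar>x $ i - y $ i\<bar> \<le> l / 2 ^ m" for x y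
    proof -
      have "dist x y \<le> (\<Sum>i\<in>UNIV. \<bar>(x - y) $ i\<bar>)" unfolding dist_norm by (rule norm_le_l1_cart)
      also have "\<dots> \<le> (\<Sum>i\<in>(UNIV :: 'n set). l / 2 ^ m)" using that(3) by (intro sum_mono) simp
      also have "\<dots> < e" using m e(1) by (simp add: field_simps)
      finally have "dist (H x) (H y) < d" using that hcube_subset_cbox[of z l] by (intro e(2)) auto
      then show ?thesis by (simp add: dist_real_def)
    qed
    let ?T = "\<lambda>k. truncation m (2 ^ k * a) z l"
    have iT: "integrable lborel (\<lambda>x. H x * ?T k x)" for k by (rule truncation_H_integrable(2)[OF l])
    have am: "abs_mean_on z l \<le> 2 ^ ?n * (2 ^ k * a)" for k
    proof -
      have "1 * a \<le> (2 ^ ?n * 2 ^ k) * a" using a by (intro mult_right_mono) (auto simp flip: power_add)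
      then have "a \<le> 2 ^ ?n * (2 ^ k * a)" by (simp only: mult_1 mult.assoc)
      with a(2) show ?thesis by (rule order_trans)
    qed
    have "\<bar>\<integral>x. H x * (?T N x - indicator (hcube z l) x * g x) \<partial>lborel\<bar> \<le> 2 * d * ?J"
      by (rule truncation_approx[OF KN _ l close]) (use d in auto)
    moreover have "(\<integral>x. H x * (?T N x - indicator (hcube z l) x * g x) \<partial>lborel) = (\<integral>x. H x * ?T N x \<partial>lborel) - ?X"
      unfolding right_diff_distrib by (rule Bochner_Integration.integral_diff[OF iT H_g_integrable])
    ultimately have 1: "\<bar>?X\<bar> \<le> 2 * d * ?J + \<bar>\<integral>x. H x * ?T N x \<partial>lborel\<bar>" by linarith
    have tele: "F N = F 0 + (\<Sum>k<N. F (Suc k) - F k)" for F :: "nat \<Rightarrow> real" by (simp add: sum_lessThan_telescope)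
    have "(\<integral>x. H x * ?T N x \<partial>lborel) = (\<integral>x. H x * ?T 0 x \<partial>lborel) + (\<Sum>k<N. (\<integral>x. H x * ?T (Suc k) x \<partial>lborel) - (\<integral>x. H x * ?T k x \<partial>lborel))"
      by (rule tele)
    also have "\<dots> = (\<integral>x. H x * ?T 0 x \<partial>lborel) + (\<Sum>k<N. \<integral>x. H x * (?T (Suc k) x - ?T k x) \<partial>lborel)"
      unfolding right_diff_distrib by (simp only: Bochner_Integration.integral_diff[OF iT iT])
    finally have t: "(\<integral>x. H x * ?T N x \<partial>lborel) = (\<integral>x. H x * ?T 0 x \<partial>lborel) + (\<Sum>k<N. \<integral>x. H x * (?T (Suc k) x - ?T k x) \<partial>lborel)" .
    have 2: "\<bar>\<integral>x. H x * ?T N x \<partial>lborel\<bar> \<le> \<bar>\<integral>x. H x * ?T 0 x \<partial>lborel\<bar> + (\<Sum>k<N. \<bar>\<integral>x. H x * (?T (Suc k) x - ?T k x) \<partial>lborel\<bar>)"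
      unfolding t by (rule order_trans[OF abs_triangle_ineq add_left_mono[OF sum_abs]])
    have "\<bar>\<integral>x. H x * ?T 0 x \<partial>lborel\<bar> \<le> (\<integral>x. (2 ^ ?n * a) * (indicator (hcube z l) x * \<bar>H x\<bar>) \<partial>lborel)"
    proof (rule integral_norm_le[OF iT integrable_mult_right[OF iH], unfolded real_norm_def])
      fix x
      have "\<bar>?T 0 x\<bar> \<le> 2 ^ ?n * a * indicator (hcube z l) x" using truncation_bound[OF l am[of 0], of m x] by simp
      from mult_left_mono[OF this, of "\<bar>H x\<bar>"]
      show "\<bar>H x * ?T 0 x\<bar> \<le> (2 ^ ?n * a) * (indicator (hcube z l) x * \<bar>H x\<bar>)"
        by (simp add: abs_mult ac_simps)
    qed
    also have "\<dots> = ?A" by (rule integral_mult_right_zero)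
    finally have 3: "\<bar>\<integral>x. H x * ?T 0 x \<partial>lborel\<bar> \<le> ?A" .
    have "ennreal (\<Sum>k<N. \<bar>\<integral>x. H x * (?T (Suc k) x - ?T k x) \<partial>lborel\<bar>) = (\<Sum>k<N. ennreal \<bar>\<integral>x. H x * (?T (Suc k) x - ?T k x) \<partial>lborel\<bar>)"
      by (rule sum_ennreal[symmetric]) simp
    also have "\<dots> \<le> (\<Sum>k<N. ennreal (4 * 2 ^ ?n) * (\<integral>\<^sup>+x. ennreal (2 ^ k * a) * (indicator (hcube z l) x * (Q x * indicator {x. ennreal (2 ^ k * a) < G x} x)) \<partial>lborel))"
    proof (rule sum_mono)
      fix k
      have "ennreal \<bar>\<integral>x. H x * (?T (Suc k) x - ?T k x) \<partial>lborel\<bar> \<le> ennreal (2 * 2 ^ ?n * (2 ^ Suc k * a)) *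
          (\<integral>\<^sup>+x. indicator (hcube z l) x * (Q x * indicator {x. ennreal (2 ^ k * a) < G x} x) \<partial>lborel)"
        by (rule truncation_difference[OF _ _ _ l am]) (use a in auto)
      also have "\<dots> = ennreal (4 * 2 ^ ?n) * (ennreal (2 ^ k * a) *
          (\<integral>\<^sup>+x. indicator (hcube z l) x * (Q x * indicator {x. ennreal (2 ^ k * a) < G x} x) \<partial>lborel))"
      proof -
        \<comment> \<open>The constant of \<open>truncation_difference\<close> belongs to the upper
          level; expressed in the lower one it becomes 4, and the 2 of
          \<open>dyadic_layer_sum\<close> makes it 8.\<close>
        have "2 * 2 ^ ?n * (2 ^ Suc k * a) = (4 * 2 ^ ?n) * (2 ^ k * a)" by simp
        then show ?thesis using a by (simp only: ennreal_mult' mult.assoc) (simp add: ennreal_mult' mult.assoc)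
      qed
      also have "\<dots> = ennreal (4 * 2 ^ ?n) * (\<integral>\<^sup>+x. ennreal (2 ^ k * a) * (indicator (hcube z l) x * (Q x * indicator {x. ennreal (2 ^ k * a) < G x} x)) \<partial>lborel)"
        by (subst nn_integral_cmult) measurable
      finally show "ennreal \<bar>\<integral>x. H x * (?T (Suc k) x - ?T k x) \<partial>lborel\<bar> \<le>
        ennreal (4 * 2 ^ ?n) * (\<integral>\<^sup>+x. ennreal (2 ^ k * a) * (indicator (hcube z l) x * (Q x * indicator {x. ennreal (2 ^ k * a) < G x} x)) \<partial>lborel)" .
    qed
    also have "\<dots> = ennreal (4 * 2 ^ ?n) * (\<integral>\<^sup>+x. (\<Sum>k<N. ennreal (2 ^ k * a) * (indicator (hcube z l) x * (Q x * indicator {x. ennreal (2 ^ k * a) < G x} x))) \<partial>lborel)"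
      by (subst sum_distrib_left[symmetric], subst nn_integral_sum) auto
    also have "\<dots> \<le> ennreal (4 * 2 ^ ?n) * (\<integral>\<^sup>+x. 2 * (Q x * G x) \<partial>lborel)"
    proof (intro mult_left_mono nn_integral_mono)
      fix x
      have "(\<Sum>k<N. ennreal (2 ^ k * a) * (indicator (hcube z l) x * (Q x * indicator {x. ennreal (2 ^ k * a) < G x} x))) =
        (indicator (hcube z l) x * Q x) * (\<Sum>k<N. ennreal (2 ^ k * a) * (if ennreal (2 ^ k * a) < G x then 1 else 0))"
        unfolding sum_distrib_left by (intro sum.cong) (auto simp: indicator_def ac_simps)
      also have "\<dots> \<le> (1 * Q x) * (2 * G x)"
        by (intro mult_mono dyadic_layer_sum[OF a(1)]) (auto simp: indicator_def)
      finally show "(\<Sum>k<N. ennreal (2 ^ k * a) * (indicator (hcube z l) x * (Q x * indicator {x. ennreal (2 ^ k * a) < G x} x))) \<le> 2 * (Q x * G x)"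
        by (simp add: ac_simps)
    qed simp
    also have "\<dots> = ?B"
    proof -
      have "ennreal (4 * 2 ^ ?n) * 2 = ennreal (8 * 2 ^ ?n)"
        by (simp add: ennreal_mult[symmetric] flip: ennreal_numeral)
      then show ?thesis by (subst nn_integral_cmult) (auto simp: mult.assoc[symmetric])
    qed
    finally have 4: "ennreal (\<Sum>k<N. \<bar>\<integral>x. H x * (?T (Suc k) x - ?T k x) \<partial>lborel\<bar>) \<le> ?B" .
    have J: "0 \<le> 2 * d * ?J" using d by (intro mult_nonneg_nonneg Bochner_Integration.integral_nonneg) auto
    have A: "0 \<le> ?A" using a by (intro mult_nonneg_nonneg Bochner_Integration.integral_nonneg) auto
    have "\<bar>?X\<bar> \<le> 2 * d * ?J + (?A + (\<Sum>k<N. \<bar>\<integral>x. H x * (?T (Suc k) x - ?T k x) \<partial>lborel\<bar>))"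
      using 1 2 3 by linarith
    then have "ennreal \<bar>?X\<bar> \<le> ennreal (2 * d * ?J) + (ennreal ?A + ennreal (\<Sum>k<N. \<bar>\<integral>x. H x * (?T (Suc k) x - ?T k x) \<partial>lborel\<bar>))"
      using J A by (simp add: ennreal_plus[symmetric] ennreal_leI sum_nonneg del: ennreal_plus)
    also have "\<dots> \<le> ennreal (2 * d * ?J) + (ennreal ?A + ?B)" using 4 by (intro add_left_mono)
    finally show ?thesis .
  qed
  have J0: "0 \<le> ?J" by (intro Bochner_Integration.integral_nonneg) auto
  show ?thesis
  proof (rule ennreal_le_epsilon)
    fix e :: real assume e: "0 < e"
    have "2 * (e / (2 * J + 1)) * J \<le> e" if J: "0 \<le> J" for J
    proof -
      have "2 * (e / (2 * J + 1)) * J = e * (2 * J / (2 * J + 1))" by simp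
      also have "\<dots> \<le> e * 1" using e J by (intro mult_left_mono) auto
      finally show ?thesis by simp
    qed
    from this[OF J0] have "2 * (e / (2 * ?J + 1)) * ?J \<le> e" .
    then have 1: "ennreal (2 * (e / (2 * ?J + 1)) * ?J) \<le> ennreal e" by (rule ennreal_leI)
    have "0 < e / (2 * ?J + 1)" using e J0 by (intro divide_pos_pos) linarith+
    then have "ennreal \<bar>?X\<bar> \<le> ennreal (2 * (e / (2 * ?J + 1)) * ?J) + (ennreal ?A + ?B)" by (rule key)
    also have "\<dots> \<le> ennreal e + (ennreal ?A + ?B)" using 1 by (rule add_right_mono)
    also have "\<dots> = ennreal ?A + ?B + ennreal e" by (rule add.commute)
    finally show "ennreal \<bar>?X\<bar> \<le> ennreal ?A + ?B + ennreal e" .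
  qed
qed

text \<open>On a large cube of half-side \<open>r\<close> around the support of \<open>g\<close> the
  starting level can be taken proportional to \<open>1 / r ^ CARD('n)\<close>. The extra term of
  \<open>duality_on_cube\<close> then is a multiple of a mean of \<open>\<bar>H\<bar>\<close> over
  the cube and vanishes in the limit.\<close>

theorem duality:
  assumes supp: "\<And>x. x \<notin> ccube R \<Longrightarrow> g x = 0"
    and decay: "vanishing_means H"
  shows "ennreal \<bar>\<integral>x. H x * g x \<partial>lborel\<bar> \<le> ennreal (8 * 2 ^ CARD('n)) * (\<integral>\<^sup>+x. Q x * G x \<partial>lborel)"
proof (rule ennreal_le_epsilon)
  let ?n = "CARD('n)" and ?X = "\<integral>x. H x * g x \<partial>lborel"
  let ?B = "ennreal (8 * 2 ^ ?n) * (\<integral>\<^sup>+x. Q x * G x \<partial>lborel)"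
  let ?J = "\<integral>x. \<bar>g x\<bar> \<partial>lborel"
  fix e :: real assume e: "0 < e"
  have J0: "0 \<le> ?J" by (intro Bochner_Integration.integral_nonneg) auto
  have "((\<lambda>r. (?J + 1) * ((\<integral>x. indicator (ccube r) x * \<bar>H x\<bar> \<partial>lborel) / r ^ ?n)) \<longlongrightarrow> (?J + 1) * 0) at_top"
    by (intro tendsto_mult tendsto_const decay)
  then have "\<forall>\<^sub>F r in at_top. (?J + 1) * ((\<integral>x. indicator (ccube r) x * \<bar>H x\<bar> \<partial>lborel) / r ^ ?n) < e"
    using e by (intro order_tendstoD(2)[of _ 0]) auto
  then have "\<forall>\<^sub>F r in at_top. (?J + 1) * ((\<integral>x. indicator (ccube r) x * \<bar>H x\<bar> \<partial>lborel) / r ^ ?n) < e \<and> max R 0 < r"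
    using eventually_gt_at_top by (rule eventually_conj)
  then obtain r where r: "(?J + 1) * ((\<integral>x. indicator (ccube r) x * \<bar>H x\<bar> \<partial>lborel) / r ^ ?n) < e" "R < r" "0 < r"
    by (auto simp: eventually_at_top_linorder)
  let ?z = "(\<chi> i. - r) :: real ^ 'n"
  have sub: "ccube R \<subseteq> hcube ?z (2 * r)" using r by (auto simp: mem_ccube hcube_def abs_le_iff) (smt (verit))+
  have sub2: "hcube ?z (2 * r) \<subseteq> ccube r" by (auto simp: mem_ccube hcube_def abs_le_iff less_imp_le) (smt (verit))
  have gi: "indicator (hcube ?z (2 * r)) x * g x = g x" "indicator (hcube ?z (2 * r)) x * \<bar>g x\<bar> = \<bar>g x\<bar>" for x
    using supp[of x] sub by (auto simp: indicator_def)
  \<comment> \<open>The summand 1 keeps \<open>a\<close> positive even when \<open>g\<close>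
    vanishes almost everywhere.\<close>
  define a where "a = (?J + 1) / (2 * r) ^ ?n"
  have "0 < ?J + 1" using J0 by linarith
  then have a: "0 < a" using r by (simp add: a_def)
  have am: "abs_mean_on ?z (2 * r) \<le> a" using r by (simp add: abs_mean_on_def gi a_def divide_right_mono)
  have "ennreal \<bar>?X\<bar> \<le> ennreal (2 ^ ?n * a * (\<integral>x. indicator (hcube ?z (2 * r)) x * \<bar>H x\<bar> \<partial>lborel)) + ?B"
    using duality_on_cube[OF _ a am] r by (simp add: gi)
  also have "\<dots> \<le> ennreal e + ?B"
  proof (intro add_right_mono ennreal_leI)
    have "2 ^ ?n * a * (\<integral>x. indicator (hcube ?z (2 * r)) x * \<bar>H x\<bar> \<partial>lborel) \<le> 2 ^ ?n * a * (\<integral>x. indicator (ccube r) x * \<bar>H x\<bar> \<partial>lborel)"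
      using a sub2 continuous_on_rabs[OF H]
      by (intro mult_left_mono integral_mono' integrable_ccube) (auto simp: indicator_def)
    also have "\<dots> = (?J + 1) * ((\<integral>x. indicator (ccube r) x * \<bar>H x\<bar> \<partial>lborel) / r ^ ?n)"
      using r by (simp add: a_def power_mult_distrib)
    also have "\<dots> \<le> e" using r by simp
    finally show "2 ^ ?n * a * (\<integral>x. indicator (hcube ?z (2 * r)) x * \<bar>H x\<bar> \<partial>lborel) \<le> e" .
  qed
  finally show "ennreal \<bar>?X\<bar> \<le> ?B + ennreal e" by (simp add: add.commute)
qed

end

section \<open>The estimate for smooth functions\<close>

lemma centered_avg_le_coord_max: "centered_avg i (2 powi k) F x \<le> coord_max i F x"
  unfolding coord_max_def by (rule SUP_upper) simp

text \<open>The iterated integral overwrites the coordinates of its point one by one. The centre of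
  the box is therefore kept in a separate \<open>z\<close>, which has to agree with \<open>x\<close>
  only in the coordinates still to be integrated.\<close>

lemma iter_int_box_le:
  assumes [measurable]: "F \<in> borel_measurable borel" and "distinct js" "\<And>j. j \<in> set js \<Longrightarrow> z $ j = x $ j"
  shows "iter_int js (\<lambda>y. (\<Prod>j\<in>set js. indicator {z $ j - 2 powi k..<z $ j + 2 powi k} (y $ j)) * F y) x
    \<le> ennreal ((2 * 2 powi k) ^ length js) * iter_max js F x"
  using assms(2,3)
proof (induction js arbitrary: x)
  case (Cons i js)
  let ?r = "2 powi k :: real"
  let ?B = "\<lambda>js y. \<Prod>j\<in>set js. indicator {z $ j - ?r..<z $ j + ?r} (y $ j) :: ennreal"
  let ?I = "\<lambda>t. indicator {x $ i - ?r..<x $ i + ?r} t :: ennreal"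
  have i: "i \<notin> set js" "distinct js" "z $ i = x $ i" using Cons.prems by auto
  have B [measurable]: "?B js \<in> borel_measurable borel" by measurable
  have inner: "iter_int js (\<lambda>y. ?B (i # js) y * F y) (update_coord x i t) \<le>
      ennreal ((2 * ?r) ^ length js) * (iter_max js F (update_coord x i t) * ?I t)" for t
  proof -
    have "iter_int js (\<lambda>y. ?B (i # js) y * F y) (update_coord x i t) =
      iter_int js (\<lambda>y. ?I (y $ i) * (?B js y * F y)) (update_coord x i t)"
      using i by (simp add: mult.assoc)
    also have "\<dots> = ?I (update_coord x i t $ i) * iter_int js (\<lambda>y. ?B js y * F y) (update_coord x i t)"
      using i by (intro iter_int_cmult_indep) (auto simp: update_coord_nth)
    also have "\<dots> \<le> ?I t * (ennreal ((2 * ?r) ^ length js) * iter_max js F (update_coord x i t))"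
      using Cons.prems i by (intro mult_mono Cons.IH) (auto simp: update_coord_nth)
    finally show ?thesis by (simp add: ac_simps)
  qed
  have "iter_int (i # js) (\<lambda>y. ?B (i # js) y * F y) x \<le>
    (\<integral>\<^sup>+t. ennreal ((2 * ?r) ^ length js) * (iter_max js F (update_coord x i t) * ?I t) \<partial>lborel)"
    unfolding iter_int.simps by (intro nn_integral_mono inner)
  also have "\<dots> = ennreal ((2 * ?r) ^ length js) * (\<integral>\<^sup>+t. iter_max js F (update_coord x i t) * ?I t \<partial>lborel)"
    by (rule nn_integral_cmult) measurable
  also have "(\<integral>\<^sup>+t. iter_max js F (update_coord x i t) * ?I t \<partial>lborel) = ennreal (2 * ?r) * centered_avg i ?r (iter_max js F) x"
  proof -
    have "ennreal c * (X / ennreal c) = X" if "0 < c" for c X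
      using that by (simp add: ennreal_times_divide mult.commute mult_divide_eq_ennreal)
    then show ?thesis by (simp add: centered_avg_def interval_avg_def)
  qed
  also have "ennreal ((2 * ?r) ^ length js) * (ennreal (2 * ?r) * centered_avg i ?r (iter_max js F) x) \<le>
     ennreal ((2 * ?r) ^ length js) * (ennreal (2 * ?r) * coord_max i (iter_max js F) x)"
    by (intro mult_left_mono centered_avg_le_coord_max) auto
  also have "\<dots> = ennreal ((2 * ?r) ^ length (i # js)) * iter_max (i # js) F x"
    by (simp add: ennreal_mult' ac_simps)
  finally show ?case .
qed simp

lemma power_int_2_between:
  fixes r :: real
  assumes "0 < r" obtains k :: int where "r < 2 powi k" "2 powi k \<le> 2 * r"
proof
  let ?k = "\<lfloor>log 2 r\<rfloor> + 1"
  have e: "2 powi ?k = 2 powr real_of_int ?k" by (rule powr_real_of_int'[symmetric]) auto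
  have "r = 2 powr log 2 r" using assms by simp
  also have "\<dots> < 2 powr real_of_int ?k" by (intro powr_less_mono) linarith+
  finally show "r < 2 powi ?k" using e by simp
  have "2 powr real_of_int ?k \<le> 2 powr (log 2 r + 1)" by (intro powr_mono) linarith+
  also have "\<dots> = 2 * r" using assms by (simp add: powr_add)
  finally show "2 powi ?k \<le> 2 * r" using e by simp
qed

text \<open>The radius is rounded up to a power of two, which is at most \<open>2 * r\<close>, so
  the enclosing cube has side at most \<open>4 * r\<close>.\<close>

lemma cube_integral_le_iter_max:
  fixes F :: "real ^ 'n::finite \<Rightarrow> ennreal"
  assumes [measurable]: "F \<in> borel_measurable borel" and js: "distinct js" "set js = UNIV" and r: "0 < r"
    and S: "\<And>y i. y \<in> S \<Longrightarrow> \<bar>y $ i - x $ i\<bar> \<le> r"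
  shows "(\<integral>\<^sup>+y. indicator S y * F y \<partial>lborel) \<le> ennreal ((4 * r) ^ CARD('n)) * iter_max js F x"
proof -
  obtain k :: int where k: "r < 2 powi k" "2 powi k \<le> 2 * r" using power_int_2_between[OF r] .
  let ?B = "\<lambda>y. \<Prod>j\<in>UNIV. indicator {x $ j - 2 powi k..<x $ j + 2 powi k} (y $ j) :: ennreal"
  have "(\<integral>\<^sup>+y. indicator S y * F y \<partial>lborel) \<le> (\<integral>\<^sup>+y. ?B y * F y \<partial>lborel)"
  proof (intro nn_integral_mono mult_right_mono)
    fix y
    show "indicator S y \<le> ?B y"
    proof (cases "y \<in> S")
      case True
      have "indicator {x $ j - 2 powi k..<x $ j + 2 powi k} (y $ j) = (1::ennreal)" for j
        using S[OF True, of j] k(1) by (auto simp: indicator_def abs_le_iff)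
      then show ?thesis using True by simp
    qed simp
  qed simp
  also have "\<dots> = iter_int js (\<lambda>y. ?B y * F y) x"
    by (rule iter_int_eq_nn_integral[symmetric]) (use js in auto)
  also have "\<dots> \<le> ennreal ((2 * 2 powi k) ^ length js) * iter_max js F x"
    using iter_int_box_le[of F js x x k] js by simp
  also have "\<dots> \<le> ennreal ((4 * r) ^ CARD('n)) * iter_max js F x"
  proof (intro mult_right_mono ennreal_leI)
    have "length js = CARD('n)" using js distinct_card[of js] by simp
    moreover have "2 * 2 powi k \<le> 4 * r" using k by simp
    ultimately show "(2 * 2 powi k) ^ length js \<le> (4 * r) ^ CARD('n)" by (simp only: ) (intro power_mono mult_nonneg_nonneg zero_le_power_int zero_le_numeral)
  qed simp
  finally show ?thesis .
qed

lemma mnorm_const_1: "is \<noteq> [] \<Longrightarrow> (\<And>i. 0 < p i) \<Longrightarrow> mnorm p is (\<lambda>_. 1) x = top"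
proof (induction "is" arbitrary: x)
  case (Cons i "is")
  have "mnorm p is (\<lambda>_. 1) = (\<lambda>_. if is = [] then 1 else top)"
    using Cons by (cases "is = []") auto
  moreover have "ennreal_powr 1 (p i) = 1" "ennreal_powr top q = top" for q
    by (auto simp: ennreal_powr_def)
  ultimately show ?case by (cases "is = []") (auto simp: ennreal_mult_top)
qed simp

text \<open>At every point of \<open>ccube r\<close> the expression \<open>?A r / r ^ ?n\<close> is
  at most \<open>8 ^ ?n\<close> times the maximal function of \<open>\<bar>H\<bar>\<close>. Taking
  norms, its product with the norm of \<open>indicator (ccube r)\<close> stays bounded, while that
  norm tends to infinity with \<open>r\<close> because the constant 1 has infinite norm.\<close>

lemma average_decay:
  fixes H :: "real ^ 'n::finite \<Rightarrow> real"
  assumes H: "continuous_on UNIV H" and p: "\<And>i. 1 < p i" and js: "distinct js" "set js = UNIV"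
    and fin: "mnorm p js (\<lambda>x. ennreal \<bar>H x\<bar>) 0 < top"
  shows "vanishing_means H"
proof -
  let ?n = "CARD('n)"
  let ?A = "\<lambda>r. (\<integral>x. indicator (ccube r) x * \<bar>H x\<bar> \<partial>lborel)"
  have p0: "0 < p i" for i using p[of i] by simp
  have [measurable]: "H \<in> borel_measurable borel" using H by (rule borel_measurable_continuous_onI)
  have A0: "0 \<le> ?A r" for r by (intro Bochner_Integration.integral_nonneg) auto
  obtain C where C: "0 \<le> C"
    "\<And>F x. F \<in> borel_measurable borel \<Longrightarrow> mnorm p js (iter_max js F) x \<le> ennreal C * mnorm p js F x"
    using iter_max_bound[of p js js] p js by auto
  let ?h = "\<lambda>x. ennreal \<bar>H x\<bar>"
  define K where "K = 8 ^ ?n * (C * enn2real (mnorm p js ?h 0))"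
  have K0: "0 \<le> K" using C(1) by (simp add: K_def)
  have le: "ennreal (?A r / r ^ ?n) * mnorm p js (indicator (ccube r)) 0 \<le> ennreal K" if r: "0 < r" for r
  proof -
    have pt: "ennreal (?A r / r ^ ?n) * indicator (ccube r) x \<le> ennreal (8 ^ ?n) * iter_max js ?h x" for x
    proof (cases "x \<in> ccube r")
      case True
      have "ennreal (?A r) = (\<integral>\<^sup>+y. ennreal (indicator (ccube r) y * \<bar>H y\<bar>) \<partial>lborel)"
        by (intro nn_integral_eq_integral[symmetric] integrable_ccube) (auto intro!: continuous_intros H)
      also have "\<dots> = (\<integral>\<^sup>+y. indicator (ccube r) y * ?h y \<partial>lborel)"
        by (intro nn_integral_cong) (auto simp: indicator_def)
      also have "\<dots> \<le> ennreal ((4 * (2 * r)) ^ ?n) * iter_max js ?h x"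
      proof (rule cube_integral_le_iter_max)
        fix y :: "real ^ 'n" and i assume "y \<in> ccube r"
        then have "\<bar>y $ i\<bar> \<le> r" "\<bar>x $ i\<bar> \<le> r" using True by (auto simp: mem_ccube)
        then show "\<bar>y $ i - x $ i\<bar> \<le> 2 * r" by linarith
      qed (use js r in auto)
      finally have 1: "ennreal (?A r) \<le> ennreal ((8 * r) ^ ?n) * iter_max js ?h x" by simp
      have "ennreal (?A r / r ^ ?n) = ennreal (1 / r ^ ?n) * ennreal (?A r)"
        using r A0 by (simp add: ennreal_mult'[symmetric])
      also have "\<dots> \<le> ennreal (1 / r ^ ?n) * (ennreal ((8 * r) ^ ?n) * iter_max js ?h x)"
        using 1 by (rule mult_left_mono) simp
      also have "\<dots> = ennreal (8 ^ ?n) * iter_max js ?h x"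
        using r by (simp add: mult.assoc[symmetric] ennreal_mult'[symmetric] power_mult_distrib)
      finally show ?thesis using True by simp
    qed simp
    have "ennreal (?A r / r ^ ?n) * mnorm p js (indicator (ccube r)) 0 = mnorm p js (\<lambda>x. ennreal (?A r / r ^ ?n) * indicator (ccube r) x) 0"
      by (rule mnorm_cmult[symmetric]) (use p0 in auto)
    also have "\<dots> \<le> mnorm p js (\<lambda>x. ennreal (8 ^ ?n) * iter_max js ?h x) 0"
      by (intro mnorm_mono pt p0)
    also have "\<dots> = ennreal (8 ^ ?n) * mnorm p js (iter_max js ?h) 0"
      by (rule mnorm_cmult) (use p0 in auto)
    also have "\<dots> \<le> ennreal (8 ^ ?n) * (ennreal C * mnorm p js ?h 0)"
      by (intro mult_left_mono C(2)) auto
    also have "mnorm p js ?h 0 = ennreal (enn2real (mnorm p js ?h 0))" using fin by simp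
    also have "ennreal (8 ^ ?n) * (ennreal C * ennreal (enn2real (mnorm p js ?h 0))) = ennreal K"
      using C(1) unfolding K_def by (simp only: ennreal_mult' zero_le_power zero_le_numeral enn2real_nonneg ennreal_mult mult_nonneg_nonneg)
    finally show ?thesis .
  qed
  have SUP: "(SUP N::nat. mnorm p js (indicator (ccube (real N))) 0) = top"
  proof -
    have "(SUP N::nat. mnorm p js (indicator (ccube (real N))) 0) = mnorm p js (\<lambda>y. SUP N::nat. indicator (ccube (real N)) y) 0"
      by (rule mnorm_SUP[symmetric]) (use p0 in \<open>auto simp: incseq_def le_fun_def indicator_def mem_ccube intro: order_trans\<close>)
    also have "\<dots> = mnorm p js (\<lambda>y. 1) 0"
    proof (rule mnorm_cong)
      fix y :: "real ^ 'n"
      obtain N where "norm y \<le> real N" using real_arch_simple by blast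
      then have N: "y \<in> ccube (real N)" using component_le_norm_cart[of y] by (auto simp: mem_ccube intro: order_trans)
      show "(SUP N::nat. indicator (ccube (real N)) y) = (1::ennreal)"
        by (rule antisym[OF SUP_least SUP_upper2[of N]]) (use N in \<open>auto simp: indicator_def\<close>)
    qed
    also have "\<dots> = top" by (rule mnorm_const_1) (use js p0 in auto)
    finally show ?thesis .
  qed
  show ?thesis
  proof (rule tendstoI)
    fix e :: real assume e: "0 < e"
    \<comment> \<open>With \<open>K + 1\<close> in place of \<open>K\<close> the resulting bound by
      \<open>e\<close> is strict.\<close>
    have "ennreal ((K + 1) / e) < (SUP N::nat. mnorm p js (indicator (ccube (real N))) 0)" by (simp add: SUP)
    then obtain N :: nat where N: "ennreal ((K + 1) / e) < mnorm p js (indicator (ccube (real N))) 0"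
      by (auto simp: less_SUP_iff)
    have "?A r / r ^ ?n < e" if r: "real N + 1 \<le> r" for r
    proof -
      have r0: "0 < r" using r by linarith
      have "mnorm p js (indicator (ccube (real N))) 0 \<le> mnorm p js (indicator (ccube r)) 0"
        using r by (intro mnorm_mono indicator_ccube_mono p0) simp
      with N have "ennreal ((K + 1) / e) \<le> mnorm p js (indicator (ccube r)) 0" by simp
      then have "ennreal (?A r / r ^ ?n) * ennreal ((K + 1) / e) \<le> ennreal (?A r / r ^ ?n) * mnorm p js (indicator (ccube r)) 0"
        by (rule mult_left_mono) simp
      also have "\<dots> \<le> ennreal K" by (rule le[OF r0])
      finally have "?A r / r ^ ?n * ((K + 1) / e) \<le> K"
        using A0 r0 K0 e by (simp add: ennreal_mult'[symmetric])
      moreover have "X * (K + 1) < e * (K + 1)" if "X * ((K + 1) / e) \<le> K" for X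
      proof -
        have "X * (K + 1) \<le> K * e" using that e by (simp add: divide_le_eq)
        also have "\<dots> < e * (K + 1)" using e by (simp add: algebra_simps)
        finally show ?thesis .
      qed
      ultimately have "?A r / r ^ ?n * (K + 1) < e * (K + 1)" by blast
      then show ?thesis using K0 by (simp only: mult_less_cancel_right)
    qed
    then show "\<forall>\<^sub>F r in at_top. dist (?A r / r ^ ?n) 0 < e"
      using A0 by (auto simp: eventually_at_top_linorder intro!: exI[of _ "real N + 1"])
  qed
qed

lemma integral_ccube_affine:
  fixes f :: "real ^ 'n::finite \<Rightarrow> real"
  assumes s: "0 < s"
  shows "(\<integral>x. indicator (ccube (s * r)) (x - a) * f x \<partial>lborel) = s ^ CARD('n) * (\<integral>y. indicator (ccube r) y * f (a + s *\<^sub>R y) \<partial>lborel)"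
proof -
  have "indicator (ccube (s * r)) (s *\<^sub>R y) = (indicator (ccube r) y :: real)" for y :: "real ^ 'n"
    using s by (auto simp: indicator_def mem_ccube abs_mult)
  then show ?thesis using lborel_integral_affine[of s "\<lambda>x. indicator (ccube (s * r)) (x - a) * f x" a] s by simp
qed

lemma integrable_shifted_ccube:
  fixes f :: "real ^ 'n::finite \<Rightarrow> real"
  assumes f: "continuous_on UNIV f"
  shows "integrable lborel (\<lambda>x. indicator (ccube r) (x - a) * f x)"
proof -
  let ?S = "(\<lambda>y. a + y) ` ccube r"
  have "compact ?S" by (rule compact_translation[OF compact_ccube])
  from borel_integrable_compact[OF this continuous_on_subset[OF f subset_UNIV]]
  have "integrable lborel (\<lambda>x. indicator ?S x *\<^sub>R f x)" .
  moreover have "indicator ?S x = (indicator (ccube r) (x - a) :: real)" for x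
    by (auto simp: indicator_def image_iff) (metis add_diff_cancel_left' diff_add_cancel add.commute)
  ultimately show ?thesis by simp
qed

text \<open>\<open>unit_oscillation\<close> on the cube \<open>hcube z l\<close>, rescaled to \<open>ccube 1\<close>. Every dilate of this cube
  about its centre lies in a cube of comparable size about \<open>x\<close>.\<close>

proposition hcube_oscillation:
  fixes i j :: "'n::finite"
  obtains C where "0 \<le> C"
    "\<And>w js z l. smooth (w :: real ^ 'n \<Rightarrow> real) \<Longrightarrow> distinct js \<Longrightarrow> set js = UNIV \<Longrightarrow> 0 < l \<Longrightarrow>
      vanishing_means (partial_derivs [i, j] w) \<Longrightarrow>
      \<exists>c. \<forall>x\<in>hcube z l. ennreal (\<integral>y. indicator (hcube z l) y * \<bar>partial_derivs [i, j] w y - c\<bar> \<partial>lborel) \<le>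
        ennreal (l ^ CARD('n)) * (ennreal C * ennreal_powr (iter_max js (\<lambda>y. ennreal ((laplacian w y)\<^sup>2)) x) (1 / 2))"
proof -
  let ?n = "CARD('n)"
  obtain C where C: "0 \<le> C"
    "\<And>w m. smooth (w :: real ^ 'n \<Rightarrow> real) \<Longrightarrow> 0 < m \<Longrightarrow>
      (\<And>r. 1 \<le> r \<Longrightarrow> (\<integral>y. indicator (ccube r) y * (laplacian w y)\<^sup>2 \<partial>lborel) \<le> m\<^sup>2 * (2 * r) ^ CARD('n)) \<Longrightarrow>
      vanishing_means (partial_derivs [i, j] w) \<Longrightarrow>
      (\<integral>x. indicator (ccube 1) x * \<bar>partial_derivs [i, j] w x - bump_avg 1 (partial_derivs [i, j] w) 0\<bar> \<partial>lborel) \<le> C * m"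
    using unit_oscillation[of i j] by blast
  show ?thesis
  \<comment> \<open>\<open>C + 1\<close> keeps the constant positive, so that the right side is
    infinite wherever the maximal function is.\<close>
  proof (rule that[of "(C + 1) * 2 ^ ?n"])
    show "0 \<le> (C + 1) * 2 ^ ?n" using C(1) by simp
    fix w :: "real ^ 'n \<Rightarrow> real" and js :: "'n list" and z :: "real ^ 'n" and l :: real
    assume w: "smooth w" and js: "distinct js" "set js = UNIV" and l: "0 < l"
      and decay: "vanishing_means (partial_derivs [i, j] w)"
    let ?H = "partial_derivs [i, j] w" and ?f = "laplacian w"
    define s where "s = l / 2"
    have s: "0 < s" using l by (simp add: s_def)
    define a where "a = z + (\<chi> i. s)"
    \<comment> \<open>The second derivatives of \<open>v\<close> and its Laplacian carry the same
      factor \<open>s\<^sup>2\<close>, so the oscillation estimate is invariant under this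
      rescaling.\<close>
    define v where "v y = w (a + s *\<^sub>R y)" for y
    have v: "smooth v" unfolding v_def[abs_def] by (rule smooth_affine[OF w])
    have dv: "partial_derivs [i, j] v y = s\<^sup>2 * partial_derivs [i, j] w (a + s *\<^sub>R y)" for i j y
      unfolding v_def[abs_def] partial_derivs_affine[OF w] by (simp add: power2_eq_square)
    have lv: "laplacian v y = s\<^sup>2 * ?f (a + s *\<^sub>R y)" for y
      unfolding laplacian_def dv sum_distrib_left ..
    have cH: "continuous_on UNIV ?H" by (rule smooth_continuous_on[OF smooth_partial_derivs[OF w]])
    have cf: "continuous_on UNIV ?f" by (rule smooth_continuous_on[OF smooth_laplacian[OF w]])
    have f_meas [measurable]: "?f \<in> borel_measurable borel" using cf by (rule borel_measurable_continuous_onI)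
    have sub: "indicator (hcube z l) y \<le> (indicator (ccube s) (y - a) :: real)" for y
      by (auto simp: indicator_def hcube_def mem_ccube a_def s_def abs_le_iff) (smt (verit) field_sum_of_halves)+
    let ?A = "\<lambda>r. \<integral>y. indicator (ccube r) y * \<bar>?H y\<bar> \<partial>lborel"
    have decay_v: "vanishing_means (partial_derivs [i, j] v)"
    proof (rule tendsto_sandwich)
      show "\<forall>\<^sub>F r in at_top. 0 \<le> (\<integral>y. indicator (ccube r) y * \<bar>partial_derivs [i, j] v y\<bar> \<partial>lborel) / r ^ ?n"
        using eventually_ge_at_top[of 0] by eventually_elim (auto intro!: divide_nonneg_nonneg Bochner_Integration.integral_nonneg)
      show "\<forall>\<^sub>F r in at_top. (\<integral>y. indicator (ccube r) y * \<bar>partial_derivs [i, j] v y\<bar> \<partial>lborel) / r ^ ?n \<le>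
          s\<^sup>2 * 2 ^ ?n * (?A (2 * s * r) / (2 * s * r) ^ ?n)"
        using eventually_ge_at_top[of "norm a / s + 1"]
      proof eventually_elim
        case (elim r)
        have r: "0 < r" "norm a \<le> s * r"
        proof -
          have "0 \<le> norm a / s" using s by simp
          then show "0 < r" using elim by linarith
          have "norm a / s \<le> r" using elim by linarith
          then show "norm a \<le> s * r" using s by (simp add: divide_le_eq mult.commute)
        qed
        have "(\<integral>y. indicator (ccube r) y * \<bar>partial_derivs [i, j] v y\<bar> \<partial>lborel) = s\<^sup>2 * (\<integral>y. indicator (ccube r) y * \<bar>?H (a + s *\<^sub>R y)\<bar> \<partial>lborel)"
          unfolding dv by (subst integral_mult_right_zero[symmetric]) (simp add: abs_mult ac_simps)
        also have "\<dots> = s\<^sup>2 * ((\<integral>x. indicator (ccube (s * r)) (x - a) * \<bar>?H x\<bar> \<partial>lborel) / s ^ ?n)"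
          using s by (subst integral_ccube_affine[OF s]) simp
        also have "\<dots> \<le> s\<^sup>2 * (?A (2 * s * r) / s ^ ?n)"
        proof (intro mult_left_mono divide_right_mono integral_mono integrable_ccube integrable_shifted_ccube)
          fix x
          have "x - a \<in> ccube (s * r) \<Longrightarrow> x \<in> ccube (2 * s * r)"
          proof (unfold mem_ccube, rule allI)
            fix i assume "\<forall>i. \<bar>(x - a) $ i\<bar> \<le> s * r"
            then have "\<bar>x $ i - a $ i\<bar> \<le> s * r" by simp
            then show "\<bar>x $ i\<bar> \<le> 2 * s * r" using component_le_norm_cart[of a i] r by linarith
          qed
          then show "indicator (ccube (s * r)) (x - a) * \<bar>?H x\<bar> \<le> indicator (ccube (2 * s * r)) x * \<bar>?H x\<bar>"
            by (auto simp: indicator_def)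
        qed (use s cH in \<open>auto intro!: continuous_intros\<close>)
        finally have "(\<integral>y. indicator (ccube r) y * \<bar>partial_derivs [i, j] v y\<bar> \<partial>lborel) / r ^ ?n \<le> s\<^sup>2 * (?A (2 * s * r) / s ^ ?n) / r ^ ?n"
          using r by (intro divide_right_mono) auto
        also have "\<dots> = s\<^sup>2 * 2 ^ ?n * (?A (2 * s * r) / (2 * s * r) ^ ?n)"
          by (simp add: power_mult_distrib)
        finally show ?case .
      qed
      have "filterlim (\<lambda>r. 2 * s * r) at_top at_top"
        by (rule filterlim_tendsto_pos_mult_at_top[OF tendsto_const]) (use s in \<open>auto intro: filterlim_ident\<close>)
      from filterlim_compose[OF decay this]
      have "((\<lambda>r. s\<^sup>2 * 2 ^ ?n * (?A (2 * s * r) / (2 * s * r) ^ ?n)) \<longlongrightarrow> s\<^sup>2 * 2 ^ ?n * 0) at_top"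
        by (intro tendsto_mult tendsto_const)
      then show "((\<lambda>r. s\<^sup>2 * 2 ^ ?n * (?A (2 * s * r) / (2 * s * r) ^ ?n)) \<longlongrightarrow> 0) at_top" by simp
    qed simp
    define c where "c = bump_avg 1 (partial_derivs [i, j] v) 0 / s\<^sup>2"
    show "\<exists>c. \<forall>x\<in>hcube z l. ennreal (\<integral>y. indicator (hcube z l) y * \<bar>?H y - c\<bar> \<partial>lborel) \<le>
        ennreal (l ^ ?n) * (ennreal ((C + 1) * 2 ^ ?n) * ennreal_powr (iter_max js (\<lambda>y. ennreal ((?f y)\<^sup>2)) x) (1 / 2))"
    proof (intro exI[of _ c] ballI)
      fix x assume x: "x \<in> hcube z l"
      let ?M = "iter_max js (\<lambda>y. ennreal ((?f y)\<^sup>2)) x"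
      let ?I = "\<integral>y. indicator (hcube z l) y * \<bar>?H y - c\<bar> \<partial>lborel"
      show "ennreal ?I \<le> ennreal (l ^ ?n) * (ennreal ((C + 1) * 2 ^ ?n) * ennreal_powr ?M (1 / 2))"
      proof (cases "?M = top")
        case True
        have "0 < (C + 1) * 2 ^ ?n" "0 < l ^ ?n" using C(1) l by auto
        then show ?thesis using True C(1) l by (simp add: ennreal_powr_def ennreal_mult_top)
      next
        case False
        define M where "M = enn2real ?M"
        have M: "?M = ennreal M" "0 \<le> M" using False by (auto simp: M_def top.not_eq_extremum)
        \<comment> \<open>\<open>4 ^ ?n\<close> compares the side \<open>4 * (2 * s * r)\<close> of
          the enclosing cube with \<open>s * (2 * r)\<close>. As \<open>unit_oscillation\<close>
          requires \<open>0 < m\<close> while \<open>M\<close> may vanish, \<open>m\<close> will be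
          \<open>2 ^ ?n * sqrt M\<close> plus a small \<open>d\<close>.\<close>
        have bound: "?I \<le> l ^ ?n * (C * m)" if m: "0 < m" "4 ^ ?n * M \<le> m\<^sup>2" for m
        proof -
          have sq: "(\<integral>y. indicator (ccube r) y * (laplacian v y)\<^sup>2 \<partial>lborel) \<le> (s\<^sup>2 * m)\<^sup>2 * (2 * r) ^ ?n" if r: "1 \<le> r" for r
          proof -
            have "ennreal (\<integral>y. indicator (ccube (s * r)) (y - a) * (?f y)\<^sup>2 \<partial>lborel) =
                (\<integral>\<^sup>+y. ennreal (indicator (ccube (s * r)) (y - a) * (?f y)\<^sup>2) \<partial>lborel)"
              by (intro nn_integral_eq_integral[symmetric] integrable_shifted_ccube) (auto intro!: continuous_intros cf)
            also have "\<dots> = (\<integral>\<^sup>+y. indicator {y. y - a \<in> ccube (s * r)} y * ennreal ((?f y)\<^sup>2) \<partial>lborel)"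
              by (intro nn_integral_cong) (auto simp: indicator_def)
            also have "\<dots> \<le> ennreal ((4 * (2 * s * r)) ^ ?n) * ?M"
            proof (rule cube_integral_le_iter_max)
              fix y :: "real ^ 'n" and i assume "y \<in> {y. y - a \<in> ccube (s * r)}"
              then have 1: "\<bar>y $ i - a $ i\<bar> \<le> s * r" by (auto simp: mem_ccube)
              have "a $ i = z $ i + s" "z $ i \<le> x $ i" "x $ i < z $ i + 2 * s"
                using x by (auto simp: hcube_def a_def s_def)
              moreover have "s * 1 \<le> s * r" using s r by (intro mult_left_mono) auto
              ultimately show "\<bar>y $ i - x $ i\<bar> \<le> 2 * s * r" using 1 by linarith
            qed (use js s r in auto)
            finally have "(\<integral>y. indicator (ccube (s * r)) (y - a) * (?f y)\<^sup>2 \<partial>lborel) \<le> (4 * (2 * s * r)) ^ ?n * M"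
              using s r M by (simp add: ennreal_mult'[symmetric])
            then have 1: "(\<integral>y. indicator (ccube r) y * (?f (a + s *\<^sub>R y))\<^sup>2 \<partial>lborel) \<le> (2 * r) ^ ?n * (4 ^ ?n * M)"
              (is "?L \<le> ?R")
            proof -
              assume le: "(\<integral>y. indicator (ccube (s * r)) (y - a) * (?f y)\<^sup>2 \<partial>lborel) \<le> (4 * (2 * s * r)) ^ ?n * M"
              have "4 * (2 * s * r) = s * ((2 * r) * 4)" by simp
              then have "(4 * (2 * s * r)) ^ ?n * M = s ^ ?n * ?R" by (simp only: power_mult_distrib mult.assoc)
              with le have "s ^ ?n * ?L \<le> s ^ ?n * ?R" by (simp only: integral_ccube_affine[OF s])
              then show ?thesis using s by (simp only: mult_le_cancel_left_pos zero_less_power)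
            qed
            have "(\<integral>y. indicator (ccube r) y * (laplacian v y)\<^sup>2 \<partial>lborel) = (s\<^sup>2)\<^sup>2 * (\<integral>y. indicator (ccube r) y * (?f (a + s *\<^sub>R y))\<^sup>2 \<partial>lborel)"
              unfolding lv by (subst integral_mult_right_zero[symmetric]) (simp add: power_mult_distrib ac_simps)
            also have "\<dots> \<le> (s\<^sup>2)\<^sup>2 * ((2 * r) ^ ?n * (4 ^ ?n * M))" by (intro mult_left_mono 1) simp
            also have "\<dots> \<le> (s\<^sup>2)\<^sup>2 * ((2 * r) ^ ?n * m\<^sup>2)" using m r by (intro mult_left_mono) auto
            finally show ?thesis by (simp add: power_mult_distrib ac_simps)
          qed
          have "0 < s\<^sup>2 * m" using s m by simp
          have cs: "s\<^sup>2 * c = bump_avg 1 (partial_derivs [i, j] v) 0" using s by (simp add: c_def)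
          from C(2)[OF v \<open>0 < s\<^sup>2 * m\<close> sq decay_v]
          have "(\<integral>y. indicator (ccube 1) y * \<bar>s\<^sup>2 * ?H (a + s *\<^sub>R y) - s\<^sup>2 * c\<bar> \<partial>lborel) \<le> C * (s\<^sup>2 * m)"
            unfolding dv cs .
          moreover have "(\<integral>y. indicator (ccube 1) y * \<bar>s\<^sup>2 * ?H (a + s *\<^sub>R y) - s\<^sup>2 * c\<bar> \<partial>lborel) =
            s\<^sup>2 * (\<integral>y. indicator (ccube 1) y * \<bar>?H (a + s *\<^sub>R y) - c\<bar> \<partial>lborel)"
          proof -
            have "\<bar>s\<^sup>2 * X - s\<^sup>2 * c\<bar> = s\<^sup>2 * \<bar>X - c\<bar>" for X
              by (simp only: right_diff_distrib[symmetric] abs_mult abs_power2)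
            then show ?thesis by (simp only: mult.left_commute[of _ "s\<^sup>2"] integral_mult_right_zero)
          qed
          ultimately have 2: "(\<integral>y. indicator (ccube 1) y * \<bar>?H (a + s *\<^sub>R y) - c\<bar> \<partial>lborel) \<le> C * m"
            using s by (simp add: mult.left_commute)
          have "?I \<le> (\<integral>y. indicator (ccube s) (y - a) * \<bar>?H y - c\<bar> \<partial>lborel)"
            using sub by (intro integral_mono' integrable_shifted_ccube mult_right_mono continuous_intros cH) auto
          also have "\<dots> = s ^ ?n * (\<integral>y. indicator (ccube 1) y * \<bar>?H (a + s *\<^sub>R y) - c\<bar> \<partial>lborel)"
            using integral_ccube_affine[OF s, of 1 a "\<lambda>y. \<bar>?H y - c\<bar>"] by simp
          also have "\<dots> \<le> l ^ ?n * (C * m)"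
            using 2 s l C(1) m by (intro mult_mono power_mono Bochner_Integration.integral_nonneg) (auto simp: s_def)
          finally show ?thesis .
        qed
        have I: "?I \<le> l ^ ?n * ((C + 1) * 2 ^ ?n * sqrt M)"
        proof (rule field_le_epsilon)
          fix e :: real assume e: "0 < e"
          define d where "d = e / (l ^ ?n * C + 1)"
          have p: "0 < l ^ ?n * C + 1" using l C(1) by (intro add_nonneg_pos) auto
          have d: "0 < d" "l ^ ?n * C * d \<le> e"
            using e p by (simp_all add: d_def field_simps)
          have "4 ^ ?n * M = (2 ^ ?n * sqrt M)\<^sup>2"
            using M by (simp add: power_mult_distrib power_mult[symmetric] mult.commute[of _ 2]) (simp add: power_mult)
          also have "\<dots> \<le> (2 ^ ?n * sqrt M + d)\<^sup>2" using d M by (intro power_mono) auto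
          finally have "?I \<le> l ^ ?n * (C * (2 ^ ?n * sqrt M + d))"
            using d M by (intro bound add_nonneg_pos) auto
          also have "\<dots> = l ^ ?n * (C * (2 ^ ?n * sqrt M)) + l ^ ?n * C * d" by (simp add: algebra_simps)
          also have "\<dots> \<le> l ^ ?n * ((C + 1) * (2 ^ ?n * sqrt M)) + e"
            using d l M C(1) by (intro add_mono mult_left_mono mult_right_mono) auto
          finally show "?I \<le> l ^ ?n * ((C + 1) * 2 ^ ?n * sqrt M) + e" by (simp add: mult.assoc)
        qed
        have "ennreal_powr ?M (1 / 2) = ennreal (sqrt M)" using M by (simp add: ennreal_powr_def powr_half_sqrt)
        then show ?thesis using I l C(1) M by (simp add: ennreal_mult'[symmetric])
      qed
    qed
  qed
qed

text \<open>The finite norm of \<open>H\<close> is used twice: by \<open>average_decay\<close> for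
  the behaviour at infinity, and by \<open>mnorm_dual\<close> for a function \<open>g\<close> at
  which the norm is attained. As \<open>Q\<close> is a multiple of the root of \<open>Mf\<close>,
  its norm with exponents \<open>p i\<close> is controlled by the maximal theorem at
  \<open>p i / 2\<close>; \<open>G\<close> is controlled at the conjugate exponents, where
  \<open>g\<close> has norm at most one.\<close>

theorem smooth_mixed_norm_estimate:
  fixes p :: "'n::finite \<Rightarrow> real"
  assumes p: "\<And>i. 2 < p i" and js: "distinct js" "set js = UNIV"
  shows "\<exists>C\<ge>0. \<forall>w. smooth w \<longrightarrow> mnorm p js (\<lambda>x. ennreal \<bar>partial_derivs [i, j] w x\<bar>) 0 < top \<longrightarrow>
    mnorm p js (\<lambda>x. ennreal \<bar>partial_derivs [i, j] w x\<bar>) 0 \<le> ennreal C * mnorm p js (\<lambda>x. ennreal \<bar>laplacian w x\<bar>) 0"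
proof -
  let ?n = "CARD('n)"
  let ?q = "\<lambda>i. p i / (p i - 1)"
  have p1: "1 < p i" and p0: "0 < p i" and p2: "1 < p i / 2" and p2': "0 < p i / 2" and q1: "1 < ?q i" and q0: "0 < ?q i" for i
    using p[of i] by (auto simp: less_divide_eq)
  obtain C0 where C0: "0 \<le> C0"
    "\<And>w js z l. smooth (w :: real ^ 'n \<Rightarrow> real) \<Longrightarrow> distinct js \<Longrightarrow> set js = UNIV \<Longrightarrow> 0 < l \<Longrightarrow>
      vanishing_means (partial_derivs [i, j] w) \<Longrightarrow>
      \<exists>c. \<forall>x\<in>hcube z l. ennreal (\<integral>y. indicator (hcube z l) y * \<bar>partial_derivs [i, j] w y - c\<bar> \<partial>lborel) \<le>
        ennreal (l ^ CARD('n)) * (ennreal C0 * ennreal_powr (iter_max js (\<lambda>y. ennreal ((laplacian w y)\<^sup>2)) x) (1 / 2))"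
    using hcube_oscillation[of i j] by blast
  obtain C1 where C1: "0 \<le> C1"
    "\<And>F x. F \<in> borel_measurable borel \<Longrightarrow> mnorm (\<lambda>i. p i / 2) js (iter_max js F) x \<le> ennreal C1 * mnorm (\<lambda>i. p i / 2) js F x"
    using iter_max_bound[of "\<lambda>i. p i / 2" js js] p2 js by auto
  obtain C2 where C2: "0 \<le> C2"
    "\<And>F x. F \<in> borel_measurable borel \<Longrightarrow> mnorm ?q js (iter_max js F) x \<le> ennreal C2 * mnorm ?q js F x"
    using iter_max_bound[of ?q js js] q1 js by auto
  define C where "C = (8 * 2 ^ ?n) * ((C0 * sqrt C1) * (4 ^ ?n * C2))"
  show ?thesis
  proof (intro exI[of _ C] conjI allI impI)
    show "0 \<le> C" using C0(1) C1(1) C2(1) by (simp add: C_def)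
    fix w :: "real ^ 'n \<Rightarrow> real"
    define H where "H = partial_derivs [i, j] w"
    let ?f = "laplacian w"
    let ?h = "\<lambda>x. ennreal \<bar>H x\<bar>"
    assume w: "smooth w" and "mnorm p js (\<lambda>x. ennreal \<bar>partial_derivs [i, j] w x\<bar>) 0 < top"
    then have fin: "mnorm p js ?h 0 < top" by (simp only: H_def)
    have cH: "continuous_on UNIV H" unfolding H_def by (rule smooth_continuous_on[OF smooth_partial_derivs[OF w]])
    have H_meas [measurable]: "H \<in> borel_measurable borel" using cH by (rule borel_measurable_continuous_onI)
    have f_meas [measurable]: "?f \<in> borel_measurable borel"
      by (rule borel_measurable_continuous_onI[OF smooth_continuous_on[OF smooth_laplacian[OF w]]])
    have decay: "vanishing_means H"
      by (rule average_decay[OF cH p1 js fin])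
    define Mf where "Mf = iter_max js (\<lambda>y. ennreal ((?f y)\<^sup>2))"
    define Q where "Q x = ennreal C0 * ennreal_powr (Mf x) (1 / 2)" for x
    have Mf [measurable]: "Mf \<in> borel_measurable borel" unfolding Mf_def by measurable
    have Q [measurable]: "Q \<in> borel_measurable borel" unfolding Q_def[abs_def] by measurable
    have "\<exists>g\<in>borel_measurable borel. (\<forall>x. mnorm ?q js g x \<le> 1) \<and>
        (\<forall>x. mnorm p js ?h x < top \<longrightarrow> iter_int js (\<lambda>y. ?h y * g y) x = mnorm p js ?h x)"
      by (rule mnorm_dual) (use p1 js in auto)
    then obtain g :: "real ^ 'n \<Rightarrow> ennreal" where g [measurable]: "g \<in> borel_measurable borel"
      and g1: "\<And>x. mnorm ?q js g x \<le> 1" and g2: "iter_int js (\<lambda>y. ?h y * g y) 0 = mnorm p js ?h 0"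
      using fin by blast
    \<comment> \<open>The factor \<open>4 ^ ?n\<close> is that of
      \<open>cube_integral_le_iter_max\<close>, since any two points of a cube of side
      \<open>l\<close> differ by at most \<open>l\<close> in each coordinate.\<close>
    define G where "G x = ennreal (4 ^ ?n) * iter_max js g x" for x
    have G [measurable]: "G \<in> borel_measurable borel" unfolding G_def[abs_def] by measurable
    \<comment> \<open>\<open>duality\<close> requires a bounded function of compact support, so
      \<open>g\<close> is cut off in height and in space. The sign of \<open>H\<close> makes the
      pairings nonnegative and increasing in \<open>m\<close>, with the pairing of
      \<open>\<bar>H\<bar>\<close> and \<open>g\<close> as their limit.\<close>
    define gm where "gm m x = indicator (ccube (real m)) x * (enn2real (min (g x) (of_nat m)) * sgn (H x))" for m :: nat and x
    have gm_meas [measurable]: "gm m \<in> borel_measurable borel" for m unfolding gm_def[abs_def] by measurable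
    have gm_abs: "\<bar>gm m x\<bar> \<le> enn2real (min (g x) (of_nat m))" for m x
      by (auto simp: gm_def indicator_def abs_mult abs_sgn_eq)
    have min_fin: "min (g x) (of_nat m) < top" for x and m :: nat
      by (auto simp: min_less_iff_disj of_nat_less_top)
    have gm_g: "ennreal \<bar>gm m x\<bar> \<le> g x" for m x
    proof -
      have "ennreal \<bar>gm m x\<bar> \<le> ennreal (enn2real (min (g x) (of_nat m)))" by (rule ennreal_leI[OF gm_abs])
      also have "\<dots> = min (g x) (of_nat m)" using min_fin by simp
      finally show ?thesis by simp
    qed
    have gm_le: "\<bar>gm m x\<bar> \<le> real m" for m x
    proof -
      have "enn2real (min (g x) (of_nat m)) \<le> real m"
        by (rule enn2real_leI) (auto simp: ennreal_of_nat_eq_real_of_nat)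
      then show ?thesis using gm_abs[of m x] by linarith
    qed
    have dual: "ennreal \<bar>\<integral>x. H x * gm m x \<partial>lborel\<bar> \<le> ennreal (8 * 2 ^ ?n) * (\<integral>\<^sup>+x. Q x * G x \<partial>lborel)" for m
    proof -
      interpret cube_duality H "gm m" Q G "real m"
      proof unfold_locales
        fix z :: "real ^ 'n" and l :: real assume l: "0 < l"
        show "\<exists>c. \<forall>x\<in>hcube z l. ennreal (\<integral>y. indicator (hcube z l) y * \<bar>H y - c\<bar> \<partial>lborel) \<le> ennreal (l ^ ?n) * Q x"
          unfolding Q_def Mf_def unfolding H_def by (rule C0(2)[OF w js l decay[unfolded H_def]])
        fix x assume x: "x \<in> hcube z l"
        have "ennreal (\<integral>y. indicator (hcube z l) y * \<bar>gm m y\<bar> \<partial>lborel) = (\<integral>\<^sup>+y. ennreal (indicator (hcube z l) y * \<bar>gm m y\<bar>) \<partial>lborel)"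
          by (intro nn_integral_eq_integral[symmetric] integrable_hcube_bounded[of _ z l "real m"]) (use gm_le in auto)
        also have "\<dots> \<le> (\<integral>\<^sup>+y. indicator (hcube z l) y * g y \<partial>lborel)"
          by (intro nn_integral_mono) (use gm_g in \<open>auto simp: indicator_def\<close>)
        also have "\<dots> \<le> ennreal ((4 * l) ^ ?n) * iter_max js g x"
        proof (rule cube_integral_le_iter_max)
          fix y :: "real ^ 'n" and i assume "y \<in> hcube z l"
          then have "z $ i \<le> y $ i" "y $ i < z $ i + l" "z $ i \<le> x $ i" "x $ i < z $ i + l" using x by (auto simp: hcube_def)
          then show "\<bar>y $ i - x $ i\<bar> \<le> l" by linarith
        qed (use js l in auto)
        also have "\<dots> = ennreal (l ^ ?n) * G x"
          using l by (simp add: G_def power_mult_distrib ennreal_mult' ac_simps)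
        finally have 1: "ennreal (\<integral>y. indicator (hcube z l) y * \<bar>gm m y\<bar> \<partial>lborel) \<le> ennreal (l ^ ?n) * G x" .
        have "ennreal ((\<integral>y. indicator (hcube z l) y * \<bar>gm m y\<bar> \<partial>lborel) / l ^ ?n) =
          ennreal (1 / l ^ ?n) * ennreal (\<integral>y. indicator (hcube z l) y * \<bar>gm m y\<bar> \<partial>lborel)"
          using l by (subst ennreal_mult'[symmetric]) auto
        also have "\<dots> \<le> ennreal (1 / l ^ ?n) * (ennreal (l ^ ?n) * G x)" using 1 by (rule mult_left_mono) simp
        also have "\<dots> = G x" using l by (simp add: mult.assoc[symmetric] ennreal_mult'[symmetric])
        finally show "ennreal ((\<integral>y. indicator (hcube z l) y * \<bar>gm m y\<bar> \<partial>lborel) / l ^ ?n) \<le> G x" .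
      qed (use cH gm_le in auto)
      show ?thesis by (rule duality[OF _ decay, of "real m"]) (auto simp: gm_def)
    qed
    have int_gm: "ennreal \<bar>\<integral>x. H x * gm m x \<partial>lborel\<bar> = (\<integral>\<^sup>+x. ?h x * (indicator (ccube (real m)) x * min (g x) (of_nat m)) \<partial>lborel)" for m
    proof -
      have eq: "H x * gm m x = indicator (ccube (real m)) x * (\<bar>H x\<bar> * enn2real (min (g x) (of_nat m)))" for x
        by (simp add: gm_def abs_sgn ac_simps)
      have "integrable lborel (\<lambda>x. indicator (ccube (real m)) x * (\<bar>H x\<bar> * enn2real (min (g x) (of_nat m))))"
      proof (rule Bochner_Integration.integrable_bound)
        show "integrable lborel (\<lambda>x. indicator (ccube (real m)) x * \<bar>H x\<bar> * real m)"
          by (intro integrable_mult_left integrable_ccube) (auto intro!: continuous_intros cH)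
        have "enn2real (min (g x) (of_nat m)) \<le> real m" for x
          by (rule enn2real_leI) (auto simp: ennreal_of_nat_eq_real_of_nat)
        then show "AE x in lborel. norm (indicator (ccube (real m)) x * (\<bar>H x\<bar> * enn2real (min (g x) (of_nat m)))) \<le>
            norm (indicator (ccube (real m)) x * \<bar>H x\<bar> * real m)"
          by (intro AE_I2) (auto simp: indicator_def abs_mult intro!: mult_left_mono)
      qed measurable
      then have "ennreal (\<integral>x. H x * gm m x \<partial>lborel) = (\<integral>\<^sup>+x. ennreal (indicator (ccube (real m)) x * (\<bar>H x\<bar> * enn2real (min (g x) (of_nat m)))) \<partial>lborel)"
        unfolding eq by (intro nn_integral_eq_integral[symmetric]) (auto intro!: AE_I2)
      also have "\<dots> = (\<integral>\<^sup>+x. ?h x * (indicator (ccube (real m)) x * min (g x) (of_nat m)) \<partial>lborel)"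
        using min_fin by (intro nn_integral_cong) (auto simp: indicator_def ennreal_mult')
      also have "(\<integral>x. H x * gm m x \<partial>lborel) = \<bar>\<integral>x. H x * gm m x \<partial>lborel\<bar>"
        unfolding eq by (intro abs_of_nonneg[symmetric] Bochner_Integration.integral_nonneg) auto
      finally show ?thesis .
    qed
    have "mnorm p js ?h 0 = (\<integral>\<^sup>+x. ?h x * g x \<partial>lborel)"
      unfolding g2[symmetric] by (rule iter_int_eq_nn_integral) (use js in auto)
    also have "\<dots> = (\<integral>\<^sup>+x. (SUP m. ?h x * (indicator (ccube (real m)) x * min (g x) (of_nat m))) \<partial>lborel)"
    proof (rule nn_integral_cong)
      fix x :: "real ^ 'n"
      have "(SUP m. indicator (ccube (real m)) x * min (g x) (of_nat m)) = g x"
      proof (rule antisym)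
        show "(SUP m. indicator (ccube (real m)) x * min (g x) (of_nat m)) \<le> g x"
          by (intro SUP_least) (auto simp: indicator_def)
        obtain N where N: "norm x \<le> real N" using real_arch_simple by blast
        have "min (g x) (of_nat k) \<le> (SUP m. indicator (ccube (real m)) x * min (g x) (of_nat m))" for k
        proof (rule SUP_upper2[of "max N k"])
          have "\<bar>x $ i\<bar> \<le> real (max N k)" for i using N component_le_norm_cart[of x i] by simp
          then have "x \<in> ccube (real (max N k))" by (simp add: mem_ccube)
          moreover have "(of_nat k :: ennreal) \<le> of_nat (max N k)" by simp
          ultimately show "min (g x) (of_nat k) \<le> indicator (ccube (real (max N k))) x * min (g x) (of_nat (max N k))"
            by (auto simp: min_le_iff_disj)
        qed simp
        then have "(SUP k::nat. min (g x) (of_nat k)) \<le> (SUP m. indicator (ccube (real m)) x * min (g x) (of_nat m))"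
          by (intro SUP_least)
        moreover have "(SUP k::nat. min (g x) (of_nat k)) = g x"
        proof -
          have "(SUP k::nat. inf (g x) (of_nat k)) = inf (g x) (SUP k::nat. of_nat k)"
            by (rule inf_SUP[symmetric])
          then show ?thesis by (simp add: ennreal_SUP_of_nat_eq_top inf_min)
        qed
        ultimately show "g x \<le> (SUP m. indicator (ccube (real m)) x * min (g x) (of_nat m))" by simp
      qed
      then show "?h x * g x = (SUP m. ?h x * (indicator (ccube (real m)) x * min (g x) (of_nat m)))"
        by (simp add: SUP_mult_left_ennreal[symmetric])
    qed
    also have "\<dots> = (SUP m. \<integral>\<^sup>+x. ?h x * (indicator (ccube (real m)) x * min (g x) (of_nat m)) \<partial>lborel)"
    proof (rule nn_integral_monotone_convergence_SUP)
      show "incseq (\<lambda>m x. ?h x * (indicator (ccube (real m)) x * min (g x) (of_nat m)))"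
      proof (intro incseq_SucI le_funI mult_left_mono mult_mono)
        fix m and x :: "real ^ 'n"
        show "indicator (ccube (real m)) x \<le> (indicator (ccube (real (Suc m))) x :: ennreal)" by (intro indicator_ccube_mono) simp
        show "min (g x) (of_nat m) \<le> min (g x) (of_nat (Suc m))" by (intro min.mono of_nat_mono) auto
      qed auto
    qed measurable
    also have "\<dots> \<le> ennreal (8 * 2 ^ ?n) * (\<integral>\<^sup>+x. Q x * G x \<partial>lborel)"
      unfolding int_gm[symmetric] by (intro SUP_least dual)
    finally have main: "mnorm p js ?h 0 \<le> ennreal (8 * 2 ^ ?n) * (\<integral>\<^sup>+x. Q x * G x \<partial>lborel)" .
    have "(\<integral>\<^sup>+x. Q x * G x \<partial>lborel) = iter_int js (\<lambda>x. Q x * G x) 0"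
      by (rule iter_int_eq_nn_integral[symmetric]) (use js in auto)
    also have "\<dots> \<le> mnorm p js Q 0 * mnorm ?q js G 0" by (rule iter_int_Hoelder) (use p1 in auto)
    also have "\<dots> \<le> (ennreal (C0 * sqrt C1) * mnorm p js (\<lambda>x. ennreal \<bar>?f x\<bar>) 0) * ennreal (4 ^ ?n * C2)"
    proof (rule mult_mono)
      have "mnorm p js Q 0 = ennreal C0 * mnorm p js (\<lambda>x. ennreal_powr (Mf x) (1 / 2)) 0"
        unfolding Q_def[abs_def] by (rule mnorm_cmult) (use p0 in auto)
      also have "mnorm p js (\<lambda>x. ennreal_powr (Mf x) (1 / 2)) 0 = ennreal_powr (mnorm (\<lambda>i. 1 / 2 * p i) js Mf 0) (1 / 2)"
        by (rule mnorm_powr) (use p0 in auto)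
      also have "\<dots> \<le> ennreal_powr (ennreal C1 * mnorm (\<lambda>i. 1 / 2 * p i) js (\<lambda>y. ennreal ((?f y)\<^sup>2)) 0) (1 / 2)"
        using C1(2)[of "\<lambda>y. ennreal ((?f y)\<^sup>2)" 0] by (intro ennreal_powr_mono) (simp_all add: Mf_def)
      also have "\<dots> = ennreal (sqrt C1) * ennreal_powr (mnorm (\<lambda>i. 1 / 2 * p i) js (\<lambda>y. ennreal ((?f y)\<^sup>2)) 0) (1 / 2)"
        using C1(1) by (simp add: ennreal_powr_mult ennreal_powr_ennreal powr_half_sqrt)
      also have "ennreal_powr (mnorm (\<lambda>i. 1 / 2 * p i) js (\<lambda>y. ennreal ((?f y)\<^sup>2)) 0) (1 / 2) =
          mnorm p js (\<lambda>y. ennreal_powr (ennreal ((?f y)\<^sup>2)) (1 / 2)) 0"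
        by (rule mnorm_powr[symmetric]) (use p0 in auto)
      also have "(\<lambda>y. ennreal_powr (ennreal ((?f y)\<^sup>2)) (1 / 2)) = (\<lambda>y. ennreal \<bar>?f y\<bar>)"
        by (simp add: ennreal_powr_ennreal powr_half_sqrt)
      finally show "mnorm p js Q 0 \<le> ennreal (C0 * sqrt C1) * mnorm p js (\<lambda>x. ennreal \<bar>?f x\<bar>) 0"
        using C0(1) C1(1) by (simp add: ennreal_mult' mult.assoc mult_left_mono)
      have "mnorm ?q js G 0 = ennreal (4 ^ ?n) * mnorm ?q js (iter_max js g) 0"
        unfolding G_def[abs_def] by (rule mnorm_cmult) (use q0 in auto)
      also have "\<dots> \<le> ennreal (4 ^ ?n) * (ennreal C2 * 1)"
        by (intro mult_left_mono order_trans[OF C2(2)] g1) auto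
      finally show "mnorm ?q js G 0 \<le> ennreal (4 ^ ?n * C2)" using C2(1) by (simp add: ennreal_mult')
    qed auto
    finally have "ennreal (8 * 2 ^ ?n) * (\<integral>\<^sup>+x. Q x * G x \<partial>lborel) \<le>
      ennreal (8 * 2 ^ ?n) * ((ennreal (C0 * sqrt C1) * mnorm p js (\<lambda>x. ennreal \<bar>?f x\<bar>) 0) * ennreal (4 ^ ?n * C2))"
      by (rule mult_left_mono) simp
    also have "\<dots> = ennreal C * mnorm p js (\<lambda>x. ennreal \<bar>?f x\<bar>) 0"
      using C0(1) C1(1) C2(1) unfolding C_def by (simp add: ennreal_mult' ac_simps)
    finally show "mnorm p js (\<lambda>x. ennreal \<bar>partial_derivs [i, j] w x\<bar>) 0 \<le> ennreal C * mnorm p js (\<lambda>x. ennreal \<bar>?f x\<bar>) 0"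
      using main unfolding H_def[symmetric] by simp
  qed
qed

section \<open>Mollification of weak derivatives\<close>

lemma nn_integral_lborel_affine:
  fixes f :: "real ^ 'n::finite \<Rightarrow> ennreal"
  assumes [measurable]: "f \<in> borel_measurable borel" and "c \<noteq> 0"
  shows "(\<integral>\<^sup>+x. f x \<partial>lborel) = ennreal (\<bar>c\<bar> ^ CARD('n)) * (\<integral>\<^sup>+x. f (t + c *\<^sub>R x) \<partial>lborel)"
proof -
  have "(\<integral>\<^sup>+x. f x \<partial>lborel) = (\<integral>\<^sup>+x. f x \<partial>density (distr lborel borel (\<lambda>x. t + c *\<^sub>R x)) (\<lambda>_. \<bar>c\<bar> ^ DIM(real ^ 'n)))"
    by (subst lborel_affine[OF assms(2), of t]) simp
  also have "\<dots> = ennreal (\<bar>c\<bar> ^ CARD('n)) * (\<integral>\<^sup>+x. f (t + c *\<^sub>R x) \<partial>lborel)"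
    by (subst nn_integral_density) (auto simp: nn_integral_distr nn_integral_cmult)
  finally show ?thesis .
qed

lemma bump_measurable [measurable]: "bump \<in> borel_measurable borel"
  by (intro smooth_measurable test_function_smooth test_function_bump)

lemma nn_integral_bump: "(\<integral>\<^sup>+x. ennreal (bump (x :: real ^ 'n::finite)) \<partial>lborel) = 1"
  using nn_integral_eq_integral[OF test_function_integrable[OF test_function_bump]]
  by (simp add: bump_nonneg integral_bump)

lemma integrable_bump_translate:
  fixes u :: "real ^ 'n::finite \<Rightarrow> real"
  assumes [measurable]: "u \<in> borel_measurable borel"
    and u: "\<And>R. integrable_cball R u" and t: "0 < t"
  shows "integrable lborel (\<lambda>z. bump z * u (x - t *\<^sub>R z))"
proof (rule integrableI_bounded)
  obtain K where K: "0 \<le> K" "\<And>x. \<bar>bump (x :: real ^ 'n)\<bar> \<le> K" using test_function_bounded[OF test_function_bump] by blast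
  have [measurable]: "(\<lambda>y. indicator (cball 0 (norm x + t)) y :: real) \<in> borel_measurable (borel :: (real ^ 'n) measure)"
    by (intro borel_measurable_indicator) simp
  define f where "f y = ennreal (norm (u y * indicator (cball 0 (norm x + t)) y))" for y
  have f [measurable]: "f \<in> borel_measurable borel" unfolding f_def[abs_def] by measurable
  have "(\<integral>\<^sup>+z. ennreal (norm (bump z * u (x - t *\<^sub>R z))) \<partial>lborel) \<le> (\<integral>\<^sup>+z. ennreal K * f (x + (- t) *\<^sub>R z) \<partial>lborel)"
  proof (rule nn_integral_mono)
    fix z :: "real ^ 'n"
    show "ennreal (norm (bump z * u (x - t *\<^sub>R z))) \<le> ennreal K * f (x + (- t) *\<^sub>R z)"
    proof (cases "norm z < 1")
      case True
      have "norm (x - t *\<^sub>R z) \<le> norm x + t * norm z" using norm_triangle_ineq4[of x "t *\<^sub>R z"] t by simp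
      also have "\<dots> \<le> norm x + t" using True t by simp
      finally have "indicator (cball 0 (norm x + t)) (x + (- t) *\<^sub>R z) = (1 :: real)" by simp
      then have "norm (bump z * u (x - t *\<^sub>R z)) \<le> K * norm (u (x + (- t) *\<^sub>R z) * indicator (cball 0 (norm x + t)) (x + (- t) *\<^sub>R z))"
        using K(2)[of z] by (simp add: abs_mult mult_right_mono)
      then show ?thesis using K(1) by (simp add: f_def ennreal_mult'[symmetric] ennreal_leI)
    qed (simp add: bump_eq_0)
  qed
  also have "\<dots> = ennreal K * (\<integral>\<^sup>+z. f (x + (- t) *\<^sub>R z) \<partial>lborel)" by (rule nn_integral_cmult) measurable
  also have "\<dots> < top"
  proof -
    have "(\<integral>\<^sup>+y. f y \<partial>lborel) < top" using u[of "norm x + t"] by (auto simp: integrable_iff_bounded f_def)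
    then have "ennreal (\<bar>- t\<bar> ^ CARD('n)) * (\<integral>\<^sup>+z. f (x + (- t) *\<^sub>R z) \<partial>lborel) < top"
      using nn_integral_lborel_affine[of f "- t" x] t by simp
    then have "(\<integral>\<^sup>+z. f (x + (- t) *\<^sub>R z) \<partial>lborel) < top" using t by (auto simp: ennreal_mult_less_top)
    then show ?thesis by (simp add: ennreal_mult_less_top)
  qed
  finally show "(\<integral>\<^sup>+z. ennreal (norm (bump z * u (x - t *\<^sub>R z))) \<partial>lborel) < \<infinity>" by simp
qed measurable

text \<open>The summand \<open>0\<close> gives the argument the affine form of
  \<open>smooth_affine\<close>.\<close>

definition scaled_bump :: "real \<Rightarrow> real ^ 'n::finite \<Rightarrow> real" where
  "scaled_bump t x = inverse (t ^ CARD('n)) * bump (0 + inverse t *\<^sub>R x)"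

lemma test_function_scaled_bump: "0 < t \<Longrightarrow> test_function (scaled_bump t)"
proof (rule test_functionI)
  assume t: "0 < t"
  show "smooth (scaled_bump t)" unfolding scaled_bump_def[abs_def]
    by (rule smooth_cmult[OF smooth_affine[OF test_function_smooth[OF test_function_bump]]])
  fix x :: "real ^ 'a" assume "t < norm x"
  then have "1 \<le> norm (inverse t *\<^sub>R x)" using t by (simp add: field_simps)
  then show "scaled_bump t x = 0" by (simp add: scaled_bump_def bump_eq_0)
qed

text \<open>The substitution \<open>y = x - t *\<^sub>R z\<close>. Norm bounds use the form with
  translates of \<open>u\<close>; derivatives use the form in which \<open>x\<close> occurs in the
  smooth kernel alone.\<close>

lemma bump_avg_eq_scaled:
  fixes u :: "real ^ 'n::finite \<Rightarrow> real"
  assumes t: "0 < t" shows "bump_avg t u = (\<lambda>x. \<integral>y. u y * scaled_bump t (x - y) \<partial>lborel)"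
proof
  fix x
  have "(\<integral>y. u y * scaled_bump t (x - y) \<partial>lborel) = t ^ CARD('n) * (\<integral>z. u (x + (- t) *\<^sub>R z) * scaled_bump t (x - (x + (- t) *\<^sub>R z)) \<partial>lborel)"
    using lborel_integral_affine[of "- t" "\<lambda>y. u y * scaled_bump t (x - y)" x] t by simp
  also have "\<dots> = (\<integral>z. t ^ CARD('n) * (u (x + (- t) *\<^sub>R z) * scaled_bump t (x - (x + (- t) *\<^sub>R z))) \<partial>lborel)" by simp
  also have "\<dots> = (\<integral>z. bump z * u (x - t *\<^sub>R z) \<partial>lborel)"
    using t by (intro Bochner_Integration.integral_cong) (auto simp: scaled_bump_def)
  finally show "bump_avg t u x = (\<integral>y. u y * scaled_bump t (x - y) \<partial>lborel)" by (simp add: bump_avg_def)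
qed

lemma bump_avg_measurable [measurable]:
  assumes [measurable]: "u \<in> borel_measurable borel"
  shows "bump_avg t u \<in> borel_measurable borel"
  unfolding bump_avg_def[abs_def] by (rule lborel.borel_measurable_lebesgue_integral) measurable

lemma abs_bump_avg_le:
  "ennreal \<bar>bump_avg t q x\<bar> \<le> (\<integral>\<^sup>+z. ennreal (bump z) * ennreal \<bar>q (x - t *\<^sub>R z)\<bar> \<partial>lborel)"
proof -
  have "ennreal \<bar>bump_avg t q x\<bar> \<le> (\<integral>\<^sup>+z. ennreal (norm (bump z * q (x - t *\<^sub>R z))) \<partial>lborel)"
  proof (cases "integrable lborel (\<lambda>z. bump z * q (x - t *\<^sub>R z))")
    case True
    from integral_norm_bound_ennreal[OF this] show ?thesis by (simp add: bump_avg_def)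
  next
    case False
    then show ?thesis by (simp add: bump_avg_def not_integrable_integral_eq)
  qed
  then show ?thesis by (simp add: abs_mult bump_nonneg ennreal_mult')
qed

lemma ccube_bump_avg_le:
  fixes q :: "real ^ 'n::finite \<Rightarrow> real"
  assumes [measurable]: "q \<in> borel_measurable borel" and t: "0 \<le> t" "t \<le> 1"
  shows "(\<integral>\<^sup>+x. indicator (ccube R) x * ennreal \<bar>bump_avg t q x\<bar> \<partial>lborel) \<le> (\<integral>\<^sup>+x. indicator (ccube (R + 1)) x * ennreal \<bar>q x\<bar> \<partial>lborel)"
proof -
  let ?f = "\<lambda>y. indicator (ccube (R + 1)) y * ennreal \<bar>q y\<bar>"
  have "(\<integral>\<^sup>+x. indicator (ccube R) x * ennreal \<bar>bump_avg t q x\<bar> \<partial>lborel) \<le>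
    (\<integral>\<^sup>+x. \<integral>\<^sup>+z. ennreal (bump z) * ?f (x - t *\<^sub>R z) \<partial>lborel \<partial>lborel)"
  proof (rule nn_integral_mono)
    fix x :: "real ^ 'n"
    show "indicator (ccube R) x * ennreal \<bar>bump_avg t q x\<bar> \<le> (\<integral>\<^sup>+z. ennreal (bump z) * ?f (x - t *\<^sub>R z) \<partial>lborel)"
    proof (cases "x \<in> ccube R")
      case True
      have "(\<integral>\<^sup>+z. ennreal (bump z) * ennreal \<bar>q (x - t *\<^sub>R z)\<bar> \<partial>lborel) \<le> (\<integral>\<^sup>+z. ennreal (bump z) * ?f (x - t *\<^sub>R z) \<partial>lborel)"
      proof (rule nn_integral_mono)
        fix z :: "real ^ 'n"
        show "ennreal (bump z) * ennreal \<bar>q (x - t *\<^sub>R z)\<bar> \<le> ennreal (bump z) * ?f (x - t *\<^sub>R z)"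
        proof (cases "norm z < 1")
          case z: True
          have "\<bar>x $ i - t * z $ i\<bar> \<le> R + 1" for i
          proof -
            have "t * \<bar>z $ i\<bar> \<le> 1 * 1" using t z component_le_norm_cart[of z i] by (intro mult_mono) auto
            then have "\<bar>t * z $ i\<bar> \<le> 1" using t by (simp add: abs_mult)
            moreover have "\<bar>x $ i\<bar> \<le> R" using True by (simp add: mem_ccube)
            ultimately show ?thesis by linarith
          qed
          then have "x - t *\<^sub>R z \<in> ccube (R + 1)" by (simp add: mem_ccube)
          then show ?thesis by simp
        qed (simp add: bump_eq_0)
      qed
      then show ?thesis using True abs_bump_avg_le[of t q x] by simp
    qed simp
  qed
  also have "\<dots> = (\<integral>\<^sup>+z. \<integral>\<^sup>+x. ennreal (bump z) * ?f (x - t *\<^sub>R z) \<partial>lborel \<partial>lborel)"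
    by (rule lborel_pair.Fubini') measurable
  also have "\<dots> = (\<integral>\<^sup>+z. ennreal (bump (z :: real ^ 'n)) * (\<integral>\<^sup>+x. ?f x \<partial>lborel) \<partial>lborel)"
  proof (rule nn_integral_cong)
    fix z :: "real ^ 'n"
    have "(\<integral>\<^sup>+x. ?f x \<partial>lborel) = (\<integral>\<^sup>+x. ?f (- t *\<^sub>R z + 1 *\<^sub>R x) \<partial>lborel)"
      using nn_integral_lborel_affine[of ?f 1 "- t *\<^sub>R z"] by simp
    then show "(\<integral>\<^sup>+x. ennreal (bump z) * ?f (x - t *\<^sub>R z) \<partial>lborel) = ennreal (bump z) * (\<integral>\<^sup>+x. ?f x \<partial>lborel)"
      by (subst nn_integral_cmult) auto
  qed
  also have "\<dots> = (\<integral>\<^sup>+x. ?f x \<partial>lborel)"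
    by (subst nn_integral_multc) (auto simp: nn_integral_bump)
  finally show ?thesis .
qed

text \<open>A measurable function is almost everywhere a limit of continuous ones. Clamping
  everything to \<open>[-m, m]\<close> preserves continuity, makes this convergence dominated on the
  cube, and changes \<open>h\<close> little in mean when \<open>m\<close> is large.\<close>

lemma L1_approx_continuous:
  fixes h :: "real ^ 'n::finite \<Rightarrow> real"
  assumes [measurable]: "h \<in> borel_measurable borel" and int: "integrable lborel (\<lambda>x. indicator (ccube R) x * \<bar>h x\<bar>)"
    and e: "0 < e"
  obtains g where "continuous_on UNIV g" "(\<integral>x. indicator (ccube R) x * \<bar>h x - g x\<bar> \<partial>lborel) < e"
proof -
  define cl where "cl m s = max (- m) (min m s)" for m s :: real
  have [measurable]: "cl m \<in> borel_measurable borel" for m unfolding cl_def[abs_def] by measurable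
  have cl_le: "0 \<le> m \<Longrightarrow> \<bar>s - cl m s\<bar> \<le> \<bar>s\<bar>" "0 \<le> m \<Longrightarrow> \<bar>cl m s\<bar> \<le> m" for m s by (auto simp: cl_def)
  have "(\<lambda>m::nat. \<integral>x. indicator (ccube R) x * \<bar>h x - cl (real m) (h x)\<bar> \<partial>lborel) \<longlonglongrightarrow> integral\<^sup>L (lborel :: (real ^ 'n) measure) (\<lambda>x. 0)"
  proof (rule integral_dominated_convergence[OF _ _ int])
    show "AE x in lborel. (\<lambda>m::nat. indicator (ccube R) x * \<bar>h x - cl (real m) (h x)\<bar>) \<longlonglongrightarrow> 0"
    proof (intro AE_I2 tendsto_eventually)
      fix x
      show "\<forall>\<^sub>F m in sequentially. indicator (ccube R) x * \<bar>h x - cl (real m) (h x)\<bar> = 0"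
        using eventually_ge_at_top[of "nat \<lceil>\<bar>h x\<bar>\<rceil>"]
      proof eventually_elim
        case (elim m)
        then have "\<bar>h x\<bar> \<le> real m" by linarith
        then show ?case by (simp add: cl_def)
      qed
    qed
    show "AE x in lborel. norm (indicator (ccube R) x * \<bar>h x - cl (real m) (h x)\<bar>) \<le> indicator (ccube R) x * \<bar>h x\<bar>" for m
      using cl_le(1)[of "real m"] by (intro AE_I2) (auto simp: indicator_def)
  qed measurable
  then have "(\<lambda>m::nat. \<integral>x. indicator (ccube R) x * \<bar>h x - cl (real m) (h x)\<bar> \<partial>lborel) \<longlonglongrightarrow> 0" by simp
  then have "\<forall>\<^sub>F m in sequentially. (\<integral>x. indicator (ccube R) x * \<bar>h x - cl (real m) (h x)\<bar> \<partial>lborel) < e / 2"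
    using e by (intro order_tendstoD(2)) auto
  then obtain m :: nat where m: "(\<integral>x. indicator (ccube R) x * \<bar>h x - cl (real m) (h x)\<bar> \<partial>lborel) < e / 2"
    by (auto simp: eventually_sequentially)
  have "h \<in> borel_measurable lborel" by simp
  then have "h \<in> borel_measurable (lebesgue_on UNIV)" by (intro measurable_restrict_space1 measurable_completion)
  then have "h measurable_on UNIV" by (intro lebesgue_measurable_imp_measurable_on_real) auto
  then obtain N and G :: "nat \<Rightarrow> real ^ 'n \<Rightarrow> real" where N: "negligible N" and G: "\<And>n. continuous_on UNIV (G n)"
    and lim: "\<And>x. x \<notin> N \<Longrightarrow> (\<lambda>n. G n x) \<longlonglongrightarrow> h x"
    unfolding measurable_on_def by auto
  have [measurable]: "G n \<in> borel_measurable borel" for n using G by (rule borel_measurable_continuous_onI)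
  have "AE x in lebesgue. x \<notin> N" using N by (intro AE_not_in) (simp add: negligible_iff_null_sets)
  then have AE: "AE x in lborel. x \<notin> N" by (simp only: AE_completion_iff)
  have cont: "continuous_on UNIV (\<lambda>x. cl (real m) (G n x))" for n
    unfolding cl_def by (intro continuous_intros G)
  have "(\<lambda>n. \<integral>x. indicator (ccube R) x * \<bar>cl (real m) (h x) - cl (real m) (G n x)\<bar> \<partial>lborel) \<longlonglongrightarrow> integral\<^sup>L (lborel :: (real ^ 'n) measure) (\<lambda>x. 0)"
  proof (rule integral_dominated_convergence[where w="\<lambda>x. indicator (ccube R) x * (2 * real m)"])
    show "integrable lborel (\<lambda>x::real ^ 'n. indicator (ccube R) x * (2 * real m))" by (rule integrable_indicator_ccube)
    show "AE x in lborel. (\<lambda>n. indicator (ccube R) x * \<bar>cl (real m) (h x) - cl (real m) (G n x)\<bar>) \<longlonglongrightarrow> 0"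
      using AE
    proof eventually_elim
      case (elim x)
      have "(\<lambda>n. indicator (ccube R) x * \<bar>cl (real m) (h x) - cl (real m) (G n x)\<bar>) \<longlonglongrightarrow> indicator (ccube R) x * \<bar>cl (real m) (h x) - cl (real m) (h x)\<bar>"
        unfolding cl_def by (intro tendsto_intros lim elim)
      then show ?case by simp
    qed
    show "AE x in lborel. norm (indicator (ccube R) x * \<bar>cl (real m) (h x) - cl (real m) (G n x)\<bar>) \<le> indicator (ccube R) x * (2 * real m)" for n
    proof (intro AE_I2)
      fix x
      have "\<bar>cl (real m) (h x) - cl (real m) (G n x)\<bar> \<le> 2 * real m"
        using cl_le(2)[of "real m" "h x"] cl_le(2)[of "real m" "G n x"] by linarith
      then show "norm (indicator (ccube R) x * \<bar>cl (real m) (h x) - cl (real m) (G n x)\<bar>) \<le> indicator (ccube R) x * (2 * real m)"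
        by (auto simp: indicator_def)
    qed
  qed measurable
  then have "(\<lambda>n. \<integral>x. indicator (ccube R) x * \<bar>cl (real m) (h x) - cl (real m) (G n x)\<bar> \<partial>lborel) \<longlonglongrightarrow> 0" by simp
  then have "\<forall>\<^sub>F n in sequentially. (\<integral>x. indicator (ccube R) x * \<bar>cl (real m) (h x) - cl (real m) (G n x)\<bar> \<partial>lborel) < e / 2"
    using e by (intro order_tendstoD(2)) auto
  then obtain n where n: "(\<integral>x. indicator (ccube R) x * \<bar>cl (real m) (h x) - cl (real m) (G n x)\<bar> \<partial>lborel) < e / 2"
    by (auto simp: eventually_sequentially)
  show ?thesis
  proof (rule that[OF cont[of n]])
    have i1: "integrable lborel (\<lambda>x. indicator (ccube R) x * \<bar>h x - cl (real m) (h x)\<bar>)"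
      by (rule Bochner_Integration.integrable_bound[OF int]) (auto simp: indicator_def cl_le intro!: AE_I2)
    have i2: "integrable lborel (\<lambda>x. indicator (ccube R) x * \<bar>cl (real m) (h x) - cl (real m) (G n x)\<bar>)"
    proof (rule Bochner_Integration.integrable_bound[OF integrable_indicator_ccube[of R "2 * real m"]])
      show "AE x in lborel. norm (indicator (ccube R) x * \<bar>cl (real m) (h x) - cl (real m) (G n x)\<bar>) \<le> norm (indicator (ccube R) x * (2 * real m))"
      proof (intro AE_I2)
        fix x
        have "\<bar>cl (real m) (h x) - cl (real m) (G n x)\<bar> \<le> 2 * real m"
          using cl_le(2)[of "real m" "h x"] cl_le(2)[of "real m" "G n x"] by linarith
        then show "norm (indicator (ccube R) x * \<bar>cl (real m) (h x) - cl (real m) (G n x)\<bar>) \<le> norm (indicator (ccube R) x * (2 * real m))"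
          by (auto simp: indicator_def)
      qed
    qed measurable
    have "(\<integral>x. indicator (ccube R) x * \<bar>h x - cl (real m) (G n x)\<bar> \<partial>lborel) \<le>
      (\<integral>x. indicator (ccube R) x * \<bar>h x - cl (real m) (h x)\<bar> + indicator (ccube R) x * \<bar>cl (real m) (h x) - cl (real m) (G n x)\<bar> \<partial>lborel)"
      by (rule integral_mono'[OF Bochner_Integration.integrable_add[OF i1 i2]]) (auto simp: indicator_def)
    also have "\<dots> < e" using m n by (subst Bochner_Integration.integral_add[OF i1 i2]) simp
    finally show "(\<integral>x. indicator (ccube R) x * \<bar>h x - cl (real m) (G n x)\<bar> \<partial>lborel) < e" .
  qed
qed

lemma continuous_loc_integrable:
  fixes g :: "real ^ 'n::finite \<Rightarrow> real"
  assumes "continuous_on UNIV g" shows "integrable_cball R g"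
  using borel_integrable_compact[OF compact_cball[of 0 R] continuous_on_subset[OF assms subset_UNIV]] by (simp add: mult.commute)

lemma loc_integrable_ccube:
  fixes h :: "real ^ 'n::finite \<Rightarrow> real"
  assumes h: "\<And>R. integrable_cball R h" and [measurable]: "h \<in> borel_measurable borel"
  shows "integrable lborel (\<lambda>x. indicator (ccube R) x * \<bar>h x\<bar>)"
proof (rule Bochner_Integration.integrable_bound[OF h[of "real CARD('n) * R"]])
  show "AE x in lborel. norm (indicator (ccube R) x * \<bar>h x\<bar>) \<le> norm (h x * indicator (cball 0 (real CARD('n) * R)) x)"
    using ccube_norm_le[of _ R] by (intro AE_I2) (auto simp: indicator_def)
qed measurable

lemma bump_avg_diff:
  fixes u v :: "real ^ 'n::finite \<Rightarrow> real"
  assumes [measurable]: "u \<in> borel_measurable borel" "v \<in> borel_measurable borel"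
    and "\<And>R. integrable_cball R u" "\<And>R. integrable_cball R v"
    and t: "0 < t"
  shows "bump_avg t (\<lambda>y. u y - v y) x = bump_avg t u x - bump_avg t v x"
  unfolding bump_avg_def right_diff_distrib
  by (intro Bochner_Integration.integral_diff integrable_bump_translate assms)

lemma bump_avg_continuous_close:
  fixes g :: "real ^ 'n::finite \<Rightarrow> real"
  assumes g: "continuous_on UNIV g" and t: "0 < t" and near: "\<And>y. dist y x < t \<Longrightarrow> \<bar>g y - g x\<bar> \<le> d"
  shows "\<bar>bump_avg t g x - g x\<bar> \<le> d"
proof -
  have [measurable]: "g \<in> borel_measurable borel" using g by (rule borel_measurable_continuous_onI)
  have i: "integrable lborel (\<lambda>z. bump z * g (x - t *\<^sub>R z))"
    by (rule integrable_bump_translate[OF _ continuous_loc_integrable[OF g] t]) simp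
  have ib: "integrable lborel (\<lambda>z::real ^ 'n. bump z * c)" for c
    by (intro integrable_mult_left test_function_integrable test_function_bump)
  have "bump_avg t g x - g x = (\<integral>z. bump z * g (x - t *\<^sub>R z) \<partial>lborel) - (\<integral>z. bump (z :: real ^ 'n) * g x \<partial>lborel)"
    by (simp add: bump_avg_def integral_bump)
  also have "\<dots> = (\<integral>z. bump z * g (x - t *\<^sub>R z) - bump z * g x \<partial>lborel)"
    by (rule Bochner_Integration.integral_diff[symmetric, OF i ib])
  finally have eq: "bump_avg t g x - g x = (\<integral>z. bump z * g (x - t *\<^sub>R z) - bump z * g x \<partial>lborel)" .
  have "\<bar>\<integral>z. bump z * g (x - t *\<^sub>R z) - bump z * g x \<partial>lborel\<bar> \<le> (\<integral>z. bump (z :: real ^ 'n) * d \<partial>lborel)"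
  proof (rule integral_norm_le[unfolded real_norm_def, OF Bochner_Integration.integrable_diff[OF i ib] ib])
    fix z :: "real ^ 'n"
    show "\<bar>bump z * g (x - t *\<^sub>R z) - bump z * g x\<bar> \<le> bump z * d"
    proof (cases "norm z < 1")
      case True
      then have "dist (x - t *\<^sub>R z) x < t" using t by (simp add: dist_norm)
      from near[OF this] show ?thesis
        using bump_nonneg[of z] by (simp add: right_diff_distrib[symmetric] abs_mult mult_left_mono)
    qed (simp add: bump_eq_0)
  qed
  then show ?thesis by (simp add: eq integral_bump)
qed

text \<open>Three errors of size \<open>e\<close>: the average of \<open>h - g\<close>, the uniform
  error of averaging the continuous \<open>g\<close>, and \<open>h - g\<close> itself. The larger
  cube \<open>ccube (R + 1)\<close> contains all points that averages at scales below one can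
  see.\<close>

lemma bump_avg_L1_tendsto:
  fixes h :: "real ^ 'n::finite \<Rightarrow> real"
  assumes h_meas [measurable]: "h \<in> borel_measurable borel" and h: "\<And>R. integrable_cball R h"
    and R: "0 \<le> R" and e: "0 < e"
  shows "\<exists>\<delta>>0. \<forall>t. 0 < t \<longrightarrow> t < \<delta> \<longrightarrow> (\<integral>\<^sup>+x. indicator (ccube R) x * ennreal \<bar>bump_avg t h x - h x\<bar> \<partial>lborel) \<le> ennreal (3 * e)"
proof -
  have hi: "integrable lborel (\<lambda>x. indicator (ccube (R + 1)) x * \<bar>h x\<bar>)" by (rule loc_integrable_ccube[OF h]) simp
  obtain g where g: "continuous_on UNIV g" and hg: "(\<integral>x. indicator (ccube (R + 1)) x * \<bar>h x - g x\<bar> \<partial>lborel) < e"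
    by (rule L1_approx_continuous[OF h_meas hi e]) blast
  have [measurable]: "g \<in> borel_measurable borel" using g by (rule borel_measurable_continuous_onI)
  have loc: "integrable lborel (\<lambda>y. (h y - g y) * indicator (cball 0 R) y)" for R
    unfolding left_diff_distrib by (intro Bochner_Integration.integrable_diff h continuous_loc_integrable g)
  have "(\<integral>\<^sup>+x. indicator (ccube (R + 1)) x * ennreal \<bar>h x - g x\<bar> \<partial>lborel) =
    (\<integral>\<^sup>+x. ennreal (indicator (ccube (R + 1)) x * \<bar>h x - g x\<bar>) \<partial>lborel)"
    by (intro nn_integral_cong) (auto simp: indicator_def)
  also have "\<dots> = ennreal (\<integral>x. indicator (ccube (R + 1)) x * \<bar>h x - g x\<bar> \<partial>lborel)"
    by (intro nn_integral_eq_integral loc_integrable_ccube loc) auto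
  also have "\<dots> \<le> ennreal e" using hg by (intro ennreal_leI) simp
  finally have hg': "(\<integral>\<^sup>+x. indicator (ccube (R + 1)) x * ennreal \<bar>h x - g x\<bar> \<partial>lborel) \<le> ennreal e" .
  define d where "d = e / ((2 * R) ^ CARD('n) + 1)"
  have V: "0 \<le> (2 * R) ^ CARD('n)" using R by simp
  have d: "0 < d" "(2 * R) ^ CARD('n) * d \<le> e"
    using e V by (auto simp: d_def divide_le_eq distrib_left mult.commute intro!: divide_pos_pos)
  have "uniformly_continuous_on (ccube (R + 1)) g"
    by (intro compact_uniformly_continuous continuous_on_subset[OF g] compact_ccube) simp
  then obtain \<delta> where \<delta>: "0 < \<delta>" "\<And>x y. x \<in> ccube (R + 1) \<Longrightarrow> y \<in> ccube (R + 1) \<Longrightarrow> dist y x < \<delta> \<Longrightarrow> dist (g y) (g x) < d"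
    unfolding uniformly_continuous_on_def using d(1) by metis
  show ?thesis
  proof (intro exI[of _ "min \<delta> 1"] conjI allI impI)
    show "0 < min \<delta> 1" using \<delta> by simp
    fix t assume t: "0 < t" "t < min \<delta> 1"
    have close: "\<bar>bump_avg t g x - g x\<bar> \<le> d" if x: "x \<in> ccube R" for x
    proof (rule bump_avg_continuous_close[OF g t(1)])
      fix y assume y: "dist y x < t"
      have "\<bar>y $ i\<bar> \<le> R + 1" for i
      proof -
        have "\<bar>y $ i - x $ i\<bar> \<le> dist y x" using component_le_norm_cart[of "y - x" i] by (simp add: dist_norm)
        moreover have "\<bar>x $ i\<bar> \<le> R" using x by (simp add: mem_ccube)
        ultimately show ?thesis using y t by linarith
      qed
      then have "y \<in> ccube (R + 1)" by (simp add: mem_ccube)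
      moreover have "x \<in> ccube (R + 1)" using x by (auto simp: mem_ccube intro: order_trans)
      ultimately show "\<bar>g y - g x\<bar> \<le> d" using \<delta>(2)[of x y] y t by (simp add: dist_real_def)
    qed
    let ?q = "\<lambda>y. h y - g y"
    have "(\<integral>\<^sup>+x. indicator (ccube R) x * ennreal \<bar>bump_avg t h x - h x\<bar> \<partial>lborel) \<le>
      (\<integral>\<^sup>+x. indicator (ccube R) x * ennreal \<bar>bump_avg t ?q x\<bar> + (ennreal d * indicator (ccube R) x + indicator (ccube (R + 1)) x * ennreal \<bar>?q x\<bar>) \<partial>lborel)"
    proof (rule nn_integral_mono)
      fix x :: "real ^ 'n"
      show "indicator (ccube R) x * ennreal \<bar>bump_avg t h x - h x\<bar> \<le>
        indicator (ccube R) x * ennreal \<bar>bump_avg t ?q x\<bar> + (ennreal d * indicator (ccube R) x + indicator (ccube (R + 1)) x * ennreal \<bar>?q x\<bar>)"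
      proof (cases "x \<in> ccube R")
        case True
        then have x: "x \<in> ccube (R + 1)" by (auto simp: mem_ccube intro: order_trans)
        have "bump_avg t ?q x = bump_avg t h x - bump_avg t g x"
          by (rule bump_avg_diff[OF _ _ h continuous_loc_integrable[OF g] t(1)]) auto
        then have "\<bar>bump_avg t h x - h x\<bar> \<le> \<bar>bump_avg t ?q x\<bar> + (d + \<bar>?q x\<bar>)"
          using close[OF True] by linarith
        then have "ennreal \<bar>bump_avg t h x - h x\<bar> \<le> ennreal (\<bar>bump_avg t ?q x\<bar> + (d + \<bar>?q x\<bar>))" by (rule ennreal_leI)
        then show ?thesis using True x d by (simp add: ennreal_plus)
      qed simp
    qed
    also have "\<dots> = (\<integral>\<^sup>+x. indicator (ccube R) x * ennreal \<bar>bump_avg t ?q x\<bar> \<partial>lborel) +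
      (ennreal d * emeasure lborel (ccube R :: (real ^ 'n) set) + (\<integral>\<^sup>+x. indicator (ccube (R + 1)) x * ennreal \<bar>?q x\<bar> \<partial>lborel))"
      by (subst nn_integral_add, measurable, subst nn_integral_add, measurable) (simp add: nn_integral_cmult_indicator)
    also have "\<dots> \<le> ennreal e + (ennreal e + ennreal e)"
    proof (intro add_mono)
      show "(\<integral>\<^sup>+x. indicator (ccube R) x * ennreal \<bar>bump_avg t ?q x\<bar> \<partial>lborel) \<le> ennreal e"
        by (rule order_trans[OF ccube_bump_avg_le hg']) (use t in auto)
      have "emeasure lborel (ccube R :: (real ^ 'n) set) = ennreal ((2 * R) ^ CARD('n))"
      proof -
        have "emeasure lborel (ccube R :: (real ^ 'n) set) = ennreal (measure lborel (ccube R :: (real ^ 'n) set))"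
          using emeasure_ccube_finite by (intro emeasure_eq_ennreal_measure) (simp add: top.not_eq_extremum)
        then show ?thesis by (simp only: measure_ccube[OF R])
      qed
      then show "ennreal d * emeasure lborel (ccube R :: (real ^ 'n) set) \<le> ennreal e"
        using d V by (simp add: ennreal_mult'[symmetric] mult.commute ennreal_leI)
    qed (rule hg')
    also have "\<dots> = ennreal (3 * e)" using e by (simp add: ennreal_plus[symmetric] del: ennreal_plus)
    finally show "(\<integral>\<^sup>+x. indicator (ccube R) x * ennreal \<bar>bump_avg t h x - h x\<bar> \<partial>lborel) \<le> ennreal (3 * e)" .
  qed
qed

text \<open>Convergence in mean on a cube yields almost everywhere convergence along a subsequence
  of scales, which is what Fatou's lemma will use.\<close>

lemma bump_avg_AE_subseq:
  fixes h :: "real ^ 'n::finite \<Rightarrow> real"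
  assumes h_meas [measurable]: "h \<in> borel_measurable borel" and h: "\<And>R. integrable_cball R h"
    and R: "0 \<le> R"
  obtains t where "\<And>k. 0 < t k" "AE x in lborel. x \<in> ccube R \<longrightarrow> (\<lambda>k. bump_avg (t k) h x) \<longlonglongrightarrow> h x"
proof -
  define U where "U k x = indicator (ccube R) x * (bump_avg (inverse (real (Suc k))) h x - h x)" for k :: nat and x
  have U_meas [measurable]: "U k \<in> borel_measurable borel" for k unfolding U_def[abs_def] by measurable
  have nU: "(\<integral>\<^sup>+x. ennreal (norm (U k x)) \<partial>lborel) = (\<integral>\<^sup>+x. indicator (ccube R) x * ennreal \<bar>bump_avg (inverse (real (Suc k))) h x - h x\<bar> \<partial>lborel)" for k
    by (intro nn_integral_cong) (auto simp: U_def indicator_def)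
  have ev: "\<forall>\<^sub>F k in sequentially. (\<integral>\<^sup>+x. ennreal (norm (U k x)) \<partial>lborel) \<le> ennreal (3 * e)" if e: "0 < e" for e
  proof -
    obtain \<delta> where \<delta>: "0 < \<delta>" "\<And>t. 0 < t \<Longrightarrow> t < \<delta> \<Longrightarrow> (\<integral>\<^sup>+x. indicator (ccube R) x * ennreal \<bar>bump_avg t h x - h x\<bar> \<partial>lborel) \<le> ennreal (3 * e)"
      using bump_avg_L1_tendsto[OF h_meas h R e] by blast
    have "\<forall>\<^sub>F k in sequentially. inverse (real (Suc k)) < \<delta>"
      using order_tendstoD(2)[OF LIMSEQ_inverse_real_of_nat \<delta>(1)] .
    then show ?thesis by eventually_elim (unfold nU, rule \<delta>(2), auto)
  qed
  \<comment> \<open>Integrability of the differences follows from the smallness of their integrals,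
    hence from some index on.\<close>
  obtain k0 where k0: "\<And>k. k0 \<le> k \<Longrightarrow> (\<integral>\<^sup>+x. ennreal (norm (U k x)) \<partial>lborel) \<le> ennreal (3 * 1)"
    using ev[of 1] unfolding eventually_sequentially by auto
  have int: "integrable lborel (U (k0 + k))" for k
    using k0[of "k0 + k"] by (intro integrableI_bounded) (auto intro: le_less_trans)
  have "(\<lambda>k. \<integral>x. norm (U (k0 + k) x) \<partial>lborel) \<longlonglongrightarrow> 0"
  proof (rule tendstoI)
    fix e :: real assume e: "0 < e"
    have "\<forall>\<^sub>F k in sequentially. (\<integral>\<^sup>+x. ennreal (norm (U (k + k0) x)) \<partial>lborel) \<le> ennreal (3 * (e / 4))"
      using ev[of "e / 4"] e by (subst eventually_sequentially_seg[where P="\<lambda>k. (\<integral>\<^sup>+x. ennreal (norm (U k x)) \<partial>lborel) \<le> ennreal (3 * (e / 4))"]) auto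
    then show "\<forall>\<^sub>F k in sequentially. dist (\<integral>x. norm (U (k0 + k) x) \<partial>lborel) 0 < e"
    proof eventually_elim
      case (elim k)
      have "ennreal (\<integral>x. norm (U (k0 + k) x) \<partial>lborel) \<le> ennreal (3 * (e / 4))"
        using elim nn_integral_eq_integral[OF integrable_norm[OF int[of k]]] by (simp add: add.commute)
      then have "(\<integral>x. norm (U (k0 + k) x) \<partial>lborel) \<le> 3 * (e / 4)" using e by (subst (asm) ennreal_le_iff) auto
      moreover have "0 \<le> (\<integral>x. norm (U (k0 + k) x) \<partial>lborel)" by (intro Bochner_Integration.integral_nonneg) auto
      ultimately show ?case using e by simp
    qed
  qed
  from tendsto_L1_AE_subseq[OF int this]
  obtain r where r: "strict_mono r" "AE x in lborel. (\<lambda>k. U (k0 + r k) x) \<longlonglongrightarrow> 0" by blast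
  show ?thesis
  proof (rule that[of "\<lambda>k. inverse (real (Suc (k0 + r k)))"])
    show "AE x in lborel. x \<in> ccube R \<longrightarrow> (\<lambda>k. bump_avg (inverse (real (Suc (k0 + r k)))) h x) \<longlonglongrightarrow> h x"
      using r(2)
    proof (eventually_elim, intro impI)
      fix x assume lim: "(\<lambda>k. U (k0 + r k) x) \<longlonglongrightarrow> 0" and x: "x \<in> ccube R"
      from x lim have "(\<lambda>k. bump_avg (inverse (real (Suc (k0 + r k)))) h x - h x) \<longlonglongrightarrow> 0" by (simp add: U_def)
      from tendsto_add[OF this tendsto_const[of "h x"]] show "(\<lambda>k. bump_avg (inverse (real (Suc (k0 + r k)))) h x) \<longlonglongrightarrow> h x" by simp
    qed
  qed simp
qed

section \<open>Limits, translations and averages in mixed norms\<close>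

lemma mnorm_cong_AE:
  fixes f g :: "real ^ 'n::finite \<Rightarrow> ennreal"
  assumes js: "distinct js" "set js = UNIV" and ae: "AE x in lborel. f x = g x"
  shows "mnorm p js f x = mnorm p js g x"
proof -
  obtain Z where Z: "{x \<in> space lborel. \<not> f x = g x} \<subseteq> Z" "emeasure lborel Z = 0" "Z \<in> sets lborel"
    using AE_E[OF ae] by blast
  show ?thesis
  proof (rule mnorm_cong_iter_int_0)
    show "iter_int js (indicator Z) x = 0" using Z js by (subst iter_int_eq_nn_integral) auto
  qed (use Z in auto)
qed

lemma mnorm_Fatou:
  fixes f :: "nat \<Rightarrow> real ^ 'n::finite \<Rightarrow> ennreal"
  assumes [measurable]: "\<And>k. f k \<in> borel_measurable borel" and p: "\<And>i. 0 < p i" and A: "\<And>k. mnorm p js (f k) x \<le> A"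
  shows "mnorm p js (\<lambda>y. liminf (\<lambda>k. f k y)) x \<le> A"
proof -
  have "mnorm p js (\<lambda>y. liminf (\<lambda>k. f k y)) x = mnorm p js (\<lambda>y. SUP n. INF k\<in>{n..}. f k y) x"
    by (simp add: liminf_SUP_INF)
  also have "\<dots> = (SUP n. mnorm p js (\<lambda>y. INF k\<in>{n..}. f k y) x)"
    by (rule mnorm_SUP) (auto simp: incseq_def le_fun_def p intro!: INF_superset_mono)
  also have "\<dots> \<le> A"
  proof (rule SUP_least)
    fix n
    have "mnorm p js (\<lambda>y. INF k\<in>{n..}. f k y) x \<le> mnorm p js (f n) x"
      by (intro mnorm_mono p INF_lower) simp
    then show "mnorm p js (\<lambda>y. INF k\<in>{n..}. f k y) x \<le> A" using A order_trans by blast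
  qed
  finally show ?thesis .
qed

lemma mnorm_translate:
  assumes g [measurable]: "g \<in> borel_measurable borel"
  shows "mnorm p is (\<lambda>y. g (y - z)) x = mnorm p is g (x - z)"
proof (induction "is" arbitrary: x)
  case (Cons i "is")
  let ?F = "\<lambda>t. ennreal_powr (mnorm p is g (update_coord (x - z) i t)) (p i)"
  have upd: "update_coord x i t - z = update_coord (x - z) i (- z $ i + 1 * t)" for t
    by (auto simp: vec_eq_iff update_coord_nth)
  have tr: "(\<integral>\<^sup>+t. ?F (- z $ i + 1 * t) \<partial>lborel) = (\<integral>\<^sup>+t. ?F t \<partial>lborel)"
    using nn_integral_real_affine[of ?F 1 "- z $ i"] by simp
  show ?case by (simp only: mnorm.simps Cons.IH upd tr)
qed simp

lemma mnorm_point: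
  "(\<And>i. i \<notin> set is \<Longrightarrow> x $ i = y $ i) \<Longrightarrow> mnorm p is g x = mnorm p is g y"
proof (induction "is" arbitrary: x y)
  case Nil
  then have "x = y" by (simp add: vec_eq_iff)
  then show ?case by simp
next
  case (Cons i "is")
  have "mnorm p is g (update_coord x i t) = mnorm p is g (update_coord y i t)" for t
    by (rule Cons.IH) (use Cons.prems in \<open>auto simp: update_coord_nth\<close>)
  then show ?case by simp
qed

text \<open>An average is an integral of translates against a density of mass one, so Minkowski's
  inequality and translation invariance apply. The base point does not matter because every
  coordinate is integrated.\<close>

lemma mnorm_bump_avg_le:
  fixes h :: "real ^ 'n::finite \<Rightarrow> real"
  assumes [measurable]: "h \<in> borel_measurable borel" and p: "\<And>i. 1 < p i" and js: "set js = UNIV"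
  shows "mnorm p js (\<lambda>x. ennreal \<bar>bump_avg t h x\<bar>) x \<le> mnorm p js (\<lambda>x. ennreal \<bar>h x\<bar>) x"
proof -
  have p0: "0 < p i" for i using p[of i] by simp
  have "mnorm p js (\<lambda>x. ennreal \<bar>bump_avg t h x\<bar>) x \<le>
    mnorm p js (\<lambda>x. \<integral>\<^sup>+z. ennreal (bump z) * ennreal \<bar>h (x - t *\<^sub>R z)\<bar> \<partial>lborel) x"
    by (intro mnorm_mono abs_bump_avg_le p0)
  also have "\<dots> \<le> (\<integral>\<^sup>+z. mnorm p js (\<lambda>x. ennreal (bump z) * ennreal \<bar>h (x - t *\<^sub>R z)\<bar>) x \<partial>lborel)"
    by (rule mnorm_Minkowski[OF p sigma_finite_lborel]) measurable
  also have "\<dots> = (\<integral>\<^sup>+z. ennreal (bump (z :: real ^ 'n)) * mnorm p js (\<lambda>x. ennreal \<bar>h x\<bar>) x \<partial>lborel)"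
  proof (rule nn_integral_cong)
    fix z :: "real ^ 'n"
    have "mnorm p js (\<lambda>x. ennreal (bump z) * ennreal \<bar>h (x - t *\<^sub>R z)\<bar>) x = ennreal (bump z) * mnorm p js (\<lambda>x. ennreal \<bar>h (x - t *\<^sub>R z)\<bar>) x"
      by (rule mnorm_cmult) (use p0 in auto)
    also have "mnorm p js (\<lambda>x. ennreal \<bar>h (x - t *\<^sub>R z)\<bar>) x = mnorm p js (\<lambda>x. ennreal \<bar>h x\<bar>) (x - t *\<^sub>R z)"
      by (rule mnorm_translate) measurable
    also have "\<dots> = mnorm p js (\<lambda>x. ennreal \<bar>h x\<bar>) x" by (rule mnorm_point) (use js in auto)
    finally show "mnorm p js (\<lambda>x. ennreal (bump z) * ennreal \<bar>h (x - t *\<^sub>R z)\<bar>) x = ennreal (bump z) * mnorm p js (\<lambda>x. ennreal \<bar>h x\<bar>) x" .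
  qed
  also have "\<dots> = mnorm p js (\<lambda>x. ennreal \<bar>h x\<bar>) x"
    by (subst nn_integral_multc) (auto simp: nn_integral_bump)
  finally show ?thesis .
qed

text \<open>Sections of Lebesgue measurable functions need not be measurable, so Borel
  representatives are chosen before norms are split into iterated integrals.\<close>

lemma locally_integrable_borel_version:
  fixes f :: "real ^ 'n::finite \<Rightarrow> real"
  assumes "locally_integrable f"
  obtains g where "g \<in> borel_measurable borel" "AE x in lborel. f x = g x"
    "\<And>R. integrable_cball R g"
proof -
  have int: "integrable lebesgue (\<lambda>x. indicator (cball 0 R) x *\<^sub>R f x)" for R
    using assms unfolding locally_integrable_def set_integrable_def by (metis compact_cball)
  have "f \<in> borel_measurable lebesgue"
  proof (rule borel_measurable_LIMSEQ_real[where u="\<lambda>k x. indicator (cball 0 (real k)) x *\<^sub>R f x"])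
    show "(\<lambda>k. indicator (cball 0 (real k)) x *\<^sub>R f x) \<longlonglongrightarrow> f x" for x
    proof (rule tendsto_eventually)
      show "\<forall>\<^sub>F k in sequentially. indicator (cball 0 (real k)) x *\<^sub>R f x = f x"
        using eventually_ge_at_top[of "nat \<lceil>norm x\<rceil>"]
      proof eventually_elim
        case (elim k)
        then have "norm x \<le> real k" by linarith
        then show ?case by simp
      qed
    qed
    show "(\<lambda>x. indicator (cball 0 (real k)) x *\<^sub>R f x) \<in> borel_measurable lebesgue" for k
      using int by (rule borel_measurable_integrable)
  qed
  then obtain g where g: "g \<in> borel_measurable lborel" "AE x in lborel. f x = g x"
    using completion_ex_borel_measurable_real by blast
  have [measurable]: "g \<in> borel_measurable borel" using g(1) by simp
  show ?thesis
  proof (rule that[OF _ g(2)])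
    fix R
    have ind [measurable]: "(\<lambda>y. indicator (cball 0 R) y :: real) \<in> borel_measurable (borel :: (real ^ 'n) measure)"
      by (intro borel_measurable_indicator) simp
    have m: "(\<lambda>y. g y * indicator (cball 0 R) y) \<in> borel_measurable lborel" by measurable
    have "integrable lebesgue (\<lambda>y. g y * indicator (cball 0 R) y)"
    proof (rule integrable_cong_AE_imp[OF int[of R]])
      show "(\<lambda>y. g y * indicator (cball 0 R) y) \<in> borel_measurable lebesgue" by (rule measurable_completion[OF m])
      show "AE x in lebesgue. indicator (cball 0 R) x *\<^sub>R f x = g x * indicator (cball 0 R) x"
        using AE_completion[OF g(2)] by eventually_elim simp
    qed
    then show "integrable_cball R g" by (simp only: integrable_completion[OF m])
  qed simp
qed

lemma lebesgue_integral_borel_version: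
  fixes f g \<phi> :: "real ^ 'n::finite \<Rightarrow> real"
  assumes [measurable]: "g \<in> borel_measurable borel" "\<phi> \<in> borel_measurable borel" and ae: "AE x in lborel. f x = g x"
  shows "(LINT x|lebesgue. f x * \<phi> x) = (\<integral>x. g x * \<phi> x \<partial>lborel)"
proof -
  have m: "(\<lambda>x. g x * \<phi> x) \<in> borel_measurable lborel" by measurable
  have ae': "AE x in lebesgue. g x * \<phi> x = f x * \<phi> x"
    using AE_completion[OF ae] by eventually_elim simp
  have mf: "(\<lambda>x. f x * \<phi> x) \<in> borel_measurable lebesgue"
    by (rule borel_measurable_AE[OF measurable_completion[OF m] ae'])
  have "(LINT x|lebesgue. f x * \<phi> x) = (LINT x|lebesgue. g x * \<phi> x)"
    using ae' by (intro integral_cong_AE mf measurable_completion[OF m]) auto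
  then show ?thesis using m by (simp only: integral_completion)
qed

text \<open>For fixed \<open>x\<close> the reflected kernel \<open>scaled_bump t (x - y)\<close> is
  a test function of \<open>y\<close>. There are two sign factors, one from the reflection and one
  from the weak derivative; for two derivatives both are one.\<close>

lemma bump_avg_weak_deriv:
  fixes u v :: "real ^ 'n::finite \<Rightarrow> real"
  assumes weak: "has_weak_deriv [i, j] u v" and t: "0 < t"
    and U: "U \<in> borel_measurable borel" "AE x in lborel. u x = U x" "\<And>R. integrable_cball R U"
    and V: "V \<in> borel_measurable borel" "AE x in lborel. v x = V x"
  shows "partial_derivs [i, j] (bump_avg t U) = bump_avg t V"
proof
  fix x
  let ?F = "scaled_bump t :: real ^ 'n \<Rightarrow> real"
  have F: "test_function ?F" by (rule test_function_scaled_bump[OF t])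
  define \<phi> where "\<phi> y = ?F (x + (-1) *\<^sub>R y)" for y
  have \<phi>: "test_function \<phi>"
  proof -
    obtain R where R: "\<And>x. R < norm x \<Longrightarrow> ?F x = 0" using test_function_support[OF F] by blast
    show ?thesis
    proof (rule test_functionI)
      show "smooth \<phi>" unfolding \<phi>_def[abs_def] by (rule smooth_affine[OF test_function_smooth[OF F]])
      fix y :: "real ^ 'n" assume y: "R + norm x < norm y"
      have "norm y \<le> norm (x - y) + norm x" using norm_triangle_ineq4[of x "x - y"] by simp
      then show "\<phi> y = 0" using y R[of "x - y"] by (simp add: \<phi>_def)
    qed
  qed
  have d\<phi>: "partial_derivs [i, j] \<phi> y = partial_derivs [i, j] ?F (x - y)" for y
    unfolding \<phi>_def[abs_def] partial_derivs_affine[OF test_function_smooth[OF F]] by simp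
  have [measurable]: "\<phi> \<in> borel_measurable borel" "partial_derivs [i, j] \<phi> \<in> borel_measurable borel"
    by (intro smooth_measurable smooth_partial_derivs test_function_smooth \<phi>)+
  have "(LINT x|lebesgue. u x * partial_derivs [i, j] \<phi> x) = (-1) ^ length [i, j] * (LINT x|lebesgue. v x * \<phi> x)"
    using weak \<phi> unfolding has_weak_deriv_def by blast
  then have w: "(LINT x|lebesgue. u x * partial_derivs [i, j] \<phi> x) = (LINT x|lebesgue. v x * \<phi> x)" by simp
  have "partial_derivs [i, j] (bump_avg t U) x = (\<integral>y. U y * partial_derivs [i, j] ?F (x - y) \<partial>lborel)"
    unfolding bump_avg_eq_scaled[OF t] mollification(2)[OF U(1,3) F] ..
  also have "\<dots> = (\<integral>y. U y * partial_derivs [i, j] \<phi> y \<partial>lborel)" unfolding d\<phi> ..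
  also have "\<dots> = (LINT x|lebesgue. u x * partial_derivs [i, j] \<phi> x)"
    by (rule lebesgue_integral_borel_version[OF U(1) _ U(2), symmetric]) (fact)
  also have "\<dots> = (\<integral>y. V y * \<phi> y \<partial>lborel)"
    unfolding w by (rule lebesgue_integral_borel_version[OF V(1) _ V(2)]) (fact)
  also have "\<dots> = bump_avg t V x" unfolding bump_avg_eq_scaled[OF t] \<phi>_def by simp
  finally show "partial_derivs [i, j] (bump_avg t U) x = bump_avg t V x" .
qed

lemma bump_avg_sum:
  fixes v :: "'a \<Rightarrow> real ^ 'n::finite \<Rightarrow> real"
  assumes "\<And>a. a \<in> A \<Longrightarrow> v a \<in> borel_measurable borel"
    and "\<And>a R. a \<in> A \<Longrightarrow> integrable_cball R (v a)" and t: "0 < t"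
  shows "bump_avg t (\<lambda>y. \<Sum>a\<in>A. v a y) x = (\<Sum>a\<in>A. bump_avg t (v a) x)"
  unfolding bump_avg_def sum_distrib_left
  by (intro Bochner_Integration.integral_sum integrable_bump_translate assms)

text \<open>On each cube a sequence of scales from \<open>bump_avg_AE_subseq\<close> and Fatou's
  lemma give the bound. The sequence may change with the cube since \<open>A\<close> does not depend
  on the scale, and monotone convergence exhausts the space.\<close>

lemma mnorm_le_of_bump_avg:
  fixes h :: "real ^ 'n::finite \<Rightarrow> real"
  assumes h_meas [measurable]: "h \<in> borel_measurable borel" and h: "\<And>R. integrable_cball R h"
    and js: "distinct js" "set js = UNIV" and p: "\<And>i. 0 < p i"
    and A: "\<And>t. 0 < t \<Longrightarrow> mnorm p js (\<lambda>x. ennreal \<bar>bump_avg t h x\<bar>) 0 \<le> A"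
  shows "mnorm p js (\<lambda>x. ennreal \<bar>h x\<bar>) 0 \<le> A"
proof -
  have cube: "mnorm p js (\<lambda>x. indicator (ccube (real m)) x * ennreal \<bar>h x\<bar>) 0 \<le> A" for m
  proof -
    obtain t where t: "\<And>k. 0 < t k" "AE x in lborel. x \<in> ccube (real m) \<longrightarrow> (\<lambda>k. bump_avg (t k) h x) \<longlonglongrightarrow> h x"
      by (rule bump_avg_AE_subseq[OF h_meas h, of "real m"]) auto
    let ?f = "\<lambda>k x. indicator (ccube (real m)) x * ennreal \<bar>bump_avg (t k) h x\<bar>"
    have "AE x in lborel. indicator (ccube (real m)) x * ennreal \<bar>h x\<bar> = liminf (\<lambda>k. ?f k x)"
      using t(2)
    proof eventually_elim
      case (elim x)
      show ?case
      proof (cases "x \<in> ccube (real m)")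
        case True
        then have lim: "(\<lambda>k. ennreal \<bar>bump_avg (t k) h x\<bar>) \<longlonglongrightarrow> ennreal \<bar>h x\<bar>"
          using elim by (intro tendsto_ennrealI tendsto_rabs) auto
        then show ?thesis using True lim_imp_Liminf[OF _ lim] by simp
      next
        case False
        then show ?thesis by (simp add: Liminf_const)
      qed
    qed
    then have "mnorm p js (\<lambda>x. indicator (ccube (real m)) x * ennreal \<bar>h x\<bar>) 0 = mnorm p js (\<lambda>x. liminf (\<lambda>k. ?f k x)) 0"
      by (rule mnorm_cong_AE[OF js])
    also have "\<dots> \<le> A"
    proof (rule mnorm_Fatou)
      fix k
      have "mnorm p js (?f k) 0 \<le> mnorm p js (\<lambda>x. ennreal \<bar>bump_avg (t k) h x\<bar>) 0"
        by (rule mnorm_mono[OF _ p]) (auto simp: indicator_def)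
      also have "\<dots> \<le> A" by (rule A[OF t(1)])
      finally show "mnorm p js (?f k) 0 \<le> A" .
    qed (use p in auto)
    finally show ?thesis .
  qed
  have "mnorm p js (\<lambda>x. ennreal \<bar>h x\<bar>) 0 = mnorm p js (\<lambda>x. SUP m::nat. indicator (ccube (real m)) x * ennreal \<bar>h x\<bar>) 0"
  proof (rule mnorm_cong)
    fix x :: "real ^ 'n"
    obtain N where "norm x \<le> real N" using real_arch_simple by blast
    then have N: "x \<in> ccube (real N)" using component_le_norm_cart[of x] by (auto simp: mem_ccube intro: order_trans)
    show "ennreal \<bar>h x\<bar> = (SUP m::nat. indicator (ccube (real m)) x * ennreal \<bar>h x\<bar>)"
      by (rule antisym[OF SUP_upper2[of N] SUP_least]) (use N in \<open>auto simp: indicator_def\<close>)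
  qed
  also have "\<dots> = (SUP m::nat. mnorm p js (\<lambda>x. indicator (ccube (real m)) x * ennreal \<bar>h x\<bar>) 0)"
  proof (rule mnorm_SUP[OF _ _ p])
    show "incseq (\<lambda>m x. indicator (ccube (real m)) x * ennreal \<bar>h x\<bar>)"
    proof (intro incseq_SucI le_funI mult_right_mono)
      fix m and x :: "real ^ 'n"
      show "indicator (ccube (real m)) x \<le> (indicator (ccube (real (Suc m))) x :: ennreal)" by (intro indicator_ccube_mono) simp
    qed simp
  qed measurable
  also have "\<dots> \<le> A" by (rule SUP_least) (rule cube)
  finally show ?thesis .
qed

section \<open>From smooth functions to local Sobolev functions\<close>

lemma mixed_norm_eq_mnorm:
  assumes "\<And>i. 0 < p i"
  shows "mixed_norm p f = mnorm p (rev (sorted_list_of_set UNIV)) (\<lambda>x. ennreal (norm (f x))) 0"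
  using mixed_int_eq_mnorm[of 1 p "sorted_list_of_set UNIV" "\<lambda>x. ennreal (norm (f x))"] assms
  by (simp add: mixed_norm_def)

theorem theorem2p5:
  fixes p :: "'n::{finite,linorder} \<Rightarrow> real"
  assumes "CARD('n) \<ge> 2"
    and "\<And>i. 2 < p i"
  shows "\<exists>N::real. 0 \<le> N \<and>
    (\<forall>u :: real ^ 'n::{finite,linorder} \<Rightarrow> real. sobolev_loc 2 2 u \<longrightarrow>
       mixed_norm p (weak_hessian u) + mixed_norm p (weak_grad u) + mixed_norm p u < \<infinity> \<longrightarrow>
       mixed_norm p (weak_hessian u) \<le> ennreal N * mixed_norm p (weak_laplacian u))"
proof -
  define js where "js = rev (sorted_list_of_set (UNIV :: 'n set))"
  have js: "distinct js" "set js = UNIV" by (simp_all add: js_def)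
  have p1: "1 < p i" and p0: "0 < p i" for i using assms(2)[of i] by simp_all
  define E where "E i j C \<longleftrightarrow> (\<forall>w. smooth w \<longrightarrow> mnorm p js (\<lambda>x. ennreal \<bar>partial_derivs [i, j] w x\<bar>) 0 < top \<longrightarrow>
    mnorm p js (\<lambda>x. ennreal \<bar>partial_derivs [i, j] w x\<bar>) 0 \<le> ennreal C * mnorm p js (\<lambda>x. ennreal \<bar>laplacian w x\<bar>) 0)" for i j C
  have "\<forall>i j. \<exists>C\<ge>0. E i j C"
    unfolding E_def by (intro allI smooth_mixed_norm_estimate[OF assms(2) js])
  then obtain C where C: "\<And>i j. 0 \<le> C i j" "\<And>i j. E i j (C i j)" by metis
  show ?thesis
  \<comment> \<open>One constant for each entry of the Hessian, whose Euclidean norm is at most the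
    sum of the absolute values of its entries.\<close>
  proof (intro exI[of _ "\<Sum>a\<in>UNIV. C (fst a) (snd a)"] conjI allI impI)
    show "0 \<le> (\<Sum>a\<in>UNIV. C (fst a) (snd a))" by (intro sum_nonneg C)
    fix u :: "real ^ 'n::{finite,linorder} \<Rightarrow> real"
    assume u: "sobolev_loc 2 2 u"
      and fin: "mixed_norm p (weak_hessian u) + mixed_norm p (weak_grad u) + mixed_norm p u < \<infinity>"
    have weak: "has_weak_deriv [i, j] u (weak_deriv [i, j] u)" for i j
    proof -
      have "length [i, j] \<le> 2" by simp
      then have "\<exists>v. has_weak_deriv [i, j] u v" using u unfolding sobolev_loc_def by blast
      then show ?thesis unfolding weak_deriv_def by (rule someI_ex)
    qed
    have "locally_integrable u" using weak by (auto simp: has_weak_deriv_def)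
    then obtain U where U: "U \<in> borel_measurable borel" "AE x in lborel. u x = U x"
      "\<And>R. integrable_cball R U"
      by (rule locally_integrable_borel_version) blast
    \<comment> \<open>The properties of a Borel representative in one predicate, so that
      representatives for all pairs can be chosen at once.\<close>
    define B where "B v V \<longleftrightarrow> V \<in> borel_measurable borel \<and> (AE x in lborel. v x = V x) \<and>
      (\<forall>R. integrable_cball R V)" for v V :: "real ^ 'n::{finite,linorder} \<Rightarrow> real"
    have "\<forall>i j. \<exists>V. B (weak_deriv [i, j] u) V"
    proof (intro allI)
      fix i j
      have "locally_integrable (weak_deriv [i, j] u)" using weak by (auto simp: has_weak_deriv_def)
      then show "\<exists>V. B (weak_deriv [i, j] u) V"
        unfolding B_def by (rule locally_integrable_borel_version) blast
    qed
    then obtain V where "\<And>i j. B (weak_deriv [i, j] u) (V i j)" by metis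
    then have V: "\<And>i j. V i j \<in> borel_measurable borel" "\<And>i j. AE x in lborel. weak_deriv [i, j] u x = V i j x"
      "\<And>i j R. integrable_cball R (V i j)"
      by (simp_all only: B_def)
    note [measurable] = U(1) V(1)
    define f where "f x = (\<Sum>i\<in>UNIV. V i i x)" for x
    have [measurable]: "f \<in> borel_measurable borel" unfolding f_def[abs_def] by measurable
    have AE_V: "AE x in lborel. \<forall>i j. weak_deriv [i, j] u x = V i j x"
      by (intro eventually_all_finite V(2))
    have lap: "mixed_norm p (weak_laplacian u) = mnorm p js (\<lambda>x. ennreal \<bar>f x\<bar>) 0"
      unfolding mixed_norm_eq_mnorm[of p, OF p0] js_def[symmetric]
    proof (rule mnorm_cong_AE[OF js])
      show "AE x in lborel. ennreal (norm (weak_laplacian u x)) = ennreal \<bar>f x\<bar>"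
        using AE_V by eventually_elim (simp add: weak_laplacian_def f_def)
    qed
    have hess: "mixed_norm p (weak_hessian u) = mnorm p js (\<lambda>x. ennreal (norm (\<chi> i j. V i j x))) 0"
      unfolding mixed_norm_eq_mnorm[of p, OF p0] js_def[symmetric]
    proof (rule mnorm_cong_AE[OF js])
      show "AE x in lborel. ennreal (norm (weak_hessian u x)) = ennreal (norm (\<chi> i j. V i j x))"
        using AE_V by eventually_elim (simp add: weak_hessian_def)
    qed
    \<comment> \<open>The estimate for smooth functions presupposes a finite left side; this passes
      from the Hessian to its entries and from there to their averages.\<close>
    have V_fin: "mnorm p js (\<lambda>x. ennreal \<bar>V i j x\<bar>) 0 < top" for i j
    proof -
      have "\<bar>V i j x\<bar> \<le> norm (\<chi> i j. V i j x)" for x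
        using order_trans[OF component_le_norm_cart[of "(\<chi> i j. V i j x) $ i" j] Finite_Cartesian_Product.norm_nth_le[of "\<chi> i j. V i j x" i]] by simp
      then have "mnorm p js (\<lambda>x. ennreal \<bar>V i j x\<bar>) 0 \<le> mixed_norm p (weak_hessian u)"
        unfolding hess by (intro mnorm_mono p0 ennreal_leI)
      also have "\<dots> < top" using fin by (simp add: less_top[symmetric])
      finally show ?thesis .
    qed
    \<comment> \<open>The averages of \<open>U\<close> are smooth, with second derivatives and
      Laplacian given by the averages of \<open>V i j\<close> and of \<open>f\<close>. Averaging
      does not increase the norm on the right, so the bound is uniform in \<open>t\<close> and
      survives the limit.\<close>
    have entry: "mnorm p js (\<lambda>x. ennreal \<bar>V i j x\<bar>) 0 \<le> ennreal (C i j) * mnorm p js (\<lambda>x. ennreal \<bar>f x\<bar>) 0" for i j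
    proof (rule mnorm_le_of_bump_avg[OF V(1,3) js p0])
      fix t :: real assume t: "0 < t"
      let ?w = "bump_avg t U"
      have w: "smooth ?w" unfolding bump_avg_eq_scaled[OF t]
        by (rule mollification(1)[OF U(1,3) test_function_scaled_bump[OF t]])
      have dw: "partial_derivs [i, j] ?w = bump_avg t (V i j)" for i j
        by (rule bump_avg_weak_deriv[OF weak t U V(1,2)])
      have lw: "laplacian ?w = bump_avg t f"
        unfolding laplacian_def[abs_def] dw f_def[abs_def]
        by (rule ext, rule bump_avg_sum[symmetric, OF V(1,3) t])
      have "mnorm p js (\<lambda>x. ennreal \<bar>bump_avg t (V i j) x\<bar>) 0 < top"
        by (rule le_less_trans[OF mnorm_bump_avg_le[OF V(1) p1 js(2)] V_fin])
      then have "mnorm p js (\<lambda>x. ennreal \<bar>bump_avg t (V i j) x\<bar>) 0 \<le> ennreal (C i j) * mnorm p js (\<lambda>x. ennreal \<bar>bump_avg t f x\<bar>) 0"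
        using C(2)[of i j, unfolded E_def, rule_format, OF w] unfolding dw lw by simp
      also have "\<dots> \<le> ennreal (C i j) * mnorm p js (\<lambda>x. ennreal \<bar>f x\<bar>) 0"
        by (intro mult_left_mono mnorm_bump_avg_le p1 js(2)) auto
      finally show "mnorm p js (\<lambda>x. ennreal \<bar>bump_avg t (V i j) x\<bar>) 0 \<le> ennreal (C i j) * mnorm p js (\<lambda>x. ennreal \<bar>f x\<bar>) 0" .
    qed
    have norm_le: "norm (\<chi> i j. V i j x) \<le> (\<Sum>a\<in>UNIV. \<bar>V (fst a) (snd a) x\<bar>)" for x
    proof -
      have "norm (\<chi> i j. V i j x) \<le> (\<Sum>i\<in>UNIV. norm ((\<chi> i j. V i j x) $ i))"
        unfolding norm_vec_def by (rule L2_set_le_sum) simp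
      also have "\<dots> \<le> (\<Sum>i\<in>UNIV. \<Sum>j\<in>UNIV. \<bar>V i j x\<bar>)"
      proof (rule sum_mono)
        fix i
        show "norm ((\<chi> i j. V i j x) $ i) \<le> (\<Sum>j\<in>UNIV. \<bar>V i j x\<bar>)"
          using norm_le_l1_cart[of "(\<chi> i j. V i j x) $ i"] by simp
      qed
      also have "\<dots> = (\<Sum>a\<in>UNIV. \<bar>V (fst a) (snd a) x\<bar>)"
        by (simp add: sum.cartesian_product case_prod_beta)
      finally show ?thesis .
    qed
    have "mixed_norm p (weak_hessian u) \<le> mnorm p js (\<lambda>x. \<Sum>a\<in>UNIV. ennreal \<bar>V (fst a) (snd a) x\<bar>) 0"
      unfolding hess
    proof (rule mnorm_mono[OF _ p0])
      fix x
      show "ennreal (norm (\<chi> i j. V i j x)) \<le> (\<Sum>a\<in>UNIV. ennreal \<bar>V (fst a) (snd a) x\<bar>)"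
        using norm_le[of x] by (simp add: sum_ennreal ennreal_leI)
    qed
    also have "\<dots> \<le> (\<Sum>a\<in>UNIV. mnorm p js (\<lambda>x. ennreal \<bar>V (fst a) (snd a) x\<bar>) 0)"
      by (rule mnorm_sum_le) (use p1 in auto)
    also have "\<dots> \<le> (\<Sum>a\<in>UNIV. ennreal (C (fst a) (snd a)) * mnorm p js (\<lambda>x. ennreal \<bar>f x\<bar>) 0)"
      by (intro sum_mono entry)
    also have "\<dots> = ennreal (\<Sum>a\<in>UNIV. C (fst a) (snd a)) * mixed_norm p (weak_laplacian u)"
      using C(1) by (simp add: lap sum_distrib_right[symmetric] sum_ennreal)
    finally show "mixed_norm p (weak_hessian u) \<le> ennreal (\<Sum>a\<in>UNIV. C (fst a) (snd a)) * mixed_norm p (weak_laplacian u)" .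
  qed
qed

end
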